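(* Let $W$ be a finite Coxeter group of type $A_n$ ($n\ge 2$), $B_n$ ($n\ge 2$), $D_n$ ($n\ge 4$), $I_2(m)$ ($m\ge 3$) or $H_3$, let $c=c_-c_+$ be a bipartite Coxeter element, and let $o$ be the following $W$-orbit: in type $A_n$, $o=\{e_1,\dots,e_{n+1}\}$; in types $B_n$ and $D_n$, $o=\{\pm e_1,\dots,\pm e_n\}$; in type $I_2(m)$, an orbit consisting of the vertices of a regular $m$-gon; in type $H_3$, the orbit consisting of the 12 vertices of a regular icosahedron. Call two blocks in a Coxeter-plane diagram noncrossing if their convex hulls either are disjoint or intersect in a single point on the boundary of both. Then a parabolic subgroup $W'$ of $W$ is noncrossing (with respect to $c$) if and only if the blocks in its Coxeter-plane diagram (the projection to the Coxeter plane $P$ of the partition of $o$ into $W'$-orbits) are pairwise noncrossing.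
   Context: Setting. $(W,S)$ is a finite irreducible Coxeter system of rank $n$, represented as a real reflection group on a Euclidean space $V$ so that only the origin is fixed by $W$ (so $\dim V=n$). $T$ is the set of reflections of $W$. For each $s\in S$ let $\alpha_s$ be the unit simple root normal to the reflecting hyperplane $H_s$, with $\langle\alpha_s,\alpha_{s'}\rangle\le 0$ for $s\ne s'$. Type $A_n$ is the symmetric group $S_{n+1}$ permuting coordinates of $\mathbb{R}^{n+1}$ modulo the line spanned by $(1,\dots,1)$ (equivalently, project orthogonally to the hyperplane where coordinates sum to zero); type $B_n$ is the group of signed permutations acting on $\mathbb{R}^n$; type $D_n$ is its subgroup of even-signed permutations, with simple reflections $s_i$ transposing $e_i,e_{i+1}$ for $i\le n-1$ and $s_n$ transposing $e_{n-1}$ and $-e_n$; type $I_2(m)$ is the dihedral group of order $2m$; type $H_3$ is the symmetry group of the regular icosahedron. Bipartite Coxeter element. $S=S_+\sqcup S_-$ is a bipartition of the Coxeter diagram (elements within each part commute pairwise), $c_\pm=\prod_{s\in S_\pm}s$, $c=c_-c_+$, and $h$ is the order of $c$ (the Coxeter number). Parabolic subgroups. A parabolic subgroup of $W$ is a conjugate of a subgroup generated by a subset of $S$. A reduced $T$-word for $w\in W$ is a shortest expression of $w$ as a product of elements of $T$. The absolute order: $u\le v$ iff some reduced $T$-word for $u$ is a prefix of some reduced $T$-word for $v$. For $x\in[1,c]$ with reduced $T$-word $t_1\cdots t_i$, the group $\langle t_1,\dots,t_i\rangle$ is parabolic; the parabolic subgroups arising this way are called noncrossing (with respect to $c$), all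 other parabolic subgroups are crossing. Coxeter plane. Let $(c_s)_{s\in S}$ be a positive eigenvector of the Gram matrix $(\langle\alpha_s,\alpha_{s'}\rangle)$ for its smallest eigenvalue, and let $(\omega_s)$ be the basis of $V$ dual to $(\alpha_s)$. The Coxeter plane is $P=\mathrm{span}(\lambda,\mu)$, where $\lambda=\sum_{s\in S_+}c_s\omega_s$ and $\mu=\sum_{s\in S_-}c_s\omega_s$. It is preserved by $\langle c_+,c_-\rangle$, which acts on $P$ as a dihedral reflection group of order $2h$. Coxeter-plane diagram. A parabolic subgroup $W'$ partitions $o$ into $W'$-orbits, called blocks. The Coxeter-plane diagram of $W'$ is the orthogonal projection of this partition to $P$. Several elements of $o$ may project to the origin; they are considered distinguishable (and may belong to different blocks). The convex hull of a block is the convex hull in $P$ of its projected points. The boundary of a convex hull means its relative boundary if the hull has dimension at least 1, and the point itself if the hull is a single point. *)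

theory Defs
  imports
    "HOL-Analysis.Analysis"
    "HOL-Algebra.Generated_Groups"
    "HOL-Library.Sublist"
begin

section \<open>Reflection groups\<close>

definition orth_group :: "('a::euclidean_space \<Rightarrow> 'a) monoid" where
  "orth_group = \<lparr>carrier = {f. orthogonal_transformation f}, mult = (\<circ>), one = id\<rparr>"

lemma group_orth_group: "group (orth_group :: ('a::euclidean_space \<Rightarrow> 'a) monoid)"
proof (rule groupI)
  fix x y z :: "'a \<Rightarrow> 'a"
  assume x: "x \<in> carrier orth_group"
  show "x \<otimes>\<^bsub>orth_group\<^esub> y \<otimes>\<^bsub>orth_group\<^esub> z
      = x \<otimes>\<^bsub>orth_group\<^esub> (y \<otimes>\<^bsub>orth_group\<^esub> z)"
    by (simp add: orth_group_def comp_assoc)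
  show "\<exists>y\<in>carrier orth_group. y \<otimes>\<^bsub>orth_group\<^esub> x = \<one>\<^bsub>orth_group\<^esub>"
  proof
    show "inv_into UNIV x \<in> carrier orth_group"
      using x by (simp add: orth_group_def orthogonal_transformation_inv)
    show "inv_into UNIV x \<otimes>\<^bsub>orth_group\<^esub> x = \<one>\<^bsub>orth_group\<^esub>"
      using x by (simp add: orth_group_def orthogonal_transformation_inj)
  qed
qed (auto simp: orth_group_def orthogonal_transformation_compose id_def
        orthogonal_transformation_id)

text \<open>The orthogonal reflection in the hyperplane normal to a nonzero vector.\<close>

definition reflection :: "'a::euclidean_space \<Rightarrow> 'a \<Rightarrow> 'a" where
  "reflection a x = x - (2 * (a \<bullet> x) / (a \<bullet> a)) *\<^sub>R a"

text \<open>A Coxeter system is given by its set \<open>\<Delta>\<close> of unit simple roots, so that \<open>S\<close> corresponds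
  to \<open>\<Delta>\<close> via \<open>\<alpha> \<mapsto> reflection \<alpha>\<close>. The space \<open>V\<close> is \<open>span \<Delta>\<close>; it may be a proper subspace of the
  ambient space, as for type \<open>A\<close>, and the group fixes its orthogonal complement pointwise.\<close>

definition refl_group :: "'a::euclidean_space set \<Rightarrow> ('a \<Rightarrow> 'a) set" where
  "refl_group \<Delta> = generate orth_group (reflection ` \<Delta>)"

definition reflections :: "'a::euclidean_space set \<Rightarrow> ('a \<Rightarrow> 'a) set" where
  "reflections \<Delta> = {t \<in> refl_group \<Delta>. \<exists>v. v \<noteq> 0 \<and> t = reflection v}"

definition orbit_of :: "('a \<Rightarrow> 'a) set \<Rightarrow> 'a \<Rightarrow> 'a set" where
  "orbit_of H x = (\<lambda>w. w x) ` H"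

section \<open>Parabolic subgroups and the absolute order\<close>

definition parabolic :: "'a::euclidean_space set \<Rightarrow> ('a \<Rightarrow> 'a) set \<Rightarrow> bool" where
  "parabolic \<Delta> H \<longleftrightarrow> (\<exists>J w. J \<subseteq> \<Delta> \<and> w \<in> refl_group \<Delta> \<and>
     H = (\<lambda>u. w \<otimes>\<^bsub>orth_group\<^esub> u \<otimes>\<^bsub>orth_group\<^esub> inv\<^bsub>orth_group\<^esub> w) ` refl_group J)"

definition word_prod :: "('a \<Rightarrow> 'a) list \<Rightarrow> 'a \<Rightarrow> 'a" where
  "word_prod ts = foldr (\<circ>) ts id"

definition reduced_word :: "('a \<Rightarrow> 'a) set \<Rightarrow> ('a \<Rightarrow> 'a) \<Rightarrow> ('a \<Rightarrow> 'a) list \<Rightarrow> bool" where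
  "reduced_word T w ts \<longleftrightarrow> set ts \<subseteq> T \<and> word_prod ts = w \<and>
     (\<forall>us. set us \<subseteq> T \<and> word_prod us = w \<longrightarrow> length ts \<le> length us)"

definition abs_le :: "('a \<Rightarrow> 'a) set \<Rightarrow> ('a \<Rightarrow> 'a) \<Rightarrow> ('a \<Rightarrow> 'a) \<Rightarrow> bool" where
  "abs_le T u v \<longleftrightarrow> (\<exists>us vs. reduced_word T u us \<and> reduced_word T v vs \<and> prefix us vs)"

definition noncrossing_parabolic ::
    "'a::euclidean_space set \<Rightarrow> ('a \<Rightarrow> 'a) \<Rightarrow> ('a \<Rightarrow> 'a) set \<Rightarrow> bool" where
  "noncrossing_parabolic \<Delta> c H \<longleftrightarrow> parabolic \<Delta> H \<and>
     (\<exists>x ts. abs_le (reflections \<Delta>) id x \<and> abs_le (reflections \<Delta>) x c \<and>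
        reduced_word (reflections \<Delta>) x ts \<and> H = generate orth_group (set ts))"

section \<open>Bipartite Coxeter elements and the Coxeter plane\<close>

definition coxeter_bipartition ::
    "'a::euclidean_space set \<Rightarrow> 'a set \<Rightarrow> 'a set \<Rightarrow> bool" where
  "coxeter_bipartition \<Delta> \<Delta>\<^sub>p \<Delta>\<^sub>m \<longleftrightarrow> \<Delta>\<^sub>p \<union> \<Delta>\<^sub>m = \<Delta> \<and> \<Delta>\<^sub>p \<inter> \<Delta>\<^sub>m = {} \<and>
     (\<forall>D\<in>{\<Delta>\<^sub>p, \<Delta>\<^sub>m}. \<forall>\<alpha>\<in>D. \<forall>\<beta>\<in>D. reflection \<alpha> \<circ> reflection \<beta> = reflection \<beta> \<circ> reflection \<alpha>)"

text \<open>The product of a finite set of pairwise commuting simple reflections.\<close>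

definition commuting_prod :: "'a::euclidean_space set \<Rightarrow> 'a \<Rightarrow> 'a" where
  "commuting_prod D = Finite_Set.fold (\<lambda>\<alpha> w. reflection \<alpha> \<circ> w) id D"

lemma commuting_prod_list:
  assumes "\<forall>\<alpha>\<in>set as. \<forall>\<beta>\<in>set as. reflection \<alpha> \<circ> reflection \<beta> = reflection \<beta> \<circ> reflection \<alpha>"
    and "distinct as"
  shows "commuting_prod (set as) = word_prod (map reflection as)"
proof -
  interpret comp_fun_commute_on "set as" "\<lambda>\<alpha> w. reflection \<alpha> \<circ> w"
    by standard (use assms(1) in \<open>auto simp: fun_eq_iff\<close>)
  have "Finite_Set.fold (\<lambda>\<alpha> w. reflection \<alpha> \<circ> w) id (set bs) = word_prod (map reflection bs)"
    if "distinct bs" "set bs \<subseteq> set as" for bs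
    using that by (induction bs) (auto simp: word_prod_def)
  with assms(2) show ?thesis
    by (simp add: commuting_prod_def)
qed

definition bipartite_coxeter_element :: "'a::euclidean_space set \<Rightarrow> 'a set \<Rightarrow> 'a \<Rightarrow> 'a" where
  "bipartite_coxeter_element \<Delta>\<^sub>p \<Delta>\<^sub>m = commuting_prod \<Delta>\<^sub>m \<circ> commuting_prod \<Delta>\<^sub>p"

definition gram_eigenvector :: "'a::euclidean_space set \<Rightarrow> real \<Rightarrow> ('a \<Rightarrow> real) \<Rightarrow> bool" where
  "gram_eigenvector \<Delta> l k \<longleftrightarrow> (\<exists>\<alpha>\<in>\<Delta>. k \<alpha> \<noteq> 0) \<and>
     (\<forall>\<alpha>\<in>\<Delta>. (\<Sum>\<beta>\<in>\<Delta>. (\<alpha> \<bullet> \<beta>) * k \<beta>) = l * k \<alpha>)"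

definition positive_min_eigenvector :: "'a::euclidean_space set \<Rightarrow> ('a \<Rightarrow> real) \<Rightarrow> bool" where
  "positive_min_eigenvector \<Delta> k \<longleftrightarrow> (\<forall>\<alpha>\<in>\<Delta>. k \<alpha> > 0) \<and>
     (\<exists>l. gram_eigenvector \<Delta> l k \<and> (\<forall>l' k'. gram_eigenvector \<Delta> l' k' \<longrightarrow> l \<le> l'))"

definition dual_basis :: "'a::euclidean_space set \<Rightarrow> 'a \<Rightarrow> 'a" where
  "dual_basis \<Delta> \<alpha> = (THE w. w \<in> span \<Delta> \<and> (\<forall>\<beta>\<in>\<Delta>. w \<bullet> \<beta> = (if \<beta> = \<alpha> then 1 else 0)))"

definition coxeter_plane ::
    "('a::euclidean_space \<Rightarrow> real) \<Rightarrow> 'a set \<Rightarrow> 'a set \<Rightarrow> 'a set" where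
  "coxeter_plane k \<Delta>\<^sub>p \<Delta>\<^sub>m =
     span {\<Sum>\<alpha>\<in>\<Delta>\<^sub>p. k \<alpha> *\<^sub>R dual_basis (\<Delta>\<^sub>p \<union> \<Delta>\<^sub>m) \<alpha>,
           \<Sum>\<alpha>\<in>\<Delta>\<^sub>m. k \<alpha> *\<^sub>R dual_basis (\<Delta>\<^sub>p \<union> \<Delta>\<^sub>m) \<alpha>}"

section \<open>Coxeter-plane diagrams\<close>

definition orth_proj :: "'a::euclidean_space set \<Rightarrow> 'a \<Rightarrow> 'a" where
  "orth_proj U x = (THE y. y \<in> U \<and> (\<forall>z\<in>U. (x - y) \<bullet> z = 0))"

text \<open>Blocks are kept as subsets of the orbit, before projecting, so that distinct points with
  the same projection remain distinguishable.\<close>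

definition blocks :: "('a \<Rightarrow> 'a) set \<Rightarrow> 'a set \<Rightarrow> 'a set set" where
  "blocks H X = orbit_of H ` X"

definition block_hull :: "'a::euclidean_space set \<Rightarrow> 'a set \<Rightarrow> 'a set" where
  "block_hull U B = convex hull (orth_proj U ` B)"

text \<open>The library's relative frontier of a single point is empty.\<close>

definition hull_boundary :: "'a::euclidean_space set \<Rightarrow> 'a set" where
  "hull_boundary C = (if \<exists>p. C = {p} then C else rel_frontier C)"

definition noncrossing_blocks ::
    "'a::euclidean_space set \<Rightarrow> 'a set \<Rightarrow> 'a set \<Rightarrow> bool" where
  "noncrossing_blocks U B B' \<longleftrightarrow>
     block_hull U B \<inter> block_hull U B' = {} \<or>
     (\<exists>p. block_hull U B \<inter> block_hull U B' = {p} \<and>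
        p \<in> hull_boundary (block_hull U B) \<and> p \<in> hull_boundary (block_hull U B'))"

section \<open>The Coxeter types and their orbits\<close>

definition orthonormal_family :: "nat \<Rightarrow> (nat \<Rightarrow> 'a::euclidean_space) \<Rightarrow> bool" where
  "orthonormal_family N e \<longleftrightarrow>
     (\<forall>i\<in>{1..N}. \<forall>j\<in>{1..N}. e i \<bullet> e j = (if i = j then 1 else 0))"

text \<open>In each predicate \<open>\<Delta>\<close> is the set of unit simple roots and \<open>X\<close> is the distinguished orbit.
  For real vectors \<open>sgn v\<close> is the unit vector in the direction of \<open>v\<close>. In type \<open>A\<close> the ambient
  coordinate vectors are projected to the hyperplane where the coordinates sum to zero, which is
  \<open>span \<Delta>\<close>.\<close>

definition type_A :: "nat \<Rightarrow> 'a::euclidean_space set \<Rightarrow> 'a set \<Rightarrow> bool" where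
  "type_A n \<Delta> X \<longleftrightarrow> (\<exists>e. orthonormal_family (n + 1) e \<and>
     \<Delta> = {sgn (e i - e (i + 1)) | i. i \<in> {1..n}} \<and>
     X = {orth_proj (span \<Delta>) (e i) | i. i \<in> {1..n + 1}})"

definition type_B :: "nat \<Rightarrow> 'a::euclidean_space set \<Rightarrow> 'a set \<Rightarrow> bool" where
  "type_B n \<Delta> X \<longleftrightarrow> (\<exists>e. orthonormal_family n e \<and>
     \<Delta> = {sgn (e i - e (i + 1)) | i. i \<in> {1..n - 1}} \<union> {e n} \<and>
     X = {e i | i. i \<in> {1..n}} \<union> {- e i | i. i \<in> {1..n}})"

definition type_D :: "nat \<Rightarrow> 'a::euclidean_space set \<Rightarrow> 'a set \<Rightarrow> bool" where
  "type_D n \<Delta> X \<longleftrightarrow> (\<exists>e. orthonormal_family n e \<and>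
     \<Delta> = {sgn (e i - e (i + 1)) | i. i \<in> {1..n - 1}} \<union> {sgn (e (n - 1) + e n)} \<and>
     X = {e i | i. i \<in> {1..n}} \<union> {- e i | i. i \<in> {1..n}})"

text \<open>An orbit in \<open>V\<close> has centroid \<open>0\<close>, since only the origin of \<open>V\<close> is fixed by the group; hence
  the polygon and the icosahedron are taken to be centred at the origin.\<close>

definition regular_polygon_vertices :: "nat \<Rightarrow> 'a::euclidean_space set \<Rightarrow> bool" where
  "regular_polygon_vertices m X \<longleftrightarrow> (\<exists>r>0. \<exists>u v. norm u = 1 \<and> norm v = 1 \<and> u \<bullet> v = 0 \<and>
     X = {r *\<^sub>R (cos (2 * pi * real k / real m) *\<^sub>R u + sin (2 * pi * real k / real m) *\<^sub>R v)
          | k. k < m})"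

definition type_I2 :: "nat \<Rightarrow> 'a::euclidean_space set \<Rightarrow> 'a set \<Rightarrow> bool" where
  "type_I2 m \<Delta> X \<longleftrightarrow>
     (\<exists>a b. norm a = 1 \<and> norm b = 1 \<and> a \<bullet> b = - cos (pi / real m) \<and> \<Delta> = {a, b}) \<and>
     (\<exists>x\<in>span \<Delta>. X = orbit_of (refl_group \<Delta>) x) \<and> regular_polygon_vertices m X"

text \<open>With \<open>\<phi>\<close> the golden ratio, the vertices of a regular icosahedron are, up to scale, the cyclic
  permutations of \<open>(\<plusminus>1, \<plusminus>\<phi>, 0)\<close>.\<close>

definition regular_icosahedron_vertices :: "'a::euclidean_space set \<Rightarrow> bool" where
  "regular_icosahedron_vertices X \<longleftrightarrow> (\<exists>r>0. \<exists>u v w.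
     norm u = 1 \<and> norm v = 1 \<and> norm w = 1 \<and> u \<bullet> v = 0 \<and> v \<bullet> w = 0 \<and> w \<bullet> u = 0 \<and>
     X = {r *\<^sub>R (s *\<^sub>R x + (t * ((1 + sqrt 5) / 2)) *\<^sub>R y) | s t x y.
          s \<in> {1, -1} \<and> t \<in> {1, -1} \<and> (x, y) \<in> {(u, v), (v, w), (w, u)}})"

definition type_H3 :: "'a::euclidean_space set \<Rightarrow> 'a set \<Rightarrow> bool" where
  "type_H3 \<Delta> X \<longleftrightarrow>
     (\<exists>a b d. norm a = 1 \<and> norm b = 1 \<and> norm d = 1 \<and>
        a \<bullet> b = - cos (pi / 5) \<and> b \<bullet> d = - cos (pi / 3) \<and> a \<bullet> d = 0 \<and> \<Delta> = {a, b, d}) \<and>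
     (\<exists>x\<in>span \<Delta>. X = orbit_of (refl_group \<Delta>) x) \<and> regular_icosahedron_vertices X"

end

theory Submission
  imports Defs
begin

text \<open>In the Coxeter plane \<open>P\<close> the orbit \<open>o\<close> becomes a regular \<open>h\<close>-gon \<open>z\<^sub>i = c\<^sup>i z\<^sub>0\<close>, in types \<open>D\<close> and
  \<open>H\<^sub>3\<close> together with a pair of opposite points over the origin, and (apart from type \<open>I\<^sub>2\<close>) every root
  is proportional to a difference \<open>b = p - q\<close> of orbit points. For such a \<open>b\<close> let \<open>v\<close> be the solution of
  \<open>c (v - b) = v\<close>, so that \<open>v\<close> is fixed by \<open>c\<close> composed with the reflection in \<open>b\<close>. The function
  \<open>i \<mapsto> \<langle>z\<^sub>i, v\<rangle>\<close> rises and falls once around the \<open>h\<close>-gon, hence its level sets are separated by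
  parallel lines of \<open>P\<close>. If \<open>W'\<close> is noncrossing, any two of its blocks lie in different level sets of some
  such \<open>v\<close> fixed by \<open>W'\<close>. Conversely, in types \<open>A\<close>, \<open>B\<close> and \<open>D\<close> one splits off an endpoint of a shortest
  chord between two points of one block; the differences of the remaining block points are orthogonal to
  the corresponding \<open>v\<close>, and induction yields a word in reflections generating \<open>W'\<close> which, by Carter's
  lemma on reflection lengths, is a prefix of a reduced word for \<open>c\<close>. In type \<open>H\<^sub>3\<close> a parabolic
  subgroup of rank two is determined by its fixed line; it is noncrossing if that line is spanned
  by one of the vectors \<open>v\<close>, and for every other line two blocks cross.\<close>


section \<open>Words in reflections\<close>

text \<open>\<open>1 - c\<^sup>-\<^sup>1\<close> is invertible on \<open>V\<close>, which supplies
  \<open>v\<close> for every root \<open>b\<close>. The steps of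
  \<open>i \<mapsto> \<langle>z i, v\<rangle>\<close> are \<open>-\<langle>z i, b\<rangle>\<close>,
  so one rise and one fall only need these products to be odd about an axis of the polygon and of
  constant sign on each side of it. The obstacle is the pair of orbit points over the origin, which
  no line of the plane separates. The bound
  \<open>|\<langle>q, v\<rangle>| \<le> |\<langle>z i, v\<rangle>|\<close> for such a point
  \<open>q\<close> puts them between the vertices of negative and of positive level, so two blocks
  containing them touch in a common corner. Where the pair exists, \<open>p - (- p)\<close> is no
  multiple of a root; the flag \<open>ii\<close> then leaves antipodal pairs out. A shortest chord
  is split off because the vertices strictly under it are alone in their blocks, and
  \<open>v\<close> takes one value on all points that stay joined to another point. Type
  \<open>H3\<close> needs its own converse: there distinct, non-opposite vertices have inner product
  \<open>s\<close> or \<open>- s\<close>, so \<open>p\<close> need not be orthogonal to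
  \<open>q - r\<close>. In type \<open>I2\<close> the plane is all of \<open>V\<close> and both
  sides hold for every parabolic subgroup.\<close>

definition rword :: "'a::euclidean_space list \<Rightarrow> 'a \<Rightarrow> 'a" where
 "rword bs = word_prod (map reflection bs)"

lemma rword_Nil [simp]: "rword [] = id"
 and rword_Cons [simp]: "rword (b # bs) = reflection b \<circ> rword bs"
 by (simp_all add: rword_def word_prod_def)

lemma rword_append: "rword (as @ bs) = rword as \<circ> rword bs"
 by (induction as) (auto simp: comp_assoc)

lemma linear_reflection: "linear (reflection a)"
 unfolding reflection_def
 by (rule linearI) (auto simp: inner_right_distrib algebra_simps add_divide_distrib)

lemma reflection_add: "reflection a (x + y) = reflection a x + reflection a y"
 and reflection_diff: "reflection a (x - y) = reflection a x - reflection a y"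
 and reflection_scaleR: "reflection a (r *\<^sub>R x) = r *\<^sub>R reflection a x"
 and reflection_minus: "reflection a (- x) = - reflection a x"
 using linear_reflection[of a] by (simp_all add: linear_add linear_diff linear_cmul linear_neg)

text \<open>Division by zero gives zero, so \<open>reflection 0\<close> is the identity and the case
  \<open>a = 0\<close> is covered; words may contain arbitrary vectors.\<close>

lemma reflection_reflection [simp]: "reflection a (reflection a x) = x"
 by (cases "a = 0") (simp_all add: reflection_def inner_diff_right)

lemma reflection_comp_self [simp]: "reflection a \<circ> reflection a = id"
 by (simp add: fun_eq_iff)

lemma orthogonal_transformation_reflection: "orthogonal_transformation (reflection a)"
proof -
 have "reflection a v \<bullet> reflection a w = v \<bullet> w" for v w
  by (cases "a = 0")
   (simp_all add: reflection_def inner_diff_right inner_diff_left inner_commute field_simps)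
 thus ?thesis
  using linear_reflection by (simp add: orthogonal_transformation_def)
qed

lemma reflection_inner: "reflection a x \<bullet> reflection a y = x \<bullet> y"
 using orthogonal_transformation_reflection by (auto simp: orthogonal_transformation_def)

lemma reflection_self: "reflection a a = - a"
 by (cases "a = 0") (simp_all add: reflection_def scaleR_2)

lemma reflection_fix_iff: "reflection a x = x \<longleftrightarrow> a \<bullet> x = 0"
 by (auto simp: reflection_def)

lemma reflection_scaled: "r \<noteq> 0 \<Longrightarrow> reflection (r *\<^sub>R a) = reflection a"
 by (cases "a = 0") (auto simp: fun_eq_iff reflection_def field_simps)

lemma reflection_uminus: "reflection (- a) = reflection a"
 using reflection_scaled[of "-1" a] by simp

lemma reflection_commute_diff: "reflection (p - q) = reflection (q - p)"
 using reflection_uminus[of "p - q"] by simp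

lemma reflection_swap:
 assumes "p \<bullet> p = q \<bullet> q"
 shows "reflection (p - q) p = q"
proof (cases "p = q")
 case False
 hence "(p - q) \<bullet> (p - q) \<noteq> 0" by (metis inner_eq_zero_iff right_minus_eq)
 moreover have "2 * ((p - q) \<bullet> p) = (p - q) \<bullet> (p - q)"
  using assms by (simp add: inner_diff_left inner_diff_right inner_commute)
 ultimately have "2 * ((p - q) \<bullet> p) / ((p - q) \<bullet> (p - q)) = 1"
  by (metis divide_self)
 hence "reflection (p - q) p = p - 1 *\<^sub>R (p - q)" unfolding reflection_def by metis
 thus ?thesis by simp
qed (simp add: reflection_def)

text \<open>The displacement \<open>p - q\<close> is a multiple of \<open>a\<close>, nonzero because
  \<open>p\<close> is moved. So one moved point determines the mirror.\<close>

lemma reflection_unique: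
 assumes "reflection a p = q" "p \<noteq> q"
 shows "reflection a = reflection (p - q)"
proof -
 let ?r = "2 * (a \<bullet> p) / (a \<bullet> a)"
 have "p - q = ?r *\<^sub>R a" using assms(1) by (auto simp: reflection_def)
 moreover from this have "?r \<noteq> 0" using assms(2) by (metis right_minus_eq scaleR_zero_left)
 ultimately show ?thesis by (metis reflection_scaled)
qed

lemma reflection_diff_in_span: "reflection a x - x \<in> span {a}"
 by (simp add: reflection_def span_base span_mul span_neg)

lemma orth_reflection_conj:
 assumes "orthogonal_transformation f"
 shows "f (reflection a x) = reflection (f a) (f x)"
 using assms
 by (simp add: reflection_def orthogonal_transformation_def linear_diff linear_cmul)

lemma orthogonal_transformation_rword: "orthogonal_transformation (rword bs)"
proof (induction bs)
 case Nil
 thus ?case by (simp add: id_def orthogonal_transformation_id)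
next
 case (Cons b bs)
 thus ?case
  using orthogonal_transformation_compose[OF orthogonal_transformation_reflection Cons.IH, of b]
  by (simp add: o_def)
qed

lemma rword_rev1: "rword (rev bs) (rword bs x) = x"
 by (induction bs arbitrary: x) (auto simp: rword_append)

lemma rword_rev2: "rword bs (rword (rev bs) x) = x"
 using rword_rev1[of "rev bs"] by simp

lemma rword_conj:
 assumes "orthogonal_transformation f"
 shows "f (rword bs x) = rword (map f bs) (f x)"
 using assms by (induction bs arbitrary: x) (auto simp: orth_reflection_conj)

lemma rword_diff_in_span: "rword bs x - x \<in> span (set bs)"
proof (induction bs)
 case (Cons b bs)
 have "reflection b (rword bs x) - rword bs x \<in> span (set (b # bs))"
  using reflection_diff_in_span[of b "rword bs x"] span_mono[of "{b}" "set (b # bs)"] by auto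
 moreover have "rword bs x - x \<in> span (set (b # bs))"
  using Cons.IH span_mono[of "set bs" "set (b # bs)"] by auto
 ultimately have "(reflection b (rword bs x) - rword bs x) + (rword bs x - x) \<in> span (set (b # bs))"
  by (rule span_add)
 thus ?case by (simp add: span_0)
qed (simp add: span_0)

lemma rword_fixes: "(\<And>b. b \<in> set bs \<Longrightarrow> b \<bullet> x = 0) \<Longrightarrow> rword bs x = x"
 by (induction bs) (auto simp: reflection_fix_iff)

lemma linear_rword: "linear (rword bs)"
 using orthogonal_transformation_rword orthogonal_transformation_def by blast

lemma rword_inner: "rword bs x \<bullet> rword bs y = x \<bullet> y"
 using orthogonal_transformation_rword[of bs] by (auto simp: orthogonal_transformation_def)

lemma rword_inj: "rword bs x = rword bs y \<longleftrightarrow> x = y"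
 by (metis rword_rev1)

lemma independent_span_disjoint:
 assumes "independent (A \<union> B)" "A \<inter> B = {}" "x \<in> span A" "x \<in> span B"
 shows "x = (0 :: 'a::euclidean_space)"
proof -
 have "finite (A \<union> B)" using assms(1) independent_bound by blast
 hence "finite A" "finite B" by auto
 obtain u where u: "x = (\<Sum>a\<in>A. u a *\<^sub>R a)"
  using assms(3) span_finite[OF \<open>finite A\<close>] by auto
 obtain v where v: "x = (\<Sum>a\<in>B. v a *\<^sub>R a)"
  using assms(4) span_finite[OF \<open>finite B\<close>] by auto
 define w where "w a = (if a \<in> A then u a else - v a)" for a
 have "(\<Sum>a\<in>A \<union> B. w a *\<^sub>R a) = (\<Sum>a\<in>A. w a *\<^sub>R a) + (\<Sum>a\<in>B. w a *\<^sub>R a)"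
  using \<open>finite A\<close> \<open>finite B\<close> assms(2) by (rule sum.union_disjoint)
 also have "(\<Sum>a\<in>A. w a *\<^sub>R a) = x" unfolding u by (auto simp: w_def)
 also have "(\<Sum>a\<in>B. w a *\<^sub>R a) = (\<Sum>a\<in>B. - (v a *\<^sub>R a))"
  using assms(2) by (intro sum.cong) (auto simp: w_def)
 also have "\<dots> = - x" unfolding v by (simp add: sum_negf)
 finally have z: "(\<Sum>a\<in>A \<union> B. w a *\<^sub>R a) = 0" by simp
 have "w a = 0" if "a \<in> A \<union> B" for a
  using assms(1) \<open>finite (A \<union> B)\<close> z that by (auto simp: dependent_finite)
 hence "u a = 0" if "a \<in> A" for a using that by (metis w_def UnI1)
 thus ?thesis unfolding u by simp
qed

text \<open>One half of Carter's lemma. If the first reflection undoes the rest of the word on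
  \<open>x\<close>, the displacement of \<open>x\<close> lies in the span of \<open>a\<close> and in
  the span of the other letters. Independence makes it zero, so both factors fix
  \<open>x\<close>.\<close>

lemma rword_fix_orthogonal:
 assumes "distinct bs" "independent (set bs)" "rword bs x = x" "b \<in> set bs"
 shows "b \<bullet> x = 0"
 using assms
proof (induction bs arbitrary: b)
 case (Cons a bs)
 have eq: "rword bs x = reflection a x"
  using Cons.prems(3) by (metis comp_apply reflection_reflection rword_Cons)
 have "rword bs x - x \<in> span {a}" using reflection_diff_in_span[of a x] eq by simp
 moreover have "rword bs x - x \<in> span (set bs)" by (rule rword_diff_in_span)
 ultimately have "rword bs x - x = 0"
  using Cons.prems(1,2) by (intro independent_span_disjoint[of "{a}" "set bs"]) auto
 hence "rword bs x = x" "reflection a x = x" using eq by auto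
 moreover have "independent (set bs)"
  using Cons.prems(2) by (rule independent_mono) auto
 ultimately show ?case using Cons by (auto simp: reflection_fix_iff)
qed simp

section \<open>Reflection groups as sets of words\<close>

lemma inv_orth_group_rword: "inv\<^bsub>orth_group\<^esub> (rword bs) = rword (rev bs)"
proof -
 interpret group "orth_group :: ('a \<Rightarrow> 'a) monoid" by (rule group_orth_group)
 show ?thesis
  by (rule inv_equality)
   (auto simp: orth_group_def orthogonal_transformation_rword fun_eq_iff rword_rev1)
qed

text \<open>Reflections are involutions, so inverses of generators give nothing new and words
  suffice.\<close>

lemma refl_group_eq: "refl_group A = {rword bs | bs. set bs \<subseteq> A}"
proof
 show "refl_group A \<subseteq> {rword bs | bs. set bs \<subseteq> A}"
 proof
  fix w assume "w \<in> refl_group A"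
  hence "w \<in> generate orth_group (reflection ` A)" by (simp add: refl_group_def)
  thus "w \<in> {rword bs | bs. set bs \<subseteq> A}"
  proof induction
   case one
   have "\<one>\<^bsub>orth_group\<^esub> = rword []" by (simp add: orth_group_def)
   thus ?case by (metis (mono_tags, lifting) empty_set empty_subsetI mem_Collect_eq)
  next
   case (incl h)
   then obtain a where "a \<in> A" "h = rword [a]" by auto
   thus ?case by (intro CollectI exI[of _ "[a]"]) auto
  next
   case (inv h)
   then obtain a where a: "a \<in> A" "h = rword [a]" by auto
   hence "inv\<^bsub>orth_group\<^esub> h = rword [a]" using inv_orth_group_rword[of "[a]"] by simp
   thus ?case using a by (intro CollectI exI[of _ "[a]"]) auto
  next
   case (eng h1 h2)
   then obtain as bs where "set as \<subseteq> A" "set bs \<subseteq> A" "h1 = rword as" "h2 = rword bs" by auto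
   thus ?case
    by (intro CollectI exI[of _ "as @ bs"]) (auto simp: orth_group_def rword_append)
  qed
 qed
next
 show "{rword bs | bs. set bs \<subseteq> A} \<subseteq> refl_group A"
 proof clarify
  fix bs assume "set bs \<subseteq> A"
  thus "rword bs \<in> refl_group A"
  proof (induction bs)
   case Nil
   have "\<one>\<^bsub>orth_group\<^esub> \<in> refl_group A"
    unfolding refl_group_def by (rule generate.one)
   moreover have "\<one>\<^bsub>orth_group\<^esub> = rword []" by (simp add: orth_group_def)
   ultimately show ?case by metis
  next
   case (Cons b bs)
   hence "reflection b \<in> refl_group A" "rword bs \<in> refl_group A"
    by (auto simp: refl_group_def intro: generate.incl)
   thus ?case
    unfolding refl_group_def rword_Cons
    by (metis generate.eng monoid.simps(1) orth_group_def)
  qed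
 qed
qed

lemma refl_groupE:
 assumes "w \<in> refl_group A"
 obtains bs where "set bs \<subseteq> A" "w = rword bs"
 using assms by (auto simp: refl_group_eq)

lemma rword_in_refl_group: "set bs \<subseteq> A \<Longrightarrow> rword bs \<in> refl_group A"
 by (auto simp: refl_group_eq)

lemma reflection_in_refl_group: "a \<in> A \<Longrightarrow> reflection a \<in> refl_group A"
 using rword_in_refl_group[of "[a]" A] by simp

lemma id_in_refl_group: "id \<in> refl_group A"
 using rword_in_refl_group[of "[]" A] by simp

lemma refl_group_comp: "u \<in> refl_group A \<Longrightarrow> w \<in> refl_group A \<Longrightarrow> u \<circ> w \<in> refl_group A"
proof -
 assume "u \<in> refl_group A" "w \<in> refl_group A"
 then obtain as bs where "set as \<subseteq> A" "set bs \<subseteq> A" "u = rword as" "w = rword bs"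
  by (meson refl_groupE)
 thus ?thesis using rword_in_refl_group[of "as @ bs" A] by (simp add: rword_append)
qed

lemma refl_group_inverse:
 assumes "w \<in> refl_group A"
 obtains w' where "w' \<in> refl_group A" "\<And>x. w' (w x) = x" "\<And>x. w (w' x) = x"
proof -
 obtain bs where bs: "set bs \<subseteq> A" "w = rword bs" using assms by (rule refl_groupE)
 show thesis
  by (rule that[of "rword (rev bs)"])
   (use bs in \<open>auto simp: rword_rev1 rword_rev2 intro!: rword_in_refl_group\<close>)
qed

lemma rword_in_refl_group_gen:
 "(\<And>b. b \<in> set bs \<Longrightarrow> reflection b \<in> refl_group A) \<Longrightarrow> rword bs \<in> refl_group A"
 by (induction bs) (auto simp: id_in_refl_group intro!: refl_group_comp)

lemma refl_group_subset:
 assumes "\<And>b. b \<in> B \<Longrightarrow> reflection b \<in> refl_group A"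
 shows "refl_group B \<subseteq> refl_group A"
 using assms by (auto elim!: refl_groupE intro!: rword_in_refl_group_gen)

lemma refl_group_orthogonal: "w \<in> refl_group A \<Longrightarrow> orthogonal_transformation w"
 by (auto elim!: refl_groupE simp: orthogonal_transformation_rword)

lemma refl_group_linear: "w \<in> refl_group A \<Longrightarrow> linear w"
 by (auto elim!: refl_groupE simp: linear_rword)

lemma refl_group_inner: "w \<in> refl_group A \<Longrightarrow> w x \<bullet> w y = x \<bullet> y"
 by (auto elim!: refl_groupE simp: rword_inner)

lemma refl_group_inj: "w \<in> refl_group A \<Longrightarrow> w x = w y \<longleftrightarrow> x = y"
 by (auto elim!: refl_groupE simp: rword_inj)

lemma refl_group_diff_in_span: "w \<in> refl_group A \<Longrightarrow> w x - x \<in> span A"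
proof -
 assume "w \<in> refl_group A"
 then obtain bs where "set bs \<subseteq> A" "w = rword bs" by (rule refl_groupE)
 thus ?thesis using rword_diff_in_span[of bs x] span_mono[of "set bs" A] by auto
qed

lemma refl_group_in_span: "w \<in> refl_group A \<Longrightarrow> x \<in> span A \<Longrightarrow> w x \<in> span A"
 using refl_group_diff_in_span[of w A x] span_add[of "w x - x" A x] by simp

lemma refl_group_fixes: "w \<in> refl_group A \<Longrightarrow> (\<And>a. a \<in> A \<Longrightarrow> a \<bullet> x = 0) \<Longrightarrow> w x = x"
 by (auto elim!: refl_groupE intro!: rword_fixes)

lemma reflection_conj_in_refl_group:
 assumes "w \<in> refl_group A" "reflection b \<in> refl_group A"
 shows "reflection (w b) \<in> refl_group A"
proof -
 obtain w' where w': "w' \<in> refl_group A" "\<And>x. w' (w x) = x" "\<And>x. w (w' x) = x"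
  using assms(1) refl_group_inverse by blast
 have "reflection (w b) = w \<circ> reflection b \<circ> w'"
  using orth_reflection_conj[OF refl_group_orthogonal[OF assms(1)], of b] w'
  by (auto simp: fun_eq_iff)
 thus ?thesis using assms w' by (auto intro!: refl_group_comp)
qed

text \<open>Conjugating \<open>reflection b\<close> by an isometry \<open>w\<close> gives
  \<open>reflection (w b)\<close>. Parabolic subgroups can thus be handled as reflection groups of
  transported simple roots.\<close>

lemma refl_group_conj:
 assumes "w \<in> refl_group A"
 shows "(\<lambda>u. w \<otimes>\<^bsub>orth_group\<^esub> u \<otimes>\<^bsub>orth_group\<^esub> inv\<^bsub>orth_group\<^esub> w) ` refl_group J
  = refl_group (w ` J)"
proof -
 obtain ws where ws: "w = rword ws" using assms by (rule refl_groupE)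
 have o: "orthogonal_transformation w" using assms by (rule refl_group_orthogonal)
 have eq: "w \<otimes>\<^bsub>orth_group\<^esub> rword bs \<otimes>\<^bsub>orth_group\<^esub> inv\<^bsub>orth_group\<^esub> w = rword (map w bs)" for bs
  unfolding ws inv_orth_group_rword using rword_conj[OF o[unfolded ws], of bs]
  by (auto simp: orth_group_def fun_eq_iff rword_rev2)
 show ?thesis
 proof (intro equalityI subsetI)
  fix x assume "x \<in> (\<lambda>u. w \<otimes>\<^bsub>orth_group\<^esub> u \<otimes>\<^bsub>orth_group\<^esub> inv\<^bsub>orth_group\<^esub> w) ` refl_group J"
  then obtain bs where "set bs \<subseteq> J" "x = rword (map w bs)" by (auto simp: refl_group_eq eq)
  moreover from this have "set (map w bs) \<subseteq> w ` J" by auto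
  ultimately show "x \<in> refl_group (w ` J)" by (metis rword_in_refl_group)
 next
  fix x assume "x \<in> refl_group (w ` J)"
  then obtain cs where "set cs \<subseteq> w ` J" "x = rword cs" by (rule refl_groupE)
  moreover from this have "cs \<in> map w ` lists J" by (auto simp flip: lists_image)
  then obtain bs where "set bs \<subseteq> J" "cs = map w bs" by auto
  ultimately show "x \<in> (\<lambda>u. w \<otimes>\<^bsub>orth_group\<^esub> u \<otimes>\<^bsub>orth_group\<^esub> inv\<^bsub>orth_group\<^esub> w) ` refl_group J"
   using eq[of bs] by (auto simp: refl_group_eq intro!: image_eqI[of _ _ "rword bs"])
 qed
qed

lemma reflection_image_in_refl_group:
 assumes "w \<in> refl_group A" "reflection b \<in> refl_group J"
 shows "reflection (w b) \<in> refl_group (w ` J)"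
proof -
 obtain bs where bs: "set bs \<subseteq> J" "reflection b = rword bs" using assms(2) by (rule refl_groupE)
 have o: "orthogonal_transformation w" using assms(1) by (rule refl_group_orthogonal)
 obtain w' where w': "\<And>x. w' (w x) = x" "\<And>x. w (w' x) = x"
  using refl_group_inverse[OF assms(1)] by metis
 have "reflection (w b) x = rword (map w bs) x" for x
  using orth_reflection_conj[OF o, of b "w' x"] rword_conj[OF o, of bs "w' x"] bs(2) w' by simp
 hence "reflection (w b) = rword (map w bs)" by auto
 moreover have "set (map w bs) \<subseteq> w ` J" using bs(1) by auto
 ultimately show ?thesis by (metis rword_in_refl_group)
qed

lemma refl_group_conj_self:
 assumes "w \<in> refl_group A"
 shows "refl_group (w ` A) = refl_group A"
proof (intro equalityI refl_group_subset)
 fix g assume "g \<in> w ` A"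
 thus "reflection g \<in> refl_group A"
  using reflection_conj_in_refl_group[OF assms] reflection_in_refl_group by blast
next
 fix a assume a: "a \<in> A"
 obtain w' where w': "w' \<in> refl_group A" "\<And>x. w' (w x) = x" "\<And>x. w (w' x) = x"
  using refl_group_inverse[OF assms] by metis
 have "reflection (w' a) \<in> refl_group A"
  using reflection_conj_in_refl_group[OF w'(1)] reflection_in_refl_group[OF a] by blast
 from reflection_image_in_refl_group[OF assms this] show "reflection a \<in> refl_group (w ` A)"
  by (simp add: w'(3))
qed

lemma parabolic_iff:
 "parabolic \<Delta> H \<longleftrightarrow> (\<exists>J w. J \<subseteq> \<Delta> \<and> w \<in> refl_group \<Delta> \<and> H = refl_group (w ` J))"
 unfolding parabolic_def by (metis refl_group_conj)

text \<open>Roots of arbitrary length: differences of orbit points can be used as roots without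
  normalising them.\<close>

definition root_of :: "'a::euclidean_space set \<Rightarrow> 'a \<Rightarrow> bool" where
 "root_of \<Delta> b \<longleftrightarrow> b \<noteq> 0 \<and> reflection b \<in> refl_group \<Delta>"

lemma root_of_in_span: "root_of \<Delta> b \<Longrightarrow> b \<in> span \<Delta>"
proof -
 assume "root_of \<Delta> b"
 hence "reflection b b - b \<in> span \<Delta>" by (auto simp: root_of_def intro: refl_group_diff_in_span)
 hence "(-1/2) *\<^sub>R (reflection b b - b) \<in> span \<Delta>" by (rule span_mul)
 moreover have "(-1/2) *\<^sub>R (reflection b b - b) = b"
  unfolding reflection_self by (simp add: scaleR_diff_right) (metis scaleR_left_distrib field_sum_of_halves scaleR_one)
 ultimately show ?thesis by simp
qed

lemma root_of_conj: "w \<in> refl_group \<Delta> \<Longrightarrow> root_of \<Delta> b \<Longrightarrow> root_of \<Delta> (w b)"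
 unfolding root_of_def
 by (metis reflection_conj_in_refl_group refl_group_inj linear_0 refl_group_linear)

lemma root_of_scaleR: "root_of \<Delta> b \<Longrightarrow> r \<noteq> 0 \<Longrightarrow> root_of \<Delta> (r *\<^sub>R b)"
 by (auto simp: root_of_def reflection_scaled)

lemma set_subset_reflections_iff:
 "set ts \<subseteq> reflections \<Delta> \<longleftrightarrow> (\<exists>bs. (\<forall>b\<in>set bs. root_of \<Delta> b) \<and> ts = map reflection bs)"
proof (induction ts)
 case (Cons t ts)
 show ?case
 proof
  assume "set (t # ts) \<subseteq> reflections \<Delta>"
  then obtain v bs where "v \<noteq> 0" "t = reflection v" "t \<in> refl_group \<Delta>"
   "\<forall>b\<in>set bs. root_of \<Delta> b" "ts = map reflection bs"
   using Cons.IH by (auto simp: reflections_def)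
  thus "\<exists>bs. (\<forall>b\<in>set bs. root_of \<Delta> b) \<and> t # ts = map reflection bs"
   by (intro exI[of _ "v # bs"]) (auto simp: root_of_def)
 next
  assume "\<exists>bs. (\<forall>b\<in>set bs. root_of \<Delta> b) \<and> t # ts = map reflection bs"
  thus "set (t # ts) \<subseteq> reflections \<Delta>"
   unfolding reflections_def root_of_def by force
 qed
qed simp


section \<open>The bipartite Coxeter element and its reduced words\<close>

lemma unit_reflection: "norm a = 1 \<Longrightarrow> reflection a x = x - (2 * (a \<bullet> x)) *\<^sub>R a"
 by (simp add: reflection_def dot_square_norm)

lemma rword_orthonormal:
 assumes "distinct as" "\<And>a. a \<in> set as \<Longrightarrow> norm a = 1"
  and "\<And>a b. a \<in> set as \<Longrightarrow> b \<in> set as \<Longrightarrow> a \<noteq> b \<Longrightarrow> a \<bullet> b = 0"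
 shows "rword as x = x - (\<Sum>a\<in>set as. (2 * (a \<bullet> x)) *\<^sub>R a)"
 using assms
proof (induction as)
 case (Cons a as)
 have "a \<bullet> (\<Sum>b\<in>set as. (2 * (b \<bullet> x)) *\<^sub>R b) = (\<Sum>b\<in>set as. (2 * (b \<bullet> x)) * (a \<bullet> b))"
  by (simp add: inner_sum_right)
 also have "\<dots> = 0" using Cons.prems by (intro sum.neutral) auto
 finally have "a \<bullet> (\<Sum>b\<in>set as. (2 * (b \<bullet> x)) *\<^sub>R b) = 0" .
 thus ?case
  using Cons by (simp add: unit_reflection inner_diff_right)
qed simp

locale cox =
 fixes \<Delta> \<Delta>\<^sub>p \<Delta>\<^sub>m :: "'a::euclidean_space set"
 assumes indep: "independent \<Delta>"
  and norm_simple: "\<alpha> \<in> \<Delta> \<Longrightarrow> norm \<alpha> = 1"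
  and bip: "coxeter_bipartition \<Delta> \<Delta>\<^sub>p \<Delta>\<^sub>m"
begin

abbreviation "V \<equiv> span \<Delta>"
abbreviation "W \<equiv> refl_group \<Delta>"
abbreviation "c \<equiv> bipartite_coxeter_element \<Delta>\<^sub>p \<Delta>\<^sub>m"

lemma finite_simple: "finite \<Delta>"
 using indep independent_bound by blast

lemma parts: "\<Delta>\<^sub>p \<union> \<Delta>\<^sub>m = \<Delta>" "\<Delta>\<^sub>p \<inter> \<Delta>\<^sub>m = {}"
 using bip by (auto simp: coxeter_bipartition_def)

lemma simple_nonzero: "\<alpha> \<in> \<Delta> \<Longrightarrow> \<alpha> \<noteq> 0"
 using norm_simple by force

text \<open>Comparing the two products on \<open>\<alpha>\<close> would, for a nonzero inner
  product, make \<open>\<beta>\<close> a multiple of \<open>\<alpha>\<close>, against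
  independence.\<close>

lemma commuting_simple_orthogonal:
 assumes "\<alpha> \<in> \<Delta>" "\<beta> \<in> \<Delta>" "\<alpha> \<noteq> \<beta>"
  and "reflection \<alpha> \<circ> reflection \<beta> = reflection \<beta> \<circ> reflection \<alpha>"
 shows "\<alpha> \<bullet> \<beta> = 0"
proof (rule ccontr)
 assume nz: "\<alpha> \<bullet> \<beta> \<noteq> 0"
 have "reflection \<alpha> (reflection \<beta> \<alpha>) = reflection \<beta> (reflection \<alpha> \<alpha>)"
  using assms(4) by (metis comp_apply)
 hence e: "reflection \<alpha> (reflection \<beta> \<alpha>) \<bullet> y = reflection \<beta> (reflection \<alpha> \<alpha>) \<bullet> y" for y
  by simp
 have "(\<alpha> \<bullet> \<beta>) * (\<alpha> \<bullet> y) = \<beta> \<bullet> y" for y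
 proof -
  have "(\<alpha> \<bullet> \<beta>) * ((\<alpha> \<bullet> \<beta>) * (\<alpha> \<bullet> y) - \<beta> \<bullet> y) = 0"
   using e[of y] norm_simple[OF assms(1)] norm_simple[OF assms(2)]
   by (simp add: unit_reflection inner_diff_right inner_diff_left inner_commute[of \<beta> \<alpha>]
     dot_square_norm algebra_simps)
  thus ?thesis using nz by simp
 qed
 hence "\<forall>y. y \<bullet> ((\<alpha> \<bullet> \<beta>) *\<^sub>R \<alpha>) = y \<bullet> \<beta>"
  by (metis inner_commute inner_scaleR_left)
 hence "(\<alpha> \<bullet> \<beta>) *\<^sub>R \<alpha> = \<beta>" by (rule vector_eq_ldot[THEN iffD1])
 hence "\<beta> \<in> span {\<alpha>}" by (metis span_base span_mul singletonI)
 moreover have "span {\<alpha>} \<subseteq> span (\<Delta> - {\<beta>})" using assms by (intro span_mono) auto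
 ultimately show False using indep assms(2) by (auto simp: dependent_def)
qed

lemma part_orthogonal:
 assumes "D \<in> {\<Delta>\<^sub>p, \<Delta>\<^sub>m}" "\<alpha> \<in> D" "\<beta> \<in> D" "\<alpha> \<noteq> \<beta>"
 shows "\<alpha> \<bullet> \<beta> = 0"
 using bip assms parts
 by (intro commuting_simple_orthogonal) (auto simp: coxeter_bipartition_def)

lemma commuting_prod_part:
 assumes "D \<in> {\<Delta>\<^sub>p, \<Delta>\<^sub>m}"
 obtains as where "set as = D" "distinct as" "commuting_prod D = rword as"
proof -
 have "finite D" using assms parts finite_simple by (metis finite_Un insert_iff singletonD)
 then obtain as where as: "set as = D" "distinct as" using finite_distinct_list by metis
 have "\<forall>\<alpha>\<in>set as. \<forall>\<beta>\<in>set as. reflection \<alpha> \<circ> reflection \<beta> = reflection \<beta> \<circ> reflection \<alpha>"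
  using bip assms as by (auto simp: coxeter_bipartition_def)
 from commuting_prod_list[OF this as(2)] show ?thesis
  using as that by (auto simp: rword_def)
qed

lemma commuting_prod_part_eq:
 assumes "D \<in> {\<Delta>\<^sub>p, \<Delta>\<^sub>m}"
 shows "commuting_prod D x = x - (\<Sum>\<alpha>\<in>D. (2 * (\<alpha> \<bullet> x)) *\<^sub>R \<alpha>)"
proof -
 obtain as where as: "set as = D" "distinct as" "commuting_prod D = rword as"
  using commuting_prod_part[OF assms] by metis
 have "D \<subseteq> \<Delta>" using assms parts by auto
 thus ?thesis
  using rword_orthonormal[of as x] as norm_simple part_orthogonal[OF assms] by auto
qed

lemma coxeter_word:
 obtains L where "set L = \<Delta>" "distinct L" "c = rword L"
proof -
 obtain as where as: "set as = \<Delta>\<^sub>p" "distinct as" "commuting_prod \<Delta>\<^sub>p = rword as"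
  using commuting_prod_part[of "\<Delta>\<^sub>p"] by auto
 obtain bs where bs: "set bs = \<Delta>\<^sub>m" "distinct bs" "commuting_prod \<Delta>\<^sub>m = rword bs"
  using commuting_prod_part[of "\<Delta>\<^sub>m"] by auto
 show thesis
  by (rule that[of "bs @ as"])
   (use as bs parts in \<open>auto simp: bipartite_coxeter_element_def rword_append\<close>)
qed

lemma c_in_W: "c \<in> W"
 by (rule coxeter_word) (simp add: rword_in_refl_group)

lemma linear_c: "linear c"
 using c_in_W refl_group_linear by blast

lemma c_inner: "c x \<bullet> c y = x \<bullet> y"
 using c_in_W refl_group_inner by blast

lemma c_in_V: "x \<in> V \<Longrightarrow> c x \<in> V"
 using c_in_W refl_group_in_span by blast

lemma orthogonal_in_V: "x \<in> V \<Longrightarrow> (\<And>\<alpha>. \<alpha> \<in> \<Delta> \<Longrightarrow> \<alpha> \<bullet> x = 0) \<Longrightarrow> x = 0"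
proof -
 assume x: "x \<in> V" and o: "\<And>\<alpha>. \<alpha> \<in> \<Delta> \<Longrightarrow> \<alpha> \<bullet> x = 0"
 have "orthogonal x x"
  using x by (rule orthogonal_to_span) (use o in \<open>auto simp: orthogonal_def inner_commute\<close>)
 thus "x = 0" by (simp add: orthogonal_def)
qed

text \<open>\<open>c\<close> is a word in the independent simple roots, so a fixed vector is
  orthogonal to all of them.\<close>

lemma c_fixed: "x \<in> V \<Longrightarrow> c x = x \<Longrightarrow> x = 0"
proof -
 assume x: "x \<in> V" "c x = x"
 obtain L where L: "set L = \<Delta>" "distinct L" "c = rword L" by (rule coxeter_word)
 show "x = 0"
  by (rule orthogonal_in_V[OF x(1)]) (use rword_fix_orthogonal[of L x] L indep x in auto)
qed

text \<open>The equation reads \<open>c b = c v - v\<close>, and \<open>c - 1\<close> is injective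
  on the finite-dimensional space \<open>V\<close>, hence onto.\<close>

lemma c_solve:
 assumes "b \<in> V"
 obtains v where "v \<in> V" "c (v - b) = v"
proof -
 define g where "g x = c x - x" for x
 have lin: "linear g" unfolding g_def by (intro linear_compose_sub linear_c linear_id[unfolded id_def])
 have inj: "inj_on g (span V)"
 proof (rule inj_onI)
  fix x y assume "x \<in> span V" "y \<in> span V" "g x = g y"
  hence "x - y \<in> V" "c (x - y) = x - y"
   by (auto simp: span_span span_diff linear_diff[OF linear_c] g_def algebra_simps)
  hence "x - y = 0" by (rule c_fixed)
  thus "x = y" by simp
 qed
 have "g ` V = V"
 proof (rule subspace_dim_equal)
  show "subspace (g ` V)" using lin by (simp add: linear_subspace_image)
  show "g ` V \<subseteq> V" by (auto simp: g_def c_in_V span_diff)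
  show "dim (g ` V) \<ge> dim V" using dim_image_eq[OF lin inj] by simp
 qed auto
 moreover have "c b \<in> V" using assms c_in_V by blast
 ultimately obtain v where "v \<in> V" "c b = g v" by blast
 thus ?thesis using that[of v] by (simp add: g_def linear_diff[OF linear_c])
qed

lemma c_solution_nonzero: "c (v - b) = v \<Longrightarrow> b \<noteq> 0 \<Longrightarrow> v \<noteq> 0"
 by (metis c_in_W diff_0 linear_0 linear_c neg_equal_0_iff_equal refl_group_inj)

text \<open>\<open>c\<close> is an isometry, so \<open>v - b\<close> and \<open>v\<close> have equal
  length; hence the reflection in \<open>b\<close> carries \<open>v\<close> to
  \<open>v - b\<close>.\<close>

lemma c_solution_inner: "c (v - b) = v \<Longrightarrow> 2 * (b \<bullet> v) = b \<bullet> b"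
proof -
 assume "c (v - b) = v"
 hence "(v - b) \<bullet> (v - b) = v \<bullet> v" using c_inner[of "v - b" "v - b"] by simp
 thus ?thesis by (simp add: inner_diff_left inner_diff_right inner_commute)
qed

lemma c_solution_reflection:
 assumes "c (v - b) = v" "b \<noteq> 0"
 shows "reflection b v = v - b"
proof -
 have "b \<bullet> b \<noteq> 0" using assms(2) by simp
 hence "2 * (b \<bullet> v) / (b \<bullet> b) = 1"
  using c_solution_inner[OF assms(1)] by (metis divide_self)
 hence "reflection b v = v - 1 *\<^sub>R b" unfolding reflection_def by metis
 thus ?thesis by simp
qed

lemma dim_V: "dim V = card \<Delta>"
 using indep by (simp add: dim_eq_card_independent)

text \<open>A vector of \<open>V\<close> orthogonal to every letter would be fixed by
  \<open>c\<close>. This bounds the length of words for \<open>c\<close> from below and makes the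
  letters of a shortest word independent.\<close>

lemma coxeter_word_spans:
 assumes "rword bs = c" "set bs \<subseteq> V"
 shows "span (set bs) = V"
proof (rule ccontr)
 assume "span (set bs) \<noteq> V"
 moreover have "span (set bs) \<subseteq> V" using assms(2) by (simp add: span_minimal)
 ultimately have "span (set bs) \<subset> V" by auto
 then obtain x where x: "x \<noteq> 0" "x \<in> V" "\<And>y. y \<in> span (set bs) \<Longrightarrow> orthogonal x y"
  by (rule orthogonal_to_subspace_exists_gen) blast
 hence "rword bs x = x"
  by (intro rword_fixes) (auto simp: orthogonal_def inner_commute span_base)
 thus False using assms(1) c_fixed x by auto
qed

lemma coxeter_word_length:
 assumes "rword bs = c" "set bs \<subseteq> V"
 shows "card \<Delta> \<le> length bs"
proof -
 have "card \<Delta> \<le> card (set bs)"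
  using dim_le_card'[of "set bs"] coxeter_word_spans[OF assms] dim_V by (metis List.finite_set dim_span)
 also have "\<dots> \<le> length bs" by (rule card_length)
 finally show ?thesis .
qed

lemma coxeter_word_independent:
 assumes "rword bs = c" "set bs \<subseteq> V" "length bs = card \<Delta>"
 shows "distinct bs" "independent (set bs)"
proof -
 have "card \<Delta> \<le> card (set bs)"
  using dim_le_card'[of "set bs"] coxeter_word_spans[OF assms(1,2)] dim_V by (metis List.finite_set dim_span)
 hence eq: "card (set bs) = card \<Delta>" using card_length[of bs] assms(3) by simp
 thus "distinct bs" using assms(3) by (simp add: card_distinct)
 show "independent (set bs)"
  by (rule card_le_dim_spanning[of _ V])
   (use assms(2) coxeter_word_spans[OF assms(1,2)] eq dim_V in auto)
qed

text \<open>A word in the simple roots attains the lower bound, so reduced words for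
  \<open>c\<close> have \<open>card \<Delta>\<close> letters. The reduced word of \<open>x\<close>
  that generates \<open>H\<close> need not be the prefix occurring in the absolute order, but it has
  the same length and the same product, so it can replace that prefix.\<close>

lemma noncrossing_parabolic_iff:
 "noncrossing_parabolic \<Delta> c H \<longleftrightarrow> parabolic \<Delta> H \<and>
  (\<exists>bs us. (\<forall>b\<in>set (bs @ us). root_of \<Delta> b) \<and> H = refl_group (set bs) \<and>
    rword (bs @ us) = c \<and> length (bs @ us) = card \<Delta>)"
  (is "?L \<longleftrightarrow> ?R")
proof
 have min: "card \<Delta> \<le> length ts" if ts: "set ts \<subseteq> reflections \<Delta>" "word_prod ts = c" for ts
 proof -
  obtain bs where "\<forall>b\<in>set bs. root_of \<Delta> b" "ts = map reflection bs"
   using ts(1) by (auto simp: set_subset_reflections_iff)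
  thus ?thesis
   using coxeter_word_length[of bs] ts(2) root_of_in_span by (auto simp: rword_def)
 qed
 {
  assume ?L
  then obtain x ts us vs where *: "parabolic \<Delta> H" "reduced_word (reflections \<Delta>) x us"
   "reduced_word (reflections \<Delta>) c vs" "prefix us vs" "reduced_word (reflections \<Delta>) x ts"
   "H = generate orth_group (set ts)"
   unfolding noncrossing_parabolic_def abs_le_def by auto
  obtain ys where ys: "vs = us @ ys" using *(4) by (auto simp: prefix_def)
  have len: "length ts = length us" using *(2,5) unfolding reduced_word_def by (metis le_antisym)
  have T: "set ts \<subseteq> reflections \<Delta>" "set ys \<subseteq> reflections \<Delta>"
   using *(3,5) ys by (auto simp: reduced_word_def)
  obtain bs where bs: "\<forall>b\<in>set bs. root_of \<Delta> b" "ts = map reflection bs"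
   using T(1) by (auto simp: set_subset_reflections_iff)
  obtain ds where ds: "\<forall>b\<in>set ds. root_of \<Delta> b" "ys = map reflection ds"
   using T(2) by (auto simp: set_subset_reflections_iff)
  have app: "word_prod (as @ cs) = word_prod as \<circ> word_prod cs" for as cs :: "('a \<Rightarrow> 'a) list"
   by (induction as) (auto simp: word_prod_def)
  have c: "rword (bs @ ds) = c"
   using * ys bs ds unfolding reduced_word_def rword_def by (simp add: app)
  obtain L where L: "set L = \<Delta>" "distinct L" "c = rword L" by (rule coxeter_word)
  have "length vs \<le> length (map reflection L)"
  proof -
   have "set (map reflection L) \<subseteq> reflections \<Delta>"
    unfolding set_subset_reflections_iff root_of_def
    using L simple_nonzero reflection_in_refl_group by auto
   moreover have "word_prod (map reflection L) = c" using L by (simp add: rword_def)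
   ultimately show ?thesis using *(3) unfolding reduced_word_def by blast
  qed
  hence "length vs \<le> card \<Delta>" using L by (simp add: distinct_card flip: L(1))
  hence "length (bs @ ds) = card \<Delta>"
   using min[of vs] *(3) ys len bs ds unfolding reduced_word_def by auto
  moreover have "H = refl_group (set bs)" using *(6) bs(2) by (simp add: refl_group_def)
  ultimately show ?R using *(1) bs(1) ds(1) c by (intro conjI exI[of _ bs] exI[of _ ds]) auto
 next
  assume ?R
  then obtain bs us where *: "parabolic \<Delta> H" "\<forall>b\<in>set (bs @ us). root_of \<Delta> b"
   "H = refl_group (set bs)" "rword (bs @ us) = c" "length (bs @ us) = card \<Delta>" by auto
  define ts where "ts = map reflection bs"
  define ys where "ys = map reflection us"
  have T: "set (ts @ ys) \<subseteq> reflections \<Delta>"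
   using *(2) set_subset_reflections_iff[of "ts @ ys"] unfolding ts_def ys_def
   by (metis map_append)
  have app: "word_prod (as @ cs) = word_prod as \<circ> word_prod cs" for as cs :: "('a \<Rightarrow> 'a) list"
   by (induction as) (auto simp: word_prod_def)
  have w: "word_prod (ts @ ys) = c" using *(4) by (simp add: rword_def ts_def ys_def)
  have len: "length (ts @ ys) = card \<Delta>" using *(5) by (simp add: ts_def ys_def)
  have 1: "reduced_word (reflections \<Delta>) c (ts @ ys)"
   using T w len min unfolding reduced_word_def by auto
  have 2: "reduced_word (reflections \<Delta>) (word_prod ts) ts"
   unfolding reduced_word_def
  proof (intro conjI allI impI refl)
   fix vs assume "set vs \<subseteq> reflections \<Delta> \<and> word_prod vs = word_prod ts"
   hence "set (vs @ ys) \<subseteq> reflections \<Delta>" "word_prod (vs @ ys) = c"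
    using T w by (auto simp: app)
   hence "card \<Delta> \<le> length (vs @ ys)" by (rule min)
   thus "length ts \<le> length vs" using len by simp
  qed (use T in auto)
  have 3: "reduced_word (reflections \<Delta>) id []"
   by (auto simp: reduced_word_def word_prod_def)
  have "abs_le (reflections \<Delta>) id (word_prod ts)" "abs_le (reflections \<Delta>) (word_prod ts) c"
   unfolding abs_le_def using 1 2 3 by (metis Nil_prefix, metis prefixI)
  moreover have "H = generate orth_group (set ts)"
   using *(3) by (simp add: refl_group_def ts_def)
  ultimately show ?L using *(1) 2 unfolding noncrossing_parabolic_def by blast
 }
qed

lemma noncrossing_full: "noncrossing_parabolic \<Delta> c W"
proof -
 obtain L where L: "set L = \<Delta>" "distinct L" "c = rword L" by (rule coxeter_word)
 have "parabolic \<Delta> W"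
  unfolding parabolic_iff using id_in_refl_group[of \<Delta>] by (intro exI[of _ \<Delta>] exI[of _ id]) auto
 moreover have "\<forall>b\<in>set (L @ []). root_of \<Delta> b"
  using L simple_nonzero reflection_in_refl_group by (auto simp: root_of_def)
 moreover have "length (L @ []) = card \<Delta>" using L distinct_card[of L] by simp
 ultimately show ?thesis unfolding noncrossing_parabolic_iff using L by (metis append_Nil2)
qed

text \<open>With \<open>c = x t\<^sub>1 \<dots> t\<^sub>m\<close>, where \<open>x\<close> is the product of the reflections in \<open>bs\<close>, the solutions
 \<open>v\<close> of \<open>(1 - c\<^sup>-\<^sup>1) v = b\<close>, for \<open>b\<close> a root of one of the \<open>t\<^sub>i\<close>, span the fixed space of \<open>x\<close>.\<close>

lemma noncrossing_separation:
 assumes roots: "\<And>b. b \<in> set (bs @ us) \<Longrightarrow> root_of \<Delta> b"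
  and c: "rword (bs @ us) = c" and len: "length (bs @ us) = card \<Delta>"
  and y: "y \<in> V" "y \<notin> span (set bs)"
 obtains b v where "root_of \<Delta> b" "v \<in> V" "c (v - b) = v" "\<And>a. a \<in> set bs \<Longrightarrow> a \<bullet> v = 0"
  "y \<bullet> v \<noteq> 0"
proof -
 have inV: "set (bs @ us) \<subseteq> V" using roots root_of_in_span by blast
 have dist: "distinct (bs @ us)" and ind: "independent (set (bs @ us))"
  using coxeter_word_independent[OF c inV len] by auto
 \<comment> \<open>Follow \<open>v - u\<close> through \<open>us2\<close>, then \<open>u\<close>,
   then \<open>bs @ us1\<close>. The displacements \<open>s2\<close> and \<open>s1\<close> add up to
   a multiple of \<open>u\<close>, so independence of the letters makes both zero; hence
   \<open>bs @ us1\<close> fixes \<open>v\<close> and its letters are orthogonal to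
   \<open>v\<close>.\<close>
 have ortho: "v \<bullet> a = 0" if u: "us = us1 @ u # us2" and v: "v \<in> V" "c (v - u) = v" and a: "a \<in> set bs"
  for us1 u us2 v a
 proof -
  let ?A = "set (bs @ us1)" and ?B = "set us2"
  define r where "r = rword us2 (v - u)"
  have "u \<noteq> 0" using roots[of u] u by (auto simp: root_of_def)
  have veq: "rword (bs @ us1) (reflection u r) = v"
   using v(2) unfolding r_def c[symmetric] u by (simp add: rword_append)
  define s2 where "s2 = r - (v - u)"
  have s2: "s2 \<in> span ?B" unfolding s2_def r_def by (rule rword_diff_in_span)
  define \<kappa> where "\<kappa> = 2 * (u \<bullet> r) / (u \<bullet> u)"
  have ref: "reflection u r = r - \<kappa> *\<^sub>R u" by (simp add: reflection_def \<kappa>_def)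
  define s1 where "s1 = v - reflection u r"
  have s1: "s1 \<in> span ?A" unfolding s1_def using rword_diff_in_span[of "bs @ us1" "reflection u r"] veq
   by simp
  have sum: "s1 + s2 = (1 + \<kappa>) *\<^sub>R u" by (simp add: s1_def s2_def ref algebra_simps)
  have disj: "?A \<inter> ?B = {}" "u \<notin> ?A \<union> ?B" using dist u by auto
  have indAB: "independent (?A \<union> ?B)" by (rule independent_mono[OF ind]) (use u in auto)
  have indu: "independent ((?A \<union> ?B) \<union> {u})" by (rule independent_mono[OF ind]) (use u in auto)
  have "s1 + s2 \<in> span (?A \<union> ?B)"
   using s1 s2 span_mono[of ?A "?A \<union> ?B"] span_mono[of ?B "?A \<union> ?B"] by (intro span_add) auto
  moreover have "s1 + s2 \<in> span {u}" by (simp add: sum span_base span_mul)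
  ultimately have z: "s1 + s2 = 0"
   using independent_span_disjoint[OF indu] disj(2) by auto
  hence "s2 = - s1" by (metis add_eq_0_iff)
  hence "s1 \<in> span ?B" using s2 by (metis span_neg minus_minus)
  hence s10: "s1 = 0" using independent_span_disjoint[OF indAB disj(1) s1] by auto
  hence rv: "reflection u r = v" by (simp add: s1_def)
  hence "rword (bs @ us1) v = v" using veq by simp
  moreover have "distinct (bs @ us1)" using dist u by auto
  moreover have "independent ?A" by (rule independent_mono[OF ind]) (use u in auto)
  ultimately show ?thesis
   using rword_fix_orthogonal[of "bs @ us1" v a] a by (simp add: inner_commute)
 qed
 \<comment> \<open>\<open>w\<close> is the part of \<open>y\<close> orthogonal to \<open>bs\<close>.
   It will turn out to be a combination of the solutions \<open>sol u\<close>, so one of these has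
   nonzero product with \<open>y\<close>.\<close>
 obtain y1 w where w: "y1 \<in> span (set bs)" "\<And>z. z \<in> span (set bs) \<Longrightarrow> orthogonal w z" "y = y1 + w"
  using orthogonal_subspace_decomp_exists[of "set bs" y] by metis
 have wV: "w \<in> V" using w(3) y(1) w(1) span_mono[of "set bs" V] inV
  by (metis add_diff_cancel_left' set_append span_diff span_span subsetD le_sup_iff)
 have "w \<noteq> 0" using w y(2) by auto
 have yw: "y \<bullet> w = w \<bullet> w"
  using w(3) w(2)[OF w(1)] by (simp add: inner_add_left orthogonal_def inner_commute[of y1])
 define sol where "sol u = (SOME v. v \<in> V \<and> c (v - u) = v)" for u
 have sol: "sol u \<in> V" "c (sol u - u) = sol u" if "u \<in> V" for u
  using someI_ex[of "\<lambda>v. v \<in> V \<and> c (v - u) = v"] c_solve[OF that] unfolding sol_def by blast+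
 have "rword bs w = w"
  by (intro rword_fixes) (use w(2) in \<open>auto simp: orthogonal_def inner_commute span_base\<close>)
 \<comment> \<open>\<open>c\<close> maps \<open>w'\<close> to \<open>w\<close>, and
   \<open>w - w'\<close> is a combination of the letters \<open>us\<close>. The equation
   \<open>c (v - b) = v\<close> is linear in \<open>b\<close> and \<open>v\<close> jointly and
   determines \<open>v\<close>, so \<open>w\<close> is the same combination of the
   \<open>sol u\<close>.\<close>
 define w' where "w' = rword (rev us) w"
 have cw: "c w' = w" unfolding w'_def c[symmetric]
  using \<open>rword bs w = w\<close> by (simp add: rword_append rword_rev2)
 have "w' - w \<in> span (set us)" unfolding w'_def using rword_diff_in_span[of "rev us" w] by simp
 hence "w - w' \<in> span (set us)" by (metis span_neg minus_diff_eq)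
 then obtain k where k: "w - w' = (\<Sum>u\<in>set us. k u *\<^sub>R u)" using span_finite[of "set us"] by auto
 define s where "s = (\<Sum>u\<in>set us. k u *\<^sub>R sol u)"
 have usV: "u \<in> V" if "u \<in> set us" for u using inV that by auto
 have sV: "s \<in> V" unfolding s_def using sol(1) usV by (intro span_sum span_mul) auto
 have "c (s - (w - w')) = (\<Sum>u\<in>set us. k u *\<^sub>R c (sol u - u))"
  unfolding k s_def by (simp add: linear_diff[OF linear_c] linear_sum[OF linear_c]
    linear_cmul[OF linear_c] sum_subtractf scaleR_diff_right)
 also have "\<dots> = s" unfolding s_def using sol(2) usV by (intro sum.cong) auto
 finally have "c (s - w) = s - w" using cw
  by (simp add: linear_diff[OF linear_c] linear_add[OF linear_c] algebra_simps)
 moreover have "s - w \<in> V" using sV wV by (rule span_diff)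
 ultimately have "s - w = 0" by (intro c_fixed)
 hence "s = w" by simp
 have "\<exists>u\<in>set us. y \<bullet> sol u \<noteq> 0"
 proof (rule ccontr)
  assume "\<not> ?thesis"
  hence "y \<bullet> s = 0" unfolding s_def by (simp add: inner_sum_right)
  thus False using \<open>s = w\<close> yw \<open>w \<noteq> 0\<close> by simp
 qed
 then obtain u where u: "u \<in> set us" "y \<bullet> sol u \<noteq> 0" by blast
 obtain us1 us2 where us: "us = us1 @ u # us2" using u(1) split_list by metis
 have "a \<bullet> sol u = 0" if "a \<in> set bs" for a
  using ortho[OF us sol[OF usV[OF u(1)]] that] by (simp add: inner_commute)
 moreover have "root_of \<Delta> u" using roots u(1) by auto
 ultimately show thesis using that[of u "sol u"] sol[OF usV[OF u(1)]] u(2) by blast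
qed

end

section \<open>Reflection length, and words for subgroups built letter by letter\<close>

locale cox_carter = cox +
 assumes carter: "w \<in> W \<Longrightarrow> w \<noteq> id \<Longrightarrow> \<exists>z\<in>V. w z \<noteq> z \<and> root_of \<Delta> (z - w z)"
begin

lemma subspace_fixed: "w \<in> W \<Longrightarrow> subspace {x \<in> V. w x = x}"
 unfolding subspace_def using refl_group_linear[of w]
 by (auto simp: linear_0 linear_add linear_cmul span_0 span_add span_mul)

text \<open>The reflection in the root \<open>b = z - w z\<close> swaps \<open>z\<close> and
  \<open>w z\<close>. Composed with \<open>w\<close> it fixes \<open>z\<close> in addition to all
  old fixed vectors, which are orthogonal to \<open>b\<close>; so each reflection used enlarges the
  fixed space.\<close>

lemma reflection_length_le:
 assumes "w \<in> W"
 shows "\<exists>us. (\<forall>u\<in>set us. root_of \<Delta> u) \<and> rword us = w \<and>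
  length us + dim {x \<in> V. w x = x} \<le> card \<Delta>"
 using assms
proof (induction "card \<Delta> - dim {x \<in> V. w x = x}" arbitrary: w rule: less_induct)
 case less
 have le: "dim {x \<in> V. u x = x} \<le> card \<Delta>" for u
  using dim_subset[of "{x \<in> V. u x = x}" V] dim_V by auto
 show ?case
 proof (cases "w = id")
  case True
  thus ?thesis using le[of w] by (intro exI[of _ "[]"]) (auto simp del: dim_span)
 next
  case False
  then obtain z where z: "z \<in> V" "w z \<noteq> z" "root_of \<Delta> (z - w z)" using carter less.prems by blast
  define b where "b = z - w z"
  define w1 where "w1 = reflection b \<circ> w"
  have w1: "w1 \<in> W" using z(3) less.prems unfolding w1_def b_def root_of_def
   by (auto intro: refl_group_comp)
  have "w1 z = z" unfolding w1_def b_def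
   using reflection_swap[of "w z" z] refl_group_inner[OF less.prems, of z z]
   by (simp add: reflection_commute_diff)
  have sub: "{x \<in> V. w x = x} \<subseteq> {x \<in> V. w1 x = x}"
  proof
   fix x assume "x \<in> {x \<in> V. w x = x}"
   hence "x \<in> V" "w x = x" by auto
   hence "b \<bullet> x = 0" using refl_group_inner[OF less.prems, of z x]
    by (simp add: b_def inner_diff_left)
   thus "x \<in> {x \<in> V. w1 x = x}" using \<open>w x = x\<close> \<open>x \<in> V\<close> by (simp add: w1_def reflection_fix_iff)
  qed
  have "dim {x \<in> V. w x = x} < dim {x \<in> V. w1 x = x}"
  proof (rule ccontr)
   assume "\<not> ?thesis"
   hence "{x \<in> V. w x = x} = {x \<in> V. w1 x = x}"
    using subspace_dim_equal[OF subspace_fixed[OF less.prems] subspace_fixed[OF w1] sub] by auto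
   thus False using z \<open>w1 z = z\<close> by auto
  qed
  moreover from this have "card \<Delta> - dim {x \<in> V. w1 x = x} < card \<Delta> - dim {x \<in> V. w x = x}"
   using le[of w1] by simp
  from less.hyps[OF this w1] obtain us where us: "\<forall>u\<in>set us. root_of \<Delta> u" "rword us = w1"
   "length us + dim {x \<in> V. w1 x = x} \<le> card \<Delta>" by auto
  moreover have "rword (b # us) = w" using us(2) by (auto simp: w1_def fun_eq_iff)
  ultimately show ?thesis
   using z(3) by (intro exI[of _ "b # us"]) (auto simp: b_def)
 qed
qed

text \<open>The orthogonality condition makes the matrix of inner products of the letters with the
  solutions belonging to them triangular. It can be checked geometrically and replaces a direct
  search for the remaining letters of a word for \<open>c\<close>.\<close>

inductive triangular :: "'a list \<Rightarrow> bool" where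
 Nil: "triangular []"
| snoc: "triangular bs \<Longrightarrow> root_of \<Delta> b \<Longrightarrow> v \<in> V \<Longrightarrow> c (v - b) = v \<Longrightarrow>
  (\<And>a. a \<in> set bs \<Longrightarrow> a \<bullet> v = 0) \<Longrightarrow> triangular (bs @ [b])"

text \<open>The inverse of the old word fixes \<open>v\<close>, the reflection in \<open>b\<close>
  sends it to \<open>v - b\<close>, and \<open>c\<close> sends that back to \<open>v\<close>. Before
  the new letter \<open>v\<close> was not fixed, because \<open>c\<close> fixes no nonzero vector of
  \<open>V\<close>.\<close>

lemma triangular_fixed_dim:
 "triangular bs \<Longrightarrow> (\<forall>b\<in>set bs. root_of \<Delta> b) \<and>
  length bs \<le> dim {x \<in> V. c (rword (rev bs) x) = x}"
proof (induction rule: triangular.induct)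
 case (snoc bs b v)
 define z where "z = c \<circ> rword (rev bs)"
 define z' where "z' = c \<circ> rword (rev (bs @ [b]))"
 have roots: "\<forall>a\<in>set (bs @ [b]). root_of \<Delta> a" using snoc by auto
 have zW: "z \<in> W" "z' \<in> W" unfolding z_def z'_def
  using roots by (auto intro!: refl_group_comp c_in_W rword_in_refl_group_gen simp: root_of_def)
 have b0: "b \<noteq> 0" using snoc by (auto simp: root_of_def)
 have fixv: "rword (rev bs) v = v" using snoc by (intro rword_fixes) auto
 have z'v: "z' v = v" unfolding z'_def using fixv c_solution_reflection[of v b] b0 snoc
  by simp
 have "z v \<noteq> v" unfolding z_def using fixv c_fixed[of v] c_solution_nonzero[of v b] b0 snoc by auto
 \<comment> \<open>Write an old fixed vector as \<open>x = c y\<close>. Then \<open>y - x\<close> is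
   orthogonal to \<open>v\<close>, while \<open>c (v - b) = v\<close> gives \<open>y\<close> and
   \<open>v - b\<close> the inner product of \<open>x\<close> and \<open>v\<close>; so
   \<open>y\<close> is orthogonal to \<open>b\<close>.\<close>
 have sub: "{x \<in> V. z x = x} \<subseteq> {x \<in> V. z' x = x}"
 proof
  fix x assume "x \<in> {x \<in> V. z x = x}"
  hence x: "x \<in> V" "z x = x" by auto
  define y where "y = rword (rev bs) x"
  have cy: "c y = x" using x by (simp add: z_def y_def)
  have "y - x \<in> span (set bs)" unfolding y_def using rword_diff_in_span[of "rev bs" x] by simp
  hence "(y - x) \<bullet> v = 0"
   using orthogonal_to_span[of "y - x" "set bs" v] snoc.hyps by (auto simp: orthogonal_def inner_commute)
  moreover have "y \<bullet> (v - b) = x \<bullet> v" using c_inner[of y "v - b"] cy snoc.hyps by simp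
  ultimately have "b \<bullet> y = 0" by (simp add: inner_diff_left inner_diff_right inner_commute)
  hence "reflection b y = y" by (simp add: reflection_fix_iff)
  thus "x \<in> {x \<in> V. z' x = x}" using x cy by (simp add: z'_def y_def)
 qed
 have "dim {x \<in> V. z x = x} < dim {x \<in> V. z' x = x}"
 proof (rule ccontr)
  assume "\<not> ?thesis"
  hence "{x \<in> V. z x = x} = {x \<in> V. z' x = x}"
   using subspace_dim_equal[OF subspace_fixed[OF zW(1)] subspace_fixed[OF zW(2)] sub] by auto
  thus False using \<open>z v \<noteq> v\<close> z'v snoc.hyps by auto
 qed
 thus ?case using snoc.IH roots by (auto simp: z_def z'_def)
qed simp

text \<open>\<open>c\<close> times the inverse word fixes a space of dimension at least
  \<open>length bs\<close>, so it is a product of at most \<open>card \<Delta> - length bs\<close>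
  reflections. Conjugating these by the inverse word moves \<open>bs\<close> to the front, and the
  lower bound on word lengths forces equality.\<close>

lemma triangular_noncrossing:
 assumes "parabolic \<Delta> H" "triangular bs" "H = refl_group (set bs)"
 shows "noncrossing_parabolic \<Delta> c H"
proof -
 have roots: "\<forall>b\<in>set bs. root_of \<Delta> b" and
  d: "length bs \<le> dim {x \<in> V. c (rword (rev bs) x) = x}"
  using triangular_fixed_dim[OF assms(2)] by auto
 have "c \<circ> rword (rev bs) \<in> W"
  using roots by (auto intro!: refl_group_comp c_in_W rword_in_refl_group_gen simp: root_of_def)
 from reflection_length_le[OF this] obtain us where
  us: "\<forall>u\<in>set us. root_of \<Delta> u" "rword us = c \<circ> rword (rev bs)" "length us + length bs \<le> card \<Delta>"
  using d by auto
 define us' where "us' = map (rword (rev bs)) us"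
 have rW: "rword (rev bs) \<in> W" using roots by (auto intro!: rword_in_refl_group_gen simp: root_of_def)
 have us': "\<forall>u\<in>set us'. root_of \<Delta> u" unfolding us'_def using us(1) root_of_conj[OF rW] by auto
 have "rword (bs @ us') x = c x" for x
 proof -
  have "rword us' x = rword (rev bs) (rword us (rword bs x))"
   unfolding us'_def
   using rword_conj[OF orthogonal_transformation_rword, of "rev bs" us "rword bs x"]
   by (simp add: rword_rev1)
  thus ?thesis by (simp add: rword_append rword_rev2 us(2) rword_rev1)
 qed
 hence c: "rword (bs @ us') = c" by auto
 have rs: "\<forall>b\<in>set (bs @ us'). root_of \<Delta> b" using roots us' by auto
 hence "set (bs @ us') \<subseteq> V" using root_of_in_span by blast
 from coxeter_word_length[OF c this] us(3) have "length (bs @ us') = card \<Delta>" by (simp add: us'_def)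
 thus ?thesis unfolding noncrossing_parabolic_iff using assms rs c by blast
qed

lemma triangular_single: "root_of \<Delta> b \<Longrightarrow> triangular [b]"
proof -
 assume b: "root_of \<Delta> b"
 then obtain v where v: "v \<in> V" "c (v - b) = v" using c_solve root_of_in_span by metis
 have "triangular ([] @ [b])" by (rule triangular.snoc[OF triangular.Nil b v]) simp
 thus ?thesis by simp
qed

end


section \<open>The Coxeter plane\<close>

text \<open>Eigenvectors of a symmetric matrix for different eigenvalues are orthogonal, which two
  positive vectors never are. So the eigenvalue belonging to \<open>k\<close> can be read off any
  explicit positive eigenvector.\<close>

lemma positive_eigenvalue_unique:
 fixes \<Delta> :: "'a::euclidean_space set"
 assumes "finite \<Delta>" "\<Delta> \<noteq> {}" "\<And>\<alpha>. \<alpha> \<in> \<Delta> \<Longrightarrow> 0 < k \<alpha>" "\<And>\<alpha>. \<alpha> \<in> \<Delta> \<Longrightarrow> 0 < k' \<alpha>"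
  and "\<And>\<alpha>. \<alpha> \<in> \<Delta> \<Longrightarrow> (\<Sum>\<beta>\<in>\<Delta>. (\<alpha> \<bullet> \<beta>) * k \<beta>) = l * k \<alpha>"
  and "\<And>\<alpha>. \<alpha> \<in> \<Delta> \<Longrightarrow> (\<Sum>\<beta>\<in>\<Delta>. (\<alpha> \<bullet> \<beta>) * k' \<beta>) = l' * k' \<alpha>"
 shows "l = (l' :: real)"
proof -
 have "l * (\<Sum>\<alpha>\<in>\<Delta>. k \<alpha> * k' \<alpha>) = (\<Sum>\<alpha>\<in>\<Delta>. (\<Sum>\<beta>\<in>\<Delta>. (\<alpha> \<bullet> \<beta>) * k \<beta>) * k' \<alpha>)"
  using assms(5) by (simp add: sum_distrib_left mult_ac)
 also have "\<dots> = (\<Sum>\<alpha>\<in>\<Delta>. \<Sum>\<beta>\<in>\<Delta>. (\<alpha> \<bullet> \<beta>) * k \<beta> * k' \<alpha>)" by (simp add: sum_distrib_right)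
 also have "\<dots> = (\<Sum>\<beta>\<in>\<Delta>. \<Sum>\<alpha>\<in>\<Delta>. (\<alpha> \<bullet> \<beta>) * k \<beta> * k' \<alpha>)" by (rule sum.swap)
 also have "\<dots> = (\<Sum>\<beta>\<in>\<Delta>. (\<Sum>\<alpha>\<in>\<Delta>. (\<beta> \<bullet> \<alpha>) * k' \<alpha>) * k \<beta>)"
  by (simp add: sum_distrib_right sum_distrib_left inner_commute mult_ac)
 also have "\<dots> = l' * (\<Sum>\<alpha>\<in>\<Delta>. k \<alpha> * k' \<alpha>)"
  using assms(6) by (simp add: sum_distrib_left mult_ac)
 finally have "l * (\<Sum>\<alpha>\<in>\<Delta>. k \<alpha> * k' \<alpha>) = l' * (\<Sum>\<alpha>\<in>\<Delta>. k \<alpha> * k' \<alpha>)" .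
 moreover have "(\<Sum>\<alpha>\<in>\<Delta>. k \<alpha> * k' \<alpha>) > 0" using assms by (intro sum_pos) auto
 ultimately show ?thesis by simp
qed

lemma orth_proj_eqI:
 assumes "subspace U" "y \<in> U" "\<And>z. z \<in> U \<Longrightarrow> (x - y) \<bullet> z = 0"
 shows "orth_proj U x = y"
 unfolding orth_proj_def
proof (rule the_equality)
 show "y \<in> U \<and> (\<forall>z\<in>U. (x - y) \<bullet> z = 0)" using assms by auto
next
 fix y' assume y': "y' \<in> U \<and> (\<forall>z\<in>U. (x - y') \<bullet> z = 0)"
 hence "y' - y \<in> U" using assms by (simp add: subspace_diff)
 hence "(x - y) \<bullet> (y' - y) - (x - y') \<bullet> (y' - y) = 0" using assms(3) y' by simp
 hence "(y' - y) \<bullet> (y' - y) = 0" by (simp add: inner_diff_left)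
 thus "y' = y" by simp
qed

lemma (in cox) dual_basis:
 assumes "\<alpha> \<in> \<Delta>"
 shows "dual_basis \<Delta> \<alpha> \<in> V"
  and "\<beta> \<in> \<Delta> \<Longrightarrow> dual_basis \<Delta> \<alpha> \<bullet> \<beta> = (if \<beta> = \<alpha> then 1 else 0)"
proof -
 have ns: "\<alpha> \<notin> span (\<Delta> - {\<alpha>})" using indep assms by (auto simp: dependent_def)
 obtain y z where yz: "y \<in> span (\<Delta> - {\<alpha>})" "\<And>w. w \<in> span (\<Delta> - {\<alpha>}) \<Longrightarrow> orthogonal z w"
  "\<alpha> = y + z"
  using orthogonal_subspace_decomp_exists[of "\<Delta> - {\<alpha>}" \<alpha>] by metis
 have "z \<noteq> 0" using yz ns by auto
 have zV: "z \<in> V" using yz(1,3) assms span_mono[of "\<Delta> - {\<alpha>}" \<Delta>]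
  by (metis Diff_subset add_diff_cancel_left' span_base span_diff subsetD)
 define w where "w = (1 / (z \<bullet> z)) *\<^sub>R z"
 have za: "z \<bullet> \<alpha> = z \<bullet> z" using yz(2)[OF yz(1)] yz(3) by (simp add: inner_add_right orthogonal_def)
 have w: "w \<in> V \<and> (\<forall>\<beta>\<in>\<Delta>. w \<bullet> \<beta> = (if \<beta> = \<alpha> then 1 else 0))"
  using zV za \<open>z \<noteq> 0\<close> yz(2) by (auto simp: w_def span_mul orthogonal_def span_base)
 have "\<exists>!w. w \<in> V \<and> (\<forall>\<beta>\<in>\<Delta>. w \<bullet> \<beta> = (if \<beta> = \<alpha> then 1 else 0))"
 proof (rule ex1I[of _ w], rule w)
  fix w' assume w': "w' \<in> V \<and> (\<forall>\<beta>\<in>\<Delta>. w' \<bullet> \<beta> = (if \<beta> = \<alpha> then 1 else 0))"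
  have "w' - w = 0"
   by (rule orthogonal_in_V) (use w w' in \<open>auto simp: span_diff inner_diff_right inner_commute[of _ w] inner_commute[of _ w']\<close>)
  thus "w' = w" by simp
 qed
 from theI'[OF this] show "dual_basis \<Delta> \<alpha> \<in> V"
  and "\<beta> \<in> \<Delta> \<Longrightarrow> dual_basis \<Delta> \<alpha> \<bullet> \<beta> = (if \<beta> = \<alpha> then 1 else 0)"
  unfolding dual_basis_def by blast+
qed

text \<open>The Coxeter number enters through the eigenvalue \<open>1 - cos (pi / h)\<close>, which
  makes the two vectors spanning the plane enclose the angle \<open>pi / h\<close>.\<close>

locale cox_plane = cox +
 fixes k :: "'a::euclidean_space \<Rightarrow> real" and h :: nat
 assumes k_pos: "\<alpha> \<in> \<Delta> \<Longrightarrow> 0 < k \<alpha>"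
  and eigen: "\<alpha> \<in> \<Delta> \<Longrightarrow> (\<Sum>\<beta>\<in>\<Delta>. (\<alpha> \<bullet> \<beta>) * k \<beta>) = (1 - cos (pi / h)) * k \<alpha>"
  and h_ge: "h \<ge> 3" and nonempty: "\<Delta> \<noteq> {}"
begin

abbreviation "\<kappa> \<equiv> cos (pi / h)"

lemma \<kappa>_pos: "\<kappa> > 0"
proof -
 have "pi / h \<le> pi / 3" using h_ge by (intro divide_left_mono) auto
 hence "pi / h < pi / 2" using pi_gt_zero by linarith
 moreover have "pi / h \<ge> 0" by simp
 ultimately show ?thesis using pi_gt_zero by (intro cos_gt_zero_pi) linarith+
qed

lemma sin_pos: "sin (pi / h) > 0"
 using h_ge by (intro sin_gt_zero) (auto simp: field_simps)

definition plane_vec :: "'a set \<Rightarrow> 'a" where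
 "plane_vec D = (\<Sum>\<alpha>\<in>D. k \<alpha> *\<^sub>R dual_basis \<Delta> \<alpha>)"

lemma plane_vec_in_V: "D \<subseteq> \<Delta> \<Longrightarrow> plane_vec D \<in> V"
 unfolding plane_vec_def using dual_basis(1) by (intro span_sum span_mul) auto

lemma plane_vec_inner:
 assumes "D \<subseteq> \<Delta>" "\<beta> \<in> \<Delta>"
 shows "plane_vec D \<bullet> \<beta> = (if \<beta> \<in> D then k \<beta> else 0)"
proof -
 have "finite D" using assms(1) finite_simple finite_subset by blast
 have "plane_vec D \<bullet> \<beta> = (\<Sum>\<alpha>\<in>D. k \<alpha> * (dual_basis \<Delta> \<alpha> \<bullet> \<beta>))"
  by (simp add: plane_vec_def inner_sum_left)
 also have "\<dots> = (\<Sum>\<alpha>\<in>D. if \<beta> = \<alpha> then k \<alpha> else 0)"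
  using assms dual_basis(2) by (intro sum.cong) auto
 finally show ?thesis using \<open>finite D\<close> by simp
qed

lemma opposite_sum:
 assumes "{D, D'} = {\<Delta>\<^sub>p, \<Delta>\<^sub>m}" "\<beta> \<in> D'"
 shows "(\<Sum>\<alpha>\<in>D. (\<beta> \<bullet> \<alpha>) * k \<alpha>) = - \<kappa> * k \<beta>"
proof -
 have D: "D \<union> D' = \<Delta>" "D \<inter> D' = {}" "D' \<in> {\<Delta>\<^sub>p, \<Delta>\<^sub>m}" using assms(1) parts by (auto simp: doubleton_eq_iff)
 have fin: "finite D" "finite D'" using D(1) finite_simple by auto
 have "(\<Sum>\<alpha>\<in>D'. (\<beta> \<bullet> \<alpha>) * k \<alpha>) = (\<Sum>\<alpha>\<in>D'. if \<alpha> = \<beta> then k \<alpha> else 0)"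
 proof (intro sum.cong refl)
  fix \<alpha> assume "\<alpha> \<in> D'"
  hence "norm \<beta> = 1" "\<alpha> \<noteq> \<beta> \<Longrightarrow> \<beta> \<bullet> \<alpha> = 0"
   using norm_simple[of \<beta>] D assms(2) part_orthogonal[OF D(3), of \<beta> \<alpha>] by auto
  thus "(\<beta> \<bullet> \<alpha>) * k \<alpha> = (if \<alpha> = \<beta> then k \<alpha> else 0)" by (auto simp: dot_square_norm)
 qed
 also have "\<dots> = k \<beta>" using fin assms(2) by simp
 finally have "(\<Sum>\<alpha>\<in>D. (\<beta> \<bullet> \<alpha>) * k \<alpha>) + k \<beta> = (1 - \<kappa>) * k \<beta>"
  using eigen[of \<beta>] assms(2) D fin sum.union_disjoint[of D D' "\<lambda>\<alpha>. (\<beta> \<bullet> \<alpha>) * k \<alpha>"] by auto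
 thus ?thesis by (simp add: algebra_simps)
qed

text \<open>\<open>plane_vec D'\<close> is orthogonal to the roots in \<open>D\<close>. The second
  identity is tested against each simple root, and at the roots of \<open>D'\<close> it is the
  eigenvector equation. So each factor of \<open>c\<close> acts on the plane as a
  reflection.\<close>

lemma commuting_prod_plane_vec:
 assumes "{D, D'} = {\<Delta>\<^sub>p, \<Delta>\<^sub>m}"
 shows "commuting_prod D (plane_vec D') = plane_vec D'"
  and "commuting_prod D (plane_vec D) = - plane_vec D + (2 * \<kappa>) *\<^sub>R plane_vec D'"
proof -
 have D: "D \<union> D' = \<Delta>" "D \<inter> D' = {}" "D \<in> {\<Delta>\<^sub>p, \<Delta>\<^sub>m}" using assms(1) parts by (auto simp: doubleton_eq_iff)
 have fin: "finite D" "finite D'" using D(1) finite_simple by auto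
 have sub: "D \<subseteq> \<Delta>" "D' \<subseteq> \<Delta>" using D by auto
 note eq = commuting_prod_part_eq[OF D(3)]
 have "(\<Sum>\<alpha>\<in>D. (2 * (\<alpha> \<bullet> plane_vec D')) *\<^sub>R \<alpha>) = 0"
  using D sub plane_vec_inner[OF sub(2)] by (intro sum.neutral) (auto simp: inner_commute)
 thus "commuting_prod D (plane_vec D') = plane_vec D'" by (simp add: eq)
 let ?x = "commuting_prod D (plane_vec D) - (- plane_vec D + (2 * \<kappa>) *\<^sub>R plane_vec D')"
 have c: "commuting_prod D (plane_vec D) = plane_vec D - (\<Sum>\<alpha>\<in>D. (2 * k \<alpha>) *\<^sub>R \<alpha>)"
  unfolding eq using sub plane_vec_inner[OF sub(1)]
  by (intro arg_cong2[where f = minus] sum.cong) (auto simp: inner_commute)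
 have sV: "(\<Sum>\<alpha>\<in>D. (2 * k \<alpha>) *\<^sub>R \<alpha>) \<in> V" using sub by (intro span_sum span_mul) (auto intro: span_base)
 have "?x = 0"
 proof (rule orthogonal_in_V)
  show "?x \<in> V" unfolding c using sV plane_vec_in_V[OF sub(1)] plane_vec_in_V[OF sub(2)]
   by (intro span_add span_diff span_neg span_mul) auto
  fix \<beta> assume \<beta>: "\<beta> \<in> \<Delta>"
  have i: "\<beta> \<bullet> ?x = 2 * (plane_vec D \<bullet> \<beta>) - 2 * (\<Sum>\<alpha>\<in>D. (\<beta> \<bullet> \<alpha>) * k \<alpha>) - 2 * \<kappa> * (plane_vec D' \<bullet> \<beta>)"
   unfolding c by (simp add: inner_diff_right inner_add_right inner_sum_right sum_distrib_left
     inner_commute mult_ac)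
  show "\<beta> \<bullet> ?x = 0"
  proof (cases "\<beta> \<in> D")
   case True
   have "(\<Sum>\<alpha>\<in>D. (\<beta> \<bullet> \<alpha>) * k \<alpha>) = (\<Sum>\<alpha>\<in>D. if \<alpha> = \<beta> then k \<alpha> else 0)"
   proof (intro sum.cong refl)
    fix \<alpha> assume "\<alpha> \<in> D"
    hence "norm \<beta> = 1" "\<alpha> \<noteq> \<beta> \<Longrightarrow> \<beta> \<bullet> \<alpha> = 0"
     using norm_simple[OF \<beta>] True part_orthogonal[OF D(3), of \<beta> \<alpha>] by auto
    thus "(\<beta> \<bullet> \<alpha>) * k \<alpha> = (if \<alpha> = \<beta> then k \<alpha> else 0)" by (auto simp: dot_square_norm)
   qed
   also have "\<dots> = k \<beta>" using fin True by simp
   finally show ?thesis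
    unfolding i using True D plane_vec_inner[OF sub(1) \<beta>] plane_vec_inner[OF sub(2) \<beta>] by auto
  next
   case False
   hence "\<beta> \<in> D'" using D \<beta> by auto
   thus ?thesis
    unfolding i using False opposite_sum[OF assms \<open>\<beta> \<in> D'\<close>]
     plane_vec_inner[OF sub(1) \<beta>] plane_vec_inner[OF sub(2) \<beta>] by auto
  qed
 qed
 thus "commuting_prod D (plane_vec D) = - plane_vec D + (2 * \<kappa>) *\<^sub>R plane_vec D'" by simp
qed

abbreviation "lam \<equiv> plane_vec \<Delta>\<^sub>p"
abbreviation "\<mu> \<equiv> plane_vec \<Delta>\<^sub>m"

lemma sub: "\<Delta>\<^sub>p \<subseteq> \<Delta>" "\<Delta>\<^sub>m \<subseteq> \<Delta>"
 using parts by auto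

lemma commuting_prod_inner:
 assumes "D \<in> {\<Delta>\<^sub>p, \<Delta>\<^sub>m}"
 shows "commuting_prod D x \<bullet> commuting_prod D y = x \<bullet> y"
 by (rule commuting_prod_part[OF assms]) (simp add: rword_inner)

lemma linear_commuting_prod: "D \<in> {\<Delta>\<^sub>p, \<Delta>\<^sub>m} \<Longrightarrow> linear (commuting_prod D)"
 by (erule commuting_prod_part) (simp add: linear_rword)

text \<open>Both factors of \<open>c\<close> are isometries; applying each of them to the pair
  \<open>lam\<close>, \<open>\<mu>\<close> gives two linear relations between the three inner
  products.\<close>

lemma plane_inner: "lam \<bullet> \<mu> = \<kappa> * (lam \<bullet> lam)" "\<mu> \<bullet> \<mu> = lam \<bullet> lam"
proof -
 have 1: "\<kappa> * (\<mu> \<bullet> \<mu>) = lam \<bullet> \<mu>"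
  using commuting_prod_inner[of \<Delta>\<^sub>p lam \<mu>] commuting_prod_plane_vec[of \<Delta>\<^sub>p \<Delta>\<^sub>m]
  by (simp add: inner_add_left inner_diff_left)
 have "{\<Delta>\<^sub>m, \<Delta>\<^sub>p} = {\<Delta>\<^sub>p, \<Delta>\<^sub>m}" by auto
 from commuting_prod_plane_vec[OF this] have 2: "\<kappa> * (lam \<bullet> lam) = lam \<bullet> \<mu>"
  using commuting_prod_inner[of \<Delta>\<^sub>m \<mu> lam]
  by (simp add: inner_add_left inner_diff_left inner_diff_right inner_commute)
 show "lam \<bullet> \<mu> = \<kappa> * (lam \<bullet> lam)" using 2 by simp
 show "\<mu> \<bullet> \<mu> = lam \<bullet> lam" using 1 2 \<kappa>_pos by (metis mult_cancel_left less_irrefl)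
qed

lemma plane_vec_nonzero: "lam \<noteq> 0"
proof
 assume z: "lam = 0"
 hence "\<mu> = 0" using plane_inner(2) by simp
 obtain \<beta> where \<beta>: "\<beta> \<in> \<Delta>" using nonempty by auto
 have "lam \<bullet> \<beta> + \<mu> \<bullet> \<beta> = k \<beta>"
  using plane_vec_inner[OF sub(1) \<beta>] plane_vec_inner[OF sub(2) \<beta>] \<beta> parts by auto
 thus False using z \<open>\<mu> = 0\<close> k_pos[OF \<beta>] by simp
qed

section \<open>An orthonormal basis of the Coxeter plane, in which \<open>c\<close> is a
  rotation\<close>

definition E1 :: 'a where "E1 = (1 / norm lam) *\<^sub>R lam"
text \<open>Gram-Schmidt up to sign; the sign is chosen so that \<open>c\<close> rotates by
  \<open>+ 2 * pi / h\<close> from \<open>E1\<close> towards \<open>E2\<close>.\<close>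

definition E2 :: 'a where "E2 = (1 / (norm lam * sin (pi / h))) *\<^sub>R (\<kappa> *\<^sub>R lam - \<mu>)"

lemma sin_sq: "sin (pi / h) * sin (pi / h) = 1 - \<kappa> * \<kappa>"
 using sin_cos_squared_add[of "pi / h"] by (simp add: power2_eq_square)

lemma E_orthonormal: "E1 \<bullet> E1 = 1" "E2 \<bullet> E2 = 1" "E1 \<bullet> E2 = 0"
proof -
 have n: "lam \<bullet> lam = norm lam * norm lam" "norm lam \<noteq> 0"
  using plane_vec_nonzero by (auto simp: dot_square_norm power2_eq_square)
 show "E1 \<bullet> E1 = 1" using n by (simp add: E1_def)
 have e: "(\<kappa> *\<^sub>R lam - \<mu>) \<bullet> (\<kappa> *\<^sub>R lam - \<mu>) = (lam \<bullet> lam) * (sin (pi / h) * sin (pi / h))"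
  unfolding sin_sq using plane_inner by (simp add: inner_diff_left inner_diff_right inner_commute[of \<mu> lam] algebra_simps)
 show "E2 \<bullet> E2 = 1" using n sin_pos by (simp add: E2_def e)
 show "E1 \<bullet> E2 = 0" using plane_inner by (simp add: E1_def E2_def inner_diff_right)
qed

lemma E_in_V: "E1 \<in> V" "E2 \<in> V"
 unfolding E1_def E2_def using plane_vec_in_V sub by (auto intro!: span_mul span_diff)

lemma plane_eq: "coxeter_plane k \<Delta>\<^sub>p \<Delta>\<^sub>m = span {E1, E2}"
proof -
 have "coxeter_plane k \<Delta>\<^sub>p \<Delta>\<^sub>m = span {lam, \<mu>}"
  unfolding coxeter_plane_def plane_vec_def parts by simp
 also have "\<dots> = span {E1, E2}"
 proof (rule span_eq[THEN iffD2], intro conjI)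
  have l: "lam = norm lam *\<^sub>R E1" using plane_vec_nonzero by (simp add: E1_def)
  have m: "\<mu> = (\<kappa> * norm lam) *\<^sub>R E1 - (norm lam * sin (pi / h)) *\<^sub>R E2"
   using plane_vec_nonzero sin_pos by (simp add: E1_def E2_def)
  have "norm lam *\<^sub>R E1 \<in> span {E1, E2}"
   "(\<kappa> * norm lam) *\<^sub>R E1 - (norm lam * sin (pi / h)) *\<^sub>R E2 \<in> span {E1, E2}"
   by (intro span_diff span_mul span_base; simp)+
  thus "{lam, \<mu>} \<subseteq> span {E1, E2}" by (simp only: l[symmetric] m[symmetric]) simp
  have "E1 \<in> span {lam, \<mu>}" unfolding E1_def by (intro span_mul span_base) simp
  moreover have "E2 \<in> span {lam, \<mu>}" unfolding E2_def by (intro span_diff span_mul span_base; simp)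
  ultimately show "{E1, E2} \<subseteq> span {lam, \<mu>}" by simp
 qed
 finally show ?thesis .
qed

lemma orth_proj_plane:
 "orth_proj (coxeter_plane k \<Delta>\<^sub>p \<Delta>\<^sub>m) x = (x \<bullet> E1) *\<^sub>R E1 + (x \<bullet> E2) *\<^sub>R E2"
 unfolding plane_eq
proof (rule orth_proj_eqI)
 show "(x \<bullet> E1) *\<^sub>R E1 + (x \<bullet> E2) *\<^sub>R E2 \<in> span {E1, E2}"
  by (intro span_add span_mul span_base) auto
 fix z assume "z \<in> span {E1, E2}"
 hence "orthogonal (x - ((x \<bullet> E1) *\<^sub>R E1 + (x \<bullet> E2) *\<^sub>R E2)) z"
  by (rule orthogonal_to_span)
   (use E_orthonormal in \<open>auto simp: orthogonal_def inner_diff_left inner_add_left inner_commute[of E2 E1]\<close>)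
 thus "(x - ((x \<bullet> E1) *\<^sub>R E1 + (x \<bullet> E2) *\<^sub>R E2)) \<bullet> z = 0" by (simp add: orthogonal_def)
qed auto

lemma c_plane_vec: "c lam = (4 * \<kappa> * \<kappa> - 1) *\<^sub>R lam - (2 * \<kappa>) *\<^sub>R \<mu>" "c \<mu> = (2 * \<kappa>) *\<^sub>R lam - \<mu>"
proof -
 have s: "{\<Delta>\<^sub>m, \<Delta>\<^sub>p} = {\<Delta>\<^sub>p, \<Delta>\<^sub>m}" by auto
 note p = commuting_prod_plane_vec[of \<Delta>\<^sub>p \<Delta>\<^sub>m, OF refl] and m = commuting_prod_plane_vec[OF s]
 have lin: "linear (commuting_prod \<Delta>\<^sub>m)" by (rule linear_commuting_prod) simp
 show "c \<mu> = (2 * \<kappa>) *\<^sub>R lam - \<mu>" by (simp add: bipartite_coxeter_element_def p m)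
 have "c lam = - lam + (2 * \<kappa>) *\<^sub>R (- \<mu> + (2 * \<kappa>) *\<^sub>R lam)"
  by (simp add: bipartite_coxeter_element_def p m linear_diff[OF lin] linear_cmul[OF lin])
 thus "c lam = (4 * \<kappa> * \<kappa> - 1) *\<^sub>R lam - (2 * \<kappa>) *\<^sub>R \<mu>"
  by (simp add: algebra_simps)
qed

lemma double_angle: "cos (2 * pi / h) = 2 * \<kappa> * \<kappa> - 1" "sin (2 * pi / h) = 2 * \<kappa> * sin (pi / h)"
 using cos_double_cos[of "pi / h"] sin_double[of "pi / h"] by (simp_all add: power2_eq_square)

lemma c_E: "c E1 = cos (2 * pi / h) *\<^sub>R E1 + sin (2 * pi / h) *\<^sub>R E2"
  "c E2 = - sin (2 * pi / h) *\<^sub>R E1 + cos (2 * pi / h) *\<^sub>R E2"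
proof -
 let ?s = "sin (pi / h)"
 define L where "L = norm lam"
 have L: "L \<noteq> 0" using plane_vec_nonzero by (simp add: L_def)
 have s0: "?s \<noteq> 0" using sin_pos by simp
 have E: "E1 = (1 / L) *\<^sub>R lam" "E2 = (\<kappa> / (L * ?s)) *\<^sub>R lam - (1 / (L * ?s)) *\<^sub>R \<mu>"
  by (simp_all add: E1_def E2_def L_def scaleR_diff_right)
 have "c E1 = ((4 * \<kappa> * \<kappa> - 1) / L) *\<^sub>R lam - (2 * \<kappa> / L) *\<^sub>R \<mu>"
  unfolding E by (simp add: linear_cmul[OF linear_c] c_plane_vec scaleR_diff_right)
 also have "(4 * \<kappa> * \<kappa> - 1) / L = cos (2 * pi / h) * (1 / L) + sin (2 * pi / h) * (\<kappa> / (L * ?s))"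
  unfolding double_angle using L s0 by (simp add: field_simps)
 also have "2 * \<kappa> / L = sin (2 * pi / h) * (1 / (L * ?s))"
  unfolding double_angle using L s0 by (simp add: field_simps)
 finally show "c E1 = cos (2 * pi / h) *\<^sub>R E1 + sin (2 * pi / h) *\<^sub>R E2"
  unfolding E by (simp add: scaleR_left_distrib scaleR_diff_right)
 have "c E2 = (\<kappa> / (L * ?s) * (4 * \<kappa> * \<kappa> - 1) - 1 / (L * ?s) * (2 * \<kappa>)) *\<^sub>R lam
   + (1 / (L * ?s) - \<kappa> / (L * ?s) * (2 * \<kappa>)) *\<^sub>R \<mu>"
 proof -
  have id: "a *\<^sub>R (A *\<^sub>R x - B *\<^sub>R y) - b *\<^sub>R (C *\<^sub>R x - y) = (a * A - b * C) *\<^sub>R x + (b - a * B) *\<^sub>R y"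
   for a A B b C :: real and x y :: 'a
   by (simp add: algebra_simps)
  show ?thesis
   unfolding E linear_diff[OF linear_c] linear_cmul[OF linear_c] c_plane_vec by (rule id)
 qed
 also have "\<kappa> / (L * ?s) * (4 * \<kappa> * \<kappa> - 1) - 1 / (L * ?s) * (2 * \<kappa>)
   = - sin (2 * pi / h) * (1 / L) + cos (2 * pi / h) * (\<kappa> / (L * ?s))"
 proof -
  have "\<kappa> * (4 * \<kappa> * \<kappa> - 1) - 2 * \<kappa> = - 2 * \<kappa> * (?s * ?s) + (2 * \<kappa> * \<kappa> - 1) * \<kappa>"
   unfolding sin_sq by (simp add: algebra_simps)
  thus ?thesis unfolding double_angle using L s0 by (simp add: divide_simps)
 qed
 also have "1 / (L * ?s) - \<kappa> / (L * ?s) * (2 * \<kappa>) = - cos (2 * pi / h) * (1 / (L * ?s))"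
  unfolding double_angle using L s0 by (simp add: field_simps)
 finally show "c E2 = - sin (2 * pi / h) *\<^sub>R E1 + cos (2 * pi / h) *\<^sub>R E2"
  unfolding E by (simp add: scaleR_left_distrib scaleR_diff_right scaleR_diff_left)
qed

definition coord :: "'a \<Rightarrow> complex" where
 "coord x = Complex (x \<bullet> E1) (x \<bullet> E2)"

lemma coord_minus: "coord (- x) = - coord x"
 by (simp add: coord_def complex_eq_iff)

lemma coord_c: "coord (c x) = cis (2 * pi / h) * coord x"
proof -
 let ?C = "cos (2 * pi / h)" and ?S = "sin (2 * pi / h)"
 have sq: "?C * ?C + ?S * ?S = 1" using sin_cos_squared_add2[of "2 * pi / h"] by (simp add: power2_eq_square)
 have 1: "?C * (c x \<bullet> E1) + ?S * (c x \<bullet> E2) = x \<bullet> E1"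
  using c_inner[of x E1] by (simp add: c_E inner_add_right)
 have 2: "- ?S * (c x \<bullet> E1) + ?C * (c x \<bullet> E2) = x \<bullet> E2"
  using c_inner[of x E2] by (simp add: c_E inner_add_right inner_diff_right)
 have "c x \<bullet> E1 = ?C * (x \<bullet> E1) - ?S * (x \<bullet> E2)" "c x \<bullet> E2 = ?S * (x \<bullet> E1) + ?C * (x \<bullet> E2)"
  unfolding 1[symmetric] 2[symmetric] using sq by algebra+
 thus ?thesis by (simp add: coord_def complex_eq_iff)
qed

lemma plane_eqI:
 assumes "x \<in> span {E1, E2}" "y \<in> span {E1, E2}" "x \<bullet> E1 = y \<bullet> E1" "x \<bullet> E2 = y \<bullet> E2"
 shows "x = y"
proof -
 have d: "x - y \<in> span {E1, E2}" using assms by (simp add: span_diff)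
 have "orthogonal (x - y) (x - y)"
  using d by (rule orthogonal_to_span) (use assms in \<open>auto simp: orthogonal_def inner_diff_left\<close>)
 thus ?thesis by (simp add: orthogonal_def)
qed

end


section \<open>Small orbits in the Coxeter plane\<close>

lemma neg_eq_self: "- x = x \<longleftrightarrow> x = (0 :: 'a::real_vector)"
proof
 assume "- x = x"
 hence "x + x = 0" by (metis add.right_inverse)
 hence "2 *\<^sub>R x = 0" by (simp add: scaleR_2)
 thus "x = 0" by simp
qed simp

text \<open>The pairs whose difference is a multiple of a root. In types D and \<open>H3\<close>,
  where \<open>ii\<close> holds, \<open>p - (- p)\<close> is no such multiple; in type B it
  is.\<close>

definition rt :: "bool \<Rightarrow> 'a::euclidean_space \<Rightarrow> 'a \<Rightarrow> bool" where
 "rt ii p q \<longleftrightarrow> p \<noteq> q \<and> (ii \<longrightarrow> p \<noteq> - q)"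

text \<open>\<open>ii\<close> tells whether two orbit points project to the origin.
  \<open>par\<close> and \<open>zero_block\<close> make the blocks of a parabolic subgroup the
  classes modulo the span of its roots, the second one taking care of antipodal points.\<close>

locale cox_orbit = cox_plane +
 fixes X :: "'a::euclidean_space set" and ii :: bool
 assumes X_in_V: "X \<subseteq> V"
  and X_spans: "\<Delta> \<subseteq> span X"
  and X_invariant: "\<alpha> \<in> \<Delta> \<Longrightarrow> p \<in> X \<Longrightarrow> reflection \<alpha> p \<in> X"
  and X_norm: "p \<in> X \<Longrightarrow> q \<in> X \<Longrightarrow> p \<bullet> p = q \<bullet> q"
  and X_card: "card X = (if ii then h + 2 else h)"
  and X_neg: "ii \<Longrightarrow> p \<in> X \<Longrightarrow> - p \<in> X"
  and par: "J \<subseteq> \<Delta> \<Longrightarrow> p \<in> X \<Longrightarrow> q \<in> X \<Longrightarrow> rt ii p q \<Longrightarrow> p - q \<in> span J \<Longrightarrow>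
   reflection (p - q) \<in> refl_group J"
  and not_root: "ii \<Longrightarrow> p \<in> X \<Longrightarrow> reflection p \<notin> W"
  and zero_block: "ii \<Longrightarrow> J \<subseteq> \<Delta> \<Longrightarrow> p \<in> X \<Longrightarrow> p \<in> span J \<Longrightarrow>
   \<exists>r\<in>X. r \<in> span J \<and> r \<noteq> p \<and> r \<noteq> - p"
begin

lemma X_finite: "finite X"
 using X_card h_ge by (intro card_ge_0_finite) (auto split: if_splits)

lemma W_X: "w \<in> W \<Longrightarrow> p \<in> X \<Longrightarrow> w p \<in> X"
proof -
 assume "w \<in> W" and p: "p \<in> X"
 then obtain bs where "set bs \<subseteq> \<Delta>" "w = rword bs" by (auto elim: refl_groupE)
 thus ?thesis using p by (induction bs arbitrary: w) (auto intro: X_invariant)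
qed

lemma V_eq_span_X: "V = span X"
 using X_in_V X_spans by (metis span_eq)

lemma linear_eq_on_X:
 assumes "linear f" "linear g" "\<And>p. p \<in> X \<Longrightarrow> f p = g p"
  and "\<And>z. (\<And>x. x \<in> V \<Longrightarrow> x \<bullet> z = 0) \<Longrightarrow> f z = g z"
 shows "f = g"
proof
 fix x
 obtain y z where yz: "y \<in> span \<Delta>" "\<And>w. w \<in> span \<Delta> \<Longrightarrow> orthogonal z w" "x = y + z"
  using orthogonal_subspace_decomp_exists[of "\<Delta>" x] by metis
 have "y \<in> span X" using yz(1) V_eq_span_X by simp
 hence "f y = g y" using linear_eq_on[of f g y X] assms by blast
 moreover have "f z = g z" by (rule assms(4)) (use yz(2) in \<open>auto simp: orthogonal_def inner_commute\<close>)
 ultimately show "f x = g x" using assms yz(3) by (simp add: linear_add)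
qed

lemma W_fixes_orthogonal: "w \<in> W \<Longrightarrow> (\<And>x. x \<in> V \<Longrightarrow> x \<bullet> z = 0) \<Longrightarrow> w z = z"
 by (rule refl_group_fixes) (auto intro: span_base)

lemma W_moves:
 assumes "w \<in> W" "w \<noteq> id"
 obtains p where "p \<in> X" "w p \<noteq> p"
proof -
 have "\<not> (\<forall>p\<in>X. w p = p)"
 proof
  assume "\<forall>p\<in>X. w p = p"
  hence "w = id"
   by (intro linear_eq_on_X refl_group_linear[OF assms(1)] linear_id)
    (use W_fixes_orthogonal[OF assms(1)] in auto)
  thus False using assms by simp
 qed
 thus ?thesis using that by auto
qed

lemma X_nonzero: "ii \<Longrightarrow> p \<in> X \<Longrightarrow> p \<noteq> 0"
proof
 assume "ii" "p \<in> X" "p = 0"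
 hence "reflection p = id" by (auto simp: reflection_def fun_eq_iff)
 thus False using not_root[of p] id_in_refl_group[of \<Delta>] \<open>ii\<close> \<open>p \<in> X\<close> by simp
qed

lemma root_of_diff:
 assumes "p \<in> X" "q \<in> X" "rt ii p q"
 shows "root_of \<Delta> (p - q)"
proof -
 have "p - q \<in> V" using assms X_in_V by (auto intro: span_diff)
 thus ?thesis using par[of \<Delta> p q] assms by (auto simp: root_of_def rt_def)
qed

lemma root_is_diff:
 assumes "root_of \<Delta> b"
 obtains p q s where "p \<in> X" "q \<in> X" "rt ii p q" "s \<noteq> 0" "b = s *\<^sub>R (p - q)" "reflection b p = q"
proof -
 have b0: "b \<noteq> 0" and bW: "reflection b \<in> W" using assms by (auto simp: root_of_def)
 have "reflection b \<noteq> id" using reflection_self[of b] b0 neg_eq_self[of b] by auto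
 then obtain p where p: "p \<in> X" "reflection b p \<noteq> p" using bW W_moves by metis
 define q where "q = reflection b p"
 define r where "r = 2 * (b \<bullet> p) / (b \<bullet> b)"
 have d: "p - q = r *\<^sub>R b" by (simp add: q_def r_def reflection_def)
 have r: "r \<noteq> 0" using p(2) d by (auto simp: q_def)
 have "rt ii p q" unfolding rt_def
 proof (intro conjI impI notI)
  assume "ii" "p = - q"
  hence "p + p = r *\<^sub>R b" using d by (metis diff_minus_eq_add minus_minus)
  hence "(1/2) *\<^sub>R (p + p) = (1/2) *\<^sub>R (r *\<^sub>R b)" by simp
  hence "p = (r / 2) *\<^sub>R b" by (simp add: scaleR_half_double)
  hence "reflection p = reflection b" using r reflection_scaled[of "r / 2" b] by (metis divide_eq_0_iff zero_neq_numeral)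
  thus False using not_root[OF \<open>ii\<close> p(1)] bW by simp
 qed (use p(2) in \<open>auto simp: q_def\<close>)
 moreover have "b = (1 / r) *\<^sub>R (p - q)" unfolding d using r by simp
 moreover have "q \<in> X" unfolding q_def using bW p(1) by (rule W_X)
 moreover have "1 / r \<noteq> 0" "reflection b p = q" using r by (simp_all add: q_def)
 ultimately show ?thesis using that[OF p(1)] by blast
qed

text \<open>A moved orbit point \<open>p\<close> gives the root \<open>p - w p\<close> unless
  \<open>w\<close> acts on the orbit by signs. Then sign changes at two independent points
  \<open>p\<close> and \<open>q\<close> negate the root \<open>p - q\<close>, and a single sign
  change would be the reflection in \<open>p\<close>, which \<open>not_root\<close>
  excludes.\<close>

lemma carter_W:
 assumes w: "w \<in> W" "w \<noteq> id"
 shows "\<exists>z\<in>V. w z \<noteq> z \<and> root_of \<Delta> (z - w z)"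
proof -
 obtain p where p: "p \<in> X" "w p \<noteq> p" using w by (rule W_moves)
 show ?thesis
 proof (cases "\<exists>q\<in>X. rt ii q (w q)")
  case True
  then obtain q where q: "q \<in> X" "rt ii q (w q)" by auto
  hence "root_of \<Delta> (q - w q)" using W_X[OF w(1)] by (intro root_of_diff) auto
  thus ?thesis using q X_in_V by (intro bexI[of _ q]) (auto simp: rt_def)
 next
  case False
  hence ii: "ii" using p by (auto simp: rt_def)
  have pm: "w q = q \<or> w q = - q" if "q \<in> X" for q
   using False that unfolding rt_def by (metis minus_minus)
  have wp: "w p = - p" using pm[OF p(1)] p(2) by auto
  show ?thesis
  proof (cases "\<exists>q\<in>X. q \<noteq> p \<and> q \<noteq> - p \<and> w q \<noteq> q")
   case True
   then obtain q where q: "q \<in> X" "q \<noteq> p" "q \<noteq> - p" "w q = - q" using pm by blast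
   have "rt ii p q" using q by (auto simp: rt_def)
   hence r: "root_of \<Delta> (p - q)" using p q by (intro root_of_diff)
   have e: "w (p - q) = - (p - q)" using refl_group_linear[OF w(1)] wp q(4) by (simp add: linear_diff)
   have "(p - q) - w (p - q) = 2 *\<^sub>R (p - q)" unfolding e by (simp add: scaleR_2)
   moreover have "root_of \<Delta> (2 *\<^sub>R (p - q))" using r by (rule root_of_scaleR) simp
   moreover have "w (p - q) \<noteq> p - q"
    unfolding e using q(2) by (simp only: neg_eq_self) simp
   ultimately show ?thesis using p q X_in_V by (intro bexI[of _ "p - q"]) (auto intro!: span_diff)
  next
   case False
   have "w = reflection p"
   proof (rule linear_eq_on_X[OF refl_group_linear[OF w(1)] linear_reflection])
    fix q assume q: "q \<in> X"
    consider "q = p" | "q = - p" | "q \<noteq> p" "q \<noteq> - p" by blast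
    thus "w q = reflection p q"
    proof cases
     case 3
     hence "w q = q" using False q by auto
     hence "p \<bullet> q = 0" using refl_group_inner[OF w(1), of p q] wp by simp
     hence "reflection p q = q" by (simp only: reflection_fix_iff)
     thus ?thesis using \<open>w q = q\<close> by simp
    qed (use wp refl_group_linear[OF w(1)] in \<open>auto simp: reflection_self reflection_minus linear_neg\<close>)
   next
    fix z assume "\<And>x. x \<in> V \<Longrightarrow> x \<bullet> z = 0"
    thus "w z = reflection p z"
     using W_fixes_orthogonal[OF w(1)] p(1) X_in_V reflection_fix_iff[of p z] by auto
   qed
   thus ?thesis using not_root[OF ii p(1)] w(1) by simp
  qed
 qed
qed

sublocale cox_carter
 by unfold_locales (rule carter_W)

lemma image_span_W: "w \<in> W \<Longrightarrow> span (w ` J) = w ` span J"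
 using refl_group_linear linear_span_image by metis

lemma par_conj:
 assumes "J \<subseteq> \<Delta>" "w \<in> W" "p \<in> X" "q \<in> X" "rt ii p q" "p - q \<in> span (w ` J)"
 shows "reflection (p - q) \<in> refl_group (w ` J)"
proof -
 obtain w' where w': "w' \<in> W" "\<And>x. w' (w x) = x" "\<And>x. w (w' x) = x"
  using refl_group_inverse[OF assms(2)] by metis
 have l: "linear w'" using w'(1) by (rule refl_group_linear)
 have "w' (p - q) \<in> span J" using assms(6) image_span_W[OF assms(2)] w'(2) by auto
 hence "w' p - w' q \<in> span J" using l by (simp add: linear_diff)
 moreover have "rt ii (w' p) (w' q)"
  using assms(5) w'(3) unfolding rt_def by (metis l linear_neg)
 ultimately have "reflection (w' p - w' q) \<in> refl_group J"
  using par[OF assms(1) W_X[OF w'(1) assms(3)] W_X[OF w'(1) assms(4)]] by simp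
 hence "reflection (w (w' p - w' q)) \<in> refl_group (w ` J)"
  by (rule reflection_image_in_refl_group[OF assms(2)])
 thus ?thesis
  using refl_group_linear[OF assms(2)] w'(3) by (simp add: linear_diff)
qed

lemma zero_block_conj:
 assumes "ii" "J \<subseteq> \<Delta>" "w \<in> W" "p \<in> X" "p \<in> span (w ` J)"
 shows "\<exists>r\<in>X. r \<in> span (w ` J) \<and> r \<noteq> p \<and> r \<noteq> - p"
proof -
 obtain w' where w': "w' \<in> W" "\<And>x. w' (w x) = x" "\<And>x. w (w' x) = x"
  using refl_group_inverse[OF assms(3)] by metis
 have "w' p \<in> span J" using assms(5) image_span_W[OF assms(3)] w'(2) by auto
 then obtain r where r: "r \<in> X" "r \<in> span J" "r \<noteq> w' p" "r \<noteq> - w' p"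
  using zero_block[of J "w' p"] assms W_X[OF w'(1)] by auto
 have "w r \<noteq> p" "w r \<noteq> - p"
  using r w' by (metis, metis linear_neg refl_group_linear)
 thus ?thesis
  using r W_X[OF assms(3)] image_span_W[OF assms(3)] by (intro bexI[of _ "w r"]) auto
qed

text \<open>If \<open>p - q\<close> is a root of the subgroup, its reflection swaps \<open>p\<close>
  and \<open>q\<close>. Antipodal points are joined through a third orbit point in the same span,
  supplied by \<open>zero_block\<close>.\<close>

lemma same_block_iff:
 assumes "J \<subseteq> \<Delta>" "w \<in> W" "p \<in> X" "q \<in> X"
 shows "p - q \<in> span (w ` J) \<longleftrightarrow> (\<exists>u\<in>refl_group (w ` J). u p = q)"
proof
 assume d: "p - q \<in> span (w ` J)"
 show "\<exists>u\<in>refl_group (w ` J). u p = q"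
 proof (cases "rt ii p q")
  case True
  thus ?thesis
   using par_conj[OF assms True d] reflection_swap[OF X_norm[OF assms(3,4)]] by auto
 next
  case False
  show ?thesis
  proof (cases "p = q")
   case True
   thus ?thesis using id_in_refl_group[of "w ` J"] by (metis id_apply)
  next
   case False
   hence ii: ii and pq: "q = - p" using \<open>\<not> rt ii p q\<close> by (auto simp: rt_def)
   have "(1/2) *\<^sub>R (p - q) \<in> span (w ` J)" using d by (rule span_mul)
   hence ps: "p \<in> span (w ` J)" unfolding pq by (simp add: scaleR_half_double)
   then obtain r where r: "r \<in> X" "r \<in> span (w ` J)" "r \<noteq> p" "r \<noteq> - p"
    using zero_block_conj[OF ii assms(1,2,3)] by auto
   have 1: "reflection (p - r) \<in> refl_group (w ` J)"
    using r ps assms by (intro par_conj) (auto simp: rt_def intro: span_diff)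
   have 2: "reflection (r - q) \<in> refl_group (w ` J)"
    using r ps assms unfolding pq by (intro par_conj) (auto simp: rt_def intro: span_add X_neg[OF ii])
   have "reflection (p - r) p = r" "reflection (r - q) r = q"
    using reflection_swap X_norm assms r(1) by auto
   thus ?thesis using refl_group_comp[OF 2 1] by (metis comp_apply)
  qed
 qed
next
 assume "\<exists>u\<in>refl_group (w ` J). u p = q"
 hence "q - p \<in> span (w ` J)" using refl_group_diff_in_span by metis
 thus "p - q \<in> span (w ` J)" by (metis minus_diff_eq span_neg)
qed

section \<open>The polygon traced by \<open>c\<close> and the pair of points over the origin\<close>

lemma coord_nonzero_ex: "\<exists>p\<in>X. coord p \<noteq> 0"
proof (rule ccontr)
 assume "\<not> ?thesis"
 hence "p \<bullet> E1 = 0" if "p \<in> X" for p using that by (auto simp: coord_def complex_eq_iff)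
 hence "orthogonal E1 E1"
  using E_in_V V_eq_span_X by (intro orthogonal_to_span[of E1 X]) (auto simp: orthogonal_def inner_commute)
 thus False using E_orthonormal by (simp add: orthogonal_def)
qed

definition p0 :: 'a where "p0 = (SOME p. p \<in> X \<and> coord p \<noteq> 0)"

lemma p0: "p0 \<in> X" "coord p0 \<noteq> 0"
 using someI_ex[of "\<lambda>p. p \<in> X \<and> coord p \<noteq> 0"] coord_nonzero_ex unfolding p0_def by blast+

text \<open>Integer indices modulo \<open>h\<close> allow cyclic intervals to be written as
  \<open>i < j < i + h\<close>, without wrapping around.\<close>

definition z :: "int \<Rightarrow> 'a" where "z i = (c ^^ nat (i mod int h)) p0"

lemma cis_eq_1_iff_dvd: "cis (2 * pi * i / h) = 1 \<longleftrightarrow> int h dvd i"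
proof
 assume "cis (2 * pi * i / h) = 1"
 hence "cos (2 * pi * i / h) = 1" by (simp add: complex_eq_iff)
 then obtain n :: int where "2 * pi * i / h = n * 2 * pi" by (auto simp: cos_one_2pi_int)
 hence "2 * pi * real_of_int i = 2 * pi * (real_of_int n * h)" using h_ge by (simp add: field_simps)
 hence "real_of_int i = real_of_int n * h" by (simp only: mult_cancel_left) auto
 hence "real_of_int i = real_of_int (n * int h)" by simp
 hence "i = n * int h" by (simp only: of_int_eq_iff)
 thus "int h dvd i" by simp
next
 assume "int h dvd i"
 then obtain n where "i = int h * n" by auto
 hence "2 * pi * i / h = 2 * pi * real_of_int n" using h_ge by simp
 thus "cis (2 * pi * i / h) = 1"
  by (simp add: complex_eq_iff cos_int_2pin sin_int_2pin)
qed

lemma coord_power: "coord ((c ^^ n) x) = cis (2 * pi * n / h) * coord x"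
proof (induction n)
 case (Suc n)
 have "cis (2 * pi / h) * cis (2 * pi * n / h) = cis (2 * pi * Suc n / h)"
  unfolding cis_mult by (rule arg_cong[of _ _ cis]) (use h_ge in \<open>simp add: field_simps\<close>)
 thus ?case by (simp add: coord_c Suc flip: mult.assoc)
qed simp

lemma c_power_X: "p \<in> X \<Longrightarrow> (c ^^ n) p \<in> X"
 by (induction n) (auto intro: W_X c_in_W)

lemma c_inj: "c x = c y \<longleftrightarrow> x = y"
 using refl_group_inj[OF c_in_W] by auto

lemma c_power_inj: "(c ^^ n) x = (c ^^ n) y \<longleftrightarrow> x = y"
 by (induction n) (auto simp: c_inj)

lemma c_power_fixed:
 assumes "coord p \<noteq> 0" "(c ^^ n) p = p"
 shows "h dvd n"
proof -
 have "cis (2 * pi * n / h) * coord p = 1 * coord p" using coord_power[of n p] assms by simp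
 hence "cis (2 * pi * of_int (int n) / h) = 1" using assms(1) by (simp only: mult_cancel_right) auto
 thus ?thesis unfolding cis_eq_1_iff_dvd by simp
qed

text \<open>The points \<open>(c ^^ n) p0\<close> with \<open>n \<le> card X\<close> cannot all
  differ. A repetition occurs at a distance divisible by \<open>h\<close>, and since this distance
  is at most \<open>h + 2 < 2 * h\<close> it is \<open>h\<close>.\<close>

lemma c_power_h: "(c ^^ h) p0 = p0"
proof -
 have "\<not> inj_on (\<lambda>n. (c ^^ n) p0) {0..card X}"
 proof
  assume "inj_on (\<lambda>n. (c ^^ n) p0) {0..card X}"
  hence "card {0..card X} \<le> card X"
   by (rule card_inj_on_le) (auto intro: c_power_X p0 X_finite)
  thus False by simp
 qed
 then obtain a b where "a \<le> card X" "b \<le> card X" "a \<noteq> b" "(c ^^ a) p0 = (c ^^ b) p0"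
  by (auto simp: inj_on_def)
 then obtain a b where ab: "a < b" "b \<le> card X" "(c ^^ a) p0 = (c ^^ b) p0"
  by (metis linorder_neqE_nat)
 have "(c ^^ a) ((c ^^ (b - a)) p0) = (c ^^ (a + (b - a))) p0" by (simp only: funpow_add comp_apply)
 hence "(c ^^ a) ((c ^^ (b - a)) p0) = (c ^^ a) p0" using ab by simp
 hence e: "(c ^^ (b - a)) p0 = p0" by (simp add: c_power_inj)
 have "h dvd b - a" using c_power_fixed[OF p0(2) e] .
 moreover have "b - a < 2 * h" "b - a > 0" using ab X_card h_ge by (auto split: if_splits)
 ultimately have "b - a = h"
 proof -
  obtain m where m: "b - a = h * m" using \<open>h dvd b - a\<close> by auto
  hence "h * m < h * 2" "m \<noteq> 0" using \<open>b - a < 2 * h\<close> \<open>b - a > 0\<close> by auto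
  hence "m = 1" by simp
  thus ?thesis using m by simp
 qed
 thus ?thesis using e by simp
qed

lemma z_Suc: "z (i + 1) = c (z i)"
proof -
 define n where "n = nat (i mod int h)"
 have h0: "0 < int h" using h_ge by simp
 have nb: "n < h" using pos_mod_bound[OF h0, of i] pos_mod_sign[OF h0, of i] unfolding n_def by linarith
 have "(i + 1) mod int h = (int n + 1) mod int h"
  unfolding n_def using pos_mod_sign[OF h0, of i] by (simp add: mod_simps)
 also have "\<dots> = int (Suc n mod h)" by (simp add: zmod_int add.commute)
 finally have e: "nat ((i + 1) mod int h) = Suc n mod h" by simp
 show ?thesis
 proof (cases "Suc n = h")
  case True
  hence "c (z i) = (c ^^ h) p0" unfolding z_def n_def[symmetric] by (metis comp_apply funpow.simps(2))
  thus ?thesis unfolding z_def e using True c_power_h by simp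
 next
  case False
  hence "Suc n mod h = Suc n" using nb by simp
  thus ?thesis unfolding z_def e n_def[symmetric] by simp
 qed
qed

lemma coord_z: "coord (z i) = cis (2 * pi * i / h) * coord p0"
proof -
 have h0: "0 < int h" using h_ge by simp
 define m where "m = i mod int h"
 define q where "q = i div int h"
 have i: "i = int h * q + m" by (simp add: m_def q_def)
 have m0: "m \<ge> 0" unfolding m_def using h0 by simp
 have "cis (2 * pi * i / h) = cis (2 * pi * of_int (int h * q) / h) * cis (2 * pi * m / h)"
  unfolding i cis_mult by (simp add: add_divide_distrib distrib_left)
 also have "cis (2 * pi * of_int (int h * q) / h) = 1" by (subst cis_eq_1_iff_dvd) simp
 finally show ?thesis unfolding z_def m_def[symmetric] coord_power using m0 by simp
qed

lemma z_in_X: "z i \<in> X"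
 unfolding z_def by (rule c_power_X[OF p0(1)])

lemma coord_z_nonzero: "coord (z i) \<noteq> 0"
 using p0(2) by (simp add: coord_z)

lemma z_eq_iff: "z i = z j \<longleftrightarrow> int h dvd (i - j)"
proof
 assume "z i = z j"
 hence "cis (2 * pi * i / h) * coord p0 = cis (2 * pi * j / h) * coord p0" using coord_z by metis
 hence "cis (2 * pi * i / h) = cis (2 * pi * j / h)" using p0(2) by simp
 hence "cis (2 * pi * i / h) / cis (2 * pi * j / h) = 1" by simp
 hence "cis (2 * pi * of_int (i - j) / h) = 1"
  by (simp add: cis_divide diff_divide_distrib right_diff_distrib)
 thus "int h dvd (i - j)" by (simp only: cis_eq_1_iff_dvd)
next
 assume "int h dvd (i - j)"
 thus "z i = z j" unfolding z_def by (metis mod_eq_dvd_iff)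
qed

lemma z_period: "z (i + int h * n) = z i"
 by (simp add: z_eq_iff)

lemma z_pred: "c x = z i \<Longrightarrow> x = z (i - 1)"
 using z_Suc[of "i - 1"] by (simp add: c_inj)

lemma card_range_z: "card (range z) = h"
proof -
 have "range z = z ` {0..<int h}"
 proof (intro equalityI subsetI)
  fix x assume "x \<in> range z"
  then obtain i where "x = z i" by auto
  moreover have "z i = z (i mod int h)" by (simp add: z_eq_iff mod_eq_dvd_iff[symmetric])
  ultimately show "x \<in> z ` {0..<int h}" using h_ge by (auto intro!: imageI)
 qed auto
 moreover have "inj_on z {0..<int h}"
 proof (rule inj_onI)
  fix i j assume "i \<in> {0..<int h}" "j \<in> {0..<int h}" "z i = z j"
  hence "\<bar>i - j\<bar> < int h" "int h dvd i - j" by (auto simp: z_eq_iff)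
  thus "i = j" using zdvd_not_zless[of "\<bar>i - j\<bar>" "int h"] by auto
 qed
 ultimately show ?thesis by (simp add: card_image)
qed

lemma range_z_sub: "range z \<subseteq> X"
 using z_in_X by auto

lemma X_eq_range: "\<not> ii \<Longrightarrow> X = range z"
 using card_subset_eq[OF X_finite range_z_sub] card_range_z X_card by simp

text \<open>A leftover point with nonzero projection would have at least \<open>h > 2\<close> images
  under powers of \<open>c\<close>, all outside the polygon, where only two points are left.\<close>

lemma centre_ex: "ii \<Longrightarrow> \<exists>v. X - range z = {v, - v} \<and> v \<noteq> - v \<and> coord v = 0"
proof -
 assume ii: ii
 define C where "C = X - range z"
 have cC: "card C = 2"
  unfolding C_def using card_Diff_subset[OF finite_subset[OF range_z_sub X_finite] range_z_sub] card_range_z X_card ii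
  by simp
 have finC: "finite C" using X_finite by (simp add: C_def)
 have co: "coord q = 0" if q: "q \<in> C" for q
 proof (rule ccontr)
  assume nz: "coord q \<noteq> 0"
  have "(c ^^ n) q \<in> C" for n
  proof (induction n)
   case (Suc n)
   have "c ((c ^^ n) q) \<in> X" using W_X[OF c_in_W] Suc by (auto simp: C_def)
   moreover have "c ((c ^^ n) q) \<notin> range z" using z_pred Suc by (force simp: C_def)
   ultimately show ?case by (simp add: C_def)
  qed (use q in auto)
  moreover have "inj_on (\<lambda>n. (c ^^ n) q) {0..<h}"
  proof (rule linorder_inj_onI)
   fix a b assume ab: "a < b" "a \<in> {0..<h}" "b \<in> {0..<h}"
   show "(c ^^ a) q \<noteq> (c ^^ b) q"
   proof
    assume "(c ^^ a) q = (c ^^ b) q"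
    moreover have "(c ^^ a) ((c ^^ (b - a)) q) = (c ^^ (a + (b - a))) q"
     by (simp only: funpow_add comp_apply)
    ultimately have "(c ^^ a) ((c ^^ (b - a)) q) = (c ^^ a) q" using ab by simp
    hence "h dvd b - a" using c_power_fixed[OF nz] by (simp add: c_power_inj)
    thus False using ab by (auto dest: dvd_imp_le)
   qed
  qed auto
  ultimately have "card {0..<h} \<le> card C" using finC by (intro card_inj_on_le[of "\<lambda>n. (c ^^ n) q"]) auto
  thus False using cC h_ge by simp
 qed
 obtain a b where ab: "C = {a, b}" "a \<noteq> b" using cC by (auto simp: card_2_iff)
 have a: "a \<in> X" "coord a = 0" using ab co by (auto simp: C_def)
 have a0: "a \<noteq> - a" using X_nonzero[OF ii a(1)] by (metis neg_eq_self)
 have "- a \<in> C"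
  using X_neg[OF ii a(1)] a(2) coord_z_nonzero coord_minus[of a] by (auto simp: C_def)
 hence "b = - a" using ab a0 by auto
 thus ?thesis using ab a a0 unfolding C_def by (intro exI[of _ a]) auto
qed

text \<open>\<open>c\<close> permutes the two leftover points and fixes no nonzero vector of
  \<open>V\<close>.\<close>

lemma centre_c: "q \<in> X - range z \<Longrightarrow> c q = - q"
proof -
 assume q: "q \<in> X - range z"
 hence ii: ii using X_eq_range by blast
 obtain v where v: "X - range z = {v, - v}" "v \<noteq> - v" using centre_ex[OF ii] by auto
 have "c q \<in> X" using W_X[OF c_in_W] q by auto
 moreover have "c q \<notin> range z" using z_pred q by force
 ultimately have "c q = v \<or> c q = - v" using v by auto
 moreover have "c q \<noteq> q" using c_fixed[of q] q X_in_V X_nonzero[OF ii] by auto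
 ultimately show ?thesis using q v by (metis insertE minus_minus singletonD)
qed

lemma centre_coord: "q \<in> X - range z \<Longrightarrow> coord q = 0"
 using centre_ex X_eq_range coord_minus by (metis Diff_cancel add.inverse_neutral empty_iff insertE)

lemma neg_z:
 assumes "- z i \<in> X"
 shows "even h" "- z i = z (i + int h div 2)"
proof -
 have "coord (- z i) \<noteq> 0" using coord_z_nonzero by (simp add: coord_minus)
 then obtain j where j: "- z i = z j" using centre_coord[of "- z i"] assms by blast
 have "coord (z j) = - coord (z i)" using j coord_minus by metis
 hence "cis (2 * pi * j / h) * coord p0 = (- cis (2 * pi * i / h)) * coord p0"
  using coord_z by (metis mult_minus_left)
 hence e: "cis (2 * pi * j / h) = - cis (2 * pi * i / h)" using p0(2) by (simp only: mult_cancel_right) auto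
 hence "cis (2 * pi * j / h) / cis (2 * pi * i / h) = - 1" by simp
 hence m1: "cis (2 * pi * of_int (j - i) / h) = - 1"
  by (simp add: cis_divide diff_divide_distrib right_diff_distrib)
 have "cis (2 * pi * of_int (2 * (j - i)) / h)
   = cis (2 * pi * of_int (j - i) / h) * cis (2 * pi * of_int (j - i) / h)"
  unfolding cis_mult by (simp add: field_simps)
 hence "cis (2 * pi * of_int (2 * (j - i)) / h) = 1" using m1 by simp
 hence d2: "int h dvd 2 * (j - i)" by (simp only: cis_eq_1_iff_dvd)
 have nd: "\<not> int h dvd (j - i)" using m1 cis_eq_1_iff_dvd[of "j - i"] by auto
 obtain n where n: "2 * (j - i) = int h * n" using d2 by auto
 have "odd n"
 proof
  assume "even n"
  then obtain m where "n = 2 * m" by auto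
  hence "j - i = int h * m" using n by simp
  thus False using nd by simp
 qed
 hence "even (int h)" using n by (metis dvd_triv_left even_mult_iff)
 thus "even h" by simp
 then obtain m where m: "h = 2 * m" by auto
 obtain t where t: "n = 2 * t + 1" using \<open>odd n\<close> by (auto elim: oddE)
 have "j - i = int m * n" using n m by simp
 hence "j - (i + int m) = int h * t" by (simp add: t m algebra_simps)
 hence "z j = z (i + int m)" by (simp only: z_eq_iff) simp
 moreover have "int h div 2 = int m" using m by simp
 ultimately show "- z i = z (i + int h div 2)" using j by metis
qed

lemma z_inner_shift: "z (i + t) \<bullet> z (j + t) = z i \<bullet> z j"
proof (induction t rule: int_induct[where k = 0])
 case (step1 t)
 thus ?case using z_Suc[of "i + t"] z_Suc[of "j + t"] c_inner by (simp add: add.assoc)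
next
 case (step2 t)
 thus ?case using z_Suc[of "i + (t - 1)"] z_Suc[of "j + (t - 1)"] c_inner by (simp add: add.assoc)
qed simp

lemma z_inner: "z i \<bullet> z j = z 0 \<bullet> z (j - i)"
 using z_inner_shift[of i "- i" j] by simp

lemma z_inner_even: "z 0 \<bullet> z (- i) = z 0 \<bullet> z i"
 using z_inner[of i 0] by (simp add: inner_commute)

text \<open>The unit vector of the plane pointing at position \<open>D / 2\<close> of the polygon: a
  vertex for even \<open>D\<close>, the middle of a side for odd \<open>D\<close>.\<close>

definition dir :: "int \<Rightarrow> 'a" where
 "dir D = cos (Arg (coord p0) + pi * D / h) *\<^sub>R E1 + sin (Arg (coord p0) + pi * D / h) *\<^sub>R E2"

lemma z_E: "z i \<bullet> E1 = cmod (coord p0) * cos (Arg (coord p0) + 2 * pi * i / h)"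
  "z i \<bullet> E2 = cmod (coord p0) * sin (Arg (coord p0) + 2 * pi * i / h)"
proof -
 have "coord (z i) = cis (2 * pi * i / h) * rcis (cmod (coord p0)) (Arg (coord p0))"
  by (simp add: coord_z rcis_cmod_Arg)
 also have "\<dots> = rcis (cmod (coord p0)) (Arg (coord p0) + 2 * pi * i / h)"
  by (simp add: rcis_def cis_mult add.commute mult.left_commute)
 finally have "coord (z i) = rcis (cmod (coord p0)) (Arg (coord p0) + 2 * pi * i / h)" .
 thus "z i \<bullet> E1 = cmod (coord p0) * cos (Arg (coord p0) + 2 * pi * i / h)"
  "z i \<bullet> E2 = cmod (coord p0) * sin (Arg (coord p0) + 2 * pi * i / h)"
  by (simp_all add: coord_def complex_eq_iff)
qed

lemma z_dir: "z i \<bullet> dir D = cmod (coord p0) * cos (pi * (2 * i - D) / h)"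
proof -
 let ?a = "Arg (coord p0) + 2 * pi * i / h" and ?b = "Arg (coord p0) + pi * D / h"
 have "z i \<bullet> dir D = cmod (coord p0) * cos (?a - ?b)"
  unfolding dir_def inner_add_right inner_scaleR_right z_E cos_diff[of ?a ?b]
  by (simp only: distrib_left mult_ac)
 also have "?a - ?b = pi * (2 * i - D) / h" by (simp add: diff_divide_distrib algebra_simps)
 finally show ?thesis by simp
qed

end


section \<open>Level sets and separation\<close>

lemma cos_minus_int_2pi: "cos (x - 2 * pi * of_int q) = cos x"
 by (simp add: cos_diff cos_int_2pin sin_int_2pin)

text \<open>A function on \<open>\<int>/h\<close> whose increments are antisymmetric about \<open>D/2\<close> is symmetric
 about \<open>D/2\<close>, so it is determined by its values on half a period, where it is monotone.\<close>

lemma unimodal: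
 fixes f \<phi> :: "int \<Rightarrow> real" and h :: nat and D :: int
 assumes h: "h > 0" and step: "\<And>i. f (i + 1) - f i = \<phi> i" and per: "\<And>i. f (i + int h) = f i"
  and anti: "\<And>i. \<phi> (D - 1 - i) = - \<phi> i"
  and pos: "\<And>i. D \<le> 2 * i \<Longrightarrow> 2 * i + 2 \<le> D + int h \<Longrightarrow> 0 \<le> \<phi> i"
  and le: "cos (pi * (2 * i - D) / h) \<le> cos (pi * (2 * j - D) / h)"
 shows "f j \<le> f i"
proof -
 have per': "f (i + int h * n) = f i" for i n
 proof (induction n rule: int_induct[where k = 0])
  case (step1 n)
  thus ?case using per[of "i + int h * n"] by (simp add: algebra_simps)
 next
  case (step2 n)
  thus ?case using per[of "i + int h * (n - 1)"] by (simp add: algebra_simps)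
 qed simp
 define G where "G i = f i - f (D - i)" for i
 have Gs: "G (i + 1) = G i" for i
  using step[of i] step[of "D - i - 1"] anti[of i] by (simp add: G_def algebra_simps)
 have G0: "G i = G 0" for i
 proof (induction i rule: int_induct[where k = 0])
  case (step2 i)
  thus ?case using Gs[of "i - 1"] by simp
 qed (use Gs in simp_all)
 have sym: "f (D - i) = f i" for i
 proof -
  have "G (D - i) = - G i" by (simp add: G_def)
  hence "G i = 0" using G0[of i] G0[of "D - i"] by simp
  thus ?thesis by (simp add: G_def)
 qed
 \<comment> \<open>Translation by \<open>h\<close> and the symmetry about \<open>D / 2\<close> bring
   every index into the half period from \<open>D / 2\<close> to \<open>(D + h) / 2\<close>, where
   the cosine decreases and \<open>f\<close> does not.\<close>
 have normal: "\<exists>i'. 0 \<le> 2 * i' - D \<and> 2 * i' - D \<le> int h \<and> f i' = f i \<and>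
  cos (pi * (2 * i' - D) / h) = cos (pi * (2 * i - D) / h)" for i
 proof -
  define q where "q = (2 * i - D) div (2 * int h)"
  define r where "r = (2 * i - D) mod (2 * int h)"
  have r: "0 \<le> r" "r < 2 * int h" using h by (auto simp: r_def)
  have e: "2 * i - D = 2 * int h * q + r" by (simp add: q_def r_def)
  define i1 where "i1 = i - int h * q"
  have i1: "2 * i1 - D = r" using e by (simp add: i1_def algebra_simps)
  have f1: "f i1 = f i" using per'[of i1 q] by (simp add: i1_def)
  have "pi * of_int (2 * i1 - D) / h = pi * of_int (2 * i - D) / h - 2 * pi * of_int q"
   using h unfolding i1 e by (simp add: field_simps)
  hence c1: "cos (pi * (2 * i1 - D) / h) = cos (pi * (2 * i - D) / h)"
   using cos_minus_int_2pi[of "pi * of_int (2 * i - D) / h" q] by simp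
  show ?thesis
  proof (cases "r \<le> int h")
   case True
   thus ?thesis using i1 r f1 c1 by (intro exI[of _ i1]) simp
  next
   case False
   define i2 where "i2 = D - i1 + int h"
   have i2: "2 * i2 - D = 2 * int h - r" using i1 by (simp add: i2_def)
   have "f i2 = f i" using per[of "D - i1"] sym[of i1] f1 by (simp add: i2_def)
   moreover have "cos (pi * (2 * i2 - D) / h) = cos (pi * (2 * i - D) / h)"
   proof -
    have "pi * of_int (2 * i2 - D) / h = 2 * pi - pi * of_int (2 * i1 - D) / h"
     using h unfolding i1 i2 by (simp add: field_simps)
    thus ?thesis using c1 by (simp add: cos_2pi_minus)
   qed
   ultimately show ?thesis using False i2 r by (intro exI[of _ i2]) simp
  qed
 qed
 obtain i' where i': "0 \<le> 2 * i' - D" "2 * i' - D \<le> int h" "f i' = f i"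
  "cos (pi * (2 * i' - D) / h) = cos (pi * (2 * i - D) / h)" using normal by blast
 obtain j' where j': "0 \<le> 2 * j' - D" "2 * j' - D \<le> int h" "f j' = f j"
  "cos (pi * (2 * j' - D) / h) = cos (pi * (2 * j - D) / h)" using normal by blast
 have range: "0 \<le> pi * t / h" "pi * t / h \<le> pi" if "0 \<le> t" "t \<le> int h" for t
 proof -
  have "real_of_int t \<le> real h" using that by linarith
  hence "pi * real_of_int t \<le> pi * real h" by (intro mult_left_mono) auto
  thus "pi * t / h \<le> pi" using h by (simp add: pos_divide_le_eq)
 qed (use that in simp)
 have "pi * of_int (2 * j' - D) / h \<le> pi * of_int (2 * i' - D) / h"
  using cos_mono_le_eq[OF range[OF i'(1,2)] range[OF j'(1,2)]] le i'(4) j'(4) by simp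
 hence "real_of_int (2 * j' - D) \<le> real_of_int (2 * i' - D)"
  using h pi_gt_zero by (simp add: divide_le_cancel del: of_int_diff of_int_mult)
 hence "j' \<le> i'" by linarith
 hence "2 * i' - D \<le> int h \<longrightarrow> f j' \<le> f i'"
 proof (induction rule: int_ge_induct)
  case (step t)
  show ?case
  proof
   assume a: "2 * (t + 1) - D \<le> int h"
   hence "0 \<le> \<phi> t" using step(1) j'(1) by (intro pos) auto
   thus "f j' \<le> f (t + 1)" using step(2) a assms(2)[of t] by simp
  qed
 qed simp
 thus ?thesis using i' j' by simp
qed

lemma reflection_in_span: "reflection b \<in> refl_group A \<Longrightarrow> b \<in> span A"
proof -
 assume "reflection b \<in> refl_group A"
 hence "reflection b b - b \<in> span A" by (rule refl_group_diff_in_span)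
 hence "- b - b \<in> span A" by (simp add: reflection_self)
 hence "(-1/2) *\<^sub>R (- b - b) \<in> span A" by (rule span_mul)
 moreover have "(-1/2) *\<^sub>R (- b - b) = b" by (simp add: scaleR_diff_right flip: scaleR_left_distrib)
 ultimately show ?thesis by simp
qed

context cox_orbit
begin

section \<open>Projections, hulls and separating lines in the plane\<close>

abbreviation "PL \<equiv> coxeter_plane k \<Delta>\<^sub>p \<Delta>\<^sub>m"
abbreviation "Cn \<equiv> X - range z"

lemma proj_inner:
 assumes "\<eta> \<in> span {E1, E2}"
 shows "orth_proj PL x \<bullet> \<eta> = x \<bullet> \<eta>"
proof -
 have "orthogonal (x - orth_proj PL x) \<eta>"
  using assms
 proof (rule orthogonal_to_span)
  fix y assume "y \<in> {E1, E2}"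
  thus "orthogonal (x - orth_proj PL x) y"
   unfolding orth_proj_plane using E_orthonormal
   by (auto simp: orthogonal_def inner_diff_left inner_add_left inner_commute[of E2 E1])
 qed
 thus ?thesis by (simp add: orthogonal_def inner_diff_left)
qed

lemma proj_zero_iff: "orth_proj PL x = 0 \<longleftrightarrow> coord x = 0"
proof
 assume "orth_proj PL x = 0"
 hence "x \<bullet> E1 = 0" "x \<bullet> E2 = 0"
  using proj_inner[of E1 x] proj_inner[of E2 x] by (auto simp: span_base)
 thus "coord x = 0" by (simp add: coord_def complex_eq_iff)
qed (simp add: orth_proj_plane coord_def complex_eq_iff)

lemma centre_inner: "q \<in> Cn \<Longrightarrow> \<eta> \<in> span {E1, E2} \<Longrightarrow> q \<bullet> \<eta> = 0"
 using proj_inner proj_zero_iff centre_coord by (metis inner_zero_left)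

lemma hull_inner_le:
 assumes "\<eta> \<in> span {E1, E2}" "\<And>b. b \<in> B \<Longrightarrow> b \<bullet> \<eta> \<le> t" "y \<in> block_hull PL B"
 shows "y \<bullet> \<eta> \<le> t"
proof -
 have "convex hull (orth_proj PL ` B) \<subseteq> {y. \<eta> \<bullet> y \<le> t}"
  by (rule hull_minimal[where S = convex])
   (use assms(2) proj_inner[OF assms(1)] convex_halfspace_le[of \<eta> t] in \<open>auto simp: inner_commute\<close>)
 thus ?thesis using assms(3) by (auto simp: block_hull_def inner_commute)
qed

lemma hull_inner_ge:
 assumes "\<eta> \<in> span {E1, E2}" "\<And>b. b \<in> B \<Longrightarrow> t \<le> b \<bullet> \<eta>" "y \<in> block_hull PL B"
 shows "t \<le> y \<bullet> \<eta>"
 using hull_inner_le[of "- \<eta>" B "- t" y] assms by (auto simp: span_neg)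

lemma separated_hulls:
 assumes "finite B" "B \<noteq> {}" "\<eta> \<in> span {E1, E2}"
  and "\<And>b b'. b \<in> B \<Longrightarrow> b' \<in> B' \<Longrightarrow> b \<bullet> \<eta> < b' \<bullet> \<eta>" "finite B'" "B' \<noteq> {}"
 shows "block_hull PL B \<inter> block_hull PL B' = {}"
proof -
 define s where "s = Max ((\<lambda>b. b \<bullet> \<eta>) ` B)"
 define t where "t = Min ((\<lambda>b. b \<bullet> \<eta>) ` B')"
 have "s < t" unfolding s_def t_def using assms by (auto simp: Max_less_iff Min_gr_iff)
 have "y \<bullet> \<eta> \<le> s" if "y \<in> block_hull PL B" for y
  by (rule hull_inner_le[OF assms(3) _ that]) (use assms in \<open>auto simp: s_def\<close>)
 moreover have "t \<le> y \<bullet> \<eta>" if "y \<in> block_hull PL B'" for y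
  by (rule hull_inner_ge[OF assms(3) _ that]) (use assms in \<open>auto simp: t_def\<close>)
 ultimately show ?thesis using \<open>s < t\<close> by fastforce
qed

text \<open>The line through \<open>0\<close> normal to \<open>\<eta>\<close> supports the hull and
  meets it only in \<open>0\<close>: a convex combination lying on that line gives no weight to
  points strictly on one side of it.\<close>

lemma zero_vertex:
 assumes fin: "finite B" and q: "q \<in> B" "coord q = 0" and \<eta>: "\<eta> \<in> span {E1, E2}"
  and neg: "\<And>x. x \<in> B \<Longrightarrow> x \<bullet> \<eta> < 0 \<or> coord x = 0"
 shows "0 \<in> block_hull PL B" "0 \<in> hull_boundary (block_hull PL B)"
  "y \<in> block_hull PL B \<Longrightarrow> y \<bullet> \<eta> \<le> 0" "y \<in> block_hull PL B \<Longrightarrow> y \<bullet> \<eta> = 0 \<Longrightarrow> y = 0"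
proof -
 let ?C = "block_hull PL B" and ?S = "orth_proj PL ` B"
 have "orth_proj PL q \<in> ?S" using q by auto
 thus z: "0 \<in> ?C"
  using q(2) unfolding block_hull_def by (metis hull_inc proj_zero_iff)
 have le0: "x \<bullet> \<eta> \<le> 0" if "x \<in> B" for x
  using neg[OF that] proj_inner[OF \<eta>, of x] proj_zero_iff[of x] by auto
 show le: "y \<bullet> \<eta> \<le> 0" if "y \<in> ?C" for y by (rule hull_inner_le[OF \<eta> le0 that])
 show eq: "y = 0" if y: "y \<in> ?C" "y \<bullet> \<eta> = 0" for y
 proof -
  obtain u where u: "\<forall>x\<in>?S. 0 \<le> u x" "(\<Sum>x\<in>?S. u x *\<^sub>R x) = y"
   using y(1) convex_hull_finite[of ?S] fin unfolding block_hull_def by auto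
  have s: "x \<bullet> \<eta> < 0 \<or> x = 0" if "x \<in> ?S" for x
   using that neg proj_inner[OF \<eta>] proj_zero_iff by fastforce
  have "(\<Sum>x\<in>?S. - (u x * (x \<bullet> \<eta>))) = 0"
   using y(2) unfolding u(2)[symmetric] by (simp add: inner_sum_left sum_negf)
  moreover have "0 \<le> - (u x * (x \<bullet> \<eta>))" if "x \<in> ?S" for x
   using u(1) s[OF that] that by (auto simp: mult_nonneg_nonpos)
  ultimately have "- (u x * (x \<bullet> \<eta>)) = 0" if "x \<in> ?S" for x
   using sum_nonneg_eq_0_iff[of ?S "\<lambda>x. - (u x * (x \<bullet> \<eta>))"] fin that by blast
  hence "u x *\<^sub>R x = 0" if "x \<in> ?S" for x
   using s[OF that] that by (metis less_irrefl mult_eq_0_iff neg_equal_0_iff_equal scaleR_eq_0_iff)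
  thus "y = 0" using u(2) by (metis (no_types, lifting) sum.neutral)
 qed
 show "0 \<in> hull_boundary ?C"
 proof (cases "\<exists>p. ?C = {p}")
  case True
  thus ?thesis using z by (simp add: hull_boundary_def)
 next
  case False
  then obtain x where x: "x \<in> ?C" "x \<noteq> 0" using z by blast
  have conv: "convex ?C" by (simp add: block_hull_def)
  \<comment> \<open>From a relative interior point the segment coming from \<open>x\<close> could be
    prolonged a little inside the hull, which would leave the half plane.\<close>
  have "0 \<notin> rel_interior ?C"
  proof
   assume "0 \<in> rel_interior ?C"
   then obtain e where e: "e > 1" "(1 - e) *\<^sub>R x + e *\<^sub>R 0 \<in> ?C"
    using convex_rel_interior_iff[OF conv, of 0] x z by auto
   hence "((1 - e) *\<^sub>R x) \<bullet> \<eta> \<le> 0" using le[of "(1 - e) *\<^sub>R x + e *\<^sub>R 0"] by simp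
   moreover have "x \<bullet> \<eta> < 0" using le[OF x(1)] eq[OF x(1)] x(2) by force
   ultimately show False using e(1) by (simp add: mult_le_0_iff)
  qed
  hence "0 \<in> rel_frontier ?C" using z closure_subset by (auto simp: rel_frontier_def)
  thus ?thesis using False by (simp add: hull_boundary_def)
 qed
qed

text \<open>Products with \<open>v\<close> are thus a discrete integral along a
  \<open>c\<close>-orbit of the products with \<open>- b\<close>.\<close>

lemma c_solution_step: "c (v - b) = v \<Longrightarrow> c x \<bullet> v - x \<bullet> v = - (x \<bullet> b)"
 using c_inner[of x "v - b"] by (simp add: inner_diff_right)

lemma c_solution_neg: "c (v - b) = v \<Longrightarrow> c (- v - (- b)) = - v"
 using linear_neg[OF linear_c, of "v - b"] by simp

lemma dir_in_plane: "dir D \<in> span {E1, E2}"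
 unfolding dir_def by (intro span_add span_mul span_base) auto

text \<open>\<open>v\<close> itself need not lie in the plane; \<open>\<eta>\<close> does, and
  sorting the vertices by \<open>\<eta>\<close> sorts them weakly by \<open>v\<close>. Hence
  vertices on different levels of \<open>v\<close> are separated by lines normal to
  \<open>\<eta>\<close>.\<close>

definition level_dir :: "'a \<Rightarrow> 'a \<Rightarrow> bool" where
 "level_dir v \<eta> \<longleftrightarrow> \<eta> \<in> span {E1, E2} \<and> (\<forall>i j. z i \<bullet> \<eta> \<le> z j \<bullet> \<eta> \<longrightarrow> z i \<bullet> v \<le> z j \<bullet> v)"

lemma level_dir_neg: "level_dir v \<eta> \<Longrightarrow> level_dir (- v) (- \<eta>)"
 by (auto simp: level_dir_def span_neg)

lemma level_dir_unimodal:
 assumes v: "c (v - b) = v"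
  and anti: "\<And>i. z (D - 1 - i) \<bullet> b = - (z i \<bullet> b)"
  and pos: "\<And>i. D \<le> 2 * i \<Longrightarrow> 2 * i + 2 \<le> D + int h \<Longrightarrow> z i \<bullet> b \<le> 0"
 shows "level_dir v (- dir D)"
 unfolding level_dir_def
proof (intro conjI allI impI)
 show "- dir D \<in> span {E1, E2}" using dir_in_plane by (rule span_neg)
 fix i j assume "z i \<bullet> - dir D \<le> z j \<bullet> - dir D"
 hence "cmod (coord p0) * cos (pi * (2 * j - D) / h) \<le> cmod (coord p0) * cos (pi * (2 * i - D) / h)"
  by (simp add: z_dir)
 hence le: "cos (pi * (2 * j - D) / h) \<le> cos (pi * (2 * i - D) / h)"
  using p0(2) by simp
 show "z i \<bullet> v \<le> z j \<bullet> v"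
 proof (rule unimodal[where f = "\<lambda>i. z i \<bullet> v" and \<phi> = "\<lambda>i. - (z i \<bullet> b)" and D = D and h = h])
  show "z (i + 1) \<bullet> v - z i \<bullet> v = - (z i \<bullet> b)" for i
   using c_solution_step[OF v, of "z i"] by (simp add: z_Suc)
  show "z (i + int h) \<bullet> v = z i \<bullet> v" for i using z_period[of i 1] by simp
 qed (use h_ge anti pos le in auto)
qed

text \<open>The index map \<open>i \<mapsto> a + b - i\<close> swaps the ends of the chord and
  negates the increments. The axis is at \<open>a + b + 1\<close> because increment \<open>i\<close>
  belongs to the step from \<open>i\<close> to \<open>i + 1\<close>.\<close>

lemma level_poly_aux:
 assumes mono: "\<And>i j. cos (2 * pi * i / h) \<le> cos (2 * pi * j / h) \<Longrightarrow>
   z 0 \<bullet> z i \<le> z 0 \<bullet> z j"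
  and ab: "a < b" "b < a + int h" and v: "c (v - (z a - z b)) = v"
 shows "level_dir v (- dir (a + b + 1))"
proof (rule level_dir_unimodal[OF v])
 have e: "z i \<bullet> (z a - z b) = z 0 \<bullet> z (i - a) - z 0 \<bullet> z (i - b)" for i
  using z_inner[of i a] z_inner[of i b] z_inner_even[of "i - a"] z_inner_even[of "i - b"]
  by (simp add: inner_diff_right)
 show "z (a + b + 1 - 1 - i) \<bullet> (z a - z b) = - (z i \<bullet> (z a - z b))" for i
  unfolding e using z_inner_even[of "i - a"] z_inner_even[of "i - b"] by (simp add: algebra_simps)
 fix i assume i: "a + b + 1 \<le> 2 * i" "2 * i + 2 \<le> a + b + 1 + int h"
 define A where "A = 2 * pi * of_int (i - a) / h"
 define B where "B = 2 * pi * of_int (i - b) / h"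
 have h0: "real h > 0" using h_ge by simp
 have range: "sin (pi * t / h) \<ge> 0" if "0 \<le> t" "t \<le> int h" for t
 proof (rule sin_ge_zero)
  show "0 \<le> pi * t / h" using that by simp
  have "real_of_int t \<le> real h" using that by linarith
  hence "pi * real_of_int t \<le> pi * real h" by (intro mult_left_mono) auto
  thus "pi * t / h \<le> pi" using h0 by (simp add: pos_divide_le_eq)
 qed
 \<comment> \<open>On the half period in question both sines are nonnegative, so the projection of
   \<open>z i\<close> is at least as close to that of \<open>z b\<close> as to that of
   \<open>z a\<close>.\<close>
 have "cos B - cos A = 2 * sin ((B + A) / 2) * sin ((A - B) / 2)" by (rule cos_diff_cos)
 also have "(B + A) / 2 = pi * of_int (2 * i - a - b) / h"
  using h0 by (simp add: A_def B_def field_simps)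
 also have "(A - B) / 2 = pi * of_int (b - a) / h"
  using h0 by (simp add: A_def B_def field_simps)
 finally have "cos B - cos A \<ge> 0" using range[of "2 * i - a - b"] range[of "b - a"] i ab by simp
 hence "z 0 \<bullet> z (i - a) \<le> z 0 \<bullet> z (i - b)" by (intro mono) (simp add: A_def B_def)
 thus "z i \<bullet> (z a - z b) \<le> 0" unfolding e by simp
qed

lemma level_poly:
 assumes mono: "\<And>i j. cos (2 * pi * i / h) \<le> cos (2 * pi * j / h) \<Longrightarrow>
   z 0 \<bullet> z i \<le> z 0 \<bullet> z j"
  and ne: "z a \<noteq> z b" and v: "c (v - (z a - z b)) = v"
 shows "\<exists>\<eta>. level_dir v \<eta>"
proof -
 define a' where "a' = a mod int h"
 define b' where "b' = b mod int h"
 have za: "z a = z a'" "z b = z b'"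
  by (simp_all add: z_eq_iff a'_def b'_def mod_eq_dvd_iff[symmetric])
 have r: "0 \<le> a'" "a' < int h" "0 \<le> b'" "b' < int h" using h_ge by (auto simp: a'_def b'_def)
 consider "a' < b'" | "b' < a'" using ne za by (metis linorder_neqE)
 thus ?thesis
 proof cases
  case 1
  thus ?thesis using level_poly_aux[OF mono 1] v r za by auto
 next
  case 2
  have "c (- v - (z b' - z a')) = - v" using c_solution_neg[OF v] za by simp
  hence "level_dir (- v) (- dir (b' + a' + 1))" using level_poly_aux[OF mono 2] r by auto
  thus ?thesis using level_dir_neg[of "- v"] by auto
 qed
qed

lemma z_half: "ii \<Longrightarrow> z (i + int h div 2) = - z i"
 using neg_z(2)[of i] X_neg z_in_X by auto

lemma h_even: "ii \<Longrightarrow> even h"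
 using neg_z(1)[of 0] X_neg z_in_X by auto

lemma centre_z_Suc: "q \<in> Cn \<Longrightarrow> z (i + 1) \<bullet> q = - (z i \<bullet> q)"
 using c_inner[of "z i" q] centre_c[of q] by (simp add: z_Suc)

lemma centre_z_even: "q \<in> Cn \<Longrightarrow> z (i + 2 * t) \<bullet> q = z i \<bullet> q"
proof (induction t rule: int_induct[where k = 0])
 case (step1 t)
 thus ?case
  using centre_z_Suc[of q "i + 2 * t"] centre_z_Suc[of q "i + 2 * t + 1"] by (simp add: algebra_simps)
next
 case (step2 t)
 thus ?case
  using centre_z_Suc[of q "i + 2 * (t - 1)"] centre_z_Suc[of q "i + 2 * (t - 1) + 1"]
  by (simp add: algebra_simps)
qed simp

text \<open>Here the index map is \<open>i \<mapsto> 2 * a + h div 2 - i\<close>, which sends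
  \<open>z i\<close> to the antipode of its mirror image \<open>z (2 * a - i)\<close>. The product
  with \<open>q\<close> depends only on the parity of the index, so it is negated like the product
  with \<open>z a\<close>.\<close>

lemma level_centre:
 assumes ii: "ii" and q: "q \<in> Cn" and v: "c (v - (z a - q)) = v"
  and neg: "\<And>m. cos (2 * pi * m / h) < 0 \<Longrightarrow> z 0 \<bullet> z m \<le> z (a + m) \<bullet> q"
 shows "\<exists>\<eta>. level_dir v \<eta>"
proof -
 obtain m where m: "h = 2 * m" using h_even[OF ii] by auto
 define D where "D = 2 * a + 1 + int m"
 have half: "z (i + int m) = - z i" for i using z_half[OF ii, of i] m by simp
 have e: "z i \<bullet> (z a - q) = z 0 \<bullet> z (i - a) - z i \<bullet> q" for i
  using z_inner[of i a] z_inner_even[of "i - a"] by (simp add: inner_diff_right)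
 have "level_dir v (- dir D)"
 proof (rule level_dir_unimodal[OF v])
  show "z (D - 1 - i) \<bullet> (z a - q) = - (z i \<bullet> (z a - q))" for i
  proof -
   have 1: "z (D - 1 - i) = - z (i + 2 * (a - i))" using half[of "2 * a - i"] by (simp add: D_def algebra_simps)
   have 2: "z (D - 1 - i - a) = - z (- (i - a))" using half[of "a - i"] by (simp add: D_def algebra_simps)
   show ?thesis unfolding e 2 using 1 centre_z_even[OF q, of i "a - i"] z_inner_even[of "i - a"] by simp
  qed
  fix i assume i: "D \<le> 2 * i" "2 * i + 2 \<le> D + int h"
  have "real_of_int (2 * (i - a)) > real m" "real_of_int (2 * (i - a)) < 3 * real m"
  proof -
   have "int m < 2 * (i - a)" "2 * (i - a) < 3 * int m" using i m unfolding D_def by auto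
   hence "real_of_int (int m) < real_of_int (2 * (i - a))"
    "real_of_int (2 * (i - a)) < real_of_int (3 * int m)" by (simp_all only: of_int_less_iff)
   thus "real_of_int (2 * (i - a)) > real m" "real_of_int (2 * (i - a)) < 3 * real m" by simp_all
  qed
  hence "pi * real m < pi * of_int (2 * (i - a))" "pi * of_int (2 * (i - a)) < pi * (3 * real m)"
   by (simp_all only: mult_less_cancel_left_pos[OF pi_gt_zero])
  moreover have "real m > 0" using m h_ge by linarith
  ultimately have "- (pi / 2) < 2 * pi * of_int (i - a) / h - pi"
   "2 * pi * of_int (i - a) / h - pi < pi / 2"
   unfolding m by (simp_all add: field_simps)
  hence "cos (2 * pi * of_int (i - a) / h - pi) > 0" by (intro cos_gt_zero_pi)
  hence "cos (2 * pi * of_int (i - a) / h) < 0" by (simp add: cos_diff)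
  from neg[OF this] show "z i \<bullet> (z a - q) \<le> 0" unfolding e by simp
 qed
 thus ?thesis by blast
qed

lemma level_dir_ex:
 assumes mono: "\<And>i j. cos (2 * pi * i / h) \<le> cos (2 * pi * j / h) \<Longrightarrow>
   z 0 \<bullet> z i \<le> z 0 \<bullet> z j"
  and neg: "\<And>q a m. q \<in> Cn \<Longrightarrow> cos (2 * pi * m / h) < 0 \<Longrightarrow> z 0 \<bullet> z m \<le> z (a + m) \<bullet> q"
  and pq: "p \<in> X" "q \<in> X" "rt ii p q" and v: "c (v - (p - q)) = v"
 shows "\<exists>\<eta>. level_dir v \<eta>"
proof -
 consider a b where "p = z a" "q = z b" | a where "p = z a" "q \<in> Cn" | b where "p \<in> Cn" "q = z b"
  | "p \<in> Cn" "q \<in> Cn" using pq by blast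
 thus ?thesis
 proof cases
  case 1
  thus ?thesis using level_poly[OF mono] pq v by (auto simp: rt_def)
 next
  case 2
  hence ii using X_eq_range by blast
  thus ?thesis using level_centre[OF _ 2(2), of v a] v neg[OF 2(2)] 2 by auto
 next
  case 3
  hence ii using X_eq_range by blast
  have "c (- v - (z b - p)) = - v" using c_solution_neg[OF v] 3 by simp
  then obtain \<eta> where "level_dir (- v) \<eta>" using level_centre[OF \<open>ii\<close> 3(1)] neg[OF 3(1)] by blast
  thus ?thesis using level_dir_neg[of "- v"] by auto
 next
  case 4
  hence ii using X_eq_range by blast
  then obtain u where "Cn = {u, - u}" using centre_ex by auto
  thus ?thesis using 4 pq \<open>ii\<close> by (auto simp: rt_def)
 qed
qed

section \<open>From noncrossing subgroups to noncrossing blocks\<close>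

lemma refl_group_conj_sub: "J \<subseteq> \<Delta> \<Longrightarrow> w \<in> W \<Longrightarrow> refl_group (w ` J) \<subseteq> W"
 by (rule refl_group_subset) (auto intro: reflection_conj_in_refl_group reflection_in_refl_group)

lemma block_eq:
 assumes "J \<subseteq> \<Delta>" "w \<in> W" "B \<in> blocks (refl_group (w ` J)) X" "p \<in> B"
 shows "p \<in> X" "B = {q \<in> X. p - q \<in> span (w ` J)}"
proof -
 let ?H = "refl_group (w ` J)"
 obtain p' where p': "p' \<in> X" "B = orbit_of ?H p'" using assms(3) by (auto simp: blocks_def)
 have B: "B = {q \<in> X. p' - q \<in> span (w ` J)}"
  using same_block_iff[OF assms(1,2) p'(1)] refl_group_conj_sub[OF assms(1,2)] W_X p'
  by (auto simp: orbit_of_def)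
 show "p \<in> X" using B assms(4) by auto
 have pp: "p' - p \<in> span (w ` J)" using B assms(4) by auto
 have "p' - q \<in> span (w ` J) \<longleftrightarrow> p - q \<in> span (w ` J)" for q
  using span_add[OF pp, of "p - q"] span_diff[of "p' - q" _ "p' - p", OF _ pp] by auto
 thus "B = {q \<in> X. p - q \<in> span (w ` J)}" using B by auto
qed

lemma blocks_nonempty: "B \<in> blocks (refl_group K) X \<Longrightarrow> B \<noteq> {}"
 unfolding blocks_def orbit_of_def using id_in_refl_group by auto

text \<open>\<open>mono\<close> and \<open>neg\<close> provide the direction \<open>\<eta>\<close>,
  and \<open>small\<close> places the points over the origin between the vertices of negative and of
  positive level. Two blocks are then separated by a line unless both contain a point over the
  origin, where they touch.\<close>

theorem noncrossing_imp_noncrossing_blocks: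
 assumes mono: "\<And>i j. cos (2 * pi * i / h) \<le> cos (2 * pi * j / h) \<Longrightarrow>
   z 0 \<bullet> z i \<le> z 0 \<bullet> z j"
  and neg: "\<And>q a m. q \<in> Cn \<Longrightarrow> cos (2 * pi * m / h) < 0 \<Longrightarrow> z 0 \<bullet> z m \<le> z (a + m) \<bullet> q"
  and small: "\<And>p q v q' i. p \<in> X \<Longrightarrow> q \<in> X \<Longrightarrow> rt ii p q \<Longrightarrow> v \<in> V \<Longrightarrow> c (v - (p - q)) = v \<Longrightarrow>
   q' \<in> Cn \<Longrightarrow> \<bar>q' \<bullet> v\<bar> \<le> \<bar>z i \<bullet> v\<bar>"
  and nc: "noncrossing_parabolic \<Delta> c H"
  and B: "B \<in> blocks H X" "B' \<in> blocks H X" "B \<noteq> B'"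
 shows "noncrossing_blocks PL B B'"
proof -
 obtain J w where J: "J \<subseteq> \<Delta>" "w \<in> W" "H = refl_group (w ` J)"
  using nc unfolding noncrossing_parabolic_iff parabolic_iff by auto
 obtain bs us where bs: "\<And>b. b \<in> set (bs @ us) \<Longrightarrow> root_of \<Delta> b" "H = refl_group (set bs)"
  "rword (bs @ us) = c" "length (bs @ us) = card \<Delta>"
  using nc unfolding noncrossing_parabolic_iff by blast
 have ne: "B \<noteq> {}" "B' \<noteq> {}" using B J blocks_nonempty by auto
 obtain p q where p: "p \<in> B" and q: "q \<in> B'" using ne by auto
 note Bp = block_eq[OF J(1,2) B(1)[unfolded J(3)] p] and Bq = block_eq[OF J(1,2) B(2)[unfolded J(3)] q]
 have pq: "p - q \<notin> span (w ` J)"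
 proof
  assume "p - q \<in> span (w ` J)"
  hence "q \<in> B" using Bp Bq by auto
  hence "B = {r \<in> X. q - r \<in> span (w ` J)}" using block_eq(2)[OF J(1,2) B(1)[unfolded J(3)]] by blast
  thus False using Bq B(3) by simp
 qed
 have "span (set bs) \<subseteq> span (w ` J)"
 proof (rule span_minimal)
  show "set bs \<subseteq> span (w ` J)"
   using reflection_in_span reflection_in_refl_group[of _ "set bs"] bs(2) J(3) by blast
 qed simp
 hence "p - q \<notin> span (set bs)" using pq by auto
 moreover have "p - q \<in> V" using Bp Bq X_in_V by (auto intro!: span_diff)
 ultimately obtain b v0 where bv: "root_of \<Delta> b" "v0 \<in> V" "c (v0 - b) = v0"
  "\<And>a. a \<in> set bs \<Longrightarrow> a \<bullet> v0 = 0" "(p - q) \<bullet> v0 \<noteq> 0"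
  using noncrossing_separation[OF bs(1,3,4)] by metis
 obtain r r' s where r: "r \<in> X" "r' \<in> X" "rt ii r r'" "s \<noteq> 0" "b = s *\<^sub>R (r - r')"
  using root_is_diff[OF bv(1)] by metis
 \<comment> \<open>Rescaled so that the root becomes the difference \<open>r - r'\<close> of orbit
   points.\<close>
 define v where "v = (1 / s) *\<^sub>R v0"
 have vV: "v \<in> V" using bv(2) by (simp add: v_def span_mul)
 have "v - (r - r') = (1 / s) *\<^sub>R (v0 - b)" using r by (simp add: v_def scaleR_diff_right)
 hence cv: "c (v - (r - r')) = v" using bv(3) by (simp add: linear_cmul[OF linear_c] v_def)
 have const: "x \<bullet> v = y \<bullet> v" if Qxy: "Q \<in> blocks H X" "x \<in> Q" "y \<in> Q" for Q x y
 proof -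
  have fixv: "u \<in> H \<Longrightarrow> u v = v" for u
   unfolding bs(2) by (rule refl_group_fixes) (use bv(4) in \<open>auto simp: v_def\<close>)
  obtain x' where "x' \<in> X" "Q = orbit_of H x'" using Qxy(1) by (auto simp: blocks_def)
  then obtain u u' where "u \<in> H" "u' \<in> H" "x = u x'" "y = u' x'"
   using Qxy(2,3) by (auto simp: orbit_of_def)
  thus ?thesis using refl_group_inner[of u "w ` J" x' v] refl_group_inner[of u' "w ` J" x' v] fixv J(3)
   by metis
 qed
 have pqv: "p \<bullet> v \<noteq> q \<bullet> v" using bv(5) r(4) by (simp add: v_def inner_diff_left)
 obtain \<eta> where \<eta>: "level_dir v \<eta>" using level_dir_ex[OF mono neg r(1,2,3) cv] by blast
 have \<eta>P: "\<eta> \<in> span {E1, E2}" using \<eta> by (simp add: level_dir_def)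
 have zz: "z i \<bullet> \<eta> < z j \<bullet> \<eta>" if "z i \<bullet> v < z j \<bullet> v" for i j
  using \<eta> that unfolding level_dir_def by (meson not_le)
 have zpos: "0 < z i \<bullet> \<eta>" if "0 < z i \<bullet> v" "ii" for i
  using zz[of "i + int h div 2" i] z_half[OF that(2), of i] that by simp
 have zneg: "z i \<bullet> \<eta> < 0" if "z i \<bullet> v < 0" "ii" for i
  using zz[of i "i + int h div 2"] z_half[OF that(2), of i] that by simp
 \<comment> \<open>By \<open>small\<close> a vertex of lower level than a centre point has negative
   level, hence a negative product with \<open>\<eta>\<close> by comparison with its antipode; the
   centre point has product zero with \<open>\<eta>\<close>. Vertices of higher level are treated
   likewise.\<close>
 have key: "x \<bullet> \<eta> < y \<bullet> \<eta> \<or> (x \<in> Cn \<and> y \<in> Cn)" if xy: "x \<in> X" "y \<in> X" "x \<bullet> v < y \<bullet> v" for x y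
 proof -
  consider i j where "x = z i" "y = z j" | i where "x = z i" "y \<in> Cn" | j where "x \<in> Cn" "y = z j"
   | "x \<in> Cn" "y \<in> Cn" using xy by blast
  thus ?thesis
  proof cases
   case 1
   thus ?thesis using zz xy by auto
  next
   case 2
   hence ii using X_eq_range by blast
   have "\<bar>y \<bullet> v\<bar> \<le> \<bar>z i \<bullet> v\<bar>" using small[OF r(1,2,3) vV cv 2(2)] .
   moreover have "z i \<bullet> v < y \<bullet> v" using xy 2 by simp
   ultimately have "z i \<bullet> v < 0" by linarith
   thus ?thesis using zneg[OF _ \<open>ii\<close>] centre_inner[OF 2(2) \<eta>P] 2 by simp
  next
   case 3
   hence ii using X_eq_range by blast
   have "\<bar>x \<bullet> v\<bar> \<le> \<bar>z j \<bullet> v\<bar>" using small[OF r(1,2,3) vV cv 3(1)] .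
   moreover have "x \<bullet> v < z j \<bullet> v" using xy 3 by simp
   ultimately have "z j \<bullet> v > 0" by linarith
   thus ?thesis using zpos[OF _ \<open>ii\<close>] centre_inner[OF 3(1) \<eta>P] 3 by simp
  qed blast
 qed
 have main: "noncrossing_blocks PL Q Q'" if Q: "Q \<in> blocks H X" "Q' \<in> blocks H X"
  "x0 \<in> Q" "y0 \<in> Q'" "x0 \<bullet> v < y0 \<bullet> v" for Q Q' x0 y0
 proof -
  have sub: "Q \<subseteq> X" "Q' \<subseteq> X"
   using block_eq(1)[OF J(1,2)] Q(1,2) unfolding J(3) by blast+
  have fin: "finite Q" "finite Q'" using sub X_finite finite_subset by blast+
  have lt: "x \<bullet> v < y \<bullet> v" if "x \<in> Q" "y \<in> Q'" for x y
   using const[OF Q(1) that(1) Q(3)] const[OF Q(2) that(2) Q(4)] Q(5) by simp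
  show ?thesis
  proof (cases "(\<exists>x\<in>Q. x \<in> Cn) \<and> (\<exists>y\<in>Q'. y \<in> Cn)")
   case False
   hence "x \<bullet> \<eta> < y \<bullet> \<eta>" if "x \<in> Q" "y \<in> Q'" for x y
    using key[of x y] lt[OF that] that sub by blast
   hence "block_hull PL Q \<inter> block_hull PL Q' = {}"
    using Q fin by (intro separated_hulls[OF _ _ \<eta>P]) auto
   thus ?thesis by (simp add: noncrossing_blocks_def)
  next
   case True
   then obtain x1 y1 where 1: "x1 \<in> Q" "x1 \<in> Cn" "y1 \<in> Q'" "y1 \<in> Cn" by blast
   have n: "x \<bullet> \<eta> < 0 \<or> coord x = 0" if "x \<in> Q" for x
    using key[of x y1] lt[OF that 1(3)] 1 that sub centre_inner[OF 1(4) \<eta>P] centre_coord[of x] by auto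
   have n': "y \<bullet> (- \<eta>) < 0 \<or> coord y = 0" if "y \<in> Q'" for y
    using key[of x1 y] lt[OF 1(1) that] 1 that sub centre_inner[OF 1(2) \<eta>P] centre_coord[of y] by auto
   note zv = zero_vertex[OF fin(1) 1(1) centre_coord[OF 1(2)] \<eta>P n]
    and zv' = zero_vertex[OF fin(2) 1(3) centre_coord[OF 1(4)] span_neg[OF \<eta>P] n']
   have "y = 0" if "y \<in> block_hull PL Q" "y \<in> block_hull PL Q'" for y
    using zv(3,4)[of y] zv'(3)[of y] that by auto
   hence "block_hull PL Q \<inter> block_hull PL Q' = {0}" using zv(1) zv'(1) by auto
   thus ?thesis unfolding noncrossing_blocks_def using zv(2) zv'(2) by blast
  qed
 qed
 have sym: "noncrossing_blocks PL B' B \<Longrightarrow> noncrossing_blocks PL B B'"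
  unfolding noncrossing_blocks_def by (auto simp: Int_commute)
 show ?thesis
  using main[OF B(1,2) p q] main[OF B(2,1) q p] sym pqv by linarith
qed

end


section \<open>Noncrossing relations on orthogonal orbits\<close>

text \<open>The feature shared by types A, B and D: a fixed orbit point has the same inner product
  with all points other than itself and its negative. So the reflection in \<open>q - r\<close>
  moves only \<open>q\<close>, \<open>r\<close> and their negatives.\<close>

locale orthogonal_orbit = cox_orbit +
 assumes orth: "p \<in> X \<Longrightarrow> q \<in> X \<Longrightarrow> r \<in> X \<Longrightarrow> p \<noteq> q \<Longrightarrow> p \<noteq> - q \<Longrightarrow> p \<noteq> r \<Longrightarrow> p \<noteq> - r \<Longrightarrow>
   p \<bullet> (q - r) = 0"
  and neg_dichotomy: "(\<forall>p\<in>X. - p \<notin> X) \<or> (\<forall>p\<in>X. - p \<in> X)"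
begin

lemma neg_all: "p \<in> X \<Longrightarrow> - p \<in> X \<Longrightarrow> q \<in> X \<Longrightarrow> - q \<in> X"
 using neg_dichotomy by blast

lemma orth_neg: "p \<in> X \<Longrightarrow> q \<in> X \<Longrightarrow> - q \<in> X \<Longrightarrow> p \<noteq> q \<Longrightarrow> p \<noteq> - q \<Longrightarrow> p \<bullet> q = 0"
 using orth[of p q "- q"] by (auto simp: inner_add_right)

lemma inner_bound:
 assumes "p \<in> X" "q \<in> X"
 shows "p \<bullet> q \<le> p \<bullet> p" "- (p \<bullet> p) \<le> p \<bullet> q"
proof -
 have "norm q = norm p" using X_norm[OF assms] by (simp add: norm_eq_sqrt_inner)
 hence "\<bar>p \<bullet> q\<bar> \<le> p \<bullet> p"
  using Cauchy_Schwarz_ineq2[of p q] by (simp add: dot_square_norm power2_eq_square)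
 thus "p \<bullet> q \<le> p \<bullet> p" "- (p \<bullet> p) \<le> p \<bullet> q" by auto
qed

lemma cos_one_imp: "cos (2 * pi * i / h) = 1 \<Longrightarrow> z i = z 0"
proof -
 assume c: "cos (2 * pi * i / h) = 1"
 hence "sin (2 * pi * i / h) = 0"
  using sin_cos_squared_add[of "2 * pi * i / h"] by simp
 hence "cis (2 * pi * i / h) = 1" using c by (simp add: complex_eq_iff)
 thus "z i = z 0" by (simp add: cis_eq_1_iff_dvd z_eq_iff)
qed

lemma z0_cos: "z i = z 0 \<Longrightarrow> cos (2 * pi * i / h) = 1"
 using cis_eq_1_iff_dvd[of i] by (simp add: z_eq_iff complex_eq_iff)

text \<open>Only three inner products occur, for antipodal, generic and equal pairs, and the cosines
  are in the same order.\<close>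

lemma z_mono:
 assumes "cos (2 * pi * i / h) \<le> cos (2 * pi * j / h)"
 shows "z 0 \<bullet> z i \<le> z 0 \<bullet> z j"
proof -
 consider "z j = z 0" | "z i = z 0" | "z i = - z 0" | "z j = - z 0"
  | "z i \<noteq> z 0" "z i \<noteq> - z 0" "z j \<noteq> z 0" "z j \<noteq> - z 0" by blast
 thus ?thesis
 proof cases
  case 1
  thus ?thesis using inner_bound[OF z_in_X z_in_X, of 0 i] by simp
 next
  case 2
  hence "cos (2 * pi * j / h) = 1"
   using assms z0_cos[of i] cos_le_one[of "2 * pi * j / h"] by simp
  thus ?thesis using cos_one_imp[of j] 2 by simp
 next
  case 3
  thus ?thesis using inner_bound[OF z_in_X z_in_X, of 0 j] by simp
 next
  case 4
  have cj: "cis (2 * pi * j / h) = - 1"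
  proof -
   have "coord (z j) = - coord (z 0)" using 4 coord_minus by simp
   hence "cis (2 * pi * j / h) * coord p0 = (- 1) * coord p0" using coord_z[of j] coord_z[of 0] by simp
   thus ?thesis using p0(2) by (simp only: mult_cancel_right) auto
  qed
  hence "cos (2 * pi * j / h) = - 1" by (simp add: complex_eq_iff)
  hence ci: "cos (2 * pi * i / h) = - 1"
   using assms cos_ge_minus_one[of "2 * pi * i / h"] by simp
  hence "sin (2 * pi * i / h) = 0"
   using sin_cos_squared_add[of "2 * pi * i / h"] by simp
  hence "cis (2 * pi * i / h) = cis (2 * pi * j / h)" using ci cj by (simp add: complex_eq_iff)
  hence "cis (2 * pi * i / h) / cis (2 * pi * j / h) = 1" by simp
  hence "cis (2 * pi * of_int (i - j) / h) = 1"
   by (simp add: cis_divide diff_divide_distrib right_diff_distrib)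
  hence "z i = z j" by (simp only: cis_eq_1_iff_dvd z_eq_iff)
  thus ?thesis by simp
 next
  case 5
  thus ?thesis using orth[OF z_in_X z_in_X z_in_X, of 0 i j]
   by (metis diff_gt_0_iff_gt inner_diff_right less_irrefl minus_minus not_le)
 qed
qed

lemma centre_orth: "q \<in> Cn \<Longrightarrow> z i \<bullet> q = 0"
proof -
 assume q: "q \<in> Cn"
 hence ii using X_eq_range by blast
 hence "- q \<in> X" using X_neg q by auto
 moreover have "z i \<noteq> q" using q by auto
 moreover have "z i \<noteq> - q" using q z_half[OF \<open>ii\<close>, of i] by (metis DiffD2 minus_minus rangeI)
 ultimately show ?thesis using orth_neg[OF z_in_X, of q i] q by auto
qed

lemma z_centre_neg:
 assumes "q \<in> Cn" "cos (2 * pi * m / h) < 0"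
 shows "z 0 \<bullet> z m \<le> z (a + m) \<bullet> q"
proof -
 have ii using X_eq_range assms(1) by blast
 have "z m \<noteq> z 0" using z0_cos[of m] assms(2) by auto
 moreover have "z 0 \<bullet> z m = 0" if "z m \<noteq> z 0" "z m \<noteq> - z 0"
  using that X_neg[OF \<open>ii\<close> z_in_X, of m] by (intro orth_neg z_in_X) auto
 ultimately have "z 0 \<bullet> z m \<le> 0" by (cases "z m = - z 0") auto
 thus ?thesis using centre_orth[OF assms(1)] by simp
qed

lemma centre_solution:
 assumes "q \<in> Cn" "c (v - b) = v"
 shows "2 * (q \<bullet> v) = q \<bullet> b"
 using c_solution_step[OF assms(2), of q] centre_c[OF assms(1)] by simp

text \<open>For the root \<open>z a - q\<close> the value at \<open>z i\<close> changes only when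
  passing \<open>z a\<close> or its antipode. It is constant on each half of the polygon and
  opposite on the two halves, and the jump at \<open>z a\<close> is the squared length.\<close>

lemma half_value:
 assumes ii: ii and q: "q \<in> Cn" and v: "c (v - (z a - q)) = v"
 shows "\<bar>z i \<bullet> v\<bar> = (z a \<bullet> z a) / 2"
proof -
 obtain m where m: "h = 2 * m" using h_even[OF ii] by auto
 have m1: "m > 1" using m h_ge by simp
 have half: "z (i + int m) = - z i" for i using z_half[OF ii, of i] m by simp
 have st: "z (i + 1) \<bullet> v = z i \<bullet> v - z i \<bullet> z a" for i
  using c_solution_step[OF v, of "z i"] centre_orth[OF q, of i] by (simp add: z_Suc inner_diff_right)
 have c: "z (a + 1 + int t) \<bullet> v = z (a + 1) \<bullet> v" if "t < m" for t
  using that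
 proof (induction t)
  case (Suc t)
  let ?i = "a + 1 + int t"
  have "z ?i \<noteq> z a"
  proof -
   have "\<not> int h dvd 1 + int t" using zdvd_not_zless[of "1 + int t" "int h"] Suc.prems m by auto
   thus ?thesis unfolding z_eq_iff by (simp add: algebra_simps)
  qed
  moreover have "z ?i \<noteq> - z a"
  proof
   assume "z ?i = - z a"
   hence "z ?i = z (a + int m)" using half by simp
   hence "int h dvd \<bar>(a + 1 + int t) - (a + int m)\<bar>" by (simp only: z_eq_iff dvd_abs_iff)
   moreover have "0 < \<bar>(a + 1 + int t) - (a + int m)\<bar>" "\<bar>(a + 1 + int t) - (a + int m)\<bar> < int h"
    using Suc.prems m by auto
   ultimately show False using zdvd_not_zless by blast
  qed
  ultimately have "z ?i \<bullet> z a = 0" using X_neg[OF ii z_in_X, of a] by (intro orth_neg z_in_X) auto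
  thus ?case using st[of ?i] Suc by (simp add: algebra_simps)
 qed simp
 have 1: "z (a + 1) \<bullet> v = - (z a \<bullet> v)"
  using c[of "m - 1"] half[of a] m1 by (simp add: of_nat_diff)
 hence va: "z a \<bullet> v = (z a \<bullet> z a) / 2" using st[of a] by simp
 define t where "t = nat ((i - a - 1) mod int h)"
 have h0: "int h > 0" using h_ge by simp
 have t: "t < h" "int t = (i - a - 1) mod int h"
  using pos_mod_bound[OF h0, of "i - a - 1"] pos_mod_sign[OF h0, of "i - a - 1"] unfolding t_def by linarith+
 have zi: "z i = z (a + 1 + int t)"
  unfolding t(2) z_eq_iff by (metis (no_types, opaque_lifting) diff_diff_eq dvd_minus_mod)
 show ?thesis
 proof (cases "t < m")
  case True
  thus ?thesis using c[OF True] zi 1 va by simp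
 next
  case False
  define s where "s = t - m"
  have s: "s < m" "t = s + m" using False t(1) m by (auto simp: s_def)
  have "z i = - z (a + 1 + int s)" using half[of "a + 1 + int s"] zi s(2) by (simp add: algebra_simps)
  thus ?thesis using c[OF s(1)] 1 va by simp
 qed
qed

lemma centre_small:
 assumes "p \<in> X" "q \<in> X" "rt ii p q" "v \<in> V" "c (v - (p - q)) = v" "q' \<in> Cn"
 shows "\<bar>q' \<bullet> v\<bar> \<le> \<bar>z i \<bullet> v\<bar>"
proof -
 have ii: ii using X_eq_range assms(6) by blast
 then obtain u where u: "Cn = {u, - u}" using centre_ex by auto
 have q'v: "2 * (q' \<bullet> v) = q' \<bullet> p - q' \<bullet> q" using centre_solution[OF assms(6,5)] by (simp add: inner_diff_right)
 have N: "\<bar>q' \<bullet> x\<bar> = z a \<bullet> z a" if "x \<in> Cn" for x a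
 proof -
  have "u \<in> X" using u by blast
  hence "u \<bullet> u = z a \<bullet> z a" using X_norm z_in_X by blast
  thus ?thesis using that assms(6) u by auto
 qed
 consider a b where "p = z a" "q = z b" | a where "p = z a" "q \<in> Cn" | b where "p \<in> Cn" "q = z b"
  | "p \<in> Cn" "q \<in> Cn" using assms(1,2) by blast
 thus ?thesis
 proof cases
  case 1
  thus ?thesis using q'v centre_orth[OF assms(6)] by (simp add: inner_commute)
 next
  case 2
  have "\<bar>z i \<bullet> v\<bar> = (z a \<bullet> z a) / 2" using half_value[OF ii 2(2)] assms(5) 2 by simp
  moreover have "\<bar>q' \<bullet> v\<bar> = (z a \<bullet> z a) / 2"
   using q'v centre_orth[OF assms(6), of a] N[OF 2(2), of a] 2(1) by (simp add: inner_commute)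
  ultimately show ?thesis by simp
 next
  case 3
  have "c (- v - (z b - p)) = - v" using c_solution_neg[OF assms(5)] 3 by simp
  hence "\<bar>z i \<bullet> v\<bar> = (z b \<bullet> z b) / 2" using half_value[OF ii 3(1), of "- v" b i] by simp
  moreover have "\<bar>q' \<bullet> v\<bar> = (z b \<bullet> z b) / 2"
   using q'v centre_orth[OF assms(6), of b] N[OF 3(1), of b] 3(2) by (simp add: inner_commute)
  ultimately show ?thesis by simp
 next
  case 4
  thus ?thesis using u assms(3) ii by (auto simp: rt_def)
 qed
qed

section \<open>Noncrossing relations generate noncrossing subgroups\<close>

definition diffs :: "('a \<times> 'a) set \<Rightarrow> 'a set" where
 "diffs r = {p - q | p q. (p, q) \<in> r \<and> rt ii p q}"

text \<open>The index conditions forbid two crossing chords in different blocks, a chord cutting the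
  radius of a vertex joined to the centre, and a centre point outside a block that surrounds the
  origin. Stated for relations, the condition passes to the smaller relations of the induction
  without asking whether these come from parabolic subgroups.\<close>

definition ncrel :: "('a \<times> 'a) set \<Rightarrow> bool" where
 "ncrel r \<longleftrightarrow> equiv X r \<and>
  (\<forall>p q. (p, q) \<in> r \<longrightarrow> - p \<in> X \<longrightarrow> - q \<in> X \<longrightarrow> (- p, - q) \<in> r) \<and>
  (\<forall>i j k l. i < j \<longrightarrow> j < k \<longrightarrow> k < l \<longrightarrow> l < i + int h \<longrightarrow> (z i, z k) \<in> r \<longrightarrow> (z j, z l) \<in> r \<longrightarrow>
   (z i, z j) \<in> r) \<and>
  (\<forall>i j k q. q \<in> Cn \<longrightarrow> i < k \<longrightarrow> k < j \<longrightarrow> 2 * (j - i) < int h \<longrightarrow> (z i, z j) \<in> r \<longrightarrow>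
   (z k, q) \<in> r \<longrightarrow> (z i, z k) \<in> r) \<and>
  (ii \<longrightarrow> (\<forall>i q. q \<in> Cn \<longrightarrow> (z i, - z i) \<in> r \<longrightarrow> (z i, q) \<in> r))"

lemma ncrelD:
 assumes "ncrel r"
 shows "equiv X r" "(p, q) \<in> r \<Longrightarrow> - p \<in> X \<Longrightarrow> - q \<in> X \<Longrightarrow> (- p, - q) \<in> r"
  "i < j \<Longrightarrow> j < u \<Longrightarrow> u < l \<Longrightarrow> l < i + int h \<Longrightarrow> (z i, z u) \<in> r \<Longrightarrow> (z j, z l) \<in> r \<Longrightarrow> (z i, z j) \<in> r"
  "q \<in> Cn \<Longrightarrow> i < u \<Longrightarrow> u < j \<Longrightarrow> 2 * (j - i) < int h \<Longrightarrow> (z i, z j) \<in> r \<Longrightarrow> (z u, q) \<in> r \<Longrightarrow>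
   (z i, z u) \<in> r"
  "ii \<Longrightarrow> q \<in> Cn \<Longrightarrow> (z i, - z i) \<in> r \<Longrightarrow> (z i, q) \<in> r"
 using assms unfolding ncrel_def by blast+

lemma ncrel_sym: "ncrel r \<Longrightarrow> (p, q) \<in> r \<Longrightarrow> (q, p) \<in> r"
 using ncrelD(1) by (meson equivE symE)

lemma ncrel_trans: "ncrel r \<Longrightarrow> (p, q) \<in> r \<Longrightarrow> (q, s) \<in> r \<Longrightarrow> (p, s) \<in> r"
 using ncrelD(1) by (meson equivE transE)

lemma ncrel_in: "ncrel r \<Longrightarrow> (p, q) \<in> r \<Longrightarrow> p \<in> X \<and> q \<in> X"
 using ncrelD(1) equiv_type by blast

lemma ncrel_refl: "ncrel r \<Longrightarrow> p \<in> X \<Longrightarrow> (p, p) \<in> r"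
 using ncrelD(1) by (meson equivE refl_onD)

lemma refl_group_diffs_eqI:
 assumes "set bs \<subseteq> diffs r" "\<And>g. g \<in> diffs r \<Longrightarrow> g \<in> set bs \<or> - g \<in> set bs"
 shows "refl_group (set bs) = refl_group (diffs r)"
proof (intro equalityI refl_group_subset)
 fix g assume "g \<in> diffs r"
 thus "reflection g \<in> refl_group (set bs)"
  using assms(2) reflection_uminus[of g] reflection_in_refl_group[of _ "set bs"] by metis
qed (use assms(1) in \<open>auto intro: reflection_in_refl_group\<close>)

lemma z_distinct:
 assumes "d > 0" "int d < int h" "- z 0 \<in> X \<Longrightarrow> 2 * d < h" "0 < \<bar>t\<bar>" "\<bar>t\<bar> \<le> int d"
 shows "z (u + t) \<noteq> z u" "z (u + t) \<noteq> - z u"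
proof -
 show "z (u + t) \<noteq> z u"
  using assms zdvd_not_zless[of "\<bar>t\<bar>" "int h"] by (auto simp: z_eq_iff)
 show "z (u + t) \<noteq> - z u"
 proof
  assume e: "z (u + t) = - z u"
  hence nX: "- z u \<in> X" using z_in_X by metis
  hence "- z 0 \<in> X" using neg_all[OF z_in_X] z_in_X by blast
  hence d: "2 * d < h" using assms by simp
  obtain m where m: "h = 2 * m" using neg_z(1)[OF nX] by auto
  have "z (u + t) = z (u + int m)" using e neg_z(2)[OF nX] m by simp
  hence dv: "int h dvd \<bar>t - int m\<bar>" by (simp add: z_eq_iff)
  have "0 < \<bar>t - int m\<bar>" "\<bar>t - int m\<bar> < int h" using d m assms by auto
  thus False using dv zdvd_not_zless by blast
 qed
qed

lemma z_normal: "\<exists>l. i \<le> l \<and> l < i + int h \<and> z j = z l"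
proof -
 have h0: "int h > 0" using h_ge by simp
 let ?l = "i + (j - i) mod int h"
 have "z j = z ?l" unfolding z_eq_iff by (metis diff_diff_eq dvd_minus_mod)
 thus ?thesis
  using pos_mod_bound[OF h0, of "j - i"] pos_mod_sign[OF h0, of "j - i"] by (intro exI[of _ ?l]) auto
qed

text \<open>Isolating the end \<open>b\<close> of a shortest chord together with \<open>- b\<close>
  gives a smaller relation \<open>r'\<close>, whose word is extended by the root
  \<open>\<beta>\<close> of the chord. When no chord is left, a block has at most two opposite
  vertices besides centre points, and at most two reflections remain.\<close>

lemma ncrel_generated:
 "ncrel r \<Longrightarrow> \<exists>bs. triangular bs \<and> refl_group (set bs) = refl_group (diffs r)"
proof (induction "card r" arbitrary: r rule: less_induct)
 case less
 note nc = less.prems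
 have "r \<subseteq> X \<times> X" using ncrelD(1)[OF nc] by (rule equiv_type)
 hence finr: "finite r" using X_finite by (meson finite_SigmaI finite_subset)
 show ?case
 proof (cases "\<exists>d>0. \<exists>i. (z i, z (i + int d)) \<in> r \<and> z (i + int d) \<noteq> z i \<and> z (i + int d) \<noteq> - z i")
  case True
  define Q where "Q d i \<longleftrightarrow> 0 < d \<and> (z i, z (i + int d)) \<in> r \<and> z (i + int d) \<noteq> z i \<and> z (i + int d) \<noteq> - z i"
   for d :: nat and i
  from True have "\<exists>d. \<exists>i. Q d i" by (auto simp: Q_def)
  then obtain d where d: "\<exists>i. Q d i" "\<forall>d'<d. \<not> (\<exists>i. Q d' i)"
   using exists_least_iff[of "\<lambda>d. \<exists>i. Q d i"] by auto
  then obtain i where Q: "Q d i" by auto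
  have least: "d \<le> d'" if "Q d' i'" for d' i'
   using d(2) that by (meson not_le)
  define j where "j = i + int d"
  have d0: "0 < d" and ij: "(z i, z j) \<in> r" "z j \<noteq> z i" "z j \<noteq> - z i" using Q by (auto simp: Q_def j_def)
  have dh: "d < h"
  proof -
   obtain l where l: "i \<le> l" "l < i + int h" "z j = z l" using z_normal by blast
   hence "Q (nat (l - i)) i" using ij unfolding Q_def by (cases "l = i") auto
   from least[OF this] l show ?thesis by linarith
  qed
  \<comment> \<open>The same two vertices are joined the other way round at distance
    \<open>h - d\<close>. Minimality gives \<open>2 * d \<le> h\<close>, and equality would make
    them antipodal.\<close>
  have negd: "2 * d < h" if n0: "- z 0 \<in> X"
  proof -
   have nX: "- z k \<in> X" for k by (rule neg_all[OF z_in_X n0 z_in_X])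
   obtain m where m: "h = 2 * m" using neg_z(1)[OF n0] by auto
   have "z (j + int (h - d)) = z i" using dh z_period[of i 1] by (simp add: j_def of_nat_diff)
   hence "Q (h - d) j" using ij dh ncrel_sym[OF nc ij(1)] unfolding Q_def
    by (metis minus_minus zero_less_diff)
   from least[OF this] have "d \<le> m" using m by simp
   moreover have "d \<noteq> m" using ij(3) neg_z(2)[OF nX[of i]] m by (auto simp: j_def)
   ultimately show ?thesis using m by simp
  qed
  note dist = z_distinct[OF d0 _ negd] 
  have near: "(z k, z (k + t)) \<notin> r" if "0 < \<bar>t\<bar>" "\<bar>t\<bar> < int d" for k t
  proof
   assume a: "(z k, z (k + t)) \<in> r"
   show False
   proof (cases "t > 0")
    case True
    hence "Q (nat t) k" unfolding Q_def using a dist[of t k] that dh by auto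
    from least[OF this] show False using that by linarith
   next
    case False
    hence "Q (nat (- t)) (k + t)"
     unfolding Q_def using ncrel_sym[OF nc a] dist[of "- t" "k + t"] that dh by auto
    from least[OF this] show False using that by linarith
   qed
  qed
  \<comment> \<open>A vertex strictly under the chord and related to another point would give a
    shorter chord, or a chord or radius crossing the given one. In the latter case the condition on
    the relation joins it to \<open>z i\<close>, again a shorter chord.\<close>
  have single: "q = z k" if k: "i < k" "k < j" "(z k, q) \<in> r" for k q
  proof (rule ccontr)
   assume qk: "q \<noteq> z k"
   have ik: "(z i, z k) \<notin> r" using near[of "k - i" i] k by (auto simp: j_def)
   show False
   proof (cases "q \<in> Cn")
    case True
    hence ii using X_eq_range by blast
    hence "2 * d < h" using negd X_neg z_in_X by blast
    thus False using ncrelD(4)[OF nc True k(1,2) _ ij(1) k(3)] ik by (auto simp: j_def)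
   next
    case False
    then obtain l' where "q = z l'" using ncrel_in[OF nc k(3)] by auto
    then obtain l where l: "i \<le> l" "l < i + int h" "q = z l" using z_normal[of i l'] by auto
    show False
    proof (cases "l \<le> j")
     case True
     have "l \<noteq> k" using qk l by auto
     moreover have "\<bar>l - k\<bar> < int d" using k(1,2) l(1) True unfolding j_def by linarith
     ultimately show False using near[of "l - k" k] k(3) l(3) by simp
    next
     case False
     thus False using ncrelD(3)[OF nc k(1,2), of l] ij(1) k(3) l ik by auto
    qed
   qed
  qed
  define b where "b = z j"
  define b' where "b' = z i"
  define \<beta> where "\<beta> = b - b'"
  have bX: "b \<in> X" "b' \<in> X" by (auto simp: b_def b'_def z_in_X)
  have bb: "b \<noteq> b'" "b \<noteq> - b'" "b' \<noteq> - b" using ij by (auto simp: b_def b'_def)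
  have bbr: "(b', b) \<in> r" "(b, b') \<in> r" using ij(1) ncrel_sym[OF nc] by (auto simp: b_def b'_def)
  have root\<beta>: "root_of \<Delta> \<beta>" unfolding \<beta>_def using bX bb by (intro root_of_diff) (auto simp: rt_def)
  \<comment> \<open>Isolating \<open>- b\<close> along with \<open>b\<close> keeps the relation
    stable under negation.\<close>
  define r' where "r' = {(p, q). (p, q) \<in> r \<and> (p = q \<or> p \<notin> {b, - b} \<and> q \<notin> {b, - b})}"
  have r'I: "(p, q) \<in> r'" if "(p, q) \<in> r" "p \<noteq> b" "p \<noteq> - b" "q \<noteq> b" "q \<noteq> - b" for p q
   using that by (auto simp: r'_def)
  have r'D: "(p, q) \<in> r" "p \<noteq> q \<Longrightarrow> p \<noteq> b \<and> p \<noteq> - b \<and> q \<noteq> b \<and> q \<noteq> - b" if "(p, q) \<in> r'" for p q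
   using that by (auto simp: r'_def)
  have r'sub: "r' \<subseteq> r" by (auto simp: r'_def)
  have "(b', b) \<in> r - r'" using bbr bb by (auto simp: r'_def)
  hence "r' \<subset> r" using r'sub by auto
  hence card: "card r' < card r" using finr by (rule psubset_card_mono[rotated])
  have zne: "z x \<noteq> z y" if "x < y" "y < x + int h" for x y
  proof
   assume "z x = z y"
   hence "z y = z x" by simp
   hence "int h dvd y - x" by (simp only: z_eq_iff)
   thus False using that zdvd_not_zless[of "y - x" "int h"] by simp
  qed
  have nc': "ncrel r'"
   unfolding ncrel_def
  proof (intro conjI allI impI)
   show "equiv X r'"
   proof (rule equivI)
    show "r' \<subseteq> X \<times> X" using r'sub ncrel_in[OF nc] by auto
    show "refl_on X r'" using ncrel_refl[OF nc] by (auto simp: refl_on_def r'_def)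
    show "sym r'" using ncrel_sym[OF nc] by (auto simp: sym_def r'_def)
    show "trans r'" unfolding trans_def r'_def using ncrel_trans[OF nc] by blast
   qed
  next
   fix p q assume a: "(p, q) \<in> r'" "- p \<in> X" "- q \<in> X"
   have r: "(- p, - q) \<in> r" using ncrelD(2)[OF nc r'D(1)[OF a(1)] a(2,3)] .
   show "(- p, - q) \<in> r'"
   proof (cases "p = q")
    case False
    hence "- p \<noteq> b" "- p \<noteq> - b" "- q \<noteq> b" "- q \<noteq> - b" using r'D(2)[OF a(1)] by (metis minus_minus)+
    thus ?thesis by (rule r'I[OF r])
   qed (use r in \<open>simp add: r'_def\<close>)
  next
   fix x y u l assume a: "x < y" "y < u" "u < l" "l < x + int h" "(z x, z u) \<in> r'" "(z y, z l) \<in> r'"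
   have "z x \<noteq> z u" "z y \<noteq> z l" using zne[of x u] zne[of y l] a by auto
   thus "(z x, z y) \<in> r'"
    using r'D[OF a(5)] r'D[OF a(6)] ncrelD(3)[OF nc a(1-4)] by (intro r'I) auto
  next
   fix x y u q assume a: "q \<in> Cn" "x < u" "u < y" "2 * (y - x) < int h" "(z x, z y) \<in> r'" "(z u, q) \<in> r'"
   have "z x \<noteq> z y" using zne[of x y] a by auto
   moreover have "z u \<noteq> q" using a(1) by auto
   ultimately show "(z x, z u) \<in> r'"
    using r'D[OF a(5)] r'D[OF a(6)] ncrelD(4)[OF nc a(1-4)] by (intro r'I) auto
  next
   fix x q assume a: ii "q \<in> Cn" "(z x, - z x) \<in> r'"
   have "z x \<noteq> - z x" using X_nonzero[OF a(1) z_in_X] by (metis neg_eq_self)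
   moreover have "q \<noteq> b" using a(2) by (auto simp: b_def)
   moreover have "q \<noteq> - b" using a(2) z_half[OF a(1), of j] by (auto simp: b_def) (metis rangeI)
   ultimately show "(z x, q) \<in> r'"
    using r'D[OF a(3)] ncrelD(5)[OF nc a(1,2)] by (intro r'I) auto
  qed
  obtain bs where bs: "triangular bs" "refl_group (set bs) = refl_group (diffs r')"
   using less.hyps[OF card nc'] by auto
  obtain v where v: "v \<in> V" "c (v - \<beta>) = v" using c_solve[OF root_of_in_span[OF root\<beta>]] by blast
  have step: "z (l + 1) \<bullet> v = z l \<bullet> v - z l \<bullet> \<beta>" for l
   using c_solution_step[OF v(2), of "z l"] by (simp add: z_Suc)
  have step0: "z (l + 1) \<bullet> v = z l \<bullet> v" if "z l \<noteq> z i" "z l \<noteq> - z i" "z l \<noteq> z j" "z l \<noteq> - z j" for l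
   using step[of l] orth[OF z_in_X[of l] bX] that by (simp add: \<beta>_def b_def b'_def)
  \<comment> \<open>The products with \<open>v\<close> change only on passing \<open>z i\<close>,
    \<open>z j\<close> and their antipodes, so they agree at all vertices outside the arc from
    \<open>i + 1\<close> to \<open>j\<close> and its antipodal arc.\<close>
  have const: "\<exists>A. \<forall>x\<in>X. (\<forall>l. i < l \<longrightarrow> l \<le> j \<longrightarrow> x \<noteq> z l \<and> x \<noteq> - z l) \<longrightarrow> x \<bullet> v = A"
  proof (cases "- z 0 \<in> X")
   case False
   have nX: "- z l \<notin> X" for l using neg_all[OF z_in_X] False z_in_X by blast
   have XR: "X = range z" using X_eq_range X_neg z_in_X nX by blast
   have zz: "z l \<noteq> - z l'" for l l' using nX z_in_X by metis
   have f: "z (j + 1 + int t) \<bullet> v = z (j + 1) \<bullet> v" if "int t < i + int h - j" for t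
    using that
   proof (induction t)
    case (Suc t)
    have "z (j + 1 + int t) \<noteq> z i" using zne[of "j + 1 + int t" "i + int h"] Suc.prems z_period[of i 1] d0
     by (auto simp: j_def)
    moreover have "z (j + 1 + int t) \<noteq> z j" using zne[of j "j + 1 + int t"] Suc.prems d0 by (auto simp: j_def)
    ultimately show ?case using step0[of "j + 1 + int t"] zz Suc by (simp add: algebra_simps)
   qed simp
   show ?thesis
   proof (intro exI[of _ "z (j + 1) \<bullet> v"] ballI impI)
    fix x assume x: "x \<in> X" "\<forall>l. i < l \<longrightarrow> l \<le> j \<longrightarrow> x \<noteq> z l \<and> x \<noteq> - z l"
    obtain l' where "x = z l'" using x XR by auto
    then obtain l where l: "i + 1 \<le> l" "l < i + 1 + int h" "x = z l" using z_normal[of "i + 1" l'] by auto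
    hence "j < l" using x(2)[rule_format, of l] by fastforce
    thus "x \<bullet> v = z (j + 1) \<bullet> v" using f[of "nat (l - j - 1)"] l by auto
   qed
  next
   case True
   have nX: "- z l \<in> X" for l by (rule neg_all[OF z_in_X True z_in_X])
   obtain m where m: "h = 2 * m" using neg_z(1)[OF True] by auto
   have half: "z (l + int m) = - z l" for l using neg_z(2)[OF nX, of l] m by simp
   have dm: "d < m" using negd[OF True] m by simp
   have nz: "z l \<noteq> - z l'" if "l < l' + int m" "l' < l + int m" for l l'
   proof
    assume "z l = - z l'"
    hence "z l = z (l' + int m)" using half by simp
    thus False using zne[of l "l' + int m"] that m by auto
   qed
   have nz': "z l \<noteq> z l'" if "l \<noteq> l'" "l < l' + int h" "l' < l + int h" for l l'
    using zne[of l l'] zne[of l' l] that by (metis linorder_neqE)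
   have f: "z (j + 1 + int t) \<bullet> v = z (j + 1) \<bullet> v" if "int t < i + int m - j" for t
    using that
   proof (induction t)
    case (Suc t)
    let ?l = "j + 1 + int t"
    have "z ?l \<noteq> z i" "z ?l \<noteq> z j" by (rule nz'; use Suc.prems d0 m in \<open>simp add: j_def\<close>)+
    moreover have "z ?l \<noteq> - z i" "z ?l \<noteq> - z j" by (rule nz; use Suc.prems d0 m dm in \<open>simp add: j_def\<close>)+
    ultimately show ?case using step0[of ?l] Suc by (simp add: algebra_simps)
   qed simp
   have f': "z (i + 1 + int t) \<bullet> v = z (i + 1) \<bullet> v" if "t < d" for t
    using that
   proof (induction t)
    case (Suc t)
    let ?l = "i + 1 + int t"
    have "z ?l \<noteq> z i" "z ?l \<noteq> z j" by (rule nz'; use Suc.prems d0 m dm in \<open>simp add: j_def\<close>)+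
    moreover have "z ?l \<noteq> - z i" "z ?l \<noteq> - z j" by (rule nz; use Suc.prems d0 m dm in \<open>simp add: j_def\<close>)+
    ultimately show ?case using step0[of ?l] Suc by (simp add: algebra_simps)
   qed simp
   \<comment> \<open>The jumps at \<open>z i\<close> and \<open>z j\<close> cancel, so the value
     just after \<open>z j\<close> is that at \<open>z i\<close>. It also persists up to the
     antipode of \<open>z i\<close>, so it equals its own negative and is zero.\<close>
   have "z j \<bullet> v = z (i + 1) \<bullet> v" using f'[of "d - 1"] d0 by (simp add: j_def of_nat_diff)
   moreover have "z j \<bullet> \<beta> + z i \<bullet> \<beta> = 0"
    using X_norm[OF bX] by (simp add: \<beta>_def b_def b'_def inner_diff_right inner_commute)
   ultimately have "z (j + 1) \<bullet> v = z i \<bullet> v" using step[of i] step[of j] by simp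
   moreover have "z (j + 1) \<bullet> v = - (z i \<bullet> v)"
    using f[of "m - d - 1"] dm half[of i] by (simp add: j_def of_nat_diff algebra_simps)
   ultimately have z0: "z (j + 1) \<bullet> v = 0" by simp
   have f0: "z l \<bullet> v = 0" if "j < l" "l \<le> i + int m" for l
    using f[of "nat (l - j - 1)"] z0 that by auto
   show ?thesis
   proof (intro exI[of _ 0] ballI impI)
    fix x assume x: "x \<in> X" "\<forall>l. i < l \<longrightarrow> l \<le> j \<longrightarrow> x \<noteq> z l \<and> x \<noteq> - z l"
    show "x \<bullet> v = 0"
    proof (cases "x \<in> Cn")
     case True
     have "x \<bullet> \<beta> = 0" using centre_orth[OF True] by (simp add: \<beta>_def b_def b'_def inner_diff_right inner_commute)
     thus ?thesis using centre_solution[OF True v(2)] by simp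
    next
     case False
     then obtain l' where "x = z l'" using x by auto
     then obtain l where l: "i + 1 \<le> l" "l < i + 1 + int h" "x = z l" using z_normal[of "i + 1" l'] by auto
     have lj: "j < l" using x(2)[rule_format, of l] l by fastforce
     show ?thesis
     proof (cases "l \<le> i + int m")
      case True
      thus ?thesis using f0 lj l by simp
     next
      case False
      have xl: "x = - z (l - int m)" using half[of "l - int m"] l by simp
      have "j < l - int m" using x(2) xl False by (metis diff_gt_0_iff_gt not_le add.commute less_diff_eq)
      thus ?thesis using f0[of "l - int m"] xl l m by simp
     qed
    qed
   qed
  qed
  then obtain A where A0: "\<forall>x\<in>X. (\<forall>l. i < l \<longrightarrow> l \<le> j \<longrightarrow> x \<noteq> z l \<and> x \<noteq> - z l) \<longrightarrow> x \<bullet> v = A"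
   by (rule exE)
  have A: "x \<bullet> v = A" if "x \<in> X" "\<And>l. i < l \<Longrightarrow> l \<le> j \<Longrightarrow> x \<noteq> z l \<and> x \<noteq> - z l" for x
   using A0 that by simp
  have far: "x \<noteq> z l \<and> x \<noteq> - z l" if "(x, y) \<in> r'" "x \<noteq> y" "i < l" "l \<le> j" for x y l
  proof (intro conjI notI)
   note D = r'D(1)[OF that(1)] r'D(2)[OF that(1,2)]
   show False if "x = z l"
   proof (cases "l = j")
    case False
    thus False using single[of l y] D(1) that \<open>x \<noteq> y\<close> \<open>i < l\<close> \<open>l \<le> j\<close> by auto
   qed (use D that in \<open>auto simp: b_def\<close>)
   show False if "x = - z l"
   proof (cases "l = j")
    case False
    have xX: "x \<in> X" "y \<in> X" using ncrel_in[OF nc D(1)] by auto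
    have "- x \<in> X" using that z_in_X by simp
    hence "- y \<in> X" using neg_all[OF xX(1)] xX(2) by blast
    hence "(z l, - y) \<in> r" using ncrelD(2)[OF nc D(1) \<open>- x \<in> X\<close>] that by simp
    hence "- y = z l" using single[of l "- y"] \<open>i < l\<close> \<open>l \<le> j\<close> False by auto
    thus False using that \<open>x \<noteq> y\<close> by (metis minus_minus)
   qed (use D that in \<open>auto simp: b_def\<close>)
  qed
  have vconst: "g \<bullet> v = 0" if g: "g \<in> diffs r'" for g
  proof -
   obtain p q where pq: "g = p - q" "(p, q) \<in> r'" "rt ii p q" using g by (auto simp: diffs_def)
   have "p \<noteq> q" using pq by (auto simp: rt_def)
   moreover have "(q, p) \<in> r'" using ncrel_sym[OF nc' pq(2)] .
   ultimately have "p \<bullet> v = A" "q \<bullet> v = A"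
    using A[of p] A[of q] far[OF pq(2)] far[of q p] ncrel_in[OF nc' pq(2)] by auto
   thus ?thesis by (simp add: pq(1) inner_diff_left)
  qed
  have vorth: "a \<bullet> v = 0" if "a \<in> set bs" for a
  proof -
   have "reflection a \<in> refl_group (diffs r')" using that bs(2) reflection_in_refl_group by blast
   hence "reflection a v = v" using vconst by (rule refl_group_fixes)
   thus ?thesis by (simp add: reflection_fix_iff)
  qed
  have tri: "triangular (bs @ [\<beta>])" using bs(1) root\<beta> v vorth by (rule triangular.snoc)
  let ?K = "refl_group (set (bs @ [\<beta>]))"
  have K1: "refl_group (diffs r') \<subseteq> ?K"
   unfolding bs(2)[symmetric] by (rule refl_group_subset) (auto intro: reflection_in_refl_group)
  have K2: "reflection \<beta> \<in> ?K" by (rule reflection_in_refl_group) simp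
  have K3: "reflection (p - q) \<in> ?K" if "(p, q) \<in> r'" "rt ii p q" for p q
   using that K1 reflection_in_refl_group[of "p - q" "diffs r'"] by (auto simp: diffs_def)
  have \<beta>b: "reflection \<beta> b' = b" unfolding \<beta>_def
   using reflection_swap[OF X_norm[OF bX(2,1)]] reflection_commute_diff[of b b'] by simp
  have conj: "reflection (w g) \<in> ?K" if "w \<in> ?K" "reflection g \<in> ?K" for w g
   using that by (rule reflection_conj_in_refl_group)
  \<comment> \<open>The reflection in \<open>\<beta>\<close> swaps \<open>b'\<close> and
    \<open>b\<close>, so roots at \<open>b\<close> come by conjugation from roots at
    \<open>b'\<close>. For \<open>q = - b'\<close> an element that negates \<open>b'\<close> and
    fixes \<open>b\<close> carries \<open>\<beta>\<close> to \<open>b - q\<close> instead.\<close>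
  have negb: "reflection (b - q) \<in> ?K" if q: "(b, q) \<in> r" "rt ii b q" for q
  proof -
   have qX: "q \<in> X" using ncrel_in[OF nc q(1)] by simp
   consider "q = b'" | "q = - b'" | "q = - b" | "q \<noteq> b'" "q \<noteq> - b'" "q \<noteq> b" "q \<noteq> - b"
    using q(2) by (auto simp: rt_def)
   thus ?thesis
   proof cases
    case 1
    thus ?thesis using K2 by (simp add: \<beta>_def)
   next
    case 2
    hence nb: "- b' \<in> X" using qX by simp
    hence nb2: "- b \<in> X" using neg_all[OF bX(2)] bX(1) by blast
    have perp: "b' \<bullet> b = 0" using orth_neg[OF bX(2,1) nb2] bb by auto
    have rb: "(b', - b') \<in> r" using ncrel_trans[OF nc bbr(1)] q(1) 2 by simp
    have "\<exists>w\<in>?K. w b = b \<and> w b' = - b' \<and> linear w"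
    proof (cases ii)
     case False
     have "b' \<noteq> - b'" using bb(2) perp X_norm[OF bX(1,2)] bb(1) by (metis inner_eq_zero_iff neg_eq_self)
     hence "reflection (b' - (- b')) \<in> ?K"
      using rb bb False nb by (intro K3 r'I) (auto simp: rt_def)
     moreover have "reflection (b' - (- b')) b = b"
      using perp by (simp add: reflection_fix_iff inner_add_left)
     moreover have "reflection (b' - (- b')) b' = - b'" by (rule reflection_swap) simp
     ultimately show ?thesis using linear_reflection by blast
    next
     case True
     obtain q0 where q0: "Cn = {q0, - q0}" using centre_ex[OF True] by auto
     have q0C: "q0 \<in> Cn" "- q0 \<in> Cn" using q0 by auto
     have s: "(b', q0) \<in> r" "(b', - q0) \<in> r"
      using ncrelD(5)[OF nc True q0C(1), of i] ncrelD(5)[OF nc True q0C(2), of i] rb by (auto simp: b'_def)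
     have zq: "z l \<noteq> q0" "z l \<noteq> - q0" for l
      using q0C by (metis DiffD2 rangeI)+
     have ne: "b' \<noteq> q0" "b' \<noteq> - q0" "q0 \<noteq> b" "q0 \<noteq> - b" "- q0 \<noteq> b" "- q0 \<noteq> - b"
      using zq unfolding b_def b'_def by (metis minus_minus)+
     have k: "reflection (b' - q0) \<in> ?K" "reflection (b' - (- q0)) \<in> ?K"
      using s ne bb by (intro K3 r'I; auto simp: rt_def)+
     have bq: "b \<bullet> q0 = 0" using centre_orth[OF q0C(1)] by (simp add: b_def)
     have nn: "b' \<bullet> b' = q0 \<bullet> q0" using X_norm[OF bX(2), of q0] q0C by auto
     have "reflection (b' - (- q0)) b = b" "reflection (b' - q0) b = b"
      unfolding reflection_fix_iff using perp bq
      by (simp_all add: inner_add_left inner_diff_left inner_commute[of q0 b])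
     hence "reflection (b' - q0) (reflection (b' - (- q0)) b) = b" by simp
     moreover have "reflection (b' - q0) (reflection (b' - (- q0)) b') = - b'"
     proof -
      have "reflection (b' - (- q0)) b' = - q0" by (rule reflection_swap) (simp add: nn)
      moreover have "reflection (b' - q0) q0 = b'"
       using reflection_swap[of q0 b'] nn reflection_commute_diff[of b' q0] by simp
      ultimately show ?thesis by (simp add: reflection_minus)
     qed
     moreover have "linear (reflection (b' - q0) \<circ> reflection (b' - (- q0)))"
      by (intro linear_compose linear_reflection)
     ultimately show ?thesis using refl_group_comp[OF k] by (metis comp_apply)
    qed
    then obtain w where w: "w \<in> ?K" "w b = b" "w b' = - b'" "linear w" by blast
    have "w \<beta> = b - q" using w 2 by (simp add: \<beta>_def linear_diff)
    thus ?thesis using conj[OF w(1) K2] by simp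
   next
    case 3
    hence nii: "\<not> ii" using q(2) by (auto simp: rt_def)
    have nb2: "- b \<in> X" using 3 qX by simp
    hence nb: "- b' \<in> X" using neg_all[OF bX(1)] bX(2) by blast
    have "(- b, - b') \<in> r" using ncrelD(2)[OF nc bbr(2) nb2 nb] .
    hence rb: "(b', - b') \<in> r" using q(1) 3 bbr(1) ncrel_trans[OF nc] by blast
    have "b' \<noteq> - b'" using bb X_norm[OF bX] by (metis inner_eq_zero_iff neg_eq_self)
    hence "reflection (b' - (- b')) \<in> ?K"
     using rb bb nii by (intro K3 r'I) (auto simp: rt_def)
    from conj[OF K2 this] have "reflection (b - (- b)) \<in> ?K"
     by (simp add: reflection_add \<beta>b)
    thus ?thesis using 3 by simp
   next
    case 4
    have "(b', q) \<in> r'" using ncrel_trans[OF nc bbr(1) q(1)] 4 bb by (intro r'I) auto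
    hence "reflection (b' - q) \<in> ?K" using 4 by (intro K3) (auto simp: rt_def)
    from conj[OF K2 this] have "reflection (reflection \<beta> b' - reflection \<beta> q) \<in> ?K"
     by (simp add: reflection_diff)
    moreover have "reflection \<beta> q = q"
     unfolding reflection_fix_iff using orth[OF qX bX] 4 by (simp add: \<beta>_def inner_commute)
    ultimately show ?thesis by (simp add: \<beta>b)
   qed
  qed
  have "refl_group (set (bs @ [\<beta>])) = refl_group (diffs r)"
  proof (intro equalityI refl_group_subset)
   fix a assume "a \<in> set (bs @ [\<beta>])"
   moreover have "refl_group (diffs r') \<subseteq> refl_group (diffs r)"
    using r'sub by (intro refl_group_subset reflection_in_refl_group) (auto simp: diffs_def)
   moreover have "\<beta> \<in> diffs r" using bbr bb by (auto simp: diffs_def \<beta>_def rt_def)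
   ultimately show "reflection a \<in> refl_group (diffs r)"
    using bs(2) reflection_in_refl_group[of a "set bs"] reflection_in_refl_group[of \<beta> "diffs r"] by auto
  next
   fix g assume "g \<in> diffs r"
   then obtain p q where pq: "g = p - q" "(p, q) \<in> r" "rt ii p q" by (auto simp: diffs_def)
   have pqX: "p \<in> X" "q \<in> X" using ncrel_in[OF nc pq(2)] by auto
   have qp: "(q, p) \<in> r" "rt ii q p" using ncrel_sym[OF nc pq(2)] pq(3) by (auto simp: rt_def)
   have neg: "(- p, - q) \<in> r" "rt ii (- p) (- q)" "(- q, - p) \<in> r" "rt ii (- q) (- p)"
    if "- p \<in> X \<or> - q \<in> X"
   proof -
    have "- p \<in> X" "- q \<in> X" using that neg_all[OF pqX(1)] neg_all[OF pqX(2)] pqX by blast+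
    thus "(- p, - q) \<in> r" "(- q, - p) \<in> r"
     using ncrelD(2)[OF nc pq(2)] ncrelD(2)[OF nc qp(1)] by blast+
    show "rt ii (- p) (- q)" "rt ii (- q) (- p)" using pq(3) by (auto simp: rt_def)
   qed
   have e: "reflection (p - q) = reflection (q - p)" "reflection (p - q) = reflection (- p - - q)"
    "reflection (p - q) = reflection (- q - - p)"
    using reflection_commute_diff[of p q] by (simp_all add: reflection_uminus[of "p - q", symmetric])
   consider "p = b" | "q = b" | "p = - b" | "q = - b" | "p \<noteq> b" "p \<noteq> - b" "q \<noteq> b" "q \<noteq> - b" by blast
   thus "reflection g \<in> ?K"
    unfolding pq(1)
   proof cases
    case 1
    thus "reflection (p - q) \<in> ?K" using negb[of q] pq by simp
   next
    case 2
    thus "reflection (p - q) \<in> ?K" using negb[of p] qp e by simp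
   next
    case 3
    hence "- p \<in> X" using bX by simp
    thus "reflection (p - q) \<in> ?K" using negb[of "- q"] neg(1,2) 3 e(2) by simp
   next
    case 4
    hence "- q \<in> X" using bX by simp
    thus "reflection (p - q) \<in> ?K" using negb[of "- p"] neg(3,4) 4 e(3) by simp
   next
    case 5
    thus "reflection (p - q) \<in> ?K" using K3[OF r'I[OF pq(2)]] pq(3) by simp
   qed
  qed
  thus ?thesis using tri by blast
 next
  case False
  have pm: "z l = z k \<or> z l = - z k" if "(z k, z l) \<in> r" for k l
  proof -
   obtain l' where l': "k \<le> l'" "l' < k + int h" "z l = z l'" using z_normal by blast
   show ?thesis
   proof (cases "l' = k")
    case False
    have F: "\<not> (0 < d \<and> (z k, z (k + int d)) \<in> r \<and> z (k + int d) \<noteq> z k \<and> z (k + int d) \<noteq> - z k)" for d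
     using \<open>\<not> (\<exists>d>0. \<exists>i. (z i, z (i + int d)) \<in> r \<and> z (i + int d) \<noteq> z i \<and> z (i + int d) \<noteq> - z i)\<close> by blast
    show ?thesis using F[of "nat (l' - k)"] l' False that by auto
   qed (use l' in auto)
  qed
  show ?thesis
  proof (cases "\<exists>i. \<exists>q\<in>Cn. (z i, q) \<in> r")
   case True
   then obtain i q0 where iq: "q0 \<in> Cn" "(z i, q0) \<in> r" by blast
   have ii: ii using X_eq_range iq(1) by blast
   define b where "b = z i"
   have bX: "b \<in> X" "q0 \<in> X" "- b \<in> X" "- q0 \<in> X" using iq z_in_X X_neg[OF ii] by (auto simp: b_def)
   have Cq: "Cn = {q0, - q0}"
   proof -
    obtain u where u: "Cn = {u, - u}" using centre_ex[OF ii] by blast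
    hence "q0 = u \<or> q0 = - u" using iq(1) by blast
    hence "{u, - u} = {q0, - q0}" by auto
    thus ?thesis using u by simp
   qed
   have zq: "z l \<noteq> q0" "z l \<noteq> - q0" for l using Cq by auto
   have bq: "b \<noteq> q0" "b \<noteq> - q0" using zq by (auto simp: b_def)
   have zb: "z l = b \<or> z l = - b" if "(z l, q) \<in> r" "q \<in> Cn" for l q
   proof (cases "q = q0")
    case True
    hence "(z l, z i) \<in> r" using that(1) iq(2) ncrel_sym[OF nc] ncrel_trans[OF nc] by blast
    thus ?thesis using pm by (metis b_def minus_minus)
   next
    case False
    hence q: "q = - q0" using that(2) Cq by auto
    have "(- z l, q0) \<in> r" using ncrelD(2)[OF nc that(1)] X_neg[OF ii z_in_X] bX q by auto
    hence "(- z l, z i) \<in> r" using iq(2) ncrel_sym[OF nc] ncrel_trans[OF nc] by blast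
    hence "(z (l + int h div 2), z i) \<in> r" using z_half[OF ii, of l] by simp
    thus ?thesis using pm z_half[OF ii, of l] by (metis b_def minus_minus)
   qed
   have D: "g = b - q0 \<or> g = - (b - q0) \<or> ((g = b + q0 \<or> g = - (b + q0)) \<and> (b, - q0) \<in> r)"
    if g: "g \<in> diffs r" for g
   proof -
    obtain p q where pq: "g = p - q" "(p, q) \<in> r" "rt ii p q" using g by (auto simp: diffs_def)
    have half: "\<exists>s t. s - t = x - y \<and> (s = b \<or> s = - b) \<and> (t = q0 \<or> t = - q0) \<and> (s, t) \<in> r"
     if "(x, y) \<in> r" "x \<in> range z" "y \<in> Cn" for x y
     using that zb Cq by blast
    have pqX: "p \<in> X" "q \<in> X" using ncrel_in[OF nc pq(2)] by auto
    have "\<not> (p \<in> range z \<and> q \<in> range z)"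
    proof
     assume "p \<in> range z \<and> q \<in> range z"
     then obtain x y where "p = z x" "q = z y" by blast
     thus False using pm[of x y] pq(2,3) ii by (auto simp: rt_def)
    qed
    moreover have "\<not> (p \<in> Cn \<and> q \<in> Cn)" using pq(3) ii Cq by (auto simp: rt_def)
    ultimately consider "p \<in> range z" "q \<in> Cn" | "q \<in> range z" "p \<in> Cn" using pqX by blast
    then obtain s t where st: "g = s - t \<or> g = - (s - t)" "s = b \<or> s = - b" "t = q0 \<or> t = - q0" "(s, t) \<in> r"
    proof cases
     case 1
     thus ?thesis using half[OF pq(2)] that pq(1) by metis
    next
     case 2
     thus ?thesis using half[OF ncrel_sym[OF nc pq(2)]] that pq(1) by (metis minus_diff_eq)
    qed
    have nst: "(- s, - t) \<in> r" using ncrelD(2)[OF nc st(4)] st bX by auto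
    show ?thesis using st nst by auto
   qed
   have r1: "root_of \<Delta> (b - q0)" "root_of \<Delta> (b + q0)"
    using root_of_diff[OF bX(1,2)] root_of_diff[OF bX(1,4)] bq by (auto simp: rt_def)
   have in1: "b - q0 \<in> diffs r" using iq(2) bq by (auto simp: diffs_def rt_def b_def)
   show ?thesis
   proof (cases "(b, - q0) \<in> r")
    case False
    have "refl_group (set [b - q0]) = refl_group (diffs r)"
     by (rule refl_group_diffs_eqI) (use in1 D False in force)+
    thus ?thesis using triangular_single[OF r1(1)] by blast
   next
    case True
    \<comment> \<open>\<open>c\<close> negates \<open>q0\<close>, so
      \<open>2 * (q0 \<bullet> v) = q0 \<bullet> (b - q0)\<close>. With
      \<open>c_solution_inner\<close>, the equal lengths and the orthogonality of \<open>b\<close>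
      and \<open>q0\<close> this makes \<open>v\<close> orthogonal to \<open>b + q0\<close>.\<close>
    obtain v where v: "v \<in> V" "c (v - (b - q0)) = v" using c_solve[OF root_of_in_span[OF r1(1)]] by blast
    have "b \<bullet> q0 = 0" using centre_orth[OF iq(1)] by (simp add: b_def)
    moreover have "2 * ((b - q0) \<bullet> v) = (b - q0) \<bullet> (b - q0)" using c_solution_inner[OF v(2)] .
    moreover have "2 * (q0 \<bullet> v) = q0 \<bullet> (b - q0)" using centre_solution[OF iq(1) v(2)] .
    moreover have "b \<bullet> b = q0 \<bullet> q0" using X_norm bX by blast
    ultimately have "(b + q0) \<bullet> v = 0"
     by (simp add: inner_add_left inner_diff_left inner_diff_right inner_commute[of q0 b])
    hence "triangular ([b + q0] @ [b - q0])"
     using triangular.snoc[OF triangular_single[OF r1(2)] r1(1) v] by simp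
    moreover have "b + q0 \<in> diffs r"
    proof -
     have "b + q0 = b - (- q0)" by simp
     thus ?thesis using True bq unfolding diffs_def rt_def by (metis (mono_tags, lifting) CollectI minus_minus)
    qed
    hence "refl_group (set ([b + q0] @ [b - q0])) = refl_group (diffs r)"
     by (intro refl_group_diffs_eqI) (use in1 D in force)+
    ultimately show ?thesis by blast
   qed
  next
   case noC: False
   have only: "p \<in> range z \<and> q = - p \<and> \<not> ii" if "(p, q) \<in> r" "rt ii p q" for p q
   proof -
    have pqX: "p \<in> X" "q \<in> X" using ncrel_in[OF nc that(1)] by auto
    have nCC: "\<not> (p \<in> Cn \<and> q \<in> Cn)"
    proof
     assume a: "p \<in> Cn \<and> q \<in> Cn"
     hence ii using X_eq_range by blast
     then obtain u where "Cn = {u, - u}" using centre_ex by blast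
     hence "p = u \<or> p = - u" "q = u \<or> q = - u" using a by blast+
     thus False using that(2) \<open>ii\<close> by (auto simp: rt_def)
    qed
    have "\<not> (p \<in> range z \<and> q \<in> Cn)" "\<not> (q \<in> range z \<and> p \<in> Cn)"
     using noC that(1) ncrel_sym[OF nc that(1)] by blast+
    hence pr: "p \<in> range z" "q \<in> range z" using nCC pqX by blast+
    then obtain x y where "p = z x" "q = z y" by blast
    hence "q = - p" using pm[of x y] that by (auto simp: rt_def)
    thus ?thesis using pr that(2) by (auto simp: rt_def)
   qed
   show ?thesis
   proof (cases "diffs r = {}")
    case True
    thus ?thesis using triangular.Nil by (intro exI[of _ "[]"]) simp
   next
    case False
    then obtain p q where pq: "(p, q) \<in> r" "rt ii p q" by (auto simp: diffs_def)
    then obtain i where i: "p = z i" "q = - z i" "\<not> ii" using only[OF pq] by auto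
    have nX: "- z k \<in> X" for k
     using neg_all[OF z_in_X[of i]] ncrel_in[OF nc pq(1)] z_in_X i by blast
    obtain m where m: "h = 2 * m" using neg_z(1)[OF nX] by auto
    have half: "z (l + int m) = - z l" for l using neg_z(2)[OF nX, of l] m by simp
    \<comment> \<open>Two different antipodal chords cross, so they would lie in one block, which
      \<open>pm\<close> rules out.\<close>
    have imp: "z l = z i \<or> z l = - z i" if l: "(z l, - z l) \<in> r" for l
    proof (rule ccontr)
     assume ne: "\<not> ?thesis"
     obtain l1 where l1: "i \<le> l1" "l1 < i + int h" "z l = z l1" using z_normal by blast
     define l2 where "l2 = (if l1 < i + int m then l1 else l1 - int m)"
     have l2: "i \<le> l2" "l2 < i + int m" using l1 m by (auto simp: l2_def)
     have zl2: "z l2 = z l \<or> z l2 = - z l" using half[of "l1 - int m"] l1 by (auto simp: l2_def)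
     have "l2 \<noteq> i" using zl2 ne by (metis minus_minus)
     have rr: "(z l2, z (l2 + int m)) \<in> r" using zl2 l ncrel_sym[OF nc l] half[of l2] by auto
     have "(z i, z (i + int m)) \<in> r" using half[of i] pq i by simp
     hence "(z i, z l2) \<in> r"
      using ncrelD(3)[OF nc, of i l2 "i + int m" "l2 + int m"] rr l2 \<open>l2 \<noteq> i\<close> m by auto
     thus False using pm zl2 ne by (metis minus_minus)
    qed
    have root: "root_of \<Delta> (p - q)"
     using pq ncrel_in[OF nc pq(1)] by (intro root_of_diff) auto
    have "refl_group (set [p - q]) = refl_group (diffs r)"
    proof (rule refl_group_diffs_eqI)
     show "set [p - q] \<subseteq> diffs r" using pq by (auto simp: diffs_def)
     fix g assume "g \<in> diffs r"
     then obtain x y where g: "g = x - y" "(x, y) \<in> r" "rt ii x y" by (auto simp: diffs_def)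
     then obtain l where l: "x = z l" "y = - z l" using only[OF g(2,3)] by auto
     hence "z l = z i \<or> z l = - z i" using imp g(2) by simp
     thus "g \<in> set [p - q] \<or> - g \<in> set [p - q]" using g(1) l i by auto
    qed
    thus ?thesis using triangular_single[OF root] by blast
   qed
  qed
 qed
qed

definition same_rel :: "'a set \<Rightarrow> ('a \<times> 'a) set" where
 "same_rel K = {(p, q). p \<in> X \<and> q \<in> X \<and> p - q \<in> span K}"

text \<open>Each generator is, up to scale, a difference of two orbit points, which are then
  related. Conversely \<open>par_conj\<close> puts the reflection of every related difference into
  the subgroup.\<close>

lemma refl_group_diffs_same_rel:
 assumes "J \<subseteq> \<Delta>" "w \<in> W"
 shows "refl_group (diffs (same_rel (w ` J))) = refl_group (w ` J)"
proof (intro equalityI refl_group_subset)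
 fix g assume "g \<in> diffs (same_rel (w ` J))"
 thus "reflection g \<in> refl_group (w ` J)"
  using par_conj[OF assms] by (auto simp: diffs_def same_rel_def)
next
 fix g assume g: "g \<in> w ` J"
 then obtain \<alpha> where \<alpha>: "\<alpha> \<in> J" "g = w \<alpha>" by auto
 have "root_of \<Delta> \<alpha>" using \<alpha>(1) assms(1) simple_nonzero reflection_in_refl_group by (auto simp: root_of_def)
 then obtain p q s where pq: "p \<in> X" "q \<in> X" "rt ii p q" "s \<noteq> 0" "\<alpha> = s *\<^sub>R (p - q)"
  using root_is_diff by metis
 have lin: "linear w" using assms(2) by (rule refl_group_linear)
 have gw: "g = s *\<^sub>R (w p - w q)" using \<alpha> pq lin by (simp add: linear_cmul linear_diff)
 hence "w p - w q = (1 / s) *\<^sub>R g" using pq(4) by simp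
 moreover have "(1 / s) *\<^sub>R g \<in> span (w ` J)" using g by (intro span_mul span_base)
 moreover have "rt ii (w p) (w q)"
  using pq(3) refl_group_inj[OF assms(2)] linear_neg[OF lin] unfolding rt_def by metis
 ultimately have "w p - w q \<in> diffs (same_rel (w ` J))"
  using W_X[OF assms(2) pq(1)] W_X[OF assms(2) pq(2)] unfolding diffs_def same_rel_def
  by (intro CollectI exI[of _ "w p"] exI[of _ "w q"]) simp
 moreover have "reflection g = reflection (w p - w q)" using gw pq(4) by (simp add: reflection_scaled)
 ultimately show "reflection g \<in> refl_group (diffs (same_rel (w ` J)))"
  by (simp add: reflection_in_refl_group)
qed

lemma ncrel_noncrossing:
 assumes "J \<subseteq> \<Delta>" "w \<in> W" "ncrel (same_rel (w ` J))"
 shows "noncrossing_parabolic \<Delta> c (refl_group (w ` J))"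
proof -
 obtain bs where "triangular bs" "refl_group (set bs) = refl_group (w ` J)"
  using ncrel_generated[OF assms(3)] refl_group_diffs_same_rel[OF assms(1,2)] by auto
 moreover have "parabolic \<Delta> (refl_group (w ` J))" using assms(1,2) parabolic_iff by blast
 ultimately show ?thesis using triangular_noncrossing by metis
qed

end


section \<open>Crossing chords\<close>

text \<open>On a circle of radius \<open>R\<close> the left side times \<open>R * R / 2\<close> is
  the area of an inscribed triangle cutting off the arcs \<open>A\<close> and \<open>B\<close>; the
  product form shows its sign.\<close>

lemma sin_triple: "sin A + sin B - sin (A + B) = 4 * sin (A / 2) * sin (B / 2) * sin ((A + B) / 2)" for A B :: real
proof -
 define a where "a = A / 2"
 define b where "b = B / 2"
 have 1: "sin A = 2 * sin a * cos a" "sin B = 2 * sin b * cos b"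
  using sin_double[of a] sin_double[of b] by (simp_all add: a_def b_def)
 have 2: "sin (A + B) = 2 * sin (a + b) * cos (a + b)"
  using sin_double[of "a + b"] by (simp add: a_def b_def distrib_left)
 have 3: "sin ((A + B) / 2) = sin (a + b)" by (simp add: a_def b_def add_divide_distrib)
 have ab: "sin (A / 2) = sin a" "sin (B / 2) = sin b" by (simp_all add: a_def b_def)
 have p: "sin a * sin a = 1 - cos a * cos a" "sin b * sin b = 1 - cos b * cos b"
  using sin_cos_squared_add[of a] sin_cos_squared_add[of b] by (simp_all add: power2_eq_square)
 show ?thesis unfolding 1 2 3 ab unfolding sin_add cos_add using p by algebra
qed

lemma sin_triple_pos:
 fixes A B :: real
 assumes "0 < A" "0 < B" "A + B < 2 * pi"
 shows "sin A + sin B - sin (A + B) > 0"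
 unfolding sin_triple using assms by (intro mult_pos_pos sin_gt_zero) auto

context cox_orbit
begin

section \<open>Plane geometry of crossing hulls\<close>

abbreviation "pr \<equiv> orth_proj PL"

lemma pr_in_plane: "pr x \<in> span {E1, E2}"
 unfolding orth_proj_plane by (intro span_add span_mul span_base) auto

lemma pr_E: "pr x \<bullet> E1 = x \<bullet> E1" "pr x \<bullet> E2 = x \<bullet> E2"
 by (rule proj_inner; simp add: span_base)+

definition crs :: "'a \<Rightarrow> 'a \<Rightarrow> real" where
 "crs a b = (a \<bullet> E1) * (b \<bullet> E2) - (a \<bullet> E2) * (b \<bullet> E1)"

text \<open>Cramer's rule in the plane, with \<open>crs\<close> as the determinant.\<close>

lemma crs_decompose:
 assumes "a \<in> span {E1, E2}" "b \<in> span {E1, E2}" "x \<in> span {E1, E2}" "crs a b \<noteq> 0"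
 shows "x = (crs x b / crs a b) *\<^sub>R a + (crs a x / crs a b) *\<^sub>R b"
proof (rule plane_eqI[OF assms(3)])
 show "(crs x b / crs a b) *\<^sub>R a + (crs a x / crs a b) *\<^sub>R b \<in> span {E1, E2}"
  using assms by (intro span_add span_mul)
 have "crs a b * (x \<bullet> E1) = crs x b * (a \<bullet> E1) + crs a x * (b \<bullet> E1)" unfolding crs_def by algebra
 thus "x \<bullet> E1 = ((crs x b / crs a b) *\<^sub>R a + (crs a x / crs a b) *\<^sub>R b) \<bullet> E1"
  using assms(4) by (simp add: inner_add_left field_simps)
 have "crs a b * (x \<bullet> E2) = crs x b * (a \<bullet> E2) + crs a x * (b \<bullet> E2)" unfolding crs_def by algebra
 thus "x \<bullet> E2 = ((crs x b / crs a b) *\<^sub>R a + (crs a x / crs a b) *\<^sub>R b) \<bullet> E2"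
  using assms(4) by (simp add: inner_add_left field_simps)
qed

lemma crs_zero_parallel:
 assumes "a \<in> span {E1, E2}" "b \<in> span {E1, E2}" "crs a b = 0" "a \<noteq> 0"
 shows "\<exists>r. b = r *\<^sub>R a"
proof -
 have "a \<bullet> E1 \<noteq> 0 \<or> a \<bullet> E2 \<noteq> 0" using plane_eqI[OF assms(1), of 0] assms(4) by (auto simp: span_0)
 then consider "a \<bullet> E1 \<noteq> 0" | "a \<bullet> E2 \<noteq> 0" by blast
 thus ?thesis
 proof cases
  case 1
  have "b = (b \<bullet> E1 / (a \<bullet> E1)) *\<^sub>R a"
   by (rule plane_eqI) (use assms 1 in \<open>auto simp: span_mul crs_def field_simps\<close>)
  thus ?thesis by blast
 next
  case 2
  have "b = (b \<bullet> E2 / (a \<bullet> E2)) *\<^sub>R a"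
   by (rule plane_eqI) (use assms 2 in \<open>auto simp: span_mul crs_def field_simps\<close>)
  thus ?thesis by blast
 qed
qed

lemma chord_nearby:
 assumes C: "convex C" "p \<in> C" "p + a \<in> C" and s: "0 < s" "s < 1" and d: "\<bar>d\<bar> \<le> min s (1 - s)"
 shows "(p + s *\<^sub>R a) + d *\<^sub>R a \<in> C"
proof -
 have "(1 - (s + d)) *\<^sub>R p + (s + d) *\<^sub>R (p + a) \<in> C"
  using d by (intro convexD[OF C]) auto
 moreover have "(1 - (s + d)) *\<^sub>R p + (s + d) *\<^sub>R (p + a) = (p + s *\<^sub>R a) + d *\<^sub>R a" by (simp add: algebra_simps)
 ultimately show ?thesis by simp
qed

lemma small_multiple:
 fixes r m :: real
 assumes "0 < m"
 obtains e where "0 < e" "e < 1" "\<bar>e * r\<bar> \<le> m"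
proof -
 let ?e = "min (1/2) (m / (\<bar>r\<bar> + 1))"
 have "?e * \<bar>r\<bar> \<le> m / (\<bar>r\<bar> + 1) * \<bar>r\<bar>" by (intro mult_right_mono) auto
 also have "\<dots> \<le> m" using assms by (simp add: field_simps)
 finally have "\<bar>?e * r\<bar> \<le> m" using assms by (simp add: abs_mult)
 moreover have "0 < ?e" "?e < 1" using assms by auto
 ultimately show ?thesis using that by blast
qed

text \<open>A chord through an inner point of a chord of \<open>C\<close>, transversal to it, either shows that the
 point is not on the relative frontier (when \<open>C\<close> is contained in a line), or runs into \<open>C\<close>.\<close>

lemma transversal_meets:
 assumes C: "convex C" "p \<in> C" "p + a \<in> C" and y: "y \<in> C" and s: "0 < s" "s < 1"
  and C': "convex C'" "p + s *\<^sub>R a \<in> C'" "x \<in> C'"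
  and x: "x - (p + s *\<^sub>R a) = \<alpha> *\<^sub>R a + \<beta> *\<^sub>R (y - (p + s *\<^sub>R a))" "\<beta> > 0" "x \<noteq> p + s *\<^sub>R a"
 shows "C \<inter> C' \<noteq> {p + s *\<^sub>R a}"
proof -
 let ?t = "p + s *\<^sub>R a"
 \<comment> \<open>\<open>e1\<close> keeps the component along \<open>a\<close> within the chord and
   \<open>e2\<close> keeps the weight of \<open>y\<close> at most one half. The factor 2 compensates
   for the later division by \<open>1 - e * \<beta>\<close>, which is at least one half.\<close>
 obtain e1 where e1: "0 < e1" "e1 < 1" "\<bar>e1 * (2 * \<alpha>)\<bar> \<le> min s (1 - s)" using small_multiple[of "min s (1 - s)"] s by auto
 obtain e2 where e2: "0 < e2" "e2 < 1" "\<bar>e2 * \<beta>\<bar> \<le> 1/2" using small_multiple[of "1/2"] by auto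
 define e where "e = min e1 e2"
 have e: "0 < e" "e < 1" using e1 e2 by (auto simp: e_def)
 have eb: "e * \<beta> \<le> 1/2" "0 < e * \<beta>"
 proof -
  have "e * \<beta> \<le> e2 * \<beta>" using x(2) by (intro mult_right_mono) (auto simp: e_def)
  thus "e * \<beta> \<le> 1/2" using e2(3) by linarith
  show "0 < e * \<beta>" using e(1) x(2) by simp
 qed
 have ea: "\<bar>e * \<alpha> / (1 - e * \<beta>)\<bar> \<le> min s (1 - s)"
 proof -
  have "\<bar>e * \<alpha>\<bar> = e * \<bar>\<alpha>\<bar>" using e by (simp add: abs_mult)
  also have "\<dots> \<le> e1 * \<bar>\<alpha>\<bar>" by (intro mult_right_mono) (auto simp: e_def)
  finally have "\<bar>e * \<alpha>\<bar> \<le> e1 * \<bar>\<alpha>\<bar>" .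
  have "\<bar>e * \<alpha> / (1 - e * \<beta>)\<bar> = \<bar>e * \<alpha>\<bar> / (1 - e * \<beta>)" using eb by (simp add: abs_divide)
  also have "\<dots> \<le> \<bar>e * \<alpha>\<bar> / (1/2)" using eb by (intro divide_left_mono) auto
  also have "\<dots> \<le> e1 * \<bar>2 * \<alpha>\<bar>" using \<open>\<bar>e * \<alpha>\<bar> \<le> e1 * \<bar>\<alpha>\<bar>\<close> by (simp add: abs_mult[of 2])
  also have "\<dots> \<le> min s (1 - s)" using e1 by (simp add: abs_mult)
  finally show ?thesis .
 qed
 define w where "w = ?t + e *\<^sub>R (x - ?t)"
 have "w = (1 - e) *\<^sub>R ?t + e *\<^sub>R x" by (simp add: w_def algebra_simps)
 also have "\<dots> \<in> C'" using e by (intro convexD[OF C']) auto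
 finally have w': "w \<in> C'" .
 have n: "?t + (e * \<alpha> / (1 - e * \<beta>)) *\<^sub>R a \<in> C" using chord_nearby[OF C s ea] .
 have "(1 - e * \<beta>) *\<^sub>R (?t + (e * \<alpha> / (1 - e * \<beta>)) *\<^sub>R a) + (e * \<beta>) *\<^sub>R y \<in> C"
  using eb by (intro convexD[OF C(1) n y]) auto
 also have "(1 - e * \<beta>) *\<^sub>R (?t + (e * \<alpha> / (1 - e * \<beta>)) *\<^sub>R a) + (e * \<beta>) *\<^sub>R y
  = (1 - e * \<beta>) *\<^sub>R ?t + (e * \<alpha>) *\<^sub>R a + (e * \<beta>) *\<^sub>R y"
  using eb by (simp add: scaleR_add_right)
 also have "\<dots> = ?t + e *\<^sub>R (\<alpha> *\<^sub>R a + \<beta> *\<^sub>R (y - ?t))"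
  by (simp add: scaleR_diff_left scaleR_diff_right scaleR_add_right left_diff_distrib mult.assoc)
 also have "\<dots> = w" unfolding w_def x(1) ..
 finally have "w \<in> C" .
 moreover have "w \<noteq> ?t" using e x(3) by (simp add: w_def)
 ultimately show ?thesis using w' by blast
qed

text \<open>If \<open>C\<close> lies on the line of its chord, the crossing point can be passed
  inside \<open>C\<close> from every point of \<open>C\<close> and is relatively interior. Otherwise
  \<open>C\<close> has a point \<open>y\<close> off this line, and the half of the other chord on
  the side of \<open>y\<close> runs into \<open>C\<close>, so the intersection is more than one
  point.\<close>

lemma crossing_chords:
 assumes C: "convex C" "C \<subseteq> span {E1, E2}" "p \<in> C" "p' \<in> C"
  and C': "convex C'" "C' \<subseteq> span {E1, E2}" "q \<in> C'" "q' \<in> C'"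
  and s: "0 < s" "s < 1" and t: "0 < t" "t < 1"
  and pt: "p + s *\<^sub>R (p' - p) = q + t *\<^sub>R (q' - q)" and nz: "crs (p' - p) (q' - q) \<noteq> 0"
 shows "C \<inter> C' \<noteq> {}" "\<not> (\<exists>x. C \<inter> C' = {x} \<and> x \<in> hull_boundary C)"
proof -
 define a where "a = p' - p"
 define b where "b = q' - q"
 define x0 where "x0 = p + s *\<^sub>R a"
 have p': "p' = p + a" by (simp add: a_def)
 have x0q: "x0 = q + t *\<^sub>R b" using pt by (simp add: x0_def a_def b_def)
 have "x0 = (1 - s) *\<^sub>R p + s *\<^sub>R p'" by (simp add: x0_def a_def algebra_simps)
 also have "\<dots> \<in> C" using s by (intro convexD[OF C(1,3,4)]) auto
 finally have xC: "x0 \<in> C" .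
 have "x0 = (1 - t) *\<^sub>R q + t *\<^sub>R q'" by (simp add: x0q b_def algebra_simps)
 also have "\<dots> \<in> C'" using t by (intro convexD[OF C'(1,3,4)]) auto
 finally have xC': "x0 \<in> C'" .
 show "C \<inter> C' \<noteq> {}" using xC xC' by blast
 have aS: "a \<in> span {E1, E2}" "b \<in> span {E1, E2}" "x0 \<in> span {E1, E2}"
  using C C' xC unfolding a_def b_def by (auto intro!: span_diff)
 have a0: "a \<noteq> 0" "b \<noteq> 0" using nz by (auto simp: a_def b_def crs_def)
 show "\<not> (\<exists>x. C \<inter> C' = {x} \<and> x \<in> hull_boundary C)"
 proof
  assume "\<exists>x. C \<inter> C' = {x} \<and> x \<in> hull_boundary C"
  then obtain x where x: "C \<inter> C' = {x}" "x \<in> hull_boundary C" by blast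
  moreover have "x = x0"
  proof -
   have "x0 \<in> C \<inter> C'" using xC xC' by simp
   thus ?thesis unfolding x(1) by simp
  qed
  ultimately have single: "C \<inter> C' = {x0}" and bd: "x0 \<in> hull_boundary C" by simp_all
  have "\<not> (\<exists>x. C = {x})" using C(3,4) a0 by (auto simp: a_def)
  hence nri: "x0 \<notin> rel_interior C" using bd by (auto simp: hull_boundary_def rel_frontier_def)
  have "\<exists>y\<in>C. crs a (y - x0) \<noteq> 0"
  proof (rule ccontr)
   assume line: "\<not> ?thesis"
   have "\<exists>e>1. (1 - e) *\<^sub>R y + e *\<^sub>R x0 \<in> C" if y: "y \<in> C" for y
   proof -
    have "y - x0 \<in> span {E1, E2}" using C y aS by (auto intro!: span_diff)
    then obtain r where r: "y - x0 = r *\<^sub>R a"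
     using crs_zero_parallel[OF aS(1) _ _ a0(1)] line y by blast
    obtain e where e: "0 < e" "\<bar>e * (- r)\<bar> \<le> min s (1 - s)" using small_multiple[of "min s (1 - s)" "- r"] s by auto
    have "x0 + (e * (- r)) *\<^sub>R a \<in> C"
     using chord_nearby[OF C(1,3) _ s e(2)] C(4) by (simp add: p' x0_def)
    also have "x0 + (e * (- r)) *\<^sub>R a = x0 - e *\<^sub>R (y - x0)" unfolding r by simp
    also have "\<dots> = (1 - (1 + e)) *\<^sub>R y + (1 + e) *\<^sub>R x0" by (simp add: algebra_simps)
    finally show ?thesis using e(1) by (intro exI[of _ "1 + e"]) auto
   qed
   hence "x0 \<in> rel_interior C"
    using convex_rel_interior_iff[OF C(1), of x0] xC by blast
   thus False using nri by simp
  qed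
  then obtain y where y: "y \<in> C" "crs a (y - x0) \<noteq> 0" by blast
  have yS: "y - x0 \<in> span {E1, E2}" using C y aS by (auto intro!: span_diff)
  define \<beta> where "\<beta> = crs a b / crs a (y - x0)"
  define \<alpha> where "\<alpha> = crs b (y - x0) / crs a (y - x0)"
  have dec: "b = \<alpha> *\<^sub>R a + \<beta> *\<^sub>R (y - x0)"
   unfolding \<alpha>_def \<beta>_def by (rule crs_decompose[OF aS(1) yS aS(2) y(2)])
  have \<beta>0: "\<beta> \<noteq> 0" using nz y(2) by (simp add: \<beta>_def a_def b_def)
  have meet: False if v: "v \<in> C'" "v - x0 = g *\<^sub>R b" "g * \<beta> > 0" for v g
  proof -
   have "v - x0 = (g * \<alpha>) *\<^sub>R a + (g * \<beta>) *\<^sub>R (y - x0)"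
    unfolding v(2) by (subst dec) (simp add: scaleR_add_right)
   moreover have "v \<noteq> x0" using v(2,3) a0(2) by auto
   ultimately have "C \<inter> C' \<noteq> {x0}"
    using transversal_meets[OF C(1,3) _ y(1) s C'(1), of a v "g * \<alpha>" "g * \<beta>"] C(4) xC' v
    by (simp add: p' x0_def)
   thus False using single by simp
  qed
  have vq: "q - x0 = (- t) *\<^sub>R b" by (simp add: x0q)
  have vq': "q' - x0 = (1 - t) *\<^sub>R b" by (simp add: x0q b_def algebra_simps)
  show False
  proof (cases "\<beta> > 0")
   case True
   thus False using meet[OF C'(4) vq'] t by simp
  next
   case False
   thus False using meet[OF C'(3) vq] t \<beta>0 by (simp add: mult_less_0_iff)
  qed
 qed
qed

lemma pr_z: "pr (z i) \<bullet> E1 = cmod (coord p0) * cos (Arg (coord p0) + 2 * pi * i / h)"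
  "pr (z i) \<bullet> E2 = cmod (coord p0) * sin (Arg (coord p0) + 2 * pi * i / h)"
 by (simp_all add: pr_E z_E)

text \<open>Twice the signed area of a triangle of polygon vertices.\<close>

definition area :: "int \<Rightarrow> int \<Rightarrow> int \<Rightarrow> real" where
 "area i j l = crs (pr (z j) - pr (z i)) (pr (z l) - pr (z i))"

lemma crs_z: "crs (pr (z i)) (pr (z j)) = (cmod (coord p0))\<^sup>2 * sin (2 * pi * (j - i) / h)"
proof -
 have e: "2 * pi * of_int (j - i) / h = (Arg (coord p0) + 2 * pi * j / h) - (Arg (coord p0) + 2 * pi * i / h)"
  by (simp add: algebra_simps diff_divide_distrib)
 show ?thesis unfolding e sin_diff crs_def pr_z by (simp add: power2_eq_square algebra_simps)
qed

lemma area_pos: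
 assumes "i < j" "j < l" "l < i + int h"
 shows "area i j l > 0"
proof -
 let ?A = "2 * pi * of_int (j - i) / h" and ?B = "2 * pi * of_int (l - j) / h"
 have h0: "real h > 0" using h_ge by simp
 have sum: "?A + ?B = 2 * pi * of_int (l - i) / h" by (simp add: add_divide_distrib[symmetric] algebra_simps)
 have "real_of_int (l - i) < real h" using assms by linarith
 hence "2 * pi * of_int (l - i) < 2 * pi * real h" by simp
 hence lt: "?A + ?B < 2 * pi" unfolding sum using h0 by (simp add: pos_divide_less_eq)
 have pos: "0 < ?A" "0 < ?B" using assms h0 by auto
 have bil: "crs (y - x) (w - x) = crs x y + crs y w - crs x w" for x y w
  unfolding crs_def by (simp add: inner_diff_left algebra_simps)
 have "area i j l = (cmod (coord p0))\<^sup>2 * (sin ?A + sin ?B - sin (?A + ?B))"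
  unfolding area_def bil crs_z sum by (simp add: algebra_simps)
 thus ?thesis using sin_triple_pos[OF pos lt] p0(2) by simp
qed

text \<open>The diagonals of a convex quadrilateral divide each other in the ratios of the areas of
  the triangles they cut off. Either pair of complementary triangles fills the quadrilateral, so
  both pairs have the same sum \<open>S\<close>.\<close>

lemma chords_cross:
 assumes "i < j" "j < u" "u < l" "l < i + int h"
 obtains s t where "0 < s" "s < 1" "0 < t" "t < 1"
  "pr (z i) + s *\<^sub>R (pr (z u) - pr (z i)) = pr (z j) + t *\<^sub>R (pr (z l) - pr (z j))"
  "crs (pr (z u) - pr (z i)) (pr (z l) - pr (z j)) \<noteq> 0"
proof -
 let ?p = "pr (z i)" and ?q = "pr (z j)" and ?p' = "pr (z u)" and ?q' = "pr (z l)"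
 have O: "area j u l > 0" "area i j l > 0" "area i u l > 0" "area i j u > 0"
  using assms by (auto intro!: area_pos)
 have sum: "area j u l + area i j l = area i u l + area i j u"
  unfolding area_def crs_def by (simp add: inner_diff_left algebra_simps)
 have cr: "crs (?p' - ?p) (?q' - ?q) = area i u l + area i j u"
  unfolding area_def crs_def by (simp add: inner_diff_left algebra_simps)
 define S where "S = area i u l + area i j u"
 have S: "S > 0" "S = area j u l + area i j l" using O sum by (auto simp: S_def)
 have id: "area j u l * (?p \<bullet> e) + area i j l * (?p' \<bullet> e) = area i u l * (?q \<bullet> e) + area i j u * (?q' \<bullet> e)"
  if "e = E1 \<or> e = E2" for e
 proof -
  have "area j u l * (?p \<bullet> E1) + area i j l * (?p' \<bullet> E1) = area i u l * (?q \<bullet> E1) + area i j u * (?q' \<bullet> E1)"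
   unfolding area_def crs_def inner_diff_left by algebra
  moreover have "area j u l * (?p \<bullet> E2) + area i j l * (?p' \<bullet> E2) = area i u l * (?q \<bullet> E2) + area i j u * (?q' \<bullet> E2)"
   unfolding area_def crs_def inner_diff_left by algebra
  ultimately show ?thesis using that by blast
 qed
 have "?p + (area i j l / S) *\<^sub>R (?p' - ?p) = ?q + (area i j u / S) *\<^sub>R (?q' - ?q)"
 proof (rule plane_eqI)
  have main: "(?p + (area i j l / S) *\<^sub>R (?p' - ?p)) \<bullet> e = (?q + (area i j u / S) *\<^sub>R (?q' - ?q)) \<bullet> e"
   if e: "e = E1 \<or> e = E2" for e
  proof -
   have "S * ((?p + (area i j l / S) *\<^sub>R (?p' - ?p)) \<bullet> e) = area j u l * (?p \<bullet> e) + area i j l * (?p' \<bullet> e)"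
    using S by (simp add: inner_add_left inner_diff_left distrib_left right_diff_distrib) (simp add: algebra_simps)
   moreover have "S * ((?q + (area i j u / S) *\<^sub>R (?q' - ?q)) \<bullet> e) = area i u l * (?q \<bullet> e) + area i j u * (?q' \<bullet> e)"
    using S(1) by (simp add: inner_add_left inner_diff_left distrib_left right_diff_distrib) (simp add: S_def algebra_simps)
   ultimately show ?thesis using id[OF e] S(1) by (metis mult_cancel_left less_irrefl)
  qed
  show "(?p + (area i j l / S) *\<^sub>R (?p' - ?p)) \<bullet> E1 = (?q + (area i j u / S) *\<^sub>R (?q' - ?q)) \<bullet> E1"
   "(?p + (area i j l / S) *\<^sub>R (?p' - ?p)) \<bullet> E2 = (?q + (area i j u / S) *\<^sub>R (?q' - ?q)) \<bullet> E2"
   by (rule main; simp)+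
 qed (intro span_add span_mul span_diff pr_in_plane)+
 moreover have "0 < area i j l / S" "area i j l / S < 1" "0 < area i j u / S" "area i j u / S < 1"
 proof -
  have "area i j l < S" using S(2) O by simp
  moreover have "area i j u < S" using O by (simp add: S_def)
  ultimately show "0 < area i j l / S" "area i j l / S < 1" "0 < area i j u / S" "area i j u / S < 1"
   using O S(1) by simp_all
 qed
 ultimately show ?thesis using that cr S by (auto simp: S_def)
qed

lemma hull_props:
 "convex (block_hull PL B)" "block_hull PL B \<subseteq> span {E1, E2}" "x \<in> B \<Longrightarrow> pr x \<in> block_hull PL B"
proof -
 show "convex (block_hull PL B)" by (simp add: block_hull_def)
 show "block_hull PL B \<subseteq> span {E1, E2}" unfolding block_hull_def
  by (rule hull_minimal) (use pr_in_plane in \<open>auto intro: subspace_imp_convex\<close>)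
 show "x \<in> B \<Longrightarrow> pr x \<in> block_hull PL B" unfolding block_hull_def by (intro hull_inc) auto
qed

lemma crossing_blocks:
 assumes "p \<in> B" "p' \<in> B" "q \<in> B'" "q' \<in> B'" "0 < s" "s < 1" "0 < t" "t < 1"
  and "pr p + s *\<^sub>R (pr p' - pr p) = pr q + t *\<^sub>R (pr q' - pr q)" "crs (pr p' - pr p) (pr q' - pr q) \<noteq> 0"
 shows "\<not> noncrossing_blocks PL B B'"
proof -
 note c = crossing_chords[OF hull_props(1,2) hull_props(3)[OF assms(1)] hull_props(3)[OF assms(2)]
   hull_props(1,2) hull_props(3)[OF assms(3)] hull_props(3)[OF assms(4)] assms(5-10)]
 thus ?thesis unfolding noncrossing_blocks_def by blast
qed

text \<open>The chord subtends less than half a circle, so the radius to \<open>z u\<close> meets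
  it; the ratios are quotients of sines of the arcs. That the meeting point comes before
  \<open>z u\<close> is \<open>sin_triple_pos\<close>.\<close>

lemma ray_chord_crossing:
 assumes a: "q \<in> Cn" "i < u" "u < j" "2 * (j - i) < int h"
  and B: "z i \<in> B" "z j \<in> B" "z u \<in> B'" "q \<in> B'"
 shows "\<not> noncrossing_blocks PL B B'"
proof -
 let ?A = "2 * pi * of_int (u - i) / h" and ?B = "2 * pi * of_int (j - u) / h"
 have h0: "real h > 0" using h_ge by simp
 have sum: "?A + ?B = 2 * pi * of_int (j - i) / h"
  by (simp add: add_divide_distrib[symmetric] algebra_simps)
 have "2 * real_of_int (j - i) < real h" using a(4) by linarith
 hence "pi * (2 * real_of_int (j - i)) < pi * real h" by simp
 hence lt: "?A + ?B < pi" unfolding sum using h0 by (simp add: pos_divide_less_eq mult.left_commute mult.assoc)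
 have pos: "0 < ?A" "0 < ?B" using a h0 by auto
 have sp: "sin ?A > 0" "sin ?B > 0" "sin (?A + ?B) > 0" using pos lt by (auto intro!: sin_gt_zero)
 define S where "S = sin ?A + sin ?B"
 have lt2: "?A + ?B < 2 * pi" using lt pi_gt_zero by linarith
 have S: "S > 0" "sin (?A + ?B) < S" using sp sin_triple_pos[OF pos lt2] unfolding S_def by linarith+
 define N where "N = (cmod (coord p0))\<^sup>2"
 have N: "N > 0" using p0(2) by (simp add: N_def)
 have c1: "crs (pr (z i)) (pr (z u)) = N * sin ?A" "crs (pr (z u)) (pr (z j)) = N * sin ?B"
  "crs (pr (z i)) (pr (z j)) = N * sin (?A + ?B)"
  unfolding crs_z sum N_def by simp_all
 have q0: "pr q = 0" using centre_coord[OF a(1)] proj_zero_iff by blast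
 have eq: "pr (z i) + (sin ?A / S) *\<^sub>R (pr (z j) - pr (z i))
   = pr q + (sin (?A + ?B) / S) *\<^sub>R (pr (z u) - pr q)"
 proof (rule plane_eqI)
  have id: "crs (pr (z u)) (pr (z j)) * (pr (z i) \<bullet> e) + crs (pr (z i)) (pr (z u)) * (pr (z j) \<bullet> e)
    = crs (pr (z i)) (pr (z j)) * (pr (z u) \<bullet> e)" if "e = E1 \<or> e = E2" for e
  proof -
   have "crs (pr (z u)) (pr (z j)) * (pr (z i) \<bullet> E1) + crs (pr (z i)) (pr (z u)) * (pr (z j) \<bullet> E1)
    = crs (pr (z i)) (pr (z j)) * (pr (z u) \<bullet> E1)" unfolding crs_def by algebra
   moreover have "crs (pr (z u)) (pr (z j)) * (pr (z i) \<bullet> E2) + crs (pr (z i)) (pr (z u)) * (pr (z j) \<bullet> E2)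
    = crs (pr (z i)) (pr (z j)) * (pr (z u) \<bullet> E2)" unfolding crs_def by algebra
   ultimately show ?thesis using that by blast
  qed
  have main: "(pr (z i) + (sin ?A / S) *\<^sub>R (pr (z j) - pr (z i))) \<bullet> e
    = (pr q + (sin (?A + ?B) / S) *\<^sub>R (pr (z u) - pr q)) \<bullet> e" if e: "e = E1 \<or> e = E2" for e
  proof -
   have "N * (sin ?B * (pr (z i) \<bullet> e) + sin ?A * (pr (z j) \<bullet> e)) = N * (sin (?A + ?B) * (pr (z u) \<bullet> e))"
    using id[OF e] unfolding c1 by (simp add: algebra_simps)
   hence "sin ?B * (pr (z i) \<bullet> e) + sin ?A * (pr (z j) \<bullet> e) = sin (?A + ?B) * (pr (z u) \<bullet> e)"
    using N by (simp only: mult_cancel_left) auto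
   moreover have "B * x + A * y = C * v \<Longrightarrow> (A + B) * x + A * (y - x) = C * v" for A B C x y v :: real
    by (simp add: algebra_simps)
   ultimately have "S * (pr (z i) \<bullet> e) + sin ?A * (pr (z j) \<bullet> e - pr (z i) \<bullet> e) = sin (?A + ?B) * (pr (z u) \<bullet> e)"
    unfolding S_def by blast
   hence "(S * (pr (z i) \<bullet> e) + sin ?A * (pr (z j) \<bullet> e - pr (z i) \<bullet> e)) / S = sin (?A + ?B) * (pr (z u) \<bullet> e) / S"
    by simp
   thus ?thesis using S(1) by (simp add: q0 inner_add_left inner_diff_left add_divide_distrib)
  qed
  show "(pr (z i) + (sin ?A / S) *\<^sub>R (pr (z j) - pr (z i))) \<bullet> E1
    = (pr q + (sin (?A + ?B) / S) *\<^sub>R (pr (z u) - pr q)) \<bullet> E1"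
   "(pr (z i) + (sin ?A / S) *\<^sub>R (pr (z j) - pr (z i))) \<bullet> E2
    = (pr q + (sin (?A + ?B) / S) *\<^sub>R (pr (z u) - pr q)) \<bullet> E2"
   by (rule main; simp)+
 qed (intro span_add span_mul span_diff pr_in_plane)+
 have "crs (pr (z j) - pr (z i)) (pr (z u) - pr q) = - (N * S)"
  using c1 unfolding q0 S_def by (simp add: crs_def inner_diff_left algebra_simps)
 hence nz: "crs (pr (z j) - pr (z i)) (pr (z u) - pr q) \<noteq> 0" using N S by simp
 have r: "0 < sin ?A / S" "sin ?A / S < 1" "0 < sin (?A + ?B) / S" "sin (?A + ?B) / S < 1"
  using sp S by (auto simp: S_def)
 show ?thesis using crossing_blocks[OF B(1,2,4,3) r eq nz] .
qed

text \<open>The point \<open>x\<close> off the origin rules out a one-point hull, whose boundary in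
  the sense of \<open>hull_boundary\<close> would contain \<open>0\<close>.\<close>

lemma zero_inside_crossing:
 assumes "q \<in> B'" "coord q = 0" "0 \<in> rel_interior (block_hull PL B)" "x \<in> B" "coord x \<noteq> 0"
 shows "\<not> noncrossing_blocks PL B B'"
proof
 have z': "0 \<in> block_hull PL B'" using hull_props(3)[OF assms(1)] assms(2) proj_zero_iff by metis
 have z: "0 \<in> block_hull PL B" using assms(3) rel_interior_subset by blast
 have "pr x \<in> block_hull PL B" "pr x \<noteq> 0" using hull_props(3)[OF assms(4)] assms(5) proj_zero_iff by auto
 hence "\<not> (\<exists>y. block_hull PL B = {y})" using z by auto
 hence nb: "0 \<notin> hull_boundary (block_hull PL B)" using assms(3) by (simp add: hull_boundary_def rel_frontier_def)
 assume "noncrossing_blocks PL B B'"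
 moreover have "block_hull PL B \<inter> block_hull PL B' \<noteq> {}" using z z' by blast
 ultimately obtain y where y: "block_hull PL B \<inter> block_hull PL B' = {y}" "y \<in> hull_boundary (block_hull PL B)"
  unfolding noncrossing_blocks_def by blast
 have "0 \<in> block_hull PL B \<inter> block_hull PL B'" using z z' by simp
 hence "y = 0" unfolding y(1) by simp
 thus False using y(2) nb by simp
qed

lemma pr_minus: "pr (- x) = - pr x"
 by (simp add: orth_proj_plane)

lemma symmetric_block_zero_inside:
 assumes "B \<noteq> {}" "\<And>x. x \<in> B \<Longrightarrow> - x \<in> B"
 shows "0 \<in> rel_interior (block_hull PL B)"
proof -
 let ?C = "block_hull PL B"
 have sub: "(\<lambda>x. (-1) *\<^sub>R x) ` (pr ` B) \<subseteq> pr ` B"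
  using assms(2) pr_minus by (auto simp: image_iff) (metis)
 have neg: "- y \<in> ?C" if "y \<in> ?C" for y
 proof -
  have "(-1) *\<^sub>R y \<in> (\<lambda>x. (-1) *\<^sub>R x) ` (convex hull (pr ` B))" using that unfolding block_hull_def by blast
  also have "\<dots> = convex hull ((\<lambda>x. (-1) *\<^sub>R x) ` (pr ` B))" by (simp only: convex_hull_scaling)
  also have "\<dots> \<subseteq> convex hull (pr ` B)" using sub by (rule hull_mono)
  finally show ?thesis by (simp add: block_hull_def)
 qed
 obtain b where "b \<in> B" using assms(1) by auto
 hence b: "pr b \<in> ?C" by (rule hull_props(3))
 have "\<exists>e>1. (1 - e) *\<^sub>R y + e *\<^sub>R 0 \<in> ?C" if "y \<in> ?C" for y
  using neg[OF that] by (intro exI[of _ 2]) simp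
 thus ?thesis using convex_rel_interior_iff[OF hull_props(1), of B 0] b by blast
qed

definition blk :: "'a set \<Rightarrow> 'a \<Rightarrow> 'a set" where
 "blk K p = {q \<in> X. p - q \<in> span K}"

lemma blk_in_blocks:
 assumes "J \<subseteq> \<Delta>" "w \<in> W" "p \<in> X"
 shows "blk (w ` J) p \<in> blocks (refl_group (w ` J)) X"
proof -
 have 1: "orbit_of (refl_group (w ` J)) p \<in> blocks (refl_group (w ` J)) X" using assms(3) by (simp add: blocks_def)
 have 2: "p \<in> orbit_of (refl_group (w ` J)) p"
  unfolding orbit_of_def using id_in_refl_group[of "w ` J"] by (metis id_apply image_eqI)
 show ?thesis using block_eq(2)[OF assms(1,2) 1 2] 1 by (simp add: blk_def)
qed

lemma blk_distinct:
 assumes "J \<subseteq> \<Delta>" "w \<in> W" "p \<in> X" "q \<in> X" "p - q \<notin> span (w ` J)"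
  and "\<forall>B\<in>blocks (refl_group (w ` J)) X. \<forall>B'\<in>blocks (refl_group (w ` J)) X. B \<noteq> B' \<longrightarrow>
   noncrossing_blocks PL B B'"
 shows "noncrossing_blocks PL (blk (w ` J) p) (blk (w ` J) q)"
proof -
 have "q \<in> blk (w ` J) q" "q \<notin> blk (w ` J) p" using assms(4,5) by (auto simp: blk_def span_0)
 hence "blk (w ` J) p \<noteq> blk (w ` J) q" by auto
 thus ?thesis using assms blk_in_blocks by blast
qed

end

context orthogonal_orbit
begin

text \<open>Failure of a clause of \<open>ncrel\<close> would exhibit two distinct crossing blocks:
  crossing chords, a radius cut by a chord, or a symmetric block around a point over the
  origin.\<close>

theorem noncrossing_blocks_imp_noncrossing:
 assumes J: "J \<subseteq> \<Delta>" "w \<in> W"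
  and nc: "\<forall>B\<in>blocks (refl_group (w ` J)) X. \<forall>B'\<in>blocks (refl_group (w ` J)) X. B \<noteq> B' \<longrightarrow>
   noncrossing_blocks PL B B'"
 shows "noncrossing_parabolic \<Delta> c (refl_group (w ` J))"
proof (rule ncrel_noncrossing[OF J])
 let ?K = "w ` J"
 let ?r = "same_rel ?K"
 have rI: "(p, q) \<in> ?r \<longleftrightarrow> p \<in> X \<and> q \<in> X \<and> p - q \<in> span ?K" for p q by (simp add: same_rel_def)
 have blkI: "q \<in> blk ?K p" if "(p, q) \<in> ?r" for p q using that by (simp add: blk_def rI)
 have self: "p \<in> blk ?K p" if "p \<in> X" for p using that by (simp add: blk_def span_0)
 note D = blk_distinct[OF J _ _ _ nc]
 show "ncrel ?r"
  unfolding ncrel_def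
 proof (intro conjI allI impI)
  show "equiv X ?r"
  proof (rule equivI)
   show "?r \<subseteq> X \<times> X" by (auto simp: rI)
   show "refl_on X ?r" by (auto simp: refl_on_def rI span_0)
   show "sym ?r" using span_neg by (fastforce simp: sym_def rI)
   show "trans ?r"
   proof (rule transI)
    fix p q s assume "(p, q) \<in> ?r" "(q, s) \<in> ?r"
    thus "(p, s) \<in> ?r" using span_add[of "p - q" ?K "q - s"] by (auto simp: rI)
   qed
  qed
 next
  fix p q assume a: "(p, q) \<in> ?r" "- p \<in> X" "- q \<in> X"
  hence "- (p - q) \<in> span ?K" by (simp only: rI) (rule span_neg, simp)
  thus "(- p, - q) \<in> ?r" using a by (simp add: rI)
 next
  fix i j u l assume a: "i < j" "j < u" "u < l" "l < i + int h" "(z i, z u) \<in> ?r" "(z j, z l) \<in> ?r"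
  show "(z i, z j) \<in> ?r"
  proof (rule ccontr)
   assume "(z i, z j) \<notin> ?r"
   hence nb: "noncrossing_blocks PL (blk ?K (z i)) (blk ?K (z j))"
    by (intro D) (auto simp: rI z_in_X)
   obtain s t where st: "0 < s" "s < 1" "0 < t" "t < 1"
    "pr (z i) + s *\<^sub>R (pr (z u) - pr (z i)) = pr (z j) + t *\<^sub>R (pr (z l) - pr (z j))"
    "crs (pr (z u) - pr (z i)) (pr (z l) - pr (z j)) \<noteq> 0"
    using chords_cross[OF a(1-4)] by blast
   show False
    using crossing_blocks[OF self[OF z_in_X] blkI[OF a(5)] self[OF z_in_X] blkI[OF a(6)] st] nb by simp
  qed
 next
  fix i j u q assume a: "q \<in> Cn" "i < u" "u < j" "2 * (j - i) < int h" "(z i, z j) \<in> ?r" "(z u, q) \<in> ?r"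
  show "(z i, z u) \<in> ?r"
  proof (rule ccontr)
   assume "(z i, z u) \<notin> ?r"
   hence nb: "noncrossing_blocks PL (blk ?K (z i)) (blk ?K (z u))"
    by (intro D) (auto simp: rI z_in_X)
   show False
    using ray_chord_crossing[OF a(1-4) self[OF z_in_X] blkI[OF a(5)] self[OF z_in_X] blkI[OF a(6)]] nb by simp
  qed
 next
  fix i q assume a: ii "q \<in> Cn" "(z i, - z i) \<in> ?r"
  show "(z i, q) \<in> ?r"
  proof (rule ccontr)
   assume "(z i, q) \<notin> ?r"
   hence nb: "noncrossing_blocks PL (blk ?K (z i)) (blk ?K q)"
    using a(2) by (intro D) (auto simp: rI z_in_X)
   have "- x \<in> blk ?K (z i)" if "x \<in> blk ?K (z i)" for x
   proof -
    have "x \<in> X" "z i - x \<in> span ?K" using that by (auto simp: blk_def)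
    moreover have "z i - - z i \<in> span ?K" using a(3) by (simp add: rI)
    ultimately have "(z i - - z i) - (z i - x) \<in> span ?K" by (metis span_diff)
    moreover have "(z i - - z i) - (z i - x) = z i - - x" by simp
    ultimately show ?thesis using X_neg[OF a(1) \<open>x \<in> X\<close>] by (simp only: blk_def) simp
   qed
   moreover have "z i \<in> blk ?K (z i)" by (rule self[OF z_in_X])
   ultimately have "0 \<in> rel_interior (block_hull PL (blk ?K (z i)))"
    by (intro symmetric_block_zero_inside) auto
   moreover have "q \<in> blk ?K q" using a(2) self by auto
   ultimately show False
    using zero_inside_crossing[OF _ centre_coord[OF a(2)] _ self[OF z_in_X] coord_z_nonzero] nb by blast
  qed
 qed
qed

theorem noncrossing_iff_noncrossing_blocks:
 assumes "parabolic \<Delta> H"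
 shows "noncrossing_parabolic \<Delta> c H \<longleftrightarrow>
  (\<forall>B\<in>blocks H X. \<forall>B'\<in>blocks H X. B \<noteq> B' \<longrightarrow> noncrossing_blocks PL B B')"
proof
 assume "noncrossing_parabolic \<Delta> c H"
 thus "\<forall>B\<in>blocks H X. \<forall>B'\<in>blocks H X. B \<noteq> B' \<longrightarrow> noncrossing_blocks PL B B'"
  by (intro ballI impI noncrossing_imp_noncrossing_blocks z_mono z_centre_neg centre_small)
next
 assume "\<forall>B\<in>blocks H X. \<forall>B'\<in>blocks H X. B \<noteq> B' \<longrightarrow> noncrossing_blocks PL B B'"
 moreover obtain J w where "J \<subseteq> \<Delta>" "w \<in> W" "H = refl_group (w ` J)"
  using assms unfolding parabolic_iff by blast
 ultimately show "noncrossing_parabolic \<Delta> c H" using noncrossing_blocks_imp_noncrossing by blast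
qed

end


section \<open>Types A, B and D\<close>

text \<open>The \<open>\<omega>\<close> pair with the \<open>\<alpha>\<close> like multiples of a
  dual basis. Besides giving independence, they detect which simple roots must belong to
  \<open>J\<close> when a vector lies in its span.\<close>

lemma dual_system:
 fixes \<alpha> \<omega> :: "'i \<Rightarrow> 'a::euclidean_space"
 assumes "\<And>l j. l \<in> I \<Longrightarrow> j \<in> I \<Longrightarrow> \<omega> l \<bullet> \<alpha> j = 0 \<longleftrightarrow> j \<noteq> l"
 shows "J \<subseteq> \<alpha> ` I \<Longrightarrow> x \<in> span J \<Longrightarrow> l \<in> I \<Longrightarrow> \<omega> l \<bullet> x \<noteq> 0 \<Longrightarrow> \<alpha> l \<in> J"
  and "inj_on \<alpha> I" and "independent (\<alpha> ` I)"
proof -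
 show 1: "\<alpha> l \<in> J" if J: "J \<subseteq> \<alpha> ` I" "x \<in> span J" "l \<in> I" "\<omega> l \<bullet> x \<noteq> 0" for J x l
 proof (rule ccontr)
  assume "\<alpha> l \<notin> J"
  hence "orthogonal (\<omega> l) a" if "a \<in> J" for a using that J assms by (auto simp: orthogonal_def)
  hence "orthogonal (\<omega> l) x" using J(2) orthogonal_to_span by blast
  thus False using J(4) by (simp add: orthogonal_def)
 qed
 show "inj_on \<alpha> I" by (rule inj_onI) (metis assms)
 show "independent (\<alpha> ` I)"
  unfolding dependent_def
 proof clarify
  fix l assume "l \<in> I" "\<alpha> l \<in> span (\<alpha> ` I - {\<alpha> l})"
  thus False using 1[of "\<alpha> ` I - {\<alpha> l}" "\<alpha> l" l] assms by auto
 qed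
qed

text \<open>The explicit positive eigenvector \<open>\<kappa>'\<close> serves only to identify the
  eigenvalue belonging to the given \<open>k\<close>.\<close>

lemma cox_plane_from_dual_system:
 fixes \<alpha> \<omega> :: "'i \<Rightarrow> 'a::euclidean_space" and \<kappa>' :: "'i \<Rightarrow> real"
 assumes I: "finite I" "I \<noteq> {}" and \<Delta>: "\<Delta> = \<alpha> ` I" and unit: "\<And>i. i \<in> I \<Longrightarrow> norm (\<alpha> i) = 1"
  and dual: "\<And>l j. l \<in> I \<Longrightarrow> j \<in> I \<Longrightarrow> \<omega> l \<bullet> \<alpha> j = 0 \<longleftrightarrow> j \<noteq> l"
  and pos: "\<And>i. i \<in> I \<Longrightarrow> 0 < \<kappa>' i"
  and eigen: "\<And>i. i \<in> I \<Longrightarrow> (\<Sum>j\<in>I. (\<alpha> i \<bullet> \<alpha> j) * \<kappa>' j) = (1 - cos (pi / h)) * \<kappa>' i"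
  and bip: "coxeter_bipartition \<Delta> \<Delta>\<^sub>p \<Delta>\<^sub>m" and k: "positive_min_eigenvector \<Delta> k" and h: "3 \<le> h"
 shows "cox_plane \<Delta> \<Delta>\<^sub>p \<Delta>\<^sub>m k h"
proof -
 note ds = dual_system[of I \<omega> \<alpha>, OF dual]
 obtain l where l: "\<forall>\<alpha>\<in>\<Delta>. 0 < k \<alpha>" "\<forall>\<alpha>\<in>\<Delta>. (\<Sum>\<beta>\<in>\<Delta>. (\<alpha> \<bullet> \<beta>) * k \<beta>) = l * k \<alpha>"
  using k unfolding positive_min_eigenvector_def gram_eigenvector_def by blast
 define k0 where "k0 = \<kappa>' \<circ> the_inv_into I \<alpha>"
 have k0: "k0 (\<alpha> i) = \<kappa>' i" if "i \<in> I" for i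
  using that ds(2) by (simp add: k0_def the_inv_into_f_f)
 have "l = 1 - cos (pi / h)"
 proof (rule positive_eigenvalue_unique[of \<Delta> k k0])
  show "finite \<Delta>" "\<Delta> \<noteq> {}" using I \<Delta> by auto
  show "\<And>\<alpha>. \<alpha> \<in> \<Delta> \<Longrightarrow> 0 < k \<alpha>" using l by auto
  show "\<And>\<alpha>. \<alpha> \<in> \<Delta> \<Longrightarrow> 0 < k0 \<alpha>" using k0 pos \<Delta> by auto
  show "\<And>\<alpha>. \<alpha> \<in> \<Delta> \<Longrightarrow> (\<Sum>\<beta>\<in>\<Delta>. (\<alpha> \<bullet> \<beta>) * k \<beta>) = l * k \<alpha>" using l by auto
  fix a assume "a \<in> \<Delta>"
  then obtain i where i: "i \<in> I" "a = \<alpha> i" using \<Delta> by auto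
  have "(\<Sum>\<beta>\<in>\<Delta>. (a \<bullet> \<beta>) * k0 \<beta>) = (\<Sum>j\<in>I. (\<alpha> i \<bullet> \<alpha> j) * \<kappa>' j)"
   unfolding \<Delta> i(2) by (subst sum.reindex[OF ds(2)]) (auto simp: k0 intro!: sum.cong)
  thus "(\<Sum>\<beta>\<in>\<Delta>. (a \<bullet> \<beta>) * k0 \<beta>) = (1 - cos (pi / h)) * k0 a" using eigen i k0 by simp
 qed
 thus ?thesis
  by unfold_locales (use \<Delta> ds(3) unit bip l h I in auto)
qed

lemma sum_tridiagonal:
 fixes f :: "nat \<Rightarrow> real"
 assumes "i \<in> {1..n}"
 shows "(\<Sum>j\<in>{1..n}. (if j = i then a else if j = i + 1 \<or> i = j + 1 then b else 0) * f j) =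
  a * f i + b * (if 1 < i then f (i - 1) else 0) + b * (if i < n then f (i + 1) else 0)"
proof -
 have "(\<Sum>j\<in>{1..n}. (if j = i then a else if j = i + 1 \<or> i = j + 1 then b else 0) * f j) =
  (\<Sum>j\<in>{1..n}. (if j = i then a * f j else 0) + (if j = i - 1 then (if 1 < i then b * f j else 0) else 0)
   + (if j = i + 1 then b * f j else 0))"
  using assms by (intro sum.cong) auto
 also have "\<dots> = a * f i + b * (if 1 < i then f (i - 1) else 0) + b * (if i < n then f (i + 1) else 0)"
  using assms by (auto simp: sum.distrib)
 finally show ?thesis .
qed

text \<open>Values of a sine along a path satisfy the recurrence of the tridiagonal Gram matrix; the
  conditions at the end of the diagram determine the angle \<open>t\<close>.\<close>

lemma sin_neighbours: "sin ((x - 1) * t) + sin ((x + 1) * t) = 2 * cos t * sin (x * t)" for x t :: real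
 by (simp add: left_diff_distrib distrib_right sin_add sin_diff)

section \<open>Orthonormal coordinates and transpositions\<close>

locale orthonormal_vectors =
 fixes N :: nat and e :: "nat \<Rightarrow> 'a::euclidean_space"
 assumes e: "orthonormal_family N e"
begin

lemma ee: "i \<in> {1..N} \<Longrightarrow> j \<in> {1..N} \<Longrightarrow> e i \<bullet> e j = (if i = j then 1 else 0)"
 using e by (simp add: orthonormal_family_def)

lemma norm_e: "i \<in> {1..N} \<Longrightarrow> norm (e i) = 1"
 using ee[of i i] by (simp add: norm_eq_sqrt_inner)

lemma e_inj: "i \<in> {1..N} \<Longrightarrow> j \<in> {1..N} \<Longrightarrow> e i = e j \<longleftrightarrow> i = j"
proof (rule iffI, rule ccontr)
 assume "i \<in> {1..N}" "j \<in> {1..N}" "e i = e j" "i \<noteq> j"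
 thus False using ee[of i j] ee[of j j] by simp
qed simp

definition psum :: "nat \<Rightarrow> 'a" where "psum l = (\<Sum>m\<in>{1..l}. e m)"

lemma psum_e: "i \<in> {1..N} \<Longrightarrow> l \<le> N \<Longrightarrow> psum l \<bullet> e i = (if i \<le> l then 1 else 0)"
proof -
 assume "i \<in> {1..N}" "l \<le> N"
 hence "psum l \<bullet> e i = (\<Sum>m\<in>{1..l}. if m = i then 1 else 0)"
  unfolding psum_def inner_sum_left by (intro sum.cong) (auto simp: ee)
 thus ?thesis using \<open>i \<in> {1..N}\<close> by simp
qed

lemma norm_diff_e: "i \<in> {1..N} \<Longrightarrow> j \<in> {1..N} \<Longrightarrow> i \<noteq> j \<Longrightarrow> norm (e i - e j) = sqrt 2"
 by (simp add: norm_eq_sqrt_inner inner_diff_left inner_diff_right ee)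

lemma norm_add_e: "i \<in> {1..N} \<Longrightarrow> j \<in> {1..N} \<Longrightarrow> i \<noteq> j \<Longrightarrow> norm (e i + e j) = sqrt 2"
 by (simp add: norm_eq_sqrt_inner inner_add_left inner_add_right ee)

definition simple :: "nat \<Rightarrow> 'a" where "simple i = sgn (e i - e (i + 1))"

lemma norm_diff_Suc_e: "i \<in> {1..N - 1} \<Longrightarrow> norm (e i - e (i + 1)) = sqrt 2"
 by (rule norm_diff_e) auto

lemma simple_eq: "i \<in> {1..N - 1} \<Longrightarrow> simple i = (1 / sqrt 2) *\<^sub>R (e i - e (i + 1))"
 unfolding simple_def sgn_div_norm by (subst norm_diff_Suc_e) (auto simp: inverse_eq_divide)

lemma norm_simple_e: "i \<in> {1..N - 1} \<Longrightarrow> norm (simple i) = 1"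
 using norm_diff_Suc_e[of i] unfolding simple_def norm_sgn by auto

lemma reflection_simple: "i \<in> {1..N - 1} \<Longrightarrow> reflection (simple i) = reflection (e i - e (i + 1))"
 by (simp add: simple_eq reflection_scaled)

lemma simple_inner:
 assumes "i \<in> {1..N - 1}" "j \<in> {1..N - 1}"
 shows "simple i \<bullet> simple j = (if j = i then 1 else if j = i + 1 \<or> i = j + 1 then - 1 / 2 else 0)"
proof -
 have "simple i \<bullet> simple j = (1 / 2) * ((e i - e (i + 1)) \<bullet> (e j - e (j + 1)))"
  using assms by (simp add: simple_eq)
 also have "(e i - e (i + 1)) \<bullet> (e j - e (j + 1)) = (if j = i then 2 else if j = i + 1 \<or> i = j + 1 then - 1 else 0)"
  using assms by (auto simp: inner_diff_left inner_diff_right ee)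
 finally show ?thesis by auto
qed

text \<open>Conjugation by the next adjacent transposition lengthens a transposition by one
  place.\<close>

lemma diff_chain:
 assumes "i < j" "j \<le> N" "1 \<le> i" "\<And>l. i \<le> l \<Longrightarrow> l < j \<Longrightarrow> reflection (e l - e (l + 1)) \<in> refl_group J"
 shows "reflection (e i - e j) \<in> refl_group J"
 using assms
proof (induction j)
 case (Suc j)
 have s: "reflection (e j - e (j + 1)) \<in> refl_group J" using Suc.prems(4)[of j] Suc.prems(1) by simp
 show ?case
 proof (cases "i = j")
  case False
  hence "reflection (e i - e j) \<in> refl_group J" using Suc by auto
  from reflection_conj_in_refl_group[OF s this]
  have "reflection (reflection (e j - e (j + 1)) (e i) - reflection (e j - e (j + 1)) (e j)) \<in> refl_group J"
   by (simp add: reflection_diff)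
  moreover have "reflection (e j - e (j + 1)) (e j) = e (j + 1)"
   using Suc.prems by (intro reflection_swap) (simp add: ee)
  moreover have "reflection (e j - e (j + 1)) (e i) = e i"
   unfolding reflection_fix_iff using False Suc.prems by (simp add: inner_diff_left ee)
  ultimately show ?thesis by simp
 qed (use s in simp)
qed simp

lemma swap_conj:
 assumes "reflection (e i - e j) \<in> refl_group J" "reflection (e j + e l) \<in> refl_group J"
  "i \<in> {1..N}" "j \<in> {1..N}" "l \<in> {1..N}" "i \<noteq> l" "j \<noteq> l"
 shows "reflection (e i + e l) \<in> refl_group J"
proof -
 have "reflection (reflection (e i - e j) (e j + e l)) \<in> refl_group J"
  using reflection_conj_in_refl_group[OF assms(1,2)] .
 moreover have "reflection (e i - e j) (e j) = e i"
  using reflection_swap[of "e j" "e i"] assms by (simp add: ee reflection_commute_diff[of "e i"])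
 moreover have "reflection (e i - e j) (e l) = e l"
  unfolding reflection_fix_iff using assms by (simp add: inner_diff_left ee)
 ultimately show ?thesis by (simp add: reflection_add)
qed

end

subsection \<open>Type A\<close>

locale type_A_vectors = orthonormal_vectors "n + 1" e for n :: nat and e :: "nat \<Rightarrow> 'a::euclidean_space" +
 fixes \<Delta> X :: "'a set"
 assumes n: "2 \<le> n" and \<Delta>: "\<Delta> = {sgn (e i - e (i + 1)) | i. i \<in> {1..n}}"
  and X: "X = {orth_proj (span \<Delta>) (e i) | i. i \<in> {1..n + 1}}"
begin

lemma \<Delta>_eq: "\<Delta> = simple ` {1..n}"
 unfolding \<Delta> simple_def by auto

lemma dual_A: "l \<in> {1..n} \<Longrightarrow> j \<in> {1..n} \<Longrightarrow> psum l \<bullet> simple j = 0 \<longleftrightarrow> j \<noteq> l"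
 by (auto simp: simple_eq inner_diff_right psum_e)

lemma diff_in_span: "i \<in> {1..n + 1} \<Longrightarrow> j \<in> {1..n + 1} \<Longrightarrow> e i - e j \<in> span \<Delta>"
proof -
 have s: "e l - e (l + 1) \<in> span \<Delta>" if "l \<in> {1..n}" for l
 proof -
  have "sqrt 2 *\<^sub>R simple l \<in> span \<Delta>" by (rule span_mul, rule span_base) (use that in \<open>auto simp: \<Delta>_eq\<close>)
  thus ?thesis using that by (simp add: simple_eq)
 qed
 have 1: "e 1 - e j \<in> span \<Delta>" if "1 \<le> j" "j \<le> n + 1" for j
  using that
 proof (induction j rule: nat_induct_at_least)
  case (Suc j)
  hence "(e 1 - e j) + (e j - e (j + 1)) \<in> span \<Delta>" using span_add[OF Suc.IH s[of j]] by auto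
  thus ?case by simp
 qed (simp add: span_0)
 assume "i \<in> {1..n + 1}" "j \<in> {1..n + 1}"
 hence "(e 1 - e j) - (e 1 - e i) \<in> span \<Delta>" using span_diff[OF 1[of j] 1[of i]] by auto
 thus ?thesis by simp
qed

definition f :: "nat \<Rightarrow> 'a" where "f i = e i - (1 / real (n + 1)) *\<^sub>R psum (n + 1)"

lemma sum_orth: "x \<in> span \<Delta> \<Longrightarrow> psum (n + 1) \<bullet> x = 0"
proof -
 assume "x \<in> span \<Delta>"
 hence "orthogonal (psum (n + 1)) x"
 proof (rule orthogonal_to_span)
  fix y assume "y \<in> \<Delta>"
  then obtain i where "i \<in> {1..n}" "y = simple i" by (auto simp: \<Delta>_eq)
  thus "orthogonal (psum (n + 1)) y"
   using psum_e[of i "n + 1"] psum_e[of "i + 1" "n + 1"]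
   by (simp add: orthogonal_def simple_eq inner_diff_right)
 qed
 thus ?thesis by (simp add: orthogonal_def)
qed

lemma f_in_span: "i \<in> {1..n + 1} \<Longrightarrow> f i \<in> span \<Delta>"
proof -
 assume i: "i \<in> {1..n + 1}"
 have "(\<Sum>m\<in>{1..n + 1}. e i - e m) \<in> span \<Delta>" using diff_in_span[OF i] by (intro span_sum) auto
 hence "(1 / real (n + 1)) *\<^sub>R (\<Sum>m\<in>{1..n + 1}. e i - e m) \<in> span \<Delta>" by (rule span_mul)
 moreover have "(1 / real (n + 1)) *\<^sub>R (\<Sum>m\<in>{1..n + 1}. e i - e m) = f i"
  by (simp add: f_def psum_def sum_subtractf scaleR_diff_right sum_constant_scaleR del: sum.cl_ivl_Suc)
 ultimately show ?thesis by simp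
qed

lemma proj_e: "i \<in> {1..n + 1} \<Longrightarrow> orth_proj (span \<Delta>) (e i) = f i"
proof (rule orth_proj_eqI)
 show "(e i - f i) \<bullet> x = 0" if "x \<in> span \<Delta>" for x using sum_orth[OF that] by (simp add: f_def)
qed (simp_all add: f_in_span)

lemma X_eq: "X = f ` {1..n + 1}"
 unfolding X Setcompr_eq_image by (intro image_cong refl proj_e)

lemma ff: "i \<in> {1..n + 1} \<Longrightarrow> j \<in> {1..n + 1} \<Longrightarrow> f i \<bullet> f j = (if i = j then 1 else 0) - 1 / real (n + 1)"
proof -
 assume ij: "i \<in> {1..n + 1}" "j \<in> {1..n + 1}"
 have "f i \<bullet> f j = f i \<bullet> e j"
  unfolding f_def[of j] inner_diff_right using sum_orth[OF f_in_span[OF ij(1)]] by (simp add: inner_commute del: sum.cl_ivl_Suc)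
 also have "\<dots> = (if i = j then 1 else 0) - 1 / real (n + 1)"
  unfolding f_def inner_diff_left using ij psum_e[of j "n + 1"] by (simp add: ee del: sum.cl_ivl_Suc)
 finally show ?thesis .
qed

lemma f_diff: "f i - f j = e i - e j"
 by (simp add: f_def)

text \<open>\<open>psum l\<close> has nonzero product with \<open>e i - e j\<close> for every
  \<open>l\<close> from \<open>i\<close> to \<open>j - 1\<close>, so all simple roots between the
  two places belong to \<open>J\<close>.\<close>

lemma par_A:
 assumes J: "J \<subseteq> \<Delta>" and ij: "i \<in> {1..n + 1}" "j \<in> {1..n + 1}" "i < j" and d: "e i - e j \<in> span J"
 shows "reflection (e i - e j) \<in> refl_group J"
proof (rule diff_chain[OF ij(3)])
 fix l assume l: "i \<le> l" "l < j"
 hence lI: "l \<in> {1..n}" using ij by auto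
 have "psum l \<bullet> (e i - e j) = 1" using l ij lI by (simp add: inner_diff_right psum_e)
 hence "simple l \<in> J"
  using dual_system(1)[of "{1..n}" "psum" simple, OF dual_A] J d lI by (simp add: \<Delta>_eq)
 thus "reflection (e l - e (l + 1)) \<in> refl_group J"
  using reflection_in_refl_group[of "simple l" J] reflection_simple[of l] lI by simp
qed (use ij in auto)

lemma plane_A:
 assumes "coxeter_bipartition \<Delta> \<Delta>\<^sub>p \<Delta>\<^sub>m" "positive_min_eigenvector \<Delta> k"
 shows "cox_plane \<Delta> \<Delta>\<^sub>p \<Delta>\<^sub>m k (n + 1)"
proof (rule cox_plane_from_dual_system[OF _ _ \<Delta>_eq _ dual_A _ _ assms])
 \<comment> \<open>\<open>sin (j * t)\<close> vanishes at the positions \<open>0\<close> and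
   \<open>n + 1\<close> just outside the diagram, so the end rows obey the same recurrence as the
   inner ones.\<close>
 define t where "t = pi / real (n + 1)"
 show "0 < sin (real i * t)" if "i \<in> {1..n}" for i
 proof (rule sin_gt_zero)
  show "0 < real i * t" using that by (auto simp: t_def)
  have "real i * pi < real (n + 1) * pi" using that by auto
  thus "real i * t < pi" by (simp add: t_def pos_divide_less_eq mult.commute)
 qed
 fix i assume i: "i \<in> {1..n}"
 have end0: "sin (real (n + 1) * t) = 0" by (simp add: t_def)
 have "(\<Sum>j\<in>{1..n}. (simple i \<bullet> simple j) * sin (real j * t)) =
  (\<Sum>j\<in>{1..n}. (if j = i then 1 else if j = i + 1 \<or> i = j + 1 then - 1 / 2 else 0) * sin (real j * t))"
  using i by (intro sum.cong) (auto simp: simple_inner)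
 also have "\<dots> = sin (real i * t) - 1 / 2 * (if 1 < i then sin (real (i - 1) * t) else 0)
   - 1 / 2 * (if i < n then sin (real (i + 1) * t) else 0)"
  by (subst sum_tridiagonal[OF i]) simp
 also have "(if 1 < i then sin (real (i - 1) * t) else 0) = sin ((real i - 1) * t)"
  using i by (cases "i = 1") (auto simp: of_nat_diff)
 also have "(if i < n then sin (real (i + 1) * t) else 0) = sin ((real i + 1) * t)"
  using i end0 by (cases "i = n") (auto simp: add.commute)
 finally have E: "(\<Sum>j\<in>{1..n}. (simple i \<bullet> simple j) * sin (real j * t)) =
   sin (real i * t) - 1 / 2 * sin ((real i - 1) * t) - 1 / 2 * sin ((real i + 1) * t)" .
 have "(1 - cos t) * sin (real i * t) = sin (real i * t) - cos t * sin (real i * t)" by algebra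
 thus "(\<Sum>j\<in>{1..n}. (simple i \<bullet> simple j) * sin (real j * t)) =
   (1 - cos (pi / real (n + 1))) * sin (real i * t)"
  unfolding E t_def[symmetric] using sin_neighbours[of "real i" t] by linarith
qed (use n norm_simple_e in auto)

lemma orbit_A:
 assumes "coxeter_bipartition \<Delta> \<Delta>\<^sub>p \<Delta>\<^sub>m" "positive_min_eigenvector \<Delta> k"
 shows "orthogonal_orbit \<Delta> \<Delta>\<^sub>p \<Delta>\<^sub>m k (n + 1) X False"
proof -
 interpret cox_plane \<Delta> \<Delta>\<^sub>p \<Delta>\<^sub>m k "n + 1" by (rule plane_A[OF assms])
 have N: "real (n + 1) \<ge> 3" using n by simp
 have inj: "f i = f j \<longleftrightarrow> i = j" if "i \<in> {1..n + 1}" "j \<in> {1..n + 1}" for i j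
  using f_diff[of i j] e_inj[OF that] by (metis right_minus_eq)
 \<comment> \<open>For opposite points \<open>1 / (n + 1)\<close> would have to be \<open>1\<close>
   or \<open>1 / 2\<close>, which \<open>n \<ge> 2\<close> excludes.\<close>
 have neg: "f i \<noteq> - f j" if "i \<in> {1..n + 1}" "j \<in> {1..n + 1}" for i j
 proof
  assume "f i = - f j"
  hence "f i \<bullet> f i = - (f i \<bullet> f j)" by (metis inner_minus_right minus_minus)
  moreover have r: "1 / real (n + 1) \<le> 1 / 3" using N by (intro divide_left_mono) auto
  moreover have "(if i = i then 1 else 0) - r = - ((if i = j then 1 else 0) - r) \<Longrightarrow> r \<le> 1 / 3 \<Longrightarrow> False"
   for r :: real by (auto split: if_splits)
  ultimately show False unfolding ff[OF that] ff[OF that(1) that(1)] by blast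
 qed
 have fdo: "f i \<bullet> (f j - f l) = 0" if "i \<in> {1..n + 1}" "j \<in> {1..n + 1}" "l \<in> {1..n + 1}" "i \<noteq> j" "i \<noteq> l" for i j l
  using that by (simp add: inner_diff_right ff)
 show ?thesis
 proof unfold_locales
  show "X \<subseteq> span \<Delta>" using f_in_span by (auto simp: X_eq)
  show "\<Delta> \<subseteq> span X"
  proof
   fix a assume "a \<in> \<Delta>"
   then obtain i where i: "i \<in> {1..n}" "a = simple i" by (auto simp: \<Delta>_eq)
   have "f i - f (i + 1) \<in> span X" using i by (intro span_diff span_base) (auto simp: X_eq)
   thus "a \<in> span X" using i by (simp add: simple_eq f_diff span_mul)
  qed
  show "reflection a p \<in> X" if ap: "a \<in> \<Delta>" "p \<in> X" for a p
  proof -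
   obtain l where l: "l \<in> {1..n}" "a = simple l" using ap(1) unfolding \<Delta>_eq by blast
   obtain i where i: "i \<in> {1..n + 1}" "p = f i" using ap(2) unfolding X_eq by blast
   have lI: "l \<in> {1..n + 1}" "l + 1 \<in> {1..n + 1}" using l by auto
   have r: "reflection a = reflection (f l - f (l + 1))" using l reflection_simple[of l] by (simp add: f_diff)
   have nn: "f l \<bullet> f l = f (l + 1) \<bullet> f (l + 1)" using lI by (simp add: ff)
   consider "i = l" | "i = l + 1" | "i \<noteq> l" "i \<noteq> l + 1" by blast
   thus ?thesis
   proof cases
    case 1
    hence "reflection a p = f (l + 1)" unfolding r i(2) using reflection_swap[OF nn] by simp
    thus ?thesis using lI by (auto simp: X_eq)
   next
    case 2
    hence "reflection a p = f l"
     unfolding r i(2) using reflection_swap[OF nn[symmetric]] by (simp add: reflection_commute_diff[of "f l"])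
    thus ?thesis using lI by (auto simp: X_eq)
   next
    case 3
    hence "reflection a p = p"
     unfolding r i(2) reflection_fix_iff using fdo[OF i(1) lI] by (simp add: inner_commute)
    thus ?thesis using ap by simp
   qed
  qed
  show "p \<bullet> p = q \<bullet> q" if "p \<in> X" "q \<in> X" for p q using that by (auto simp: X_eq ff)
  have "inj_on f {1..n + 1}" using inj by (auto simp: inj_on_def)
  thus "card X = (if False then n + 1 + 2 else n + 1)" by (simp add: X_eq card_image)
  show "reflection (p - q) \<in> refl_group J"
   if J: "J \<subseteq> \<Delta>" and p: "p \<in> X" and q: "q \<in> X" and ne: "rt False p q" and d: "p - q \<in> span J" for J p q
  proof -
   obtain i j where ij: "i \<in> {1..n + 1}" "j \<in> {1..n + 1}" "p = f i" "q = f j" using p q by (auto simp: X_eq)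
   have "i \<noteq> j" using ne ij by (auto simp: rt_def)
   then consider "i < j" | "j < i" by linarith
   thus ?thesis
   proof cases
    case 1
    thus ?thesis using par_A[OF J ij(1,2)] d ij(3,4) by (simp add: f_diff)
   next
    case 2
    have "- (p - q) \<in> span J" using d by (rule span_neg)
    hence "e j - e i \<in> span J" using ij f_diff by simp
    hence "reflection (e j - e i) \<in> refl_group J" using par_A[OF J ij(2,1) 2] by simp
    thus ?thesis using ij(3,4) by (simp add: f_diff reflection_commute_diff[of "e i"])
   qed
  qed
  show "p \<bullet> (q - r) = 0" if "p \<in> X" "q \<in> X" "r \<in> X" "p \<noteq> q" "p \<noteq> - q" "p \<noteq> r" "p \<noteq> - r" for p q r
  proof -
   obtain i j l where "i \<in> {1..n + 1}" "j \<in> {1..n + 1}" "l \<in> {1..n + 1}" "p = f i" "q = f j" "r = f l"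
    using \<open>p \<in> X\<close> \<open>q \<in> X\<close> \<open>r \<in> X\<close> unfolding X_eq by blast
   thus ?thesis using fdo[of i j l] \<open>p \<noteq> q\<close> \<open>p \<noteq> r\<close> by blast
  qed
  show "(\<forall>p\<in>X. - p \<notin> X) \<or> (\<forall>p\<in>X. - p \<in> X)" using neg by (auto simp: X_eq) (metis minus_minus)
 qed auto
qed

end

subsection \<open>Signed permutations\<close>

locale signed_vectors = orthonormal_vectors n e for n :: nat and e :: "nat \<Rightarrow> 'a::euclidean_space" +
 fixes X :: "'a set"
 assumes X: "X = {e i | i. i \<in> {1..n}} \<union> {- e i | i. i \<in> {1..n}}" and n2: "2 \<le> n"
begin

lemma X_cases:
 assumes "p \<in> X"
 obtains i where "i \<in> {1..n}" "p = e i \<or> p = - e i"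
 using assms by (auto simp: X)

lemma e_in_X: "i \<in> {1..n} \<Longrightarrow> e i \<in> X" "i \<in> {1..n} \<Longrightarrow> - e i \<in> X"
 by (auto simp: X)

lemma e_neq_neg: "i \<in> {1..n} \<Longrightarrow> j \<in> {1..n} \<Longrightarrow> e i \<noteq> - e j"
proof
 assume ij: "i \<in> {1..n}" "j \<in> {1..n}" "e i = - e j"
 hence "e i \<bullet> e i = - (e i \<bullet> e j)" by (metis inner_minus_right minus_minus)
 thus False using ij ee[of i i] ee[of i j] by (simp split: if_splits)
qed

lemma X_neg_signed: "p \<in> X \<Longrightarrow> - p \<in> X"
 by (auto simp: X)

lemma X_norm_signed: "p \<in> X \<Longrightarrow> p \<bullet> p = 1"
 by (auto simp: X ee)

lemma X_card_signed: "card X = 2 * n"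
proof -
 have 1: "X = e ` {1..n} \<union> (\<lambda>i. - e i) ` {1..n}" by (auto simp: X)
 have "inj_on e {1..n}" using e_inj by (auto simp: inj_on_def)
 moreover have "inj_on (\<lambda>i. - e i) {1..n}" using e_inj by (intro inj_onI) simp
 moreover have "e ` {1..n} \<inter> (\<lambda>i. - e i) ` {1..n} = {}" using e_neq_neg by auto
 ultimately show ?thesis unfolding 1 by (subst card_Un_disjoint) (auto simp: card_image)
qed

lemma X_perp: "p \<in> X \<Longrightarrow> q \<in> X \<Longrightarrow> p \<noteq> q \<Longrightarrow> p \<noteq> - q \<Longrightarrow> p \<bullet> q = 0"
 by (erule X_cases, erule X_cases) (auto simp: ee)

lemma reflection_X:
 assumes "p \<in> X" "q \<in> X" "x \<in> X"
 shows "reflection (p - q) x \<in> X"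
proof -
 have n: "p \<bullet> p = q \<bullet> q" using assms X_norm_signed by simp
 consider "x = p" | "x = - p" | "x = q" | "x = - q" | "x \<noteq> p" "x \<noteq> - p" "x \<noteq> q" "x \<noteq> - q" by blast
 thus ?thesis
 proof cases
  case 5
  hence "(p - q) \<bullet> x = 0" using X_perp[OF assms(3,1)] X_perp[OF assms(3,2)]
   by (simp add: inner_diff_left inner_commute[of p x] inner_commute[of q x])
  hence "reflection (p - q) x = x" by (simp only: reflection_fix_iff)
  thus ?thesis using assms by simp
 qed (use reflection_swap[OF n] reflection_swap[OF n[symmetric]] assms X_neg_signed in
   \<open>auto simp: reflection_minus reflection_commute_diff[of p]\<close>)
qed

lemma diff_cases:
 assumes "p \<in> X" "q \<in> X" "p \<noteq> q"
 obtains i where "i \<in> {1..n}" "p = - q" "p - q = 2 *\<^sub>R e i \<or> p - q = - (2 *\<^sub>R e i)"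
 | i j where "i \<in> {1..n}" "j \<in> {1..n}" "i < j" "p - q = e i - e j \<or> p - q = - (e i - e j)"
 | i j where "i \<in> {1..n}" "j \<in> {1..n}" "i < j" "p - q = e i + e j \<or> p - q = - (e i + e j)"
proof -
 obtain i where i: "i \<in> {1..n}" "p = e i \<or> p = - e i" using assms(1) by (rule X_cases)
 obtain j where j: "j \<in> {1..n}" "q = e j \<or> q = - e j" using assms(2) by (rule X_cases)
 consider "i = j" | "i < j" | "j < i" by linarith
 thus thesis
 proof cases
  case 1
  hence "p = - q" using i j assms(3) by auto
  thus thesis using that(1)[OF i(1)] 1 i j by (auto simp: scaleR_2)
 next
  case 2
  thus thesis using that(2)[OF i(1) j(1) 2] that(3)[OF i(1) j(1) 2] i j by auto
 next
  case 3
  have *: "p - q = e j - e i \<or> p - q = - (e j - e i) \<or> p - q = e j + e i \<or> p - q = - (e j + e i)"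
   using i j by auto
  thus thesis using that(2)[OF j(1) i(1) 3] that(3)[OF j(1) i(1) 3] by blast
 qed
qed

text \<open>Shared by types B and D, which differ in \<open>h\<close>, in the last simple root and
  in whether the coordinate vectors are roots.\<close>

lemma signed_orbit:
 assumes plane: "cox_plane \<Delta> \<Delta>\<^sub>p \<Delta>\<^sub>m k h" and h: "2 * n = (if ii then h + 2 else h)"
  and form: "\<And>a. a \<in> \<Delta> \<Longrightarrow> \<exists>p\<in>X. \<exists>q\<in>X. reflection a = reflection (p - q) \<and> a \<in> span {p, q}"
  and span: "e n \<in> span \<Delta>" "\<And>l. l \<in> {1..n - 1} \<Longrightarrow> e l - e (l + 1) \<in> span \<Delta>"
  and par: "\<And>J p q. J \<subseteq> \<Delta> \<Longrightarrow> p \<in> X \<Longrightarrow> q \<in> X \<Longrightarrow> rt ii p q \<Longrightarrow> p - q \<in> span J \<Longrightarrow>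
   reflection (p - q) \<in> refl_group J"
  and not_root: "\<And>p. ii \<Longrightarrow> p \<in> X \<Longrightarrow> reflection p \<notin> refl_group \<Delta>"
  and zero: "\<And>J p. ii \<Longrightarrow> J \<subseteq> \<Delta> \<Longrightarrow> p \<in> X \<Longrightarrow> p \<in> span J \<Longrightarrow> \<exists>r\<in>X. r \<in> span J \<and> r \<noteq> p \<and> r \<noteq> - p"
 shows "orthogonal_orbit \<Delta> \<Delta>\<^sub>p \<Delta>\<^sub>m k h X ii"
proof -
 interpret cox_plane \<Delta> \<Delta>\<^sub>p \<Delta>\<^sub>m k h by (rule plane)
 have eV: "e i \<in> span \<Delta>" if "i \<in> {1..n}" for i
  using that
 proof (induction "n - i" arbitrary: i)
  case 0
  hence "i = n" by auto
  thus ?case using span(1) by simp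
 next
  case (Suc m)
  hence i: "i \<in> {1..n - 1}" "i + 1 \<in> {1..n}" "m = n - (i + 1)" by auto
  show ?case using span_add[OF span(2)[OF i(1)] Suc.hyps(1)[OF i(3,2)]] by simp
 qed
 show ?thesis
 proof unfold_locales
  show "X \<subseteq> span \<Delta>" using eV by (auto simp: X span_neg)
  show "\<Delta> \<subseteq> span X"
  proof
   fix a assume "a \<in> \<Delta>"
   then obtain p q where "p \<in> X" "q \<in> X" "a \<in> span {p, q}" using form by blast
   thus "a \<in> span X" using span_mono[of "{p, q}" X] by auto
  qed
  show "reflection a p \<in> X" if "a \<in> \<Delta>" "p \<in> X" for a p
   using form[OF that(1)] reflection_X that(2) by metis
  show "p \<bullet> p = q \<bullet> q" if "p \<in> X" "q \<in> X" for p q using that X_norm_signed by simp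
  show "card X = (if ii then h + 2 else h)" using X_card_signed h by simp
  show "p \<bullet> (q - r) = 0" if "p \<in> X" "q \<in> X" "r \<in> X" "p \<noteq> q" "p \<noteq> - q" "p \<noteq> r" "p \<noteq> - r" for p q r
   using that X_perp by (simp add: inner_diff_right)
  show "(\<forall>p\<in>X. - p \<notin> X) \<or> (\<forall>p\<in>X. - p \<in> X)" using X_neg_signed by blast
 qed (use X_neg_signed par not_root zero in auto)
qed

end

subsection \<open>Type B\<close>

locale type_B_vectors = signed_vectors n e X for n :: nat and e :: "nat \<Rightarrow> 'a::euclidean_space" and X +
 fixes \<Delta> :: "'a set"
 assumes \<Delta>: "\<Delta> = {sgn (e i - e (i + 1)) | i. i \<in> {1..n - 1}} \<union> {e n}"
begin

definition \<alpha> :: "nat \<Rightarrow> 'a" where "\<alpha> i = (if i < n then simple i else e n)"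

lemma \<Delta>_eq: "\<Delta> = \<alpha> ` {1..n}"
proof -
 have "{1..n} = insert n {1..n - 1}" using n2 by auto
 hence "\<alpha> ` {1..n} = insert (\<alpha> n) (\<alpha> ` {1..n - 1})" by simp
 also have "\<alpha> ` {1..n - 1} = simple ` {1..n - 1}" using n2 by (intro image_cong) (auto simp: \<alpha>_def)
 finally show ?thesis unfolding \<Delta> by (auto simp: \<alpha>_def simple_def)
qed

lemma dual_B: "l \<in> {1..n} \<Longrightarrow> j \<in> {1..n} \<Longrightarrow> psum l \<bullet> \<alpha> j = 0 \<longleftrightarrow> j \<noteq> l"
 by (cases "j < n") (auto simp: \<alpha>_def simple_eq inner_diff_right psum_e)

lemma reflection_\<alpha>: "l \<in> {1..n - 1} \<Longrightarrow> reflection (\<alpha> l) = reflection (e l - e (l + 1))"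
 using reflection_simple[of l] by (auto simp: \<alpha>_def)

lemma \<alpha>_in: "J \<subseteq> \<Delta> \<Longrightarrow> x \<in> span J \<Longrightarrow> l \<in> {1..n} \<Longrightarrow> psum l \<bullet> x \<noteq> 0 \<Longrightarrow> \<alpha> l \<in> J"
 using dual_system(1)[of "{1..n}" "psum" \<alpha>, OF dual_B] by (simp add: \<Delta>_eq)

lemma chain_B:
 assumes "\<And>l. i \<le> l \<Longrightarrow> l < j \<Longrightarrow> \<alpha> l \<in> J" "i < j" "j \<le> n" "1 \<le> i"
 shows "reflection (e i - e j) \<in> refl_group J"
proof (rule diff_chain[OF assms(2,3,4)])
 fix l assume l: "i \<le> l" "l < j"
 hence "l \<in> {1..n - 1}" using assms by auto
 thus "reflection (e l - e (l + 1)) \<in> refl_group J"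
  using reflection_in_refl_group[OF assms(1)[OF l]] reflection_\<alpha>[of l] by simp
qed

lemma short_B:
 assumes "\<And>l. i \<le> l \<Longrightarrow> l \<le> n \<Longrightarrow> \<alpha> l \<in> J" "i \<in> {1..n}"
 shows "reflection (e i) \<in> refl_group J"
proof -
 have en: "reflection (e n) \<in> refl_group J"
  using reflection_in_refl_group[OF assms(1)[of n]] assms(2) by (simp add: \<alpha>_def)
 show ?thesis
 proof (cases "i = n")
  case False
  hence "reflection (e i - e n) \<in> refl_group J" using assms by (intro chain_B) auto
  from reflection_conj_in_refl_group[OF this en]
  have "reflection (reflection (e i - e n) (e n)) \<in> refl_group J" .
  moreover have "reflection (e i - e n) (e n) = e i"
   using reflection_swap[of "e n" "e i"] assms(2) n2 by (simp add: ee reflection_commute_diff[of "e i"])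
  ultimately show ?thesis by simp
 qed (use en in simp)
qed

lemma par_B:
 assumes J: "J \<subseteq> \<Delta>" and pq: "p \<in> X" "q \<in> X" "p \<noteq> q" and d: "p - q \<in> span J"
 shows "reflection (p - q) \<in> refl_group J"
 using pq
proof (cases rule: diff_cases)
 case (1 i)
 have "x \<in> span J" if "p - q = x \<or> p - q = - x" for x using that d by (metis minus_minus span_neg)
 hence s: "2 *\<^sub>R e i \<in> span J" using 1 by blast
 have "\<alpha> l \<in> J" if "i \<le> l" "l \<le> n" for l
  using that 1(1) by (intro \<alpha>_in[OF J s]) (auto simp: psum_e)
 hence "reflection (e i) \<in> refl_group J" using 1(1) by (intro short_B) auto
 hence "reflection (2 *\<^sub>R e i) \<in> refl_group J" by (simp add: reflection_scaled)
 thus ?thesis using 1(3) reflection_uminus by metis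
next
 case (2 i j)
 have "x \<in> span J" if "p - q = x \<or> p - q = - x" for x using that d by (metis minus_minus span_neg)
 hence s: "e i - e j \<in> span J" using 2 by blast
 have "\<alpha> l \<in> J" if "i \<le> l" "l < j" for l
  using that 2(1-3) by (intro \<alpha>_in[OF J s]) (auto simp: inner_diff_right psum_e)
 hence "reflection (e i - e j) \<in> refl_group J" using 2 by (intro chain_B) auto
 thus ?thesis using 2(4) reflection_uminus by metis
next
 case (3 i j)
 have "x \<in> span J" if "p - q = x \<or> p - q = - x" for x using that d by (metis minus_minus span_neg)
 hence s: "e i + e j \<in> span J" using 3 by blast
 have a: "\<alpha> l \<in> J" if "i \<le> l" "l \<le> n" for l
  using that 3(1-3) by (intro \<alpha>_in[OF J s]) (auto simp: inner_add_right psum_e)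
 hence 1: "reflection (e i - e j) \<in> refl_group J" using 3 by (intro chain_B) auto
 have 2: "reflection (e j) \<in> refl_group J" using a 3 by (intro short_B) auto
 have "reflection (reflection (e j) (e i - e j)) \<in> refl_group J"
  using reflection_conj_in_refl_group[OF 2 1] .
 moreover have "reflection (e j) (e i) = e i"
  unfolding reflection_fix_iff using 3 by (simp add: ee)
 ultimately have "reflection (e i + e j) \<in> refl_group J" by (simp add: reflection_diff reflection_self)
 thus ?thesis using 3(4) reflection_uminus by metis
qed

lemma plane_B:
 assumes "coxeter_bipartition \<Delta> \<Delta>\<^sub>p \<Delta>\<^sub>m" "positive_min_eigenvector \<Delta> k"
 shows "cox_plane \<Delta> \<Delta>\<^sub>p \<Delta>\<^sub>m k (2 * n)"
proof (rule cox_plane_from_dual_system[OF _ _ \<Delta>_eq _ dual_B _ _ assms])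
 define t where "t = pi / real (2 * n)"
 have nt: "real n * t = pi / 2" using n2 by (simp add: t_def)
 \<comment> \<open>The last edge has inner product \<open>- 1 / sqrt 2\<close> instead of
   \<open>- 1 / 2\<close>. With the entry \<open>1 / sqrt 2\<close> it contributes to row
   \<open>n - 1\<close> what an ordinary edge would contribute with
   \<open>sin (n * t) = 1\<close>.\<close>
 define \<kappa>' where "\<kappa>' i = (if i < n then sin (real i * t) else 1 / sqrt 2)" for i
 show "0 < \<kappa>' i" if "i \<in> {1..n}" for i
 proof -
  have "0 < sin (real i * t)" if "i < n" "1 \<le> i"
  proof (rule sin_gt_zero)
   show "0 < real i * t" using that by (auto simp: t_def)
   have "real i * t < real n * t" using that n2 by (intro mult_strict_right_mono) (auto simp: t_def)
   thus "real i * t < pi" using nt pi_gt_zero by linarith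
  qed
  thus ?thesis using that by (auto simp: \<kappa>'_def)
 qed
 show "norm (\<alpha> i) = 1" if "i \<in> {1..n}" for i
  using that norm_simple_e[of i] norm_e[of n] by (auto simp: \<alpha>_def)
 have last: "\<alpha> i \<bullet> \<alpha> n = (if i = n - 1 then - 1 / sqrt 2 else 0)" if "i \<in> {1..n - 1}" for i
  using that n2 by (auto simp: \<alpha>_def simple_eq inner_diff_left ee)
 have split: "(\<Sum>j\<in>{1..n}. g j) = (\<Sum>j\<in>{1..n - 1}. g j) + g n" for g :: "nat \<Rightarrow> real"
  using n2 sum.cl_ivl_Suc[of g 1 "n - 1"] by simp
 fix i assume i: "i \<in> {1..n}"
 show "(\<Sum>j\<in>{1..n}. (\<alpha> i \<bullet> \<alpha> j) * \<kappa>' j) = (1 - cos (pi / real (2 * n))) * \<kappa>' i"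
 proof (cases "i = n")
  case True
  have "(\<Sum>j\<in>{1..n - 1}. (\<alpha> n \<bullet> \<alpha> j) * \<kappa>' j) = (\<Sum>j\<in>{1..n - 1}. if j = n - 1 then - 1 / sqrt 2 * \<kappa>' j else 0)"
   using last by (intro sum.cong) (auto simp: inner_commute)
  also have "\<dots> = - 1 / sqrt 2 * \<kappa>' (n - 1)" using n2 by simp
  finally have 1: "(\<Sum>j\<in>{1..n - 1}. (\<alpha> n \<bullet> \<alpha> j) * \<kappa>' j) = - 1 / sqrt 2 * \<kappa>' (n - 1)" .
  have "real (n - 1) * t = pi / 2 - t" using nt n2 by (simp add: of_nat_diff left_diff_distrib)
  hence 2: "\<kappa>' (n - 1) = cos t" using n2 by (simp add: \<kappa>'_def sin_diff)
  have 3: "\<alpha> n \<bullet> \<alpha> n = 1" using n2 by (simp add: \<alpha>_def ee)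
  show ?thesis unfolding True split 1 2 3 t_def[symmetric] by (simp add: \<kappa>'_def diff_divide_distrib)
 next
  case False
  hence i': "i \<in> {1..n - 1}" using i by auto
  have "(\<Sum>j\<in>{1..n - 1}. (\<alpha> i \<bullet> \<alpha> j) * \<kappa>' j) =
   (\<Sum>j\<in>{1..n - 1}. (if j = i then 1 else if j = i + 1 \<or> i = j + 1 then - 1 / 2 else 0) * sin (real j * t))"
   using i' by (intro sum.cong) (auto simp: \<alpha>_def \<kappa>'_def simple_inner)
  also have "\<dots> = sin (real i * t) - 1 / 2 * (if 1 < i then sin (real (i - 1) * t) else 0)
   - 1 / 2 * (if i < n - 1 then sin (real (i + 1) * t) else 0)"
   by (subst sum_tridiagonal[OF i']) simp
  also have "(if 1 < i then sin (real (i - 1) * t) else 0) = sin ((real i - 1) * t)"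
   using i by (cases "i = 1") (auto simp: of_nat_diff)
  finally have 1: "(\<Sum>j\<in>{1..n - 1}. (\<alpha> i \<bullet> \<alpha> j) * \<kappa>' j) = sin (real i * t) - 1 / 2 * sin ((real i - 1) * t)
   - 1 / 2 * (if i < n - 1 then sin (real (i + 1) * t) else 0)" .
  have 2: "1 / 2 * (if i < n - 1 then sin (real (i + 1) * t) else 0) - (\<alpha> i \<bullet> \<alpha> n) * \<kappa>' n = 1 / 2 * sin ((real i + 1) * t)"
  proof (cases "i = n - 1")
   case True
   hence "(real i + 1) * t = pi / 2" using nt n2 by (simp add: of_nat_diff)
   hence s1: "sin ((real i + 1) * t) = 1" by (simp only: sin_pi_half)
   have "\<alpha> i \<bullet> \<alpha> n = - 1 / sqrt 2" "\<not> i < n - 1" using True last[OF i'] by auto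
   thus ?thesis using s1 by (simp add: \<kappa>'_def)
  next
   case False
   thus ?thesis using i' last[OF i'] by (simp add: add.commute)
  qed
  have "(\<Sum>j\<in>{1..n}. (\<alpha> i \<bullet> \<alpha> j) * \<kappa>' j)
   = sin (real i * t) - 1 / 2 * (sin ((real i - 1) * t) + sin ((real i + 1) * t))"
   unfolding split 1 using 2 by (simp add: algebra_simps)
  moreover have "(1 - cos t) * sin (real i * t) = sin (real i * t) - cos t * sin (real i * t)" by algebra
  moreover have "\<kappa>' i = sin (real i * t)" using False i by (simp add: \<kappa>'_def)
  ultimately show ?thesis unfolding sin_neighbours t_def[symmetric] by simp
 qed
qed (use n2 in auto)

lemma orbit_B:
 assumes "coxeter_bipartition \<Delta> \<Delta>\<^sub>p \<Delta>\<^sub>m" "positive_min_eigenvector \<Delta> k"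
 shows "orthogonal_orbit \<Delta> \<Delta>\<^sub>p \<Delta>\<^sub>m k (2 * n) X False"
proof (rule signed_orbit[OF plane_B[OF assms]])
 have n1: "n \<in> {1..n}" using n2 by auto
 show "e n \<in> span \<Delta>" by (auto simp: \<Delta> span_base)
 show "e l - e (l + 1) \<in> span \<Delta>" if l: "l \<in> {1..n - 1}" for l
 proof -
  have "sqrt 2 *\<^sub>R simple l \<in> span \<Delta>" using l by (intro span_mul span_base) (auto simp: \<Delta> simple_def)
  thus ?thesis using l by (simp add: simple_eq)
 qed
 show "\<exists>p\<in>X. \<exists>q\<in>X. reflection a = reflection (p - q) \<and> a \<in> span {p, q}" if "a \<in> \<Delta>" for a
 proof -
  obtain l where l: "l \<in> {1..n}" "a = \<alpha> l" using \<open>a \<in> \<Delta>\<close> by (auto simp: \<Delta>_eq)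
  show ?thesis
  proof (cases "l = n")
   case True
   have "reflection (e n) = reflection (e n - - e n)"
    using reflection_scaled[of 2 "e n"] by (simp add: scaleR_2)
   thus ?thesis using True l e_in_X[OF n1]
    by - (rule bexI[of _ "e n"], rule bexI[of _ "- e n"], auto simp: \<alpha>_def span_base)
  next
   case False
   hence l': "l \<in> {1..n - 1}" "l + 1 \<in> {1..n}" using l by auto
   have "a = (1 / sqrt 2) *\<^sub>R (e l - e (l + 1))" using l' False l by (simp add: \<alpha>_def simple_eq)
   hence "a \<in> span {e l, e (l + 1)}" by (simp add: span_mul span_diff span_base)
   thus ?thesis using l l' reflection_\<alpha>[OF l'(1)] e_in_X(1)[OF l(1)] e_in_X(1)[OF l'(2)]
    by - (rule bexI[of _ "e l"], rule bexI[of _ "e (l + 1)"], auto)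
  qed
 qed
qed (use par_B in \<open>auto simp: rt_def\<close>)

end

subsection \<open>Type D\<close>

lemma prod_change_two:
 fixes g g' :: "'i \<Rightarrow> real"
 assumes "finite S" "a \<in> S" "b \<in> S" "a \<noteq> b" "\<And>j. j \<in> S \<Longrightarrow> j \<noteq> a \<Longrightarrow> j \<noteq> b \<Longrightarrow> g' j = g j"
  and "g' a * g' b = g a * g b"
 shows "prod g' S = prod g S"
proof -
 have "prod u S = u a * (u b * prod u (S - {a} - {b}))" for u :: "'i \<Rightarrow> real"
  using assms(1-4) by (simp add: prod.remove[of S a] prod.remove[of "S - {a}" b])
 moreover have "prod g' (S - {a} - {b}) = prod g (S - {a} - {b})"
  using assms(5) by (intro prod.cong) auto
 ultimately show ?thesis using assms(6) by (metis mult.assoc)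
qed

locale type_D_vectors = signed_vectors n e X for n :: nat and e :: "nat \<Rightarrow> 'a::euclidean_space" and X +
 fixes \<Delta> :: "'a set"
 assumes \<Delta>: "\<Delta> = {sgn (e i - e (i + 1)) | i. i \<in> {1..n - 1}} \<union> {sgn (e (n - 1) + e n)}" and n4: "4 \<le> n"
begin

definition \<alpha> :: "nat \<Rightarrow> 'a" where "\<alpha> i = (if i < n then simple i else sgn (e (n - 1) + e n))"

lemma nI: "n \<in> {1..n}" "n - 1 \<in> {1..n}" "n - 1 \<noteq> n" "n - 1 \<in> {1..n - 1}" "n - 1 + 1 = n"
 using n4 by auto

lemma \<Delta>_eq: "\<Delta> = \<alpha> ` {1..n}"
proof -
 have "{1..n} = insert n {1..n - 1}" using n4 by auto
 hence "\<alpha> ` {1..n} = insert (\<alpha> n) (\<alpha> ` {1..n - 1})" by simp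
 also have "\<alpha> ` {1..n - 1} = simple ` {1..n - 1}" using n4 by (intro image_cong) (auto simp: \<alpha>_def)
 finally show ?thesis unfolding \<Delta> by (auto simp: \<alpha>_def simple_def)
qed

lemma \<alpha>_n: "\<alpha> n = (1 / sqrt 2) *\<^sub>R (e (n - 1) + e n)"
 using norm_add_e[OF nI(2,1,3)] by (simp add: \<alpha>_def sgn_div_norm inverse_eq_divide)

lemma \<alpha>_lt: "i \<in> {1..n - 1} \<Longrightarrow> \<alpha> i = (1 / sqrt 2) *\<^sub>R (e i - e (i + 1))"
 using simple_eq[of i] by (auto simp: \<alpha>_def)

text \<open>Up to scale the fundamental weights; the indices \<open>n - 1\<close> and
  \<open>n\<close> give the two half-spin weights.\<close>

definition \<omega> :: "nat \<Rightarrow> 'a" where "\<omega> l = (if l = n - 1 then psum n - 2 *\<^sub>R e n else psum l)"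

lemma \<omega>_e: "i \<in> {1..n} \<Longrightarrow> l \<in> {1..n} \<Longrightarrow>
  \<omega> l \<bullet> e i = (if l = n - 1 then (if i = n then - 1 else 1) else if i \<le> l then 1 else 0)"
 using nI by (auto simp: \<omega>_def inner_diff_left psum_e ee)

lemma dual_D: "l \<in> {1..n} \<Longrightarrow> j \<in> {1..n} \<Longrightarrow> \<omega> l \<bullet> \<alpha> j = 0 \<longleftrightarrow> j \<noteq> l"
proof (cases "j = n")
 case True
 assume "l \<in> {1..n}" "j \<in> {1..n}"
 thus ?thesis unfolding True \<alpha>_n using nI by (auto simp: inner_add_right \<omega>_e)
next
 case False
 assume lj: "l \<in> {1..n}" "j \<in> {1..n}"
 hence j: "j \<in> {1..n - 1}" "j + 1 \<in> {1..n}" using False by auto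
 show ?thesis unfolding \<alpha>_lt[OF j(1)] using lj j nI by (auto simp: inner_diff_right \<omega>_e)
qed

lemma \<alpha>_in: "J \<subseteq> \<Delta> \<Longrightarrow> x \<in> span J \<Longrightarrow> l \<in> {1..n} \<Longrightarrow> \<omega> l \<bullet> x \<noteq> 0 \<Longrightarrow> \<alpha> l \<in> J"
 using dual_system(1)[of "{1..n}" \<omega> \<alpha>, OF dual_D] by (simp add: \<Delta>_eq)

lemma reflection_\<alpha>: "l \<in> {1..n - 1} \<Longrightarrow> reflection (\<alpha> l) = reflection (e l - e (l + 1))"
 by (simp add: \<alpha>_lt reflection_scaled)

lemma reflection_\<alpha>_n: "reflection (\<alpha> n) = reflection (e (n - 1) + e n)"
 by (simp add: \<alpha>_n reflection_scaled)

lemma chain_D: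
 assumes "\<And>l. i \<le> l \<Longrightarrow> l < j \<Longrightarrow> \<alpha> l \<in> J" "i < j" "j \<le> n" "1 \<le> i"
 shows "reflection (e i - e j) \<in> refl_group J"
proof (rule diff_chain[OF assms(2,3,4)])
 fix l assume l: "i \<le> l" "l < j"
 hence "l \<in> {1..n - 1}" using assms by auto
 thus "reflection (e l - e (l + 1)) \<in> refl_group J"
  using reflection_in_refl_group[OF assms(1)[OF l]] reflection_\<alpha>[of l] by simp
qed

lemma sum_last_D:
 assumes "\<And>l. i \<le> l \<Longrightarrow> l < n - 1 \<Longrightarrow> \<alpha> l \<in> J" "\<alpha> n \<in> J" "i < n" "1 \<le> i"
 shows "reflection (e i + e n) \<in> refl_group J"
proof -
 have s: "reflection (e (n - 1) + e n) \<in> refl_group J"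
  using reflection_in_refl_group[OF assms(2)] by (simp add: reflection_\<alpha>_n)
 show ?thesis
 proof (cases "i = n - 1")
  case False
  hence "i < n - 1" using assms by auto
  hence "reflection (e i - e (n - 1)) \<in> refl_group J" using assms by (intro chain_D) auto
  from swap_conj[OF this s] show ?thesis using assms nI by auto
 qed (use s in simp)
qed

lemma par_D:
 assumes J: "J \<subseteq> \<Delta>" and pq: "p \<in> X" "q \<in> X" "p \<noteq> q" "p \<noteq> - q" and d: "p - q \<in> span J"
 shows "reflection (p - q) \<in> refl_group J"
 using pq(1-3)
proof (cases rule: diff_cases)
 case (1 i)
 thus ?thesis using pq(4) by simp
next
 case (2 i j)
 have "x \<in> span J" if "p - q = x \<or> p - q = - x" for x using that d by (metis minus_minus span_neg)
 hence s: "e i - e j \<in> span J" using 2 by blast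
 have "\<alpha> l \<in> J" if "i \<le> l" "l < j" for l
  using that 2(1-3) by (intro \<alpha>_in[OF J s]) (auto simp: inner_diff_right \<omega>_e)
 hence "reflection (e i - e j) \<in> refl_group J" using 2 by (intro chain_D) auto
 thus ?thesis using 2(4) reflection_uminus by metis
next
 case (3 i j)
 have "x \<in> span J" if "p - q = x \<or> p - q = - x" for x using that d by (metis minus_minus span_neg)
 hence s: "e i + e j \<in> span J" using 3 by blast
 have a: "\<alpha> l \<in> J" if "i \<le> l" "l \<le> n" "l \<noteq> n - 1 \<or> j < n" for l
  using that 3(1-3) by (intro \<alpha>_in[OF J s]) (auto simp: inner_add_right \<omega>_e)
 have "\<alpha> n \<in> J" using a[of n] 3 nI by auto
 hence 1: "reflection (e i + e n) \<in> refl_group J"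
  using a 3 by (intro sum_last_D) auto
 have "reflection (e i + e j) \<in> refl_group J"
 proof (cases "j = n")
  case False
  hence jn: "j < n" using 3 by auto
  have "reflection (e j - e n) \<in> refl_group J" using a jn 3 by (intro chain_D) auto
  moreover have "reflection (e n + e i) \<in> refl_group J" using 1 by (simp add: add.commute)
  ultimately have "reflection (e j + e i) \<in> refl_group J" using swap_conj[of j n J i] 3 jn nI by auto
  thus ?thesis by (simp add: add.commute)
 qed (use 1 in simp)
 thus ?thesis using 3(4) reflection_uminus by metis
qed

lemma plane_D:
 assumes "coxeter_bipartition \<Delta> \<Delta>\<^sub>p \<Delta>\<^sub>m" "positive_min_eigenvector \<Delta> k"
 shows "cox_plane \<Delta> \<Delta>\<^sub>p \<Delta>\<^sub>m k (2 * n - 2)"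
proof (rule cox_plane_from_dual_system[OF _ _ \<Delta>_eq _ dual_D _ _ assms])
 define t where "t = pi / real (2 * n - 2)"
 have nt: "(real n - 1) * t = pi / 2" using n4 by (simp add: t_def of_nat_diff field_simps)
 have t0: "0 < t" using n4 by (simp add: t_def)
 \<comment> \<open>The two ends of the fork share the value \<open>sin ((n - 1) * t) = 1\<close>
   equally.\<close>
 define \<kappa>' where "\<kappa>' i = (if i < n - 1 then sin (real i * t) else 1 / 2)" for i
 show "0 < \<kappa>' i" if "i \<in> {1..n}" for i
 proof -
  have "0 < sin (real i * t)" if "i < n - 1" "1 \<le> i"
  proof (rule sin_gt_zero)
   show "0 < real i * t" using that t0 by auto
   have "real i < real n - 1" using that by linarith
   hence "real i * t < (real n - 1) * t" using t0 by (intro mult_strict_right_mono) auto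
   thus "real i * t < pi" using nt pi_gt_zero by linarith
  qed
  thus ?thesis using that by (auto simp: \<kappa>'_def)
 qed
 show "norm (\<alpha> i) = 1" if "i \<in> {1..n}" for i
 proof (cases "i = n")
  case True
  thus ?thesis using norm_add_e[OF nI(2,1,3)] by (simp add: \<alpha>_n)
 next
  case False
  thus ?thesis using that norm_simple_e[of i] by (auto simp: \<alpha>_def)
 qed
 have last: "\<alpha> i \<bullet> \<alpha> n = (if i = n - 2 then - 1 / 2 else 0)" if i: "i \<in> {1..n - 1}" for i
 proof -
  have "i \<in> {1..n}" "i + 1 \<in> {1..n}" using i by auto
  hence "(e i - e (i + 1)) \<bullet> (e (n - 1) + e n) = (if i = n - 2 then - 1 else 0)"
   using nI i by (auto simp: inner_diff_left inner_add_right ee)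
  thus ?thesis unfolding \<alpha>_lt[OF i] \<alpha>_n by auto
 qed
 have tri: "\<alpha> i \<bullet> \<alpha> j = (if j = i then 1 else if j = i + 1 \<or> i = j + 1 then - 1 / 2 else 0)"
  if "i \<in> {1..n - 1}" "j \<in> {1..n - 1}" for i j
  using that simple_inner[OF that] by (auto simp: \<alpha>_def)
 have split: "(\<Sum>j\<in>{1..n}. g j) = (\<Sum>j\<in>{1..n - 1}. g j) + g n" for g :: "nat \<Rightarrow> real"
  using n4 sum.cl_ivl_Suc[of g 1 "n - 1"] by simp
 fix i assume i: "i \<in> {1..n}"
 have cc: "(1 - cos t) * x = x - cos t * x" for x by algebra
 show "(\<Sum>j\<in>{1..n}. (\<alpha> i \<bullet> \<alpha> j) * \<kappa>' j) = (1 - cos (pi / real (2 * n - 2))) * \<kappa>' i"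
 proof (cases "i = n")
  case True
  have "(\<Sum>j\<in>{1..n - 1}. (\<alpha> n \<bullet> \<alpha> j) * \<kappa>' j) = (\<Sum>j\<in>{1..n - 1}. if j = n - 2 then - 1 / 2 * \<kappa>' j else 0)"
   using last by (intro sum.cong) (auto simp: inner_commute)
  also have "\<dots> = - 1 / 2 * \<kappa>' (n - 2)"
  proof -
   have "n - 2 \<in> {1..n - 1}" using n4 by auto
   thus ?thesis by simp
  qed
  finally have 1: "(\<Sum>j\<in>{1..n - 1}. (\<alpha> n \<bullet> \<alpha> j) * \<kappa>' j) = - 1 / 2 * \<kappa>' (n - 2)" .
  have "real (n - 2) * t = pi / 2 - t" using nt n4 by (simp add: of_nat_diff algebra_simps)
  hence 2: "\<kappa>' (n - 2) = cos t" using n4 by (simp add: \<kappa>'_def sin_diff)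
  have 3: "\<alpha> n \<bullet> \<alpha> n = 1" using nI by (simp add: \<alpha>_n inner_add_left inner_add_right ee)
  show ?thesis unfolding True split 1 2 3 t_def[symmetric] cc by (simp add: \<kappa>'_def)
 next
  case False
  hence i': "i \<in> {1..n - 1}" using i by auto
  have "(\<Sum>j\<in>{1..n - 1}. (\<alpha> i \<bullet> \<alpha> j) * \<kappa>' j) =
   (\<Sum>j\<in>{1..n - 1}. (if j = i then 1 else if j = i + 1 \<or> i = j + 1 then - 1 / 2 else 0) * \<kappa>' j)"
   using i' by (intro sum.cong) (auto simp: tri)
  also have "\<dots> = \<kappa>' i - 1 / 2 * (if 1 < i then \<kappa>' (i - 1) else 0) - 1 / 2 * (if i < n - 1 then \<kappa>' (i + 1) else 0)"
   by (subst sum_tridiagonal[OF i']) simp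
  also have "(if 1 < i then \<kappa>' (i - 1) else 0) = sin ((real i - 1) * t)"
   using i' by (cases "i = 1") (auto simp: \<kappa>'_def of_nat_diff)
  finally have S1: "(\<Sum>j\<in>{1..n - 1}. (\<alpha> i \<bullet> \<alpha> j) * \<kappa>' j) = \<kappa>' i - 1 / 2 * sin ((real i - 1) * t)
   - 1 / 2 * (if i < n - 1 then \<kappa>' (i + 1) else 0)" .
  consider "i = n - 1" | "i = n - 2" | "i < n - 2" using i' by force
  thus ?thesis
  proof cases
   case 1
   hence "(real i - 1) * t = pi / 2 - t" using nt n4 by (simp add: of_nat_diff algebra_simps)
   hence s: "sin ((real i - 1) * t) = cos t" by (simp add: sin_diff)
   have "\<alpha> i \<bullet> \<alpha> n = 0" using 1 last[OF i'] n4 by auto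
   thus ?thesis unfolding split S1 s t_def[symmetric] cc
    using 1 by (simp add: \<kappa>'_def)
  next
   case 2
   hence "(real i + 1) * t = pi / 2" using nt n4 by (simp add: of_nat_diff algebra_simps)
   hence s1: "sin ((real i + 1) * t) = 1" by (simp only: sin_pi_half)
   have "\<alpha> i \<bullet> \<alpha> n = - 1 / 2" using 2 last[OF i'] by auto
   moreover have "\<kappa>' (i + 1) = 1 / 2" "\<kappa>' n = 1 / 2" "\<kappa>' i = sin (real i * t)" "i < n - 1"
    using 2 n4 by (auto simp: \<kappa>'_def)
   ultimately show ?thesis
    unfolding split S1 t_def[symmetric] cc using sin_neighbours[of "real i" t] s1 by simp
  next
   case 3
   have "\<alpha> i \<bullet> \<alpha> n = 0" using 3 last[OF i'] by auto
   moreover have "\<kappa>' (i + 1) = sin ((real i + 1) * t)" "\<kappa>' i = sin (real i * t)" "i < n - 1"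
    using 3 by (auto simp: \<kappa>'_def add.commute)
   ultimately show ?thesis
    unfolding split S1 t_def[symmetric] cc using sin_neighbours[of "real i" t] by simp
  qed
 qed
qed (use n4 in auto)

text \<open>Even-signed permutations preserve the product of the coordinates, while a single sign
  change negates it. This shows that no coordinate vector is a root in type D.\<close>

lemma signs_invariant:
 assumes "w \<in> refl_group \<Delta>"
 shows "(\<Prod>j\<in>{1..n}. w u \<bullet> e j) = (\<Prod>j\<in>{1..n}. u \<bullet> e j)"
proof -
 have gen: "(\<Prod>j\<in>{1..n}. reflection (\<alpha> l) u \<bullet> e j) = (\<Prod>j\<in>{1..n}. u \<bullet> e j)" if l: "l \<in> {1..n}" for l u
 proof -
  have mv: "reflection a u \<bullet> e j = u \<bullet> reflection a (e j)" for a j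
   using reflection_inner[of a u "reflection a (e j)"] by simp
  show ?thesis
  proof (cases "l = n")
   case True
   have 1: "reflection (e (n - 1) + e n) (e (n - 1)) = - e n" "reflection (e (n - 1) + e n) (e n) = - e (n - 1)"
    using reflection_swap[of "e (n - 1)" "- e n"] reflection_swap[of "e n" "- e (n - 1)"] nI
    by (auto simp: ee add.commute)
   have 2: "reflection (e (n - 1) + e n) (e j) = e j" if "j \<in> {1..n}" "j \<noteq> n - 1" "j \<noteq> n" for j
    unfolding reflection_fix_iff using that nI by (simp add: inner_add_left ee)
   show ?thesis unfolding True reflection_\<alpha>_n mv
    by (rule prod_change_two[OF _ nI(2,1,3)]) (use 1 2 in \<open>auto simp: mult.commute\<close>)
  next
   case False
   hence l': "l \<in> {1..n - 1}" "l + 1 \<in> {1..n}" "l \<noteq> l + 1" using l by auto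
   have 1: "reflection (e l - e (l + 1)) (e l) = e (l + 1)" "reflection (e l - e (l + 1)) (e (l + 1)) = e l"
    using reflection_swap[of "e l" "e (l + 1)"] reflection_swap[of "e (l + 1)" "e l"] l l'
    by (simp_all add: ee reflection_commute_diff[of "e l"])
   have 2: "reflection (e l - e (l + 1)) (e j) = e j" if "j \<in> {1..n}" "j \<noteq> l" "j \<noteq> l + 1" for j
    unfolding reflection_fix_iff using that l l' by (simp add: inner_diff_left ee)
   show ?thesis unfolding reflection_\<alpha>[OF l'(1)] mv
    by (rule prod_change_two[OF _ l l'(2,3)]) (use 1 2 in \<open>auto simp: mult.commute\<close>)
  qed
 qed
 obtain bs where "set bs \<subseteq> \<Delta>" "w = rword bs" using assms by (rule refl_groupE)
 thus ?thesis
 proof (induction bs arbitrary: w)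
  case (Cons b bs)
  obtain l where l: "l \<in> {1..n}" "b = \<alpha> l" using Cons.prems(1) unfolding \<Delta>_eq by auto
  have "set bs \<subseteq> \<Delta>" using Cons.prems by auto
  thus ?case using Cons.IH[OF _ refl] gen[OF l(1), of "rword bs u"] Cons.prems(2) l(2) by simp
 qed simp
qed

lemma orbit_D:
 assumes "coxeter_bipartition \<Delta> \<Delta>\<^sub>p \<Delta>\<^sub>m" "positive_min_eigenvector \<Delta> k"
 shows "orthogonal_orbit \<Delta> \<Delta>\<^sub>p \<Delta>\<^sub>m k (2 * n - 2) X True"
proof (rule signed_orbit[OF plane_D[OF assms]])
 show "\<exists>p\<in>X. \<exists>q\<in>X. reflection a = reflection (p - q) \<and> a \<in> span {p, q}" if "a \<in> \<Delta>" for a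
 proof -
  have s: "(1 / sqrt 2) *\<^sub>R (p - q) \<in> span {p, q}" for p q :: 'a by (simp add: span_mul span_diff span_base)
  obtain l where l: "l \<in> {1..n}" "a = \<alpha> l" using \<open>a \<in> \<Delta>\<close> unfolding \<Delta>_eq by blast
  show ?thesis
  proof (cases "l = n")
   case True
   thus ?thesis using s[of "e (n - 1)" "- e n"] l e_in_X(1)[OF nI(2)] e_in_X(2)[OF nI(1)]
    by - (rule bexI[of _ "e (n - 1)"], rule bexI[of _ "- e n"], auto simp: \<alpha>_n reflection_scaled)
  next
   case False
   hence l': "l \<in> {1..n - 1}" "l + 1 \<in> {1..n}" using l by auto
   show ?thesis using s[of "e l" "e (l + 1)"] l l' e_in_X(1)[OF l(1)] e_in_X(1)[OF l'(2)]
    by - (rule bexI[of _ "e l"], rule bexI[of _ "e (l + 1)"], auto simp: \<alpha>_lt reflection_scaled)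
  qed
 qed
 have en: "e n \<in> span J" "e (n - 1) \<in> span J" if "\<alpha> (n - 1) \<in> J" "\<alpha> n \<in> J" for J
 proof -
  have "(sqrt 2 / 2) *\<^sub>R (\<alpha> n - \<alpha> (n - 1)) \<in> span J" "(sqrt 2 / 2) *\<^sub>R (\<alpha> n + \<alpha> (n - 1)) \<in> span J"
   using that by (auto intro!: span_mul span_diff[OF span_base span_base] span_add[OF span_base span_base])
  moreover have "(sqrt 2 / 2) *\<^sub>R (\<alpha> n - \<alpha> (n - 1)) = (1 / 2) *\<^sub>R (e n + e n)"
   "(sqrt 2 / 2) *\<^sub>R (\<alpha> n + \<alpha> (n - 1)) = (1 / 2) *\<^sub>R (e (n - 1) + e (n - 1))"
   unfolding \<alpha>_n \<alpha>_lt[OF nI(4)] nI(5) by (simp_all flip: scaleR_diff_right scaleR_add_right)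
  ultimately show "e n \<in> span J" "e (n - 1) \<in> span J" by (simp_all add: scaleR_half_double)
 qed
 show "e n \<in> span \<Delta>" using en(1)[of \<Delta>] nI unfolding \<Delta>_eq by blast
 show "e l - e (l + 1) \<in> span \<Delta>" if l: "l \<in> {1..n - 1}" for l
 proof -
  have "\<alpha> l \<in> \<Delta>" using l by (auto simp: \<Delta>_eq)
  hence "sqrt 2 *\<^sub>R \<alpha> l \<in> span \<Delta>" by (intro span_mul span_base)
  thus ?thesis using l by (simp add: \<alpha>_lt)
 qed
 show "reflection p \<notin> refl_group \<Delta>" if p: "p \<in> X" for p
 proof
  assume r: "reflection p \<in> refl_group \<Delta>"
  obtain i where i: "i \<in> {1..n}" "p = e i \<or> p = - e i" using p by (rule X_cases)
  hence r': "reflection (e i) \<in> refl_group \<Delta>" using r by (auto simp: reflection_uminus)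
  have pe: "psum n \<bullet> e j = 1" if "j \<in> {1..n}" for j using that by (simp add: psum_e)
  have "reflection (e i) (psum n) \<bullet> e j = (if j = i then - 1 else 1)" if "j \<in> {1..n}" for j
   using i(1) that pe by (simp add: unit_reflection norm_e inner_diff_left ee inner_commute[of "e i" "psum n"])
  hence "(\<Prod>j\<in>{1..n}. reflection (e i) (psum n) \<bullet> e j) = (\<Prod>j\<in>{1..n}. if j = i then - 1 else 1)"
   by (intro prod.cong) auto
  also have "\<dots> = - 1" using i(1) by simp
  finally show False using signs_invariant[OF r', of "psum n"] pe by simp
 qed
 \<comment> \<open>A coordinate vector in the span needs both fork roots, and their sum and
   difference put \<open>e (n - 1)\<close> and \<open>e n\<close> into the span; one of these
   differs from \<open>p\<close> up to sign.\<close>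
 show "\<exists>r\<in>X. r \<in> span J \<and> r \<noteq> p \<and> r \<noteq> - p" if J: "J \<subseteq> \<Delta>" "p \<in> X" "p \<in> span J" for J p
 proof -
  obtain i where i: "i \<in> {1..n}" "p = e i \<or> p = - e i" using J(2) by (rule X_cases)
  hence s: "e i \<in> span J" using J(3) by (metis minus_minus span_neg)
  have "\<alpha> (n - 1) \<in> J" "\<alpha> n \<in> J"
   using i(1) nI by (intro \<alpha>_in[OF J(1) s]; simp add: \<omega>_e)+
  note m = en[OF this]
  show ?thesis
  proof (cases "i = n")
   case True
   have "e (n - 1) \<noteq> e n" "e (n - 1) \<noteq> - e n"
    using e_inj[OF nI(2,1)] e_neq_neg[OF nI(2,1)] nI(3) by simp_all
   thus ?thesis using m(2) i True e_in_X(1)[OF nI(2)] by (metis minus_minus)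
  next
   case False
   hence "e n \<noteq> e i" "e n \<noteq> - e i" using e_inj[OF nI(1) i(1)] e_neq_neg[OF nI(1) i(1)] by auto
   thus ?thesis using m(1) i(2) e_in_X(1)[OF nI(1)] by (metis minus_minus)
  qed
 qed
qed (use n4 par_D in \<open>auto simp: rt_def\<close>)

end


section \<open>Dihedral groups\<close>

context cox
begin

lemma W_eq_on_V:
 assumes "w \<in> W" "linear g" "\<And>x. x \<in> V \<Longrightarrow> w x = g x" "\<And>z. (\<And>x. x \<in> V \<Longrightarrow> x \<bullet> z = 0) \<Longrightarrow> g z = z"
 shows "w = g"
proof
 fix x
 obtain y z where yz: "y \<in> V" "\<And>u. u \<in> V \<Longrightarrow> orthogonal z u" "x = y + z"
  using orthogonal_subspace_decomp_exists[of "\<Delta>" x] by metis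
 have o: "u \<bullet> z = 0" if "u \<in> V" for u using yz(2)[OF that] by (simp add: orthogonal_def inner_commute)
 have "w z = z" by (rule refl_group_fixes[OF assms(1)]) (use o in \<open>auto intro: span_base\<close>)
 moreover have "g z = z" by (rule assms(4)[OF o])
 ultimately show "w x = g x"
  using assms(3)[OF yz(1)] linear_add[OF refl_group_linear[OF assms(1)]] linear_add[OF assms(2)] yz(3) by simp
qed

end

lemma refl_group_empty: "refl_group {} = {id}"
 by (auto simp: refl_group_eq)

lemma refl_group_single: "refl_group {b} = {id, reflection b}"
proof (intro equalityI subsetI)
 fix w assume "w \<in> refl_group {b}"
 then obtain bs where "set bs \<subseteq> {b}" "w = rword bs" by (rule refl_groupE)
 thus "w \<in> {id, reflection b}"
 proof (induction bs arbitrary: w)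
  case (Cons x bs)
  hence "rword bs \<in> {id, reflection b}" "x = b" by auto
  thus ?case using Cons.prems(2) by auto
 qed simp
qed (auto intro: id_in_refl_group reflection_in_refl_group)

lemma refl_group_funpow: "w \<in> refl_group A \<Longrightarrow> w ^^ n \<in> refl_group A"
 by (induction n) (auto simp: id_in_refl_group intro: refl_group_comp)

text \<open>Fermat's little theorem for both primes at once, since \<open>2\<close> and
  \<open>4\<close> divide \<open>4\<close>. It makes \<open>j ^ 3\<close> an inverse of
  \<open>j\<close>.\<close>

lemma fourth_power_mod:
 assumes "m = 3 \<or> m = 5" "\<not> m dvd (j::nat)"
 shows "j ^ 4 mod m = 1"
proof -
 have "j ^ 4 mod m = (j mod m) ^ 4 mod m" by (simp add: power_mod)
 moreover have "j mod m \<noteq> 0" "j mod m < m" using assms by (auto simp: mod_eq_0_iff_dvd)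
 ultimately show ?thesis using assms(1)
 proof (elim disjE)
  assume m: "m = 3"
  hence "j mod m = 1 \<or> j mod m = 2" using \<open>j mod m \<noteq> 0\<close> \<open>j mod m < m\<close> by auto
  thus ?thesis using \<open>j ^ 4 mod m = (j mod m) ^ 4 mod m\<close> m by (elim disjE) simp_all
 next
  assume m: "m = 5"
  hence "j mod m = 1 \<or> j mod m = 2 \<or> j mod m = 3 \<or> j mod m = 4"
   using \<open>j mod m \<noteq> 0\<close> \<open>j mod m < m\<close> by auto
  thus ?thesis using \<open>j ^ 4 mod m = (j mod m) ^ 4 mod m\<close> m by (elim disjE) simp_all
 qed
qed

text \<open>For prime \<open>m\<close> every nontrivial rotation generates all rotations, so any two
  distinct reflections generate the group. The values \<open>3\<close> and \<open>5\<close> cover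
  the rank two parabolic subgroups of \<open>H3\<close> with noncommuting generators.\<close>

lemma dihedral_generated:
 fixes b1 b2 g1 g2 :: "'a::euclidean_space"
 assumes m: "m = 3 \<or> m = 5" and R: "(reflection b1 \<circ> reflection b2) ^^ m = id"
  and g: "reflection g1 \<in> refl_group {b1, b2}" "reflection g2 \<in> refl_group {b1, b2}"
  and ne: "reflection g1 \<noteq> reflection g2" "g1 \<noteq> 0" "g2 \<noteq> 0"
 shows "refl_group {g1, g2} = refl_group {b1, b2}"
proof -
 define t where "t = reflection b1"
 define r where "r = reflection b1 \<circ> reflection b2"
 have tt: "t \<circ> t = id" by (simp add: t_def)
 have rm: "r ^^ m = id" using R by (simp add: r_def)
 have t2: "reflection b2 = t \<circ> r" by (simp add: t_def r_def fun_eq_iff)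
 have m1: "m = Suc (m - 1)" using m by auto
 define s where "s = r ^^ (m - 1)"
 have srt: "t \<circ> r = s \<circ> t"
 proof -
  have "r \<circ> (t \<circ> r) = t" by (simp add: t_def r_def fun_eq_iff)
  moreover have "s \<circ> r = id" using rm unfolding s_def by (metis funpow_Suc_right m1)
  ultimately show ?thesis by (metis comp_assoc id_comp)
 qed
 have trk: "t \<circ> r ^^ n = r ^^ ((m - 1) * n) \<circ> t" for n
 proof (induction n)
  case (Suc n)
  have "t \<circ> r ^^ Suc n = (t \<circ> r) \<circ> r ^^ n" by (simp add: comp_assoc)
  also have "\<dots> = s \<circ> (t \<circ> r ^^ n)" unfolding srt by (simp add: comp_assoc)
  also have "\<dots> = (s \<circ> r ^^ ((m - 1) * n)) \<circ> t" unfolding Suc by (simp add: comp_assoc)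
  also have "s \<circ> r ^^ ((m - 1) * n) = r ^^ ((m - 1) * Suc n)" unfolding s_def by (simp add: funpow_add)
  finally show ?case .
 qed simp
 have elts: "\<exists>n. w = r ^^ n \<or> w = r ^^ n \<circ> t" if w: "w \<in> refl_group {b1, b2}" for w
 proof -
  obtain bs where "set bs \<subseteq> {b1, b2}" "w = rword bs" using w by (rule refl_groupE)
  thus ?thesis
  proof (induction bs arbitrary: w)
   case Nil
   thus ?case by (intro exI[of _ 0]) simp
  next
   case (Cons x bs)
   then obtain n where n: "rword bs = r ^^ n \<or> rword bs = r ^^ n \<circ> t" by fastforce
   have A: "\<exists>n'. t \<circ> u = r ^^ n' \<or> t \<circ> u = r ^^ n' \<circ> t" if u: "u = r ^^ q \<or> u = r ^^ q \<circ> t" for u q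
   proof -
    have "t \<circ> u = r ^^ ((m - 1) * q) \<circ> t \<or> t \<circ> u = r ^^ ((m - 1) * q)"
     using u trk[of q] tt by (metis comp_assoc comp_id)
    thus ?thesis by blast
   qed
   have "x = b1 \<or> x = b2" using Cons.prems by auto
   thus ?case
   proof
    assume "x = b1"
    hence "w = t \<circ> rword bs" using Cons.prems by (auto simp: t_def fun_eq_iff)
    thus ?thesis using A[OF n] by (simp only:)
   next
    assume "x = b2"
    hence "w = t \<circ> (r \<circ> rword bs)" using Cons.prems by (auto simp: t2 fun_eq_iff)
    moreover have "r \<circ> rword bs = r ^^ Suc n \<or> r \<circ> rword bs = r ^^ Suc n \<circ> t"
     using n by (auto simp: comp_assoc)
    ultimately show ?thesis using A by metis
   qed
  qed
 qed
 have rmul: "r ^^ (q * m) = id" for q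
  using rm by (metis funpow_mult id_funpow mult.commute)
 \<comment> \<open>A reflection that is a power of \<open>r\<close> would be a rotation with trivial
   square, hence trivial because \<open>m\<close> is odd.\<close>
 have refl: "\<exists>n. reflection x = r ^^ n \<circ> t" if x: "reflection x \<in> refl_group {b1, b2}" "x \<noteq> 0" for x
 proof (rule ccontr)
  assume "\<not> ?thesis"
  then obtain n where n: "reflection x = r ^^ n" using elts[OF x(1)] by blast
  hence "r ^^ n \<circ> r ^^ n = id" by (metis reflection_comp_self)
  hence 2: "r ^^ (n + n) = id" by (simp add: funpow_add)
  obtain q where q: "m = 2 * q + 1" using m by (metis numeral_3_eq_3 Suc_eq_plus1 numeral_2_eq_2 mult_2 add_2_eq_Suc' oddE odd_numeral)
  have "r ^^ n = r ^^ n \<circ> (r ^^ (n + n)) ^^ q" unfolding 2 by simp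
  also have "\<dots> = r ^^ (n + (n + n) * q)" unfolding funpow_mult by (simp only: funpow_add)
  also have "n + (n + n) * q = n * m" by (simp add: q algebra_simps)
  finally have "reflection x = id" by (simp only: n rmul)
  thus False using reflection_self[of x] neg_eq_self[of x] x(2) by auto
 qed
 obtain k1 k2 where k: "reflection g1 = r ^^ k1 \<circ> t" "reflection g2 = r ^^ k2 \<circ> t"
  using refl g ne by blast
 \<comment> \<open>\<open>r ^^ (m - 1)\<close> is the inverse of \<open>r\<close>, so
   \<open>r ^^ j\<close> is the product of the two reflections; its power with exponent
   \<open>j ^ 3\<close> is \<open>r\<close>.\<close>
 define j where "j = k1 + (m - 1) * k2"
 have D: "reflection g1 \<circ> reflection g2 = r ^^ j"
 proof -
  have "reflection g1 \<circ> reflection g2 = r ^^ k1 \<circ> (t \<circ> r ^^ k2) \<circ> t" unfolding k by (simp add: comp_assoc)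
  also have "\<dots> = r ^^ k1 \<circ> r ^^ ((m - 1) * k2) \<circ> (t \<circ> t)" unfolding trk by (simp add: comp_assoc)
  finally show ?thesis by (simp add: tt j_def funpow_add)
 qed
 have "\<not> m dvd j"
 proof
  assume "m dvd j"
  hence "r ^^ j = id" using rmul by (metis dvdE mult.commute)
  hence "reflection g1 \<circ> reflection g2 = id" using D by simp
  hence "reflection g1 = reflection g2" by (metis comp_assoc comp_id id_comp reflection_comp_self)
  thus False using ne by simp
 qed
 hence j4: "j ^ 4 mod m = 1" using fourth_power_mod[OF m] by simp
 let ?H = "refl_group {g1, g2}"
 have "r ^^ (j * j ^ 3) = r"
 proof -
  define q where "q = j ^ 4 div m"
  have "j * j ^ 3 = j ^ 4" by (simp add: power_numeral_reduce)
  also have "\<dots> = 1 + q * m" using j4 div_mult_mod_eq[of "j ^ 4" m] by (simp add: q_def)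
  finally have "r ^^ (j * j ^ 3) = r ^^ (1 + q * m)" by simp
  also have "\<dots> = r ^^ 1 \<circ> r ^^ (q * m)" by (simp only: funpow_add)
  finally show ?thesis using rmul by simp
 qed
 moreover have "(r ^^ j) ^^ (j ^ 3) \<in> ?H"
  unfolding D[symmetric] by (intro refl_group_funpow refl_group_comp reflection_in_refl_group) auto
 ultimately have rH: "r \<in> ?H" by (simp add: funpow_mult)
 have "t = r ^^ ((m - 1) * k1) \<circ> reflection g1"
 proof -
  have "r ^^ ((m - 1) * k1) \<circ> reflection g1 = r ^^ ((m - 1) * k1 + k1) \<circ> t"
   unfolding k funpow_add by (simp add: comp_assoc)
  also have "(m - 1) * k1 + k1 = k1 * m" using m1 by (metis add.commute mult.commute mult_Suc)
  also have "r ^^ (k1 * m) = id" by (rule rmul)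
  finally show ?thesis by (simp only: id_comp)
 qed
 hence tH: "t \<in> ?H"
  using refl_group_comp[OF refl_group_funpow[OF rH] reflection_in_refl_group[of g1 "{g1, g2}"]] by simp
 hence "reflection b2 \<in> ?H" unfolding t2 using rH by (rule refl_group_comp)
 thus ?thesis using tH g by (intro equalityI refl_group_subset) (auto simp: t_def)
qed

section \<open>Type I2\<close>

locale type_I2_roots =
 fixes m :: nat and a b :: "'a::euclidean_space" and \<Delta> :: "'a set"
 assumes m: "3 \<le> m" and ab: "norm a = 1" "norm b = 1" "a \<bullet> b = - cos (pi / real m)" and \<Delta>: "\<Delta> = {a, b}"
begin

lemma ab_bound: "(a \<bullet> b) * (a \<bullet> b) < 1"
proof -
 have "sin (pi / real m) > 0" using m by (intro sin_gt_zero) (auto simp: field_simps)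
 hence "sin (pi / real m) * sin (pi / real m) > 0" by simp
 thus ?thesis using sin_cos_squared_add[of "pi / real m"] ab(3) by (simp add: power2_eq_square)
qed

lemma aa: "a \<bullet> a = 1" "b \<bullet> b = 1" "a \<noteq> b"
 using ab ab_bound by (auto simp: dot_square_norm)

lemma plane_I2:
 assumes "coxeter_bipartition \<Delta> \<Delta>\<^sub>p \<Delta>\<^sub>m" "positive_min_eigenvector \<Delta> k"
 shows "cox_plane \<Delta> \<Delta>\<^sub>p \<Delta>\<^sub>m k m"
proof (rule cox_plane_from_dual_system[where I = \<Delta> and \<alpha> = "\<lambda>x. x" and \<kappa>' = "\<lambda>_. 1"
   and \<omega> = "\<lambda>l. if l = a then a - (a \<bullet> b) *\<^sub>R b else b - (a \<bullet> b) *\<^sub>R a", OF _ _ _ _ _ _ _ assms m])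
 show "(if l = a then a - (a \<bullet> b) *\<^sub>R b else b - (a \<bullet> b) *\<^sub>R a) \<bullet> j = 0 \<longleftrightarrow> j \<noteq> l"
  if "l \<in> \<Delta>" "j \<in> \<Delta>" for l j
  using that aa ab_bound by (auto simp: \<Delta> inner_diff_left inner_commute[of b a])
 show "(\<Sum>j\<in>\<Delta>. (i \<bullet> j) * 1) = (1 - cos (pi / real m)) * 1" if "i \<in> \<Delta>" for i
  using that aa ab(3) by (auto simp: \<Delta> inner_commute[of b a])
qed (use \<Delta> ab in auto)

text \<open>The plane is all of \<open>V\<close>, so nothing collapses and both sides are true. A
  single reflection starts a word of length two for \<open>c\<close>, and its blocks lie on distinct
  parallel lines; the trivial and the full group are immediate.\<close>

theorem noncrossing_iff_I2:
 assumes "coxeter_bipartition \<Delta> \<Delta>\<^sub>p \<Delta>\<^sub>m" "positive_min_eigenvector \<Delta> k"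
  and X: "x0 \<in> span \<Delta>" "X = orbit_of (refl_group \<Delta>) x0" and H: "parabolic \<Delta> H"
 shows "noncrossing_parabolic \<Delta> (bipartite_coxeter_element \<Delta>\<^sub>p \<Delta>\<^sub>m) H \<longleftrightarrow>
  (\<forall>B\<in>blocks H X. \<forall>B'\<in>blocks H X. B \<noteq> B' \<longrightarrow> noncrossing_blocks (coxeter_plane k \<Delta>\<^sub>p \<Delta>\<^sub>m) B B')"
proof -
 interpret cox_plane \<Delta> \<Delta>\<^sub>p \<Delta>\<^sub>m k m by (rule plane_I2[OF assms(1,2)])
 have V: "span {E1, E2} = V"
 proof (rule subspace_dim_equal)
  show "span {E1, E2} \<subseteq> V" using E_in_V by (intro span_minimal) auto
  have ne: "E1 \<noteq> E2" using E_orthonormal by auto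
  have "pairwise orthogonal {E1, E2}"
   using E_orthonormal by (auto simp: pairwise_def orthogonal_def inner_commute)
  moreover have "0 \<notin> {E1, E2}" using E_orthonormal by auto
  ultimately have "independent {E1, E2}" by (rule pairwise_orthogonal_independent)
  hence "dim (span {E1, E2}) = 2" using ne by (simp add: dim_eq_card_independent)
  moreover have "card \<Delta> = 2" using aa by (simp add: \<Delta>)
  ultimately show "dim V \<le> dim (span {E1, E2})" using dim_V by simp
 qed auto
 \<comment> \<open>A quarter turn; \<open>y\<close> and \<open>rot y\<close> form an orthogonal
   basis of \<open>V\<close> for every nonzero \<open>y\<close> in \<open>V\<close>.\<close>
 define rot where "rot y = (- (y \<bullet> E2)) *\<^sub>R E1 + (y \<bullet> E1) *\<^sub>R E2" for y
 have rotV: "rot y \<in> V" for y unfolding rot_def using E_in_V by (intro span_add span_mul)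
 have rotE: "rot y \<bullet> E1 = - (y \<bullet> E2)" "rot y \<bullet> E2 = y \<bullet> E1" for y
  using E_orthonormal by (simp_all add: rot_def inner_add_left inner_diff_left inner_commute[of E2 E1])
 have exp: "y = (y \<bullet> E1) *\<^sub>R E1 + (y \<bullet> E2) *\<^sub>R E2" if "y \<in> V" for y
  by (rule plane_eqI) (use that V E_orthonormal E_in_V in \<open>auto simp: inner_add_left inner_commute[of E2 E1] intro!: span_add span_mul\<close>)
 have inn: "y \<bullet> u = (y \<bullet> E1) * (u \<bullet> E1) + (y \<bullet> E2) * (u \<bullet> E2)" if "y \<in> V" for y u
  by (subst exp[OF that]) (simp add: inner_add_left inner_add_right inner_commute)
 have rot_perp: "y \<bullet> rot y = 0" if "y \<in> V" for y using inn[OF that, of "rot y"] rotE[of y] by simp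
 have rot_norm: "rot y \<bullet> rot y = y \<bullet> y" if "y \<in> V" for y
  using inn[OF rotV, of y "rot y"] inn[OF that, of y] rotE[of y] by simp
 have dec: "(y \<bullet> y) *\<^sub>R u = (u \<bullet> y) *\<^sub>R y + (u \<bullet> rot y) *\<^sub>R rot y" if "y \<in> V" "u \<in> V" for y u
 proof (rule plane_eqI)
  show "(y \<bullet> y) *\<^sub>R u \<in> span {E1, E2}" "(u \<bullet> y) *\<^sub>R y + (u \<bullet> rot y) *\<^sub>R rot y \<in> span {E1, E2}"
   unfolding V using that rotV by (auto intro!: span_add span_mul)
  show "((y \<bullet> y) *\<^sub>R u) \<bullet> E1 = ((u \<bullet> y) *\<^sub>R y + (u \<bullet> rot y) *\<^sub>R rot y) \<bullet> E1"
   unfolding inner_add_left inner_scaleR_left inn[OF that(1), of y] inn[OF that(2), of y]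
    inn[OF that(2), of "rot y"] rotE by algebra
  show "((y \<bullet> y) *\<^sub>R u) \<bullet> E2 = ((u \<bullet> y) *\<^sub>R y + (u \<bullet> rot y) *\<^sub>R rot y) \<bullet> E2"
   unfolding inner_add_left inner_scaleR_left inn[OF that(1), of y] inn[OF that(2), of y]
    inn[OF that(2), of "rot y"] rotE by algebra
 qed
 \<comment> \<open>An isometry of a plane that fixes a line pointwise and is not the identity is the
   reflection in that line.\<close>
 have mirror: "\<exists>u. root_of \<Delta> u \<and> w = reflection u" if w: "w \<in> W" "w \<noteq> id" and x: "x \<in> V" "x \<noteq> 0" "w x = x" for w x
 proof -
  define u where "u = rot x"
  have uV: "u \<in> V" by (simp add: u_def rotV)
  have xu: "x \<bullet> u = 0" "u \<bullet> u = x \<bullet> x" using rot_perp rot_norm x(1) by (auto simp: u_def)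
  have u0: "u \<noteq> 0" using xu(2) x(2) by auto
  have lin: "linear w" using w(1) by (rule refl_group_linear)
  have wuV: "w u \<in> V" using refl_group_in_span[OF w(1) uV] .
  have wux: "w u \<bullet> x = 0" using refl_group_inner[OF w(1), of u x] x(3) xu(1) by (simp add: inner_commute)
  define r where "r = (w u \<bullet> u) / (x \<bullet> x)"
  have "(x \<bullet> x) *\<^sub>R w u = (w u \<bullet> u) *\<^sub>R u" using dec[OF x(1) wuV] wux by (simp add: u_def)
  hence "(1 / (x \<bullet> x)) *\<^sub>R ((x \<bullet> x) *\<^sub>R w u) = (1 / (x \<bullet> x)) *\<^sub>R ((w u \<bullet> u) *\<^sub>R u)" by simp
  hence wu: "w u = r *\<^sub>R u" using x(2) by (simp add: r_def)
  have "r * r * (u \<bullet> u) = u \<bullet> u" using refl_group_inner[OF w(1), of u u] unfolding wu by simp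
  hence "(r - 1) * (r + 1) = 0" using u0 by (simp add: algebra_simps)
  moreover have "r \<noteq> 1"
  proof
   assume "r = 1"
   have "w = id"
   proof (rule W_eq_on_V[OF w(1) linear_id])
    fix y assume y: "y \<in> V"
    have "w ((x \<bullet> x) *\<^sub>R y) = (x \<bullet> x) *\<^sub>R y"
     unfolding dec[OF x(1) y] u_def[symmetric] using lin x(3) wu \<open>r = 1\<close>
     by (simp add: linear_add linear_cmul)
    thus "w y = id y" using x(2) lin by (simp add: linear_cmul)
   qed simp
   thus False using w(2) by simp
  qed
  ultimately have wu': "w u = - u" using wu by (auto simp: add_eq_0_iff2)
  have "w = reflection u"
  proof (rule W_eq_on_V[OF w(1) linear_reflection])
   fix y assume y: "y \<in> V"
   have fx: "reflection u x = x" using xu(1) by (simp add: reflection_fix_iff inner_commute)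
   have "w ((x \<bullet> x) *\<^sub>R y) = reflection u ((x \<bullet> x) *\<^sub>R y)"
    unfolding dec[OF x(1) y] u_def[symmetric] using lin x(3) wu' fx
    by (simp add: linear_add linear_cmul reflection_add reflection_scaleR reflection_self)
   thus "w y = reflection u y" using x(2) lin by (simp add: linear_cmul reflection_scaleR)
  next
   fix z assume "\<And>x. x \<in> V \<Longrightarrow> x \<bullet> z = 0"
   thus "reflection u z = z" using uV by (simp add: reflection_fix_iff)
  qed
  thus ?thesis using w(1) u0 by (auto simp: root_of_def)
 qed
 have card: "card \<Delta> = 2" using aa by (simp add: \<Delta>)
 obtain J w where J: "J \<subseteq> \<Delta>" "w \<in> W" "H = refl_group (w ` J)" using H unfolding parabolic_iff by blast
 have simple_root: "root_of \<Delta> \<alpha>" if "\<alpha> \<in> \<Delta>" for \<alpha>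
  using that simple_nonzero reflection_in_refl_group by (auto simp: root_of_def)
 have "J = {} \<or> J = {a} \<or> J = {b} \<or> J = \<Delta>" using J(1) by (auto simp: \<Delta>)
 then consider "J = {}" | \<alpha> where "\<alpha> \<in> \<Delta>" "J = {\<alpha>}" | "J = \<Delta>" by (auto simp: \<Delta>)
 note Jcases = this
 have nc: "noncrossing_parabolic \<Delta> c H"
  using Jcases
 proof cases
  case 1
  obtain L where L: "set L = \<Delta>" "distinct L" "c = rword L" by (rule coxeter_word)
  hence "length L = card \<Delta>" by (metis distinct_card)
  thus ?thesis unfolding noncrossing_parabolic_iff using H L simple_root J(3) 1
   by (intro conjI exI[of _ "[]"] exI[of _ L]) auto
 next
  case 2
  define b0 where "b0 = w \<alpha>"
  have rb: "root_of \<Delta> b0" unfolding b0_def using 2 by (intro root_of_conj[OF J(2)] simple_root)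
  hence b0: "b0 \<noteq> 0" "reflection b0 \<in> W" by (auto simp: root_of_def)
  obtain v where v: "v \<in> V" "c (v - b0) = v" using c_solve[OF root_of_in_span[OF rb]] by blast
  have "reflection b0 \<circ> c \<noteq> id"
  proof
   assume "reflection b0 \<circ> c = id"
   hence "rword [b0] = c" by (simp add: fun_eq_iff) (metis reflection_reflection)
   thus False using coxeter_word_length[of "[b0]"] root_of_in_span[OF rb] card by simp
  qed
  moreover have "reflection b0 \<circ> c \<in> W" by (rule refl_group_comp[OF b0(2) c_in_W])
  moreover have "v - b0 \<in> V" using v(1) root_of_in_span[OF rb] by (rule span_diff)
  moreover have "v - b0 \<noteq> 0" using v(2) b0(1) linear_0[OF linear_c] by auto
  moreover have "(reflection b0 \<circ> c) (v - b0) = v - b0"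
   using v(2) c_solution_reflection[OF v(2) b0(1)] by simp
  ultimately obtain u where u: "root_of \<Delta> u" "reflection b0 \<circ> c = reflection u" using mirror by blast
  have "rword ([b0] @ [u]) = c" by (simp add: u(2)[symmetric] fun_eq_iff)
  thus ?thesis unfolding noncrossing_parabolic_iff using H J(3) 2 rb u(1) card
   by (intro conjI exI[of _ "[b0]"] exI[of _ "[u]"]) (auto simp: b0_def)
 next
  case 3
  thus ?thesis using noncrossing_full refl_group_conj_self[OF J(2)] J(3) by simp
 qed
 have XV: "p \<in> V" "p \<bullet> p = x0 \<bullet> x0" if "p \<in> X" for p
  using that X refl_group_in_span[OF _ X(1)] refl_group_inner[of _ \<Delta> x0 x0] by (auto simp: orbit_of_def)
 have WX: "g p \<in> X" if "p \<in> X" "g \<in> W" for g p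
 proof -
  obtain g' where "g' \<in> W" "p = g' x0" using \<open>p \<in> X\<close> X(2) by (auto simp: orbit_of_def)
  hence "g p = (g \<circ> g') x0" "g \<circ> g' \<in> W" using refl_group_comp[OF \<open>g \<in> W\<close>] by auto
  thus ?thesis unfolding X(2) orbit_of_def by blast
 qed
 have HW: "H \<subseteq> W" unfolding J(3)
  using J(1,2) by (intro refl_group_subset) (auto intro: reflection_conj_in_refl_group reflection_in_refl_group)
 have proj: "orth_proj (coxeter_plane k \<Delta>\<^sub>p \<Delta>\<^sub>m) p = p" if "p \<in> V" for p
  unfolding plane_eq V using that by (intro orth_proj_eqI) auto
 have hull: "block_hull (coxeter_plane k \<Delta>\<^sub>p \<Delta>\<^sub>m) B = convex hull B" if "B \<subseteq> X" for B
 proof -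
  have "orth_proj (coxeter_plane k \<Delta>\<^sub>p \<Delta>\<^sub>m) ` B = B" using that proj XV by force
  thus ?thesis by (simp add: block_hull_def)
 qed
 have blk: "noncrossing_blocks (coxeter_plane k \<Delta>\<^sub>p \<Delta>\<^sub>m) B B'"
  if B: "B \<in> blocks H X" "B' \<in> blocks H X" "B \<noteq> B'" for B B'
 proof -
  obtain p q where pq: "p \<in> X" "q \<in> X" "B = orbit_of H p" "B' = orbit_of H q" using B by (auto simp: blocks_def)
  have sub: "B \<subseteq> X" "B' \<subseteq> X" using pq WX HW by (auto simp: orbit_of_def)
  have "block_hull (coxeter_plane k \<Delta>\<^sub>p \<Delta>\<^sub>m) B \<inter> block_hull (coxeter_plane k \<Delta>\<^sub>p \<Delta>\<^sub>m) B' = {}"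
   unfolding hull[OF sub(1)] hull[OF sub(2)]
   using Jcases
  proof cases
   case 1
   hence "H = {id}" using J(3) refl_group_empty by simp
   thus "convex hull B \<inter> convex hull B' = {}" using pq B(3) by (auto simp: orbit_of_def)
  next
   case 2
   define \<beta> where "\<beta> = w \<alpha>"
   have "root_of \<Delta> \<beta>" unfolding \<beta>_def by (rule root_of_conj[OF J(2) simple_root[OF 2(1)]])
   hence \<beta>V: "\<beta> \<in> V" "\<beta> \<noteq> 0" by (auto simp: root_of_in_span) (auto simp: root_of_def)
   have Hb: "H = {id, reflection \<beta>}" using J(3) 2 refl_group_single[of \<beta>] by (simp add: \<beta>_def)
   define u where "u = rot \<beta>"
   have ub: "\<beta> \<bullet> u = 0" using rot_perp[OF \<beta>V(1)] by (simp add: u_def)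
   have ru: "reflection \<beta> y \<bullet> u = y \<bullet> u" for y using ub by (simp add: reflection_def inner_diff_left)
   have lev: "y \<bullet> u = p \<bullet> u" if "y \<in> convex hull B" for y
   proof -
    have "convex hull B \<subseteq> {y. u \<bullet> y = u \<bullet> p}"
     by (intro hull_minimal convex_hyperplane)
      (use pq Hb ru[of p] in \<open>auto simp: orbit_of_def inner_commute[of u]\<close>)
    thus ?thesis using that by (auto simp: inner_commute)
   qed
   have lev': "y \<bullet> u = q \<bullet> u" if "y \<in> convex hull B'" for y
   proof -
    have "convex hull B' \<subseteq> {y. u \<bullet> y = u \<bullet> q}"
     by (intro hull_minimal convex_hyperplane)
      (use pq Hb ru[of q] in \<open>auto simp: orbit_of_def inner_commute[of u]\<close>)
    thus ?thesis using that by (auto simp: inner_commute)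
   qed
   have "p \<bullet> u \<noteq> q \<bullet> u"
   proof
    assume e: "p \<bullet> u = q \<bullet> u"
    have "p - q \<in> V" using XV(1) pq(1,2) by (intro span_diff)
    from dec[OF \<beta>V(1) this] have d: "(\<beta> \<bullet> \<beta>) *\<^sub>R (p - q) = ((p - q) \<bullet> \<beta>) *\<^sub>R \<beta>"
     using e by (simp add: inner_diff_left u_def)
    have "reflection \<beta> p = q" if "p \<noteq> q"
    proof -
     have bb: "\<beta> \<bullet> \<beta> \<noteq> 0" using \<beta>V(2) by simp
     hence "(p - q) \<bullet> \<beta> \<noteq> 0" using d that by auto
     hence "reflection \<beta> = reflection (p - q)" using reflection_scaled[OF bb, of "p - q"] d by (simp add: reflection_scaled)
     thus ?thesis using reflection_swap[of p q] XV(2) pq(1,2) by simp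
    qed
    hence "q = p \<or> q = reflection \<beta> p" by blast
    thus False using B(3) pq Hb by (auto simp: orbit_of_def)
   qed
   thus "convex hull B \<inter> convex hull B' = {}" using lev lev' by fastforce
  next
   case 3
   hence "H = W" using J(3) refl_group_conj_self[OF J(2)] by simp
   have "orbit_of W p = X" if p: "p \<in> X" for p
   proof -
    obtain g where g: "g \<in> W" "p = g x0" using p X(2) by (auto simp: orbit_of_def)
    obtain g' where g': "g' \<in> W" "\<And>x. g' (g x) = x" using refl_group_inverse[OF g(1)] by metis
    have "h x0 \<in> orbit_of W p" if "h \<in> W" for h
     unfolding orbit_of_def g(2)
     by (rule image_eqI[of _ _ "h \<circ> g'"]) (use refl_group_comp[OF that g'(1)] g'(2) in auto)
    thus ?thesis using WX[OF p] unfolding X(2) by (auto simp: orbit_of_def)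
   qed
   thus "convex hull B \<inter> convex hull B' = {}" using B(3) pq \<open>H = W\<close> by simp
  qed
  thus ?thesis by (simp add: noncrossing_blocks_def)
 qed
 show ?thesis using nc blk by blast
qed

end


section \<open>Icosahedral orbits\<close>

text \<open>For \<open>t = pi / 5\<close> the angles \<open>3 * t\<close> and \<open>2 * t\<close>
  add up to \<open>pi\<close>. Comparing their cosines gives a cubic equation with the factor
  \<open>x + 1\<close>, and the sign of \<open>x\<close> selects the root.\<close>

lemma cos_pi_5: "cos (pi / 5) = (1 + sqrt 5) / 4"
proof -
 define x where "x = cos (pi / 5)"
 have x0: "0 < x" unfolding x_def by (rule cos_gt_zero) (auto simp: field_simps)
 have "cos (3 * (pi / 5)) = - cos (2 * (pi / 5))"
  using cos_pi_minus[of "2 * (pi / 5)"] by (simp add: algebra_simps)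
 hence "4 * x ^ 3 - 3 * x = - (2 * x\<^sup>2 - 1)"
  unfolding cos_treble_cos cos_double_cos x_def by simp
 hence "(x + 1) * (4 * x\<^sup>2 - 2 * x - 1) = 0" by (simp add: algebra_simps power2_eq_square power3_eq_cube)
 hence "4 * x\<^sup>2 - 2 * x - 1 = 0" using x0 by simp
 hence "(4 * x - 1)\<^sup>2 = 5" by (simp add: power2_eq_square algebra_simps)
 hence "sqrt 5 = \<bar>4 * x - 1\<bar>" by (metis real_sqrt_abs)
 moreover have "0 \<le> 4 * x - 1"
 proof (rule ccontr)
  assume "\<not> ?thesis"
  hence "\<bar>4 * x - 1\<bar> < 1" using x0 by simp
  moreover have "1 < sqrt 5" by simp
  ultimately show False using \<open>sqrt 5 = \<bar>4 * x - 1\<bar>\<close> by simp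
 qed
 ultimately show ?thesis unfolding x_def[symmetric] by simp
qed

lemma cos_2pi_5: "cos (2 * pi / 5) = (sqrt 5 - 1) / 4"
 using cos_double_cos[of "pi / 5"] unfolding cos_pi_5 by (simp add: power2_eq_square field_simps)

lemma sqrt_5_bounds: "2 < sqrt 5" "sqrt 5 < 3"
 by (auto intro: real_less_rsqrt real_less_lsqrt simp: power2_eq_square)

text \<open>The directions of the axes of a regular icosahedron with vertex set \<open>X\<close>, where \<open>s\<close> is the
 inner product of adjacent vertices.\<close>

definition axis :: "real \<Rightarrow> 'a::euclidean_space set \<Rightarrow> 'a \<Rightarrow> bool" where
 "axis s X u \<longleftrightarrow> u \<in> X \<or> (\<exists>p\<in>X. \<exists>q\<in>X. p \<bullet> q = s \<and> u = p + q) \<or>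
  (\<exists>p\<in>X. \<exists>q\<in>X. \<exists>r\<in>X. p \<bullet> q = s \<and> q \<bullet> r = s \<and> p \<bullet> r = s \<and> u = p + q + r)"

text \<open>\<open>P\<close> lists, over all vertices, the values of the two functionals compared in
  \<open>centre_small\<close>: the product with a sum of five consecutive polygon vertices and, up
  to sign, with a centre point. The excluded combinations are the two opposite centre
  points.\<close>

lemma vertex_pairs_bound:
 fixes S s A B A' B' :: real
 assumes "0 < s" "2 * s < S" "S < 3 * s"
  and P: "P = {(S, s), (S + 2 * s, - s), (S + 4 * s, s), (s, S), (- S, - s), (- S - 2 * s, s), (- S - 4 * s, - s), (- s, - S)}"
  and "(A, B) \<in> P" "(A', B') \<in> P" "\<not> (A = s \<and> A' = - s)" "\<not> (A = - s \<and> A' = s)"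
 shows "\<bar>B - B'\<bar> \<le> \<bar>A - A'\<bar>"
proof -
 have "\<forall>(A, B)\<in>P. \<forall>(A', B')\<in>P. \<not> (A = s \<and> A' = - s) \<longrightarrow> \<not> (A = - s \<and> A' = s) \<longrightarrow>
   (B - B' \<le> A - A' \<and> B' - B \<le> A - A') \<or> (B - B' \<le> A' - A \<and> B' - B \<le> A' - A)"
  unfolding P using assms(1-3) by simp
 hence "(B - B' \<le> A - A' \<and> B' - B \<le> A - A') \<or> (B - B' \<le> A' - A \<and> B' - B \<le> A' - A)"
  using assms(5-8) by fast
 thus ?thesis by linarith
qed

text \<open>\<open>axis_ex\<close> describes each standard rank two subgroup by its fixed line, and
  \<open>generated\<close> recovers the subgroup from any two of its reflections.\<close>

locale icosahedral_orbit = cox_orbit +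
 fixes s :: real
 assumes h10: "h = 10" and ii: ii and rank3: "card \<Delta> = 3" and s_pos: "0 < s"
  and self: "p \<in> X \<Longrightarrow> p \<bullet> p = sqrt 5 * s"
  and other: "p \<in> X \<Longrightarrow> q \<in> X \<Longrightarrow> p \<noteq> q \<Longrightarrow> p \<noteq> - q \<Longrightarrow> p \<bullet> q = s \<or> p \<bullet> q = - s"
  and axis_ex: "J \<subseteq> \<Delta> \<Longrightarrow> card J = 2 \<Longrightarrow> \<exists>u. axis s X u \<and> (\<forall>x\<in>V. x \<in> span J \<longleftrightarrow> x \<bullet> u = 0)"
  and generated: "J \<subseteq> \<Delta> \<Longrightarrow> card J = 2 \<Longrightarrow> g \<noteq> 0 \<Longrightarrow> g' \<noteq> 0 \<Longrightarrow> reflection g \<in> refl_group J \<Longrightarrow>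
   reflection g' \<in> refl_group J \<Longrightarrow> reflection g \<noteq> reflection g' \<Longrightarrow> refl_group {g, g'} = refl_group J"
begin

definition S :: real where "S = sqrt 5 * s"

lemma sS: "2 * s < S" "S < 3 * s" "0 < S"
 using sqrt_5_bounds s_pos by (auto simp: S_def)

lemma self': "p \<in> X \<Longrightarrow> p \<bullet> p = S"
 using self by (simp add: S_def)

lemma inner_s_distinct: "p \<in> X \<Longrightarrow> q \<in> X \<Longrightarrow> p \<bullet> q = s \<Longrightarrow> p \<noteq> q \<and> p \<noteq> - q"
proof -
 assume *: "p \<in> X" "q \<in> X" "p \<bullet> q = s"
 have "s \<noteq> S" "s \<noteq> - S" using sS s_pos by linarith+
 moreover have "p = q \<Longrightarrow> s = S" "p = - q \<Longrightarrow> s = - S" using * self'[OF *(2)] by simp_all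
 ultimately show "p \<noteq> q \<and> p \<noteq> - q" by blast
qed

lemma z5: "z (i + 5) = - z i"
 using z_half[OF ii, of i] by (simp add: h10)

lemma centre_nonempty: "Cn \<noteq> {}"
 using centre_ex[OF ii] by auto

lemma z_centre:
 assumes "q \<in> Cn"
 shows "z i \<bullet> q = s \<or> z i \<bullet> q = - s"
proof (rule other)
 show "z i \<noteq> - q"
 proof
  assume "z i = - q"
  hence "q = z (i + 5)" unfolding z5 by simp
  thus False using assms by auto
 qed
qed (use assms z_in_X in auto)

lemma centre_E: "q \<in> Cn \<Longrightarrow> q \<bullet> E1 = 0 \<and> q \<bullet> E2 = 0"
 using centre_coord[of q] by (simp add: coord_def complex_eq_iff)

text \<open>The rank is three, so \<open>V\<close> is the plane plus the line of the centre
  points.\<close>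

lemma inner_expand:
 assumes q: "q \<in> Cn" and x: "x \<in> V"
 shows "x \<bullet> y = (x \<bullet> E1) * (y \<bullet> E1) + (x \<bullet> E2) * (y \<bullet> E2) + (x \<bullet> q) * (y \<bullet> q) / S"
proof -
 note qE = centre_E[OF q]
 have qq: "q \<bullet> q = S" using q self' by auto
 have q0: "q \<noteq> 0" using qq sS(3) by auto
 have dist: "E1 \<noteq> E2" "q \<noteq> E1" "q \<noteq> E2" using E_orthonormal qE by auto
 have "pairwise orthogonal {E1, E2, q}"
  using E_orthonormal qE by (auto simp: pairwise_def orthogonal_def inner_commute)
 moreover have "0 \<notin> {E1, E2, q}" using E_orthonormal q0 by auto
 ultimately have "independent {E1, E2, q}" by (rule pairwise_orthogonal_independent)
 hence "dim (span {E1, E2, q}) = 3" using dist by (simp add: dim_eq_card_independent)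
 moreover have sub: "{E1, E2, q} \<subseteq> V" using E_in_V q X_in_V by auto
 ultimately have V: "span {E1, E2, q} = V"
  using dim_V rank3 by (intro subspace_dim_equal span_minimal) auto
 define d where "d = x - ((x \<bullet> E1) *\<^sub>R E1 + (x \<bullet> E2) *\<^sub>R E2 + ((x \<bullet> q) / S) *\<^sub>R q)"
 have dV: "d \<in> span {E1, E2, q}"
  unfolding V d_def using x E_in_V sub by (intro span_diff span_add span_mul) auto
 have "orthogonal d b" if "b \<in> {E1, E2, q}" for b
  using that E_orthonormal qE qq sS(3)
  by (auto simp: orthogonal_def d_def inner_diff_left inner_add_left inner_commute[of E2 E1] inner_commute[of E1 q] inner_commute[of E2 q])
 hence "orthogonal d d" by (rule orthogonal_to_span[OF dV])
 hence "d = 0" by (simp add: orthogonal_def)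
 hence e: "x = (x \<bullet> E1) *\<^sub>R E1 + (x \<bullet> E2) *\<^sub>R E2 + ((x \<bullet> q) / S) *\<^sub>R q"
  by (simp add: d_def)
 show ?thesis by (subst e) (simp add: inner_add_left inner_commute[of E1 y] inner_commute[of E2 y] inner_commute[of q y])
qed

definition g :: "int \<Rightarrow> real" where "g i = z 0 \<bullet> z i"

lemma z_g: "z i \<bullet> z j = g (j - i)"
 unfolding g_def by (rule z_inner)

lemma g_minus: "g (- i) = g i"
 unfolding g_def by (rule z_inner_even)

lemma g_add5: "g (i + 5) = - g i"
 unfolding g_def by (simp add: z5)

text \<open>The polygon vertices lie alternately above and below the plane, and subtracting this
  height from the length gives the radius by \<open>R * R = 4 * S / 5\<close>. The values of the
  cosines then make \<open>z i\<close> adjacent to both \<open>z (i + 1)\<close> and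
  \<open>z (i + 2)\<close>: the polygon is a Petrie decagon.\<close>

lemma g_small: "g 0 = S" "g 1 = s" "g 2 = s"
proof -
 obtain q where q: "q \<in> Cn" using centre_nonempty by auto
 define R where "R = cmod (coord p0)"
 have zV: "z i \<in> V" for i using z_in_X X_in_V by auto
 have E: "(z 0 \<bullet> E1) * (z i \<bullet> E1) + (z 0 \<bullet> E2) * (z i \<bullet> E2) = R * R * cos (2 * pi * i / 10)" for i
 proof -
  let ?a = "Arg (coord p0) + 2 * pi * i / h" and ?b = "Arg (coord p0)"
  have "(z 0 \<bullet> E1) * (z i \<bullet> E1) + (z 0 \<bullet> E2) * (z i \<bullet> E2) = R * R * cos (?a - ?b)"
   unfolding z_E R_def cos_diff[of ?a ?b] by (simp add: algebra_simps)
  also have "?a - ?b = 2 * pi * i / 10" using h10 by simp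
  finally show ?thesis .
 qed
 have G: "g i = R * R * cos (2 * pi * i / 10) + (z 0 \<bullet> q) * (z i \<bullet> q) / S" for i
  unfolding g_def by (subst inner_expand[OF q zV]) (simp only: E)
 have q1: "z 1 \<bullet> q = - (z 0 \<bullet> q)" using centre_z_Suc[OF q, of 0] by simp
 have q2: "z 2 \<bullet> q = z 0 \<bullet> q" using centre_z_Suc[OF q, of 1] q1 by simp
 have qs: "(z 0 \<bullet> q) * (z 0 \<bullet> q) = s * s" using z_centre[OF q, of 0] by auto
 show g0: "g 0 = S" using self'[OF z_in_X] by (simp add: g_def)
 have t: "s * s / S = S / 5" using s_pos by (simp add: S_def field_simps)
 have RR: "R * R = 4 * S / 5" using G[of 0] g0 qs t sS(3) by (simp add: field_simps)
 have "g 1 = R * R * ((1 + sqrt 5) / 4) - S / 5"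
  using G[of 1] cos_pi_5 q1 qs t by simp
 thus "g 1 = s" unfolding RR by (simp add: S_def field_simps)
 have "g 2 = R * R * ((sqrt 5 - 1) / 4) + S / 5"
  using G[of 2] cos_2pi_5 q2 qs t by simp
 thus "g 2 = s" unfolding RR by (simp add: S_def field_simps)
qed

lemma g_values: "g 3 = - s" "g 4 = - s" "g 5 = - S" "g 6 = - s" "g 7 = - s" "g 8 = s" "g 9 = s"
 "g (- 1) = s" "g (- 2) = s" "g (- 3) = - s" "g (- 4) = - s"
 using g_add5[of "- 2"] g_add5[of "- 1"] g_add5[of 0] g_add5[of 1] g_add5[of 2] g_add5[of 3] g_add5[of 4]
  g_minus[of 1] g_minus[of 2] g_minus[of 3] g_minus[of 4] g_small by simp_all

lemmas g_vals = g_small g_values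

lemma z_eq_iff_10: "z i = z j \<longleftrightarrow> 10 dvd i - j"
 unfolding z_eq_iff by (simp add: h10)

lemma int_mod_10: "\<exists>r\<in>{0, 1, 2, 3, 4, 5, 6, 7, 8, 9}. 10 dvd i - (r :: int)"
proof (rule bexI[of _ "i mod 10"])
 show "10 dvd i - i mod 10" by (rule dvd_minus_mod)
 have "0 \<le> i mod 10" "i mod 10 < 10" by auto
 thus "i mod 10 \<in> {0, 1, 2, 3, 4, 5, 6, 7, 8, 9}" by (auto simp: set_eq_iff) presburger
qed

lemma z_rel: "\<exists>r\<in>{0, 1, 2, 3, 4, 5, 6, 7, 8, 9}. z j = z (i + r)"
 using int_mod_10[of "j - i"] by (auto simp: z_eq_iff_10 diff_diff_eq)

text \<open>Written this way, \<open>g\<close> is visibly a nondecreasing function of the cosine,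
  which gives \<open>g_mono\<close> and \<open>g_neg\<close>.\<close>

lemma cos_g: "g i = (let t = cos (2 * pi * i / h) in
  if t = 1 then S else if 0 < t then s else if - 1 < t then - s else - S)"
proof -
 obtain r where r: "r \<in> {0, 1, 2, 3, 4, 5, 6, 7, 8, 9}" "10 dvd i - (r :: int)" using int_mod_10 by blast
 have "z i = z r" using r(2) by (simp only: z_eq_iff_10)
 hence gi: "g i = g r" by (simp add: g_def)
 obtain n where "i - r = 10 * n" using r(2) by (rule dvdE)
 hence n: "i = r + 10 * n" by simp
 have "2 * pi * i / h = 2 * pi * r / 10 - 2 * pi * of_int (- n)"
  unfolding n h10 by (simp add: field_simps)
 hence t: "cos (2 * pi * i / h) = cos (pi * r / 5)" by (simp only: cos_minus_int_2pi) simp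
 define a b where "a = cos (pi / 5)" and "b = cos (2 * pi / 5)"
 have ab: "0 < a" "a < 1" "0 < b" "b < 1"
  unfolding a_def b_def cos_pi_5 cos_2pi_5 using sqrt_5_bounds by auto
 have "cos (pi * 2 / 5) = b" by (simp add: b_def mult.commute)
 moreover have "cos (pi * 3 / 5) = - b" unfolding b_def using cos_pi_minus[of "2 * pi / 5"] by (simp add: algebra_simps)
 moreover have "cos (pi * 4 / 5) = - a" unfolding a_def using cos_pi_minus[of "pi / 5"] by (simp add: algebra_simps)
 moreover have "cos (pi * 6 / 5) = - a" unfolding a_def using cos_periodic_pi[of "pi / 5"] by (simp add: algebra_simps)
 moreover have "cos (pi * 7 / 5) = - b" unfolding b_def using cos_periodic_pi[of "2 * pi / 5"] by (simp add: algebra_simps)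
 moreover have "cos (pi * 8 / 5) = b" unfolding b_def using cos_2pi_minus[of "2 * pi / 5"] by (simp add: algebra_simps)
 moreover have "cos (pi * 9 / 5) = a" unfolding a_def using cos_2pi_minus[of "pi / 5"] by (simp add: algebra_simps)
 moreover have "cos (pi / 5) = a" by (simp add: a_def)
 moreover note ab
 moreover from r(1) have "r = 0 \<or> r = 1 \<or> r = 2 \<or> r = 3 \<or> r = 4 \<or> r = 5 \<or> r = 6 \<or> r = 7 \<or> r = 8 \<or> r = 9" by simp
 ultimately show ?thesis unfolding gi t by (elim disjE) (simp_all add: g_vals)
qed

lemma g_mono:
 assumes "cos (2 * pi * i / h) \<le> cos (2 * pi * j / h)"
 shows "z 0 \<bullet> z i \<le> z 0 \<bullet> z j"
proof -
 have "(if a = 1 then S else if 0 < a then s else if - 1 < a then - s else - S) \<le>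
   (if b = 1 then S else if 0 < b then s else if - 1 < b then - s else - S)" if "a \<le> b" "b \<le> 1" for a b :: real
  using that s_pos sS by auto
 from this[OF assms cos_le_one] show ?thesis unfolding g_def[symmetric] cos_g Let_def .
qed

lemma g_neg:
 assumes "q \<in> Cn" "cos (2 * pi * m / h) < 0"
 shows "z 0 \<bullet> z m \<le> z (a + m) \<bullet> q"
proof -
 have "g m \<le> - s" unfolding cos_g Let_def using assms(2) s_pos sS by auto
 thus ?thesis using z_centre[OF assms(1), of "a + m"] s_pos by (auto simp: g_def)
qed

text \<open>Since \<open>z (i + 5) = - z i\<close>, adding five steps expresses twice the value at
  \<open>z i\<close> through \<open>p - q\<close>. For a centre point one step suffices, as
  \<open>c\<close> negates it. What remains is a comparison over a finite table.\<close>

lemma centre_small: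
 assumes pq: "p \<in> X" "q \<in> X" "rt ii p q" and v: "c (v - (p - q)) = v" and q': "q' \<in> Cn"
 shows "\<bar>q' \<bullet> v\<bar> \<le> \<bar>z i \<bullet> v\<bar>"
proof -
 define Z where "Z = z i + z (i + 1) + z (i + 2) + z (i + 3) + z (i + 4)"
 \<comment> \<open>The sign that puts the scaled centre point on the same side of the plane as
   \<open>z i\<close>.\<close>
 define \<theta> where "\<theta> = (if z i \<bullet> q' = s then 1 else - 1 :: real)"
 have th: "z i \<bullet> q' = \<theta> * s" "\<theta> * \<theta> = 1" "\<theta> = 1 \<or> \<theta> = - 1" using z_centre[OF q', of i] by (auto simp: \<theta>_def)
 have st: "z (j + 1) \<bullet> v = z j \<bullet> v - z j \<bullet> (p - q)" for j
  using c_solution_step[OF v, of "z j"] by (simp add: z_Suc)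
 have "z (i + 5) \<bullet> v = z i \<bullet> v - Z \<bullet> (p - q)"
  using st[of i] st[of "i + 1"] st[of "i + 2"] st[of "i + 3"] st[of "i + 4"]
  by (simp add: Z_def inner_add_left add.assoc)
 hence zv: "2 * (z i \<bullet> v) = Z \<bullet> p - Z \<bullet> q" unfolding z5 by (simp add: inner_diff_right)
 have qv: "2 * (q' \<bullet> v) = q' \<bullet> p - q' \<bullet> q"
  using c_solution_step[OF v, of q'] centre_c[OF q'] by (simp add: inner_diff_right)
 have qs: "z (i + 1) \<bullet> q' = - (\<theta> * s)" "z (i + 2) \<bullet> q' = \<theta> * s" "z (i + 3) \<bullet> q' = - (\<theta> * s)" "z (i + 4) \<bullet> q' = \<theta> * s"
  using centre_z_Suc[OF q', of i] centre_z_Suc[OF q', of "i + 1"] centre_z_Suc[OF q', of "i + 2"]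
   centre_z_Suc[OF q', of "i + 3"] th(1) by (simp_all add: add.assoc)
 have Zq: "Z \<bullet> q' = \<theta> * s" by (simp add: Z_def inner_add_left qs th(1))
 let ?P = "{(S, s), (S + 2 * s, - s), (S + 4 * s, s), (s, S), (- S, - s), (- S - 2 * s, s), (- S - 4 * s, - s), (- s, - S)}"
 have "(Z \<bullet> x, \<theta> * (q' \<bullet> x)) \<in> ?P \<and> (Z \<bullet> x = s \<longrightarrow> x = \<theta> *\<^sub>R q') \<and> (Z \<bullet> x = - s \<longrightarrow> x = - (\<theta> *\<^sub>R q'))"
  if x: "x \<in> X" for x
 proof (cases "x \<in> Cn")
  case True
  obtain v where "Cn = {v, - v}" using centre_ex[OF ii] by auto
  hence "x = q' \<or> x = - q'" using True q' by auto
  hence x: "x = \<theta> *\<^sub>R q' \<or> x = - (\<theta> *\<^sub>R q')" using th(3) by auto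
  have qq: "q' \<bullet> q' = S" using self' q' by auto
  have e: "Z \<bullet> (\<theta> *\<^sub>R q') = s" "\<theta> * (q' \<bullet> (\<theta> *\<^sub>R q')) = S" using th(2,3) Zq qq by auto
  show ?thesis using x
  proof
   assume x: "x = \<theta> *\<^sub>R q'"
   show ?thesis unfolding x e using s_pos by simp
  next
   assume x: "x = - (\<theta> *\<^sub>R q')"
   show ?thesis unfolding x inner_minus_right mult_minus_right e using s_pos by simp
  qed
 next
  case False
  have Zz: "Z \<bullet> z i = S" "Z \<bullet> z (i + 1) = S + 2 * s" "Z \<bullet> z (i + 2) = S + 4 * s" "Z \<bullet> z (i + 3) = S + 2 * s" "Z \<bullet> z (i + 4) = S"
   by (simp_all add: Z_def inner_add_left z_g g_vals)
  have q'z: "\<theta> * (q' \<bullet> z i) = s" "\<theta> * (q' \<bullet> z (i + 1)) = - s" "\<theta> * (q' \<bullet> z (i + 2)) = s"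
   "\<theta> * (q' \<bullet> z (i + 3)) = - s" "\<theta> * (q' \<bullet> z (i + 4)) = s"
   using th qs by (auto simp: inner_commute[of q'])
  obtain j where "x = z j" using False x by blast
  then obtain r where r: "r \<in> {0, 1, 2, 3, 4, 5, 6, 7, 8, 9}" "x = z (i + r)" using z_rel[of j i] by blast
  have n: "z (i + 6) = - z (i + 1)" "z (i + 7) = - z (i + 2)" "z (i + 8) = - z (i + 3)" "z (i + 9) = - z (i + 4)"
   using z5[of "i + 1"] z5[of "i + 2"] z5[of "i + 3"] z5[of "i + 4"] by (simp_all add: add.assoc)
  from r(1) have "r = 0 \<or> r = 1 \<or> r = 2 \<or> r = 3 \<or> r = 4 \<or> r = 5 \<or> r = 6 \<or> r = 7 \<or> r = 8 \<or> r = 9" by simp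
  hence "x = z i \<or> x = z (i + 1) \<or> x = z (i + 2) \<or> x = z (i + 3) \<or> x = z (i + 4) \<or>
   x = - z i \<or> x = - z (i + 1) \<or> x = - z (i + 2) \<or> x = - z (i + 3) \<or> x = - z (i + 4)"
   unfolding r(2) by (elim disjE) (simp_all add: n z5)
  thus ?thesis using s_pos sS by (elim disjE) (simp_all add: Zz q'z)
 qed
 note T = this
 have "\<bar>\<theta> * (q' \<bullet> p) - \<theta> * (q' \<bullet> q)\<bar> \<le> \<bar>Z \<bullet> p - Z \<bullet> q\<bar>"
 proof -
  have "\<not> (Z \<bullet> p = s \<and> Z \<bullet> q = - s)" "\<not> (Z \<bullet> p = - s \<and> Z \<bullet> q = s)"
   using T[OF pq(1)] T[OF pq(2)] pq(3) ii unfolding rt_def by (metis minus_minus)+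
  thus ?thesis
   using vertex_pairs_bound[OF s_pos sS(1,2) refl conjunct1[OF T[OF pq(1)]] conjunct1[OF T[OF pq(2)]]] by blast
 qed
 hence "\<bar>q' \<bullet> p - q' \<bullet> q\<bar> \<le> \<bar>Z \<bullet> p - Z \<bullet> q\<bar>" using th(3) by auto
 thus ?thesis using zv qv by linarith
qed

section \<open>Rank two subgroups and their axes\<close>

lemma axis_image:
 assumes "axis s X u" "w \<in> W"
 shows "axis s X (w u)"
proof -
 have l: "linear w" using assms(2) by (rule refl_group_linear)
 note wi = W_X[OF assms(2)] refl_group_inner[OF assms(2)]
 from assms(1) consider "u \<in> X" | p q where "p \<in> X" "q \<in> X" "p \<bullet> q = s" "u = p + q"
  | p q r where "p \<in> X" "q \<in> X" "r \<in> X" "p \<bullet> q = s" "q \<bullet> r = s" "p \<bullet> r = s" "u = p + q + r"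
  unfolding axis_def by blast
 thus ?thesis
 proof cases
  case 2
  hence "w p \<in> X" "w q \<in> X" "w p \<bullet> w q = s" "w u = w p + w q" using wi l by (auto simp: linear_add)
  thus ?thesis unfolding axis_def by blast
 next
  case 3
  hence "w p \<in> X" "w q \<in> X" "w r \<in> X" "w p \<bullet> w q = s" "w q \<bullet> w r = s" "w p \<bullet> w r = s" "w u = w p + w q + w r"
   using wi l by (auto simp: linear_add)
  thus ?thesis unfolding axis_def by blast
 qed (use wi in \<open>auto simp: axis_def\<close>)
qed

lemma axis_conj_ex:
 assumes J: "J \<subseteq> \<Delta>" "card J = 2" and w: "w \<in> W"
 obtains u where "axis s X u" "\<And>x. x \<in> V \<Longrightarrow> x \<in> span (w ` J) \<longleftrightarrow> x \<bullet> u = 0"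
proof -
 obtain w' where w': "w' \<in> W" "\<And>x. w' (w x) = x" "\<And>x. w (w' x) = x" using refl_group_inverse[OF w] by metis
 obtain u where u: "axis s X u" "\<And>x. x \<in> V \<Longrightarrow> x \<in> span J \<longleftrightarrow> x \<bullet> u = 0" using axis_ex[OF J] by blast
 have "x \<in> span (w ` J) \<longleftrightarrow> x \<bullet> w u = 0" if "x \<in> V" for x
 proof -
  have "x \<in> span (w ` J) \<longleftrightarrow> w' x \<in> span J"
   unfolding image_span_W[OF w] using w' by (metis image_iff)
  also have "\<dots> \<longleftrightarrow> w' x \<bullet> u = 0" using u(2) refl_group_in_span[OF w'(1) that] by blast
  also have "w' x \<bullet> u = x \<bullet> w u" using refl_group_inner[OF w, of "w' x" u] w'(3) by simp
  finally show ?thesis .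
 qed
 thus ?thesis using that axis_image[OF u(1) w] by blast
qed

lemma generated_conj:
 assumes J: "J \<subseteq> \<Delta>" "card J = 2" and w: "w \<in> W" and b1: "b1 \<noteq> 0" "b2 \<noteq> 0" "reflection b1 \<in> refl_group (w ` J)"
   "reflection b2 \<in> refl_group (w ` J)" "reflection b1 \<noteq> reflection b2"
 shows "refl_group {b1, b2} = refl_group (w ` J)"
proof -
 obtain w' where w': "w' \<in> W" "\<And>x. w' (w x) = x" "\<And>x. w (w' x) = x" using refl_group_inverse[OF w] by metis
 have o: "orthogonal_transformation w" using w by (rule refl_group_orthogonal)
 have J': "w' ` w ` J = J" using w'(2) by (auto simp: image_iff)
 have gw: "w ` {w' b1, w' b2} = {b1, b2}" using w'(3) by simp
 have "refl_group {w' b1, w' b2} = refl_group J"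
 proof (rule generated[OF J])
  show "w' b1 \<noteq> 0" "w' b2 \<noteq> 0" using b1(1,2) w'(3) linear_0[OF refl_group_linear[OF w]] by metis+
  show "reflection (w' b1) \<in> refl_group J" "reflection (w' b2) \<in> refl_group J"
   using reflection_image_in_refl_group[OF w'(1) b1(3)] reflection_image_in_refl_group[OF w'(1) b1(4)] J' by simp_all
  show "reflection (w' b1) \<noteq> reflection (w' b2)"
  proof
   assume e: "reflection (w' b1) = reflection (w' b2)"
   have "reflection b1 x = reflection b2 x" for x
    using orth_reflection_conj[OF o, of "w' b1" "w' x"] orth_reflection_conj[OF o, of "w' b2" "w' x"] e w'(3) by simp
   thus False using b1(5) by blast
  qed
 qed
 thus ?thesis using refl_group_conj[OF w, of J] refl_group_conj[OF w, of "{w' b1, w' b2}"] gw by simp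
qed

text \<open>\<open>c\<close> times the reflection in \<open>b\<close> fixes \<open>u\<close>, so it
  is a product of at most two reflections, and of exactly two because \<open>c\<close> needs three.
  Their independent roots are orthogonal to \<open>u\<close>, hence they are distinct reflections of
  the subgroup and generate it.\<close>

lemma axis_noncrossing:
 assumes J: "J \<subseteq> \<Delta>" "card J = 2" and w: "w \<in> W"
  and u: "\<And>x. x \<in> V \<Longrightarrow> x \<in> span (w ` J) \<longleftrightarrow> x \<bullet> u = 0" "u \<in> V" "u \<noteq> 0"
  and b: "root_of \<Delta> b" "c (u - b) = u"
 shows "noncrossing_parabolic \<Delta> c (refl_group (w ` J))"
proof -
 have b0: "b \<noteq> 0" and bW: "reflection b \<in> W" using b(1) by (auto simp: root_of_def)
 define x where "x = c \<circ> reflection b"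
 have xW: "x \<in> W" unfolding x_def by (rule refl_group_comp[OF c_in_W bW])
 have xu: "x u = u" using c_solution_reflection[OF b(2) b0] b(2) by (simp add: x_def)
 obtain us where us: "\<forall>u\<in>set us. root_of \<Delta> u" "rword us = x" "length us + dim {y \<in> V. x y = y} \<le> card \<Delta>"
  using reflection_length_le[OF xW] by blast
 have "{u} \<subseteq> {y \<in> V. x y = y}" using xu u(2) by simp
 hence "dim {u} \<le> dim {y \<in> V. x y = y}" by (rule dim_subset)
 moreover have "dim {u} = 1" using u(3) by (subst dim_eq_card_independent) auto
 ultimately have len: "length us \<le> 2" using us(3) rank3 by simp
 have "rword (us @ [b]) = c" by (simp add: rword_append us(2) x_def comp_assoc)
 note c = this
 have rts: "\<And>y. y \<in> set (us @ [b]) \<Longrightarrow> root_of \<Delta> y" using us(1) b(1) by auto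
 have sub: "set (us @ [b]) \<subseteq> V" using rts root_of_in_span by blast
 have "length us = 2" using coxeter_word_length[OF c sub] len rank3 by simp
 then obtain b1 b2 where b1: "us = [b1, b2]" by (auto simp: length_Suc_conv numeral_2_eq_2)
 have ind: "distinct (us @ [b])" "independent (set (us @ [b]))"
  using coxeter_word_independent[OF c sub] \<open>length us = 2\<close> rank3 by simp_all
 have ind2: "distinct us" "independent (set us)"
  using ind independent_mono[OF ind(2), of "set us"] by auto
 have rg: "reflection y \<in> refl_group (w ` J)" if y: "y \<in> set us" for y
 proof -
  have "y \<bullet> u = 0" using rword_fix_orthogonal[OF ind2 _ y, of u] us(2) xu by simp
  hence yK: "y \<in> span (w ` J)" using u(1) y sub by auto
  obtain p q t where t: "p \<in> X" "q \<in> X" "rt ii p q" "t \<noteq> 0" "y = t *\<^sub>R (p - q)"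
   using root_is_diff us(1) y by metis
  have "p - q = (1 / t) *\<^sub>R y" using t by simp
  hence "p - q \<in> span (w ` J)" using span_mul[OF yK] by simp
  hence "reflection (p - q) \<in> refl_group (w ` J)" by (rule par_conj[OF J(1) w t(1-3)])
  thus ?thesis using t by (simp add: reflection_scaled)
 qed
 have "refl_group {b1, b2} = refl_group (w ` J)"
 proof (rule generated_conj[OF J w])
  show "b1 \<noteq> 0" "b2 \<noteq> 0" using us(1) by (auto simp: b1 root_of_def)
  show "reflection b1 \<in> refl_group (w ` J)" "reflection b2 \<in> refl_group (w ` J)" using rg by (auto simp: b1)
  show "reflection b1 \<noteq> reflection b2"
  proof
   assume "reflection b1 = reflection b2"
   hence "reflection b1 \<in> refl_group {b2}" by (simp add: reflection_in_refl_group)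
   hence "b1 \<in> span {b2}" by (rule reflection_in_span)
   thus False using ind2 by (auto simp: b1 dependent_def)
  qed
 qed
 hence "refl_group (w ` J) = refl_group (set us)" by (simp add: b1)
 moreover have "parabolic \<Delta> (refl_group (w ` J))" using J w by (auto simp: parabolic_iff)
 moreover have "length (us @ [b]) = card \<Delta>" using \<open>length us = 2\<close> rank3 by simp
 ultimately show ?thesis unfolding noncrossing_parabolic_iff using rts c by blast
qed

text \<open>The average writes \<open>0\<close> as a convex combination of all projected points with
  positive weights. Points may coincide after projection, so the weights count
  multiplicities.\<close>

lemma balanced_zero_inside:
 assumes fin: "finite B" "B \<noteq> {}" and T: "(\<Sum>x\<in>B. pr x) = 0"
 shows "0 \<in> rel_interior (block_hull PL B)"
proof -
 define m where "m y = real (card {x \<in> B. pr x = y}) / card B" for y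
 have cB: "0 < card B" using fin by (simp add: card_gt_0_iff)
 have "m y > 0" if "y \<in> pr ` B" for y
 proof -
  have "{x \<in> B. pr x = y} \<noteq> {}" using that by auto
  thus ?thesis using fin cB by (simp add: m_def card_gt_0_iff)
 qed
 moreover have "sum m (pr ` B) = 1"
 proof -
  have "(\<Sum>y\<in>pr ` B. \<Sum>x\<in>{x \<in> B. pr x = y}. 1 :: real) = (\<Sum>x\<in>B. 1)"
   by (rule sum.image_gen[OF fin(1), symmetric])
  hence "(\<Sum>y\<in>pr ` B. real (card {x \<in> B. pr x = y})) = card B" by simp
  thus ?thesis unfolding m_def sum_divide_distrib[symmetric] using cB by simp
 qed
 moreover have "(\<Sum>y\<in>pr ` B. m y *\<^sub>R y) = 0"
 proof -
  have "(\<Sum>y\<in>pr ` B. real (card {x \<in> B. pr x = y}) *\<^sub>R y) = (\<Sum>y\<in>pr ` B. \<Sum>x\<in>{x \<in> B. pr x = y}. pr x)"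
   by (intro sum.cong refl) (simp add: sum_constant_scaleR)
  also have "\<dots> = (\<Sum>x\<in>B. pr x)" by (rule sum.image_gen[OF fin(1), symmetric])
  finally have "(1 / card B) *\<^sub>R (\<Sum>y\<in>pr ` B. real (card {x \<in> B. pr x = y}) *\<^sub>R y) = 0" using T by simp
  thus ?thesis by (simp add: m_def scaleR_sum_right)
 qed
 ultimately show ?thesis
  using explicit_subset_rel_interior_convex_hull_minimal[of "pr ` B"] fin unfolding block_hull_def by blast
qed

lemma pr_sum: "pr (\<Sum>x\<in>B. x) = (\<Sum>x\<in>B. pr x)"
 by (simp add: orth_proj_plane inner_sum_left sum.distrib scaleR_sum_left)

text \<open>Polygon vertices adjacent to \<open>z i\<close> have index \<open>i + r\<close> with
  \<open>r\<close> among 1, 2, -1, -2, and consecutive vertices have opposite products with a centre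
  point. Shifting the index brings each vertex, edge and face to one of these shapes; the first
  shape is the noncrossing one.\<close>

lemma axis_cases:
 assumes "axis s X u"
 obtains i where "u = z i \<or> u = z i + z (i + 1) \<or> u = z i + z (i + 1) + z (i + 2)"
 | "u \<in> Cn" | q i where "q \<in> Cn" "z i \<bullet> q = s" "u = q + z i" | i where "u = z i + z (i + 2)"
 | q i where "q \<in> Cn" "z i \<bullet> q = s" "z (i + 2) \<bullet> q = s" "u = q + z i + z (i + 2)"
proof -
 have Cn_s: False if "p \<in> Cn" "q \<in> Cn" "p \<bullet> q = s" for p q
 proof -
  obtain v where "Cn = {v, - v}" using centre_ex[OF ii] by auto
  hence "p = q \<or> p = - q" using that by auto
  thus False using that inner_s_distinct[of p q] by auto
 qed
 have adj: "\<exists>r\<in>{1, 2, - 1, - 2}. z j = z (i + r)" if ij: "z i \<bullet> z j = s" for i j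
 proof -
  obtain r where r: "r \<in> {0, 1, 2, 3, 4, 5, 6, 7, 8, 9}" "z j = z (i + r)" using z_rel[of j i] by blast
  have "g r = s" using ij unfolding r(2) z_g by simp
  have "r = 0 \<or> r = 1 \<or> r = 2 \<or> r = 3 \<or> r = 4 \<or> r = 5 \<or> r = 6 \<or> r = 7 \<or> r = 8 \<or> r = 9" using r(1) by simp
  hence "r \<in> {1, 2, 8, 9}"
   by (elim disjE) (use \<open>g r = s\<close> s_pos sS in \<open>simp_all add: g_vals\<close>)
  moreover have "z (i + 8) = z (i + - 2)" "z (i + 9) = z (i + - 1)" unfolding z_eq_iff_10 by simp_all
  ultimately show ?thesis using r(2) by auto
 qed
 have zz: "(\<exists>l. z i + z j = z l + z (l + 1) \<or> z i + z j = z l + z (l + 2))" if ij: "z i \<bullet> z j = s" for i j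
 proof -
  obtain r where r: "r \<in> {1, 2, - 1, - 2}" "z j = z (i + r)" using adj[OF ij] by blast
  then consider "r = 1" | "r = 2" | "r = - 1" | "r = - 2" by blast
  thus ?thesis
  proof cases
   case 3
   thus ?thesis unfolding r(2) by (intro exI[of _ "i - 1"]) (simp add: add.commute)
  next
   case 4
   thus ?thesis unfolding r(2) by (intro exI[of _ "i - 2"]) (simp add: add.commute)
  qed (use r(2) in auto)
 qed
 have qzz: "\<exists>l. z l \<bullet> q = s \<and> z (l + 2) \<bullet> q = s \<and> z i + z j = z l + z (l + 2)"
  if q: "q \<in> Cn" "z i \<bullet> q = s" "z j \<bullet> q = s" and ij: "z i \<bullet> z j = s" for i j q
 proof -
  obtain r where r: "r \<in> {1, 2, - 1, - 2}" "z j = z (i + r)" using adj[OF ij] by blast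
  have "r \<noteq> 1" using centre_z_Suc[OF q(1), of i] q(2,3) r(2) s_pos by auto
  moreover have "r \<noteq> - 1" using centre_z_Suc[OF q(1), of "i - 1"] q(2,3) r(2) s_pos by auto
  ultimately consider "r = 2" | "r = - 2" using r(1) by blast
  thus ?thesis
  proof cases
   case 2
   thus ?thesis using q(2,3) unfolding r(2) by (intro exI[of _ "i - 2"]) (simp add: add.commute)
  qed (use r(2) q in auto)
 qed
 have zzz: "\<exists>l. z i + z j + z m = z l + z (l + 1) + z (l + 2)"
  if ij: "z i \<bullet> z j = s" "z i \<bullet> z m = s" "z j \<bullet> z m = s" for i j m
 proof -
  obtain r where r: "r \<in> {1, 2, - 1, - 2}" "z j = z (i + r)" using adj[OF ij(1)] by blast
  obtain t where t: "t \<in> {1, 2, - 1, - 2}" "z m = z (i + t)" using adj[OF ij(2)] by blast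
  have "g (t - r) = s" using ij(3) unfolding r t z_g by simp
  have "(r = 1 \<and> t = 2 \<or> r = 2 \<and> t = 1) \<or> (r = 1 \<and> t = - 1 \<or> r = - 1 \<and> t = 1) \<or>
   (r = - 1 \<and> t = - 2 \<or> r = - 2 \<and> t = - 1)"
   using r(1) t(1) by (elim insertE emptyE) (use \<open>g (t - r) = s\<close> s_pos sS in \<open>simp_all add: g_vals\<close>)
  then consider "r = 1 \<and> t = 2 \<or> r = 2 \<and> t = 1" | "r = 1 \<and> t = - 1 \<or> r = - 1 \<and> t = 1"
   | "r = - 1 \<and> t = - 2 \<or> r = - 2 \<and> t = - 1" by blast
  thus ?thesis
  proof cases
   case 1
   thus ?thesis using r(2) t(2) by (intro exI[of _ i]) (auto simp: add_ac)
  next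
   case 2
   thus ?thesis using r(2) t(2) by (intro exI[of _ "i - 1"]) (auto simp: add_ac)
  next
   case 3
   thus ?thesis using r(2) t(2) by (intro exI[of _ "i - 2"]) (auto simp: add_ac)
  qed
 qed
 have X: "p \<in> Cn \<or> (\<exists>i. p = z i)" if "p \<in> X" for p using that by blast
 from assms consider "u \<in> X" | p q where "p \<in> X" "q \<in> X" "p \<bullet> q = s" "u = p + q"
  | p q r where "p \<in> X" "q \<in> X" "r \<in> X" "p \<bullet> q = s" "q \<bullet> r = s" "p \<bullet> r = s" "u = p + q + r"
  unfolding axis_def by blast
 thus thesis
 proof cases
  case 1
  thus thesis using X that(1,2) by blast
 next
  case 2
  have c: "q \<bullet> p = s" using 2(3) by (simp add: inner_commute)
  show thesis
   using X[OF 2(1)] X[OF 2(2)]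
  proof (elim disjE exE)
   fix i j assume "p = z i" "q = z j"
   thus thesis using zz[of i j] 2(3,4) that(1,4) by blast
  next
   fix i assume "p = z i" "q \<in> Cn"
   thus thesis using that(3)[of q i] 2(3,4) by (simp add: add.commute)
  next
   fix i assume "p \<in> Cn" "q = z i"
   thus thesis using that(3)[of p i] c 2(4) by simp
  qed (use Cn_s 2(3) in blast)
 next
  case 3
  have c: "q \<bullet> p = s" "r \<bullet> q = s" "r \<bullet> p = s" using 3 by (simp_all add: inner_commute)
  show thesis
   using X[OF 3(1)] X[OF 3(2)] X[OF 3(3)]
  proof (elim disjE exE)
   fix i j m assume "p = z i" "q = z j" "r = z m"
   thus thesis using zzz[of i j m] 3(4-7) that(1) by blast
  next
   fix i j assume e: "p = z i" "q = z j" "r \<in> Cn"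
   have "z i \<bullet> r = s" "z j \<bullet> r = s" "z i \<bullet> z j = s" using e 3(4-6) by auto
   then obtain l where "z l \<bullet> r = s" "z (l + 2) \<bullet> r = s" "z i + z j = z l + z (l + 2)" using qzz[OF e(3)] by blast
   moreover have "u = r + (z i + z j)" using e 3(7) by (simp add: add_ac)
   ultimately show thesis using that(5)[OF e(3), of l] by (simp add: add.assoc)
  next
   fix i j assume e: "p = z i" "q \<in> Cn" "r = z j"
   have "z i \<bullet> q = s" "z j \<bullet> q = s" "z i \<bullet> z j = s" using e 3(4-6) c by auto
   then obtain l where "z l \<bullet> q = s" "z (l + 2) \<bullet> q = s" "z i + z j = z l + z (l + 2)" using qzz[OF e(2)] by blast
   moreover have "u = q + (z i + z j)" using e 3(7) by (simp add: add_ac)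
   ultimately show thesis using that(5)[OF e(2), of l] by (simp add: add.assoc)
  next
   fix i j assume e: "p \<in> Cn" "q = z i" "r = z j"
   have "z i \<bullet> p = s" "z j \<bullet> p = s" "z i \<bullet> z j = s" using e 3(4-6) c by auto
   then obtain l where "z l \<bullet> p = s" "z (l + 2) \<bullet> p = s" "z i + z j = z l + z (l + 2)" using qzz[OF e(1)] by blast
   moreover have "u = p + (z i + z j)" using e 3(7) by (simp add: add_ac)
   ultimately show thesis using that(5)[OF e(1), of l] by (simp add: add.assoc)
  qed (use Cn_s 3(4-6) in blast)+
 qed
qed

text \<open>\<open>c\<close> applied twice fixes \<open>u\<close> and so preserves the block of
  \<open>z 0\<close>. On the plane it is a nontrivial rotation, so the projected points of this
  block sum to zero and surround the projection of \<open>u\<close>, which is in another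
  block.\<close>

lemma axis_centre_crossing:
 assumes J: "J \<subseteq> \<Delta>" and w: "w \<in> W" and q: "u \<in> Cn"
  and u: "\<And>x. x \<in> V \<Longrightarrow> x \<in> span (w ` J) \<longleftrightarrow> x \<bullet> u = 0"
 shows "\<not> noncrossing_blocks PL (blk (w ` J) (z 0)) (blk (w ` J) u)" "z 0 - u \<notin> span (w ` J)"
proof -
 have uX: "u \<in> X" "coord u = 0" using q centre_coord by auto
 have bl: "blk (w ` J) p = {x \<in> X. x \<bullet> u = p \<bullet> u}" if "p \<in> X" for p
  unfolding blk_def using that u X_in_V by (auto simp: span_diff subset_iff inner_diff_left)
 define B where "B = blk (w ` J) (z 0)"
 have B: "B = {x \<in> X. x \<bullet> u = z 0 \<bullet> u}" unfolding B_def by (rule bl[OF z_in_X])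
 have fin: "finite B" using X_finite by (simp add: B)
 have cc: "c (c x) \<bullet> u = x \<bullet> u" for x
  using c_inner[of "c x" u] c_inner[of x u] centre_c[OF q] by simp
 have im: "(c \<circ> c) ` B = B"
 proof (rule card_subset_eq[OF fin])
  show "(c \<circ> c) ` B \<subseteq> B" using W_X[OF c_in_W] cc by (auto simp: B)
  show "card ((c \<circ> c) ` B) = card B" by (rule card_image) (auto simp: inj_on_def c_inj)
 qed
 have "(c ^^ 2) (\<Sum>x\<in>B. x) = (\<Sum>x\<in>B. x)"
 proof -
  have "(c ^^ 2) (\<Sum>x\<in>B. x) = (\<Sum>x\<in>B. (c \<circ> c) x)" by (simp add: numeral_2_eq_2 linear_sum[OF linear_c])
  also have "\<dots> = (\<Sum>x\<in>(c \<circ> c) ` B. x)" by (rule sum.reindex_cong[symmetric]) (auto simp: inj_on_def c_inj)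
  finally show ?thesis unfolding im .
 qed
 hence "coord (\<Sum>x\<in>B. x) = 0" using c_power_fixed[of _ 2] h10 by auto
 hence "(\<Sum>x\<in>B. pr x) = 0" unfolding pr_sum[symmetric] by (simp add: proj_zero_iff)
 moreover have zB: "z 0 \<in> B" using z_in_X by (simp add: B)
 ultimately have "0 \<in> rel_interior (block_hull PL B)" using fin by (intro balanced_zero_inside) auto
 thus "\<not> noncrossing_blocks PL (blk (w ` J) (z 0)) (blk (w ` J) u)"
  unfolding B_def[symmetric] using uX zB coord_z_nonzero
  by (intro zero_inside_crossing[of u _ _ "z 0"]) (auto simp: bl[OF uX(1)])
 have "z 0 \<bullet> u \<noteq> u \<bullet> u" using z_centre[OF q, of 0] self'[OF uX(1)] s_pos sS by auto
 thus "z 0 - u \<notin> span (w ` J)"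
  using u[of "z 0 - u"] z_in_X[of 0] uX X_in_V by (auto simp: span_diff subset_iff inner_diff_left)
qed

text \<open>The vertices orthogonal to the axis form a block closed under negation. Its hull has the
  origin as relative interior point, and \<open>q\<close> from another block projects there.\<close>

lemma axis_zero_crossing:
 assumes J: "J \<subseteq> \<Delta>" and w: "w \<in> W" and q: "q \<in> Cn"
  and u: "\<And>x. x \<in> V \<Longrightarrow> x \<in> span (w ` J) \<longleftrightarrow> x \<bullet> u = 0"
  and i: "z i \<bullet> u = 0" "q \<bullet> u \<noteq> 0"
 shows "\<not> noncrossing_blocks PL (blk (w ` J) (z i)) (blk (w ` J) q)" "z i - q \<notin> span (w ` J)"
proof -
 have qX: "q \<in> X" "coord q = 0" using q centre_coord by auto
 have bl: "blk (w ` J) p = {x \<in> X. x \<bullet> u = p \<bullet> u}" if "p \<in> X" for p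
  unfolding blk_def using that u X_in_V by (auto simp: span_diff subset_iff inner_diff_left)
 have "0 \<in> rel_interior (block_hull PL (blk (w ` J) (z i)))"
  unfolding bl[OF z_in_X] i(1) by (rule symmetric_block_zero_inside) (use z_in_X[of i] i X_neg[OF ii] in auto)
 thus "\<not> noncrossing_blocks PL (blk (w ` J) (z i)) (blk (w ` J) q)"
  using qX coord_z_nonzero z_in_X
  by (intro zero_inside_crossing[of q _ _ "z i"]) (auto simp: bl)
 show "z i - q \<notin> span (w ` J)"
  using u[of "z i - q"] z_in_X[of i] qX X_in_V i by (auto simp: span_diff subset_iff inner_diff_left)
qed

text \<open>\<open>z (i + 1)\<close> is in the block of \<open>z (i - 2)\<close>, and
  \<open>z i\<close> in that of \<open>q\<close>, so the chord between the former cuts the radius to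
  \<open>z i\<close>.\<close>

lemma axis_triple_crossing:
 assumes J: "J \<subseteq> \<Delta>" and w: "w \<in> W" and q: "q \<in> Cn" "z i \<bullet> q = s" "z (i + 2) \<bullet> q = s"
  and u: "\<And>x. x \<in> V \<Longrightarrow> x \<in> span (w ` J) \<longleftrightarrow> x \<bullet> (q + z i + z (i + 2)) = 0"
 shows "\<not> noncrossing_blocks PL (blk (w ` J) (z (i - 2))) (blk (w ` J) q)" "z (i - 2) - q \<notin> span (w ` J)"
proof -
 have qX: "q \<in> X" using q by auto
 let ?u = "q + z i + z (i + 2)"
 have bl: "blk (w ` J) p = {x \<in> X. x \<bullet> ?u = p \<bullet> ?u}" if "p \<in> X" for p
  unfolding blk_def using that u X_in_V by (auto simp: span_diff subset_iff inner_diff_left)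
 have q2: "z (i - 2) \<bullet> q = s" using centre_z_even[OF q(1), of i "- 1"] q(2) by simp
 have q1: "z (i + 1) \<bullet> q = - s" using centre_z_Suc[OF q(1), of i] q(2) by simp
 have qz: "q \<bullet> z i = s" "q \<bullet> z (i + 2) = s" using q(2,3) by (simp_all add: inner_commute)
 have l: "z (i - 2) \<bullet> ?u = s" "z (i + 1) \<bullet> ?u = s" "z i \<bullet> ?u = S + 2 * s" "q \<bullet> ?u = S + 2 * s"
  by (simp_all add: inner_add_right q2 q1 q(2) qz z_g g_vals self'[OF qX])
 show "\<not> noncrossing_blocks PL (blk (w ` J) (z (i - 2))) (blk (w ` J) q)"
  by (rule ray_chord_crossing[OF q(1), of "i - 2" i "i + 1"])
   (use z_in_X qX l h10 in \<open>auto simp: bl\<close>)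
 show "z (i - 2) - q \<notin> span (w ` J)"
  using u[of "z (i - 2) - q"] z_in_X[of "i - 2"] qX X_in_V l s_pos sS
  by (auto simp: span_diff subset_iff inner_diff_left)
qed

text \<open>Axes spanned by up to three consecutive polygon vertices give noncrossing subgroups;
  each other shape of axis produces two crossing blocks.\<close>

lemma noncrossing_blocks_imp_noncrossing_rank2:
 assumes J: "J \<subseteq> \<Delta>" "card J = 2" and w: "w \<in> W"
  and nc: "\<forall>B\<in>blocks (refl_group (w ` J)) X. \<forall>B'\<in>blocks (refl_group (w ` J)) X. B \<noteq> B' \<longrightarrow>
   noncrossing_blocks PL B B'"
 shows "noncrossing_parabolic \<Delta> c (refl_group (w ` J))"
proof -
 obtain u where ax: "axis s X u" and u: "\<And>x. x \<in> V \<Longrightarrow> x \<in> span (w ` J) \<longleftrightarrow> x \<bullet> u = 0"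
  using axis_conj_ex[OF J w] by blast
 have cr: False if "p \<in> X" "q \<in> X" "p - q \<notin> span (w ` J)"
  "\<not> noncrossing_blocks PL (blk (w ` J) p) (blk (w ` J) q)" for p q
  using blk_distinct[OF J(1) w that(1-3) nc] that(4) by blast
 have C: "p \<in> X" if "p \<in> Cn" for p using that by auto
 have zV: "z i \<in> V" for i using z_in_X X_in_V by auto
 have cz: "c (z i) = z (i + 1)" for i by (simp add: z_Suc)
 have rt: "rt ii (z i) (z (i - r))" if "r \<in> {1, 2, 3}" for i r
 proof -
  have "z i \<bullet> z (i - r) = s \<or> z i \<bullet> z (i - r) = - s" using that by (auto simp: z_g g_vals)
  hence "z i \<bullet> z (i - r) \<noteq> S" "z i \<bullet> z (i - r) \<noteq> - S" using s_pos sS by linarith+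
  moreover have "z i = z (i - r) \<Longrightarrow> z i \<bullet> z (i - r) = S" "z i = - z (i - r) \<Longrightarrow> z i \<bullet> z (i - r) = - S"
   using self'[OF z_in_X, of "i - r"] by simp_all
  ultimately show ?thesis unfolding rt_def by blast
 qed
 show ?thesis
 proof (rule axis_cases[OF ax])
  fix i assume cases: "u = z i \<or> u = z i + z (i + 1) \<or> u = z i + z (i + 1) + z (i + 2)"
  have uV: "u \<in> V" using cases zV by (auto intro!: span_add)
  have "z i \<bullet> u \<noteq> 0" using cases s_pos sS by (auto simp: inner_add_right z_g g_vals)
  hence u0: "u \<noteq> 0" by auto
  define r where "r = (if u = z i then 0 else if u = z i + z (i + 1) then 1 else 2 :: int)"
  \<comment> \<open>\<open>c\<close> shifts a sum of consecutive vertices by one, so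
    \<open>u - b\<close> has to be that sum one place earlier: \<open>z (i + r)\<close> leaves and
    \<open>z (i - 1)\<close> enters.\<close>
  define b where "b = z (i + r) - z (i + r - (r + 1))"
  have "root_of \<Delta> b" unfolding b_def by (intro root_of_diff z_in_X rt) (auto simp: r_def)
  moreover have "c (u - b) = u"
   using cases unfolding b_def r_def
   by (auto simp: linear_add[OF linear_c] linear_diff[OF linear_c] cz algebra_simps)
  ultimately show ?thesis using axis_noncrossing[OF J w u uV u0] by blast
 next
  assume "u \<in> Cn"
  thus ?thesis using axis_centre_crossing[OF J(1) w _ u] cr[OF z_in_X C] by blast
 next
  fix q i assume q: "q \<in> Cn" "z i \<bullet> q = s" "u = q + z i"
  have 1: "z (i + 1) \<bullet> u = 0" using centre_z_Suc[OF q(1), of i] q(2) by (simp add: q(3) inner_add_right z_g g_vals)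
  have "q \<bullet> u = S + s" using q(2) self'[OF C[OF q(1)]] by (simp add: q(3) inner_add_right inner_commute[of q "z i"])
  hence 2: "q \<bullet> u \<noteq> 0" using s_pos sS by linarith
  show ?thesis using axis_zero_crossing[OF J(1) w q(1) u 1 2] cr[OF z_in_X C[OF q(1)]] by blast
 next
  fix i assume i: "u = z i + z (i + 2)"
  obtain q where q: "q \<in> Cn" using centre_nonempty by blast
  have 1: "z (i - 1) \<bullet> u = 0" by (simp add: i inner_add_right z_g g_vals)
  have "z (i + 2) \<bullet> q = z i \<bullet> q" using centre_z_even[OF q, of i 1] by simp
  hence 2: "q \<bullet> u \<noteq> 0" using z_centre[OF q, of i] s_pos by (auto simp: i inner_add_right inner_commute[of q])
  show ?thesis using axis_zero_crossing[OF J(1) w q u 1 2] cr[OF z_in_X C[OF q]] by blast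
 next
  fix q i assume q: "q \<in> Cn" "z i \<bullet> q = s" "z (i + 2) \<bullet> q = s" "u = q + z i + z (i + 2)"
  show ?thesis using axis_triple_crossing[OF J(1) w q(1-3) u[unfolded q(4)]] cr[OF z_in_X C[OF q(1)]] by blast
 qed
qed

theorem noncrossing_iff_icosahedral:
 assumes "parabolic \<Delta> H"
 shows "noncrossing_parabolic \<Delta> c H \<longleftrightarrow>
  (\<forall>B\<in>blocks H X. \<forall>B'\<in>blocks H X. B \<noteq> B' \<longrightarrow> noncrossing_blocks PL B B')"
proof (intro iffI ballI impI)
 fix B B' assume "noncrossing_parabolic \<Delta> c H" "B \<in> blocks H X" "B' \<in> blocks H X" "B \<noteq> B'"
 thus "noncrossing_blocks PL B B'"
  by (intro noncrossing_imp_noncrossing_blocks[OF g_mono g_neg centre_small])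
next
 assume nc: "\<forall>B\<in>blocks H X. \<forall>B'\<in>blocks H X. B \<noteq> B' \<longrightarrow> noncrossing_blocks PL B B'"
 obtain J w where J: "J \<subseteq> \<Delta>" "w \<in> W" "H = refl_group (w ` J)" using assms unfolding parabolic_iff by blast
 have finJ: "finite J" using J(1) finite_simple by (rule finite_subset)
 have "card J \<le> 3" using card_mono[OF finite_simple J(1)] rank3 by simp
 then consider "card J = 0" | "card J = 1" | "card J = 2" | "card J = 3" by linarith
 thus "noncrossing_parabolic \<Delta> c H"
 proof cases
  case 1
  thus ?thesis using triangular_noncrossing[OF assms triangular.Nil] J(3) finJ by simp
 next
  case 2
  then obtain \<alpha> where \<alpha>: "J = {\<alpha>}" by (auto simp: card_1_singleton_iff)
  hence "root_of \<Delta> \<alpha>" using J(1) simple_nonzero reflection_in_refl_group by (auto simp: root_of_def)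
  hence "triangular [w \<alpha>]" by (intro triangular_single root_of_conj[OF J(2)])
  thus ?thesis using triangular_noncrossing[OF assms, of "[w \<alpha>]"] J(3) \<alpha> by simp
 next
  case 3
  thus ?thesis using noncrossing_blocks_imp_noncrossing_rank2[OF J(1) _ J(2)] nc J(3) by simp
 next
  case 4
  hence "J = \<Delta>" using card_subset_eq[OF finite_simple J(1)] rank3 by simp
  thus ?thesis using noncrossing_full refl_group_conj_self[OF J(2)] J(3) by simp
 qed
qed

end


section \<open>Type H3\<close>

definition \<phi> :: real where "\<phi> = (1 + sqrt 5) / 2"

lemma \<phi>_square: "\<phi> * \<phi> = \<phi> + 1" "\<phi> * (\<phi> * x) = \<phi> * x + x"
proof -
 show 1: "\<phi> * \<phi> = \<phi> + 1" by (simp add: \<phi>_def field_simps)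
 show "\<phi> * (\<phi> * x) = \<phi> * x + x" using arg_cong[OF 1, of "\<lambda>t. t * x"] by (simp add: algebra_simps)
qed

lemma \<phi>_bounds: "3 / 2 < \<phi>" "\<phi> < 2"
 using sqrt_5_bounds by (simp_all add: \<phi>_def)

lemma sqrt_5_\<phi>: "sqrt 5 = 2 * \<phi> - 1"
 by (simp add: \<phi>_def field_simps)

lemma reflection_conj_reflection: "reflection (reflection x y) = reflection x \<circ> reflection y \<circ> reflection x"
proof
 fix u
 show "reflection (reflection x y) u = (reflection x \<circ> reflection y \<circ> reflection x) u"
  using orth_reflection_conj[OF orthogonal_transformation_reflection, of x y "reflection x u"] by simp
qed

lemma refl_group_orthogonal_pair:
 assumes "x \<bullet> y = 0"
 shows "refl_group {x, y} = {id, reflection x, reflection y, reflection x \<circ> reflection y}"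
proof (intro equalityI subsetI)
 have com: "reflection y (reflection x u) = reflection x (reflection y u)" for u
  using assms by (simp add: reflection_def inner_diff_right inner_commute[of y x])
 fix w assume "w \<in> refl_group {x, y}"
 then obtain bs where "set bs \<subseteq> {x, y}" "w = rword bs" by (rule refl_groupE)
 thus "w \<in> {id, reflection x, reflection y, reflection x \<circ> reflection y}"
 proof (induction bs arbitrary: w)
  case (Cons t bs)
  hence IH: "rword bs \<in> {id, reflection x, reflection y, reflection x \<circ> reflection y}"
   and w: "w = reflection t \<circ> rword bs" and t: "t = x \<or> t = y" by auto
  show ?case using IH t unfolding w by (auto simp: fun_eq_iff com)
 qed simp
qed (auto intro: id_in_refl_group reflection_in_refl_group refl_group_comp)

text \<open>The product of the two reflections negates both \<open>x\<close> and \<open>y\<close>,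
  whereas a reflection negates only the multiples of its root.\<close>

lemma reflection_in_orthogonal_pair:
 assumes xy: "x \<bullet> y = 0" "x \<noteq> 0" "y \<noteq> 0" and g: "reflection g \<in> refl_group {x, y}" "g \<noteq> 0"
 shows "reflection g = reflection x \<or> reflection g = reflection y"
proof -
 have "reflection g \<noteq> id" using reflection_self[of g] neg_eq_self[of g] g(2) by auto
 moreover have "reflection g \<noteq> reflection x \<circ> reflection y"
 proof
  assume e: "reflection g = reflection x \<circ> reflection y"
  have "reflection g x = - x" "reflection g y = - y"
   using xy(1) unfolding e by (simp_all add: reflection_fix_iff[THEN iffD2] reflection_self reflection_minus inner_commute)
  moreover have "\<exists>r. z = r *\<^sub>R g" if "reflection g z = - z" for z
  proof -
   have "z + z = (2 * (g \<bullet> z) / (g \<bullet> g)) *\<^sub>R g" using that by (simp add: reflection_def algebra_simps)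
   hence "(1 / 2) *\<^sub>R (z + z) = (1 / 2) *\<^sub>R ((2 * (g \<bullet> z) / (g \<bullet> g)) *\<^sub>R g)" by simp
   thus ?thesis by (simp only: scaleR_half_double scaleR_scaleR) blast
  qed
  ultimately obtain r r' where r: "x = r *\<^sub>R g" "y = r' *\<^sub>R g" by blast
  hence "r * r' * (g \<bullet> g) = 0" using xy(1) by auto
  thus False using r xy g(2) by auto
 qed
 ultimately show ?thesis using g(1) unfolding refl_group_orthogonal_pair[OF xy(1)] by blast
qed

text \<open>By \<open>not_vertex_inner\<close> this is no inner product of two vertices, so the
  reflection in a vertex does not preserve the icosahedron.\<close>

lemma reflected_vertex_inner:
 assumes "p \<bullet> p = sqrt 5 * s" "q \<bullet> q = sqrt 5 * s" "p \<bullet> q = s \<or> p \<bullet> q = - s" "0 < s"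
 shows "q \<bullet> reflection p q = 3 * s / sqrt 5"
proof -
 have "q \<bullet> reflection p q = q \<bullet> q - 2 * (p \<bullet> q) / (p \<bullet> p) * (p \<bullet> q)"
  by (simp add: reflection_def inner_diff_right inner_commute[of q p])
 also have "2 * (p \<bullet> q) / (p \<bullet> p) * (p \<bullet> q) = 2 * s / sqrt 5"
  using assms(3,4) unfolding assms(1) by (auto simp: field_simps)
 finally show ?thesis unfolding assms(2) by (simp add: field_simps)
qed

lemma not_vertex_inner:
 assumes "0 < (s :: real)"
 shows "3 * s / sqrt 5 \<notin> {sqrt 5 * s, - (sqrt 5 * s), s, - s}"
proof -
 have "3 * s / sqrt 5 > 0" "- (sqrt 5 * s) < 0" "- s < 0" using assms by auto
 moreover have "3 * s / sqrt 5 \<noteq> sqrt 5 * s" "3 * s / sqrt 5 \<noteq> s" using assms sqrt_5_bounds by (auto simp: field_simps)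
 moreover have "3 * s / sqrt 5 \<noteq> - (sqrt 5 * s)" "3 * s / sqrt 5 \<noteq> - s" using calculation by linarith+
 ultimately show ?thesis by blast
qed

section \<open>Coordinates with respect to the simple roots of \<open>H3\<close>\<close>

locale type_H3_roots =
 fixes a b d :: "'a::euclidean_space" and \<Delta> :: "'a set"
 assumes unit: "norm a = 1" "norm b = 1" "norm d = 1"
  and gram: "a \<bullet> b = - \<phi> / 2" "b \<bullet> d = - 1 / 2" "a \<bullet> d = 0" and \<Delta>: "\<Delta> = {a, b, d}"
begin

definition vec :: "real \<Rightarrow> real \<Rightarrow> real \<Rightarrow> 'a" where
 "vec p q r = p *\<^sub>R a + q *\<^sub>R b + r *\<^sub>R d"

lemma gram': "a \<bullet> a = 1" "b \<bullet> b = 1" "d \<bullet> d = 1" "b \<bullet> a = - \<phi> / 2" "d \<bullet> b = - 1 / 2" "d \<bullet> a = 0"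
 using unit gram by (simp_all add: dot_square_norm inner_commute)

lemma vec_inner: "vec p q r \<bullet> vec p' q' r' =
  p * p' + q * q' + r * r' - \<phi> / 2 * (p * q' + q * p') - (q * r' + r * q') / 2"
 by (simp add: vec_def inner_add_left inner_add_right gram gram' algebra_simps)

lemma vec_simple: "vec 1 0 0 = a" "vec 0 1 0 = b" "vec 0 0 1 = d"
 by (simp_all add: vec_def)

lemma vec_arith: "vec p q r + vec p' q' r' = vec (p + p') (q + q') (r + r')"
  "vec p q r - vec p' q' r' = vec (p - p') (q - q') (r - r')" "- vec p q r = vec (- p) (- q) (- r)"
  "t *\<^sub>R vec p q r = vec (t * p) (t * q) (t * r)"
 by (simp_all add: vec_def algebra_simps)

lemma reflection_vec: "reflection a (vec p q r) = vec (\<phi> * q - p) q r"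
  "reflection b (vec p q r) = vec p (\<phi> * p + r - q) r" "reflection d (vec p q r) = vec p q (q - r)"
proof -
 have "a \<bullet> vec p q r = p - \<phi> / 2 * q" "b \<bullet> vec p q r = q - \<phi> / 2 * p - r / 2" "d \<bullet> vec p q r = r - q / 2"
  using vec_inner[of 1 0 0 p q r] vec_inner[of 0 1 0 p q r] vec_inner[of 0 0 1 p q r]
  by (simp_all add: vec_simple algebra_simps)
 note i = this
 have v: "vec p q r - t *\<^sub>R a = vec (p - t) q r" "vec p q r - t *\<^sub>R b = vec p (q - t) r" "vec p q r - t *\<^sub>R d = vec p q (r - t)" for t
  by (simp_all add: vec_def algebra_simps)
 show "reflection a (vec p q r) = vec (\<phi> * q - p) q r"
  unfolding unit_reflection[OF unit(1)] i v by (rule arg_cong[of _ _ "\<lambda>t. vec t q r"]) (simp add: field_simps)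
 show "reflection b (vec p q r) = vec p (\<phi> * p + r - q) r"
  unfolding unit_reflection[OF unit(2)] i v by (rule arg_cong[of _ _ "\<lambda>t. vec p t r"]) (simp add: field_simps)
 show "reflection d (vec p q r) = vec p q (q - r)"
  unfolding unit_reflection[OF unit(3)] i v by (rule arg_cong[of _ _ "\<lambda>t. vec p q t"]) (simp add: field_simps)
qed

lemma reflection_simple: "reflection a b = vec \<phi> 1 0" "reflection b a = vec 1 \<phi> 0"
  "reflection b d = vec 0 1 1" "reflection d b = vec 0 1 1"
 using reflection_vec[of 0 1 0] reflection_vec[of 1 0 0] reflection_vec[of 0 0 1] by (simp_all add: vec_simple)

text \<open>Multiples of the basis dual to the simple roots.\<close>

definition dual_a :: 'a where "dual_a = vec (3 * \<phi> - 3) 2 1"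
definition dual_b :: 'a where "dual_b = vec \<phi> 2 1"
definition dual_d :: 'a where "dual_d = vec \<phi> 2 (3 - \<phi>)"

lemma dual_inner: "vec p q r \<bullet> dual_a = (2 * \<phi> - 3) * p" "vec p q r \<bullet> dual_b = (2 - \<phi>) / 2 * q"
  "vec p q r \<bullet> dual_d = (2 - \<phi>) * r"
 unfolding dual_a_def dual_b_def dual_d_def vec_inner by (simp_all add: field_simps \<phi>_square)

lemma vec_eq_iff: "vec p q r = vec p' q' r' \<longleftrightarrow> p = p' \<and> q = q' \<and> r = r'"
proof
 assume "vec p q r = vec p' q' r'"
 thus "p = p' \<and> q = q' \<and> r = r'"
  using dual_inner[of p q r] dual_inner[of p' q' r'] \<phi>_bounds by auto
qed simp

lemma span_vec: "x \<in> span \<Delta> \<Longrightarrow> \<exists>p q r. x = vec p q r"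
proof -
 assume "x \<in> span \<Delta>"
 hence "x \<in> range (\<lambda>(p, q, r). vec p q r)"
 proof (rule span_induct_alt)
  show "0 \<in> range (\<lambda>(p, q, r). vec p q r)" by (rule range_eqI[of _ _ "(0, 0, 0)"]) (simp add: vec_def)
  fix t x y assume x: "x \<in> \<Delta>" and "y \<in> range (\<lambda>(p, q, r). vec p q r)"
  then obtain p q r where y: "y = vec p q r" by auto
  obtain p' q' r' where "x = vec p' q' r'" using x vec_simple[symmetric] unfolding \<Delta> by blast
  hence "t *\<^sub>R x + y = vec (t * p' + p) (t * q' + q) (t * r' + r)" by (simp add: y vec_arith)
  thus "t *\<^sub>R x + y \<in> range (\<lambda>(p, q, r). vec p q r)"
   by (intro range_eqI[of _ _ "(t * p' + p, t * q' + q, t * r' + r)"]) simp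
 qed
 thus ?thesis by auto
qed

lemma vec_in_span: "vec p q r \<in> span \<Delta>"
 unfolding vec_def \<Delta> by (intro span_add span_mul span_base) auto

lemma distinct_simple: "a \<noteq> b" "a \<noteq> d" "b \<noteq> d"
 using vec_eq_iff[of 1 0 0 0 1 0] vec_eq_iff[of 1 0 0 0 0 1] vec_eq_iff[of 0 1 0 0 0 1] by (auto simp: vec_simple)

lemma plane_H3:
 assumes "coxeter_bipartition \<Delta> \<Delta>\<^sub>p \<Delta>\<^sub>m" "positive_min_eigenvector \<Delta> k"
 shows "cox_plane \<Delta> \<Delta>\<^sub>p \<Delta>\<^sub>m k 10"
proof (rule cox_plane_from_dual_system[where I = \<Delta> and \<alpha> = "\<lambda>x. x"
   and \<kappa>' = "\<lambda>x. if x = a then \<phi> else if x = b then 2 * cos (pi / 10) else 1"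
   and \<omega> = "\<lambda>x. if x = a then dual_a else if x = b then dual_b else dual_d", OF _ _ _ _ _ _ _ assms])
 \<comment> \<open>In the rows of \<open>a\<close> and \<open>d\<close> the entries
   \<open>\<phi>\<close>, \<open>2 * C\<close>, \<open>1\<close> satisfy the eigenvector equation
   identically; the row of \<open>b\<close> needs \<open>4 * C * C = \<phi> + 2\<close>.\<close>
 define C where "C = cos (pi / 10)"
 have "cos (pi / 5) = 2 * C\<^sup>2 - 1" using cos_double_cos[of "pi / 10"] by (simp add: C_def)
 hence C: "C * C = (2 + \<phi>) / 4" unfolding cos_pi_5 \<phi>_def by (simp add: power2_eq_square field_simps)
 have C0: "C > 0" unfolding C_def by (rule cos_gt_zero) (auto simp: field_simps)
 note ne = distinct_simple distinct_simple[symmetric]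
 show "0 < (if i = a then \<phi> else if i = b then 2 * cos (pi / 10) else 1)" for i
  using \<phi>_bounds C0 by (simp add: C_def)
 show "(\<Sum>j\<in>\<Delta>. i \<bullet> j * (if j = a then \<phi> else if j = b then 2 * cos (pi / 10) else 1)) =
   (1 - cos (pi / real 10)) * (if i = a then \<phi> else if i = b then 2 * cos (pi / 10) else 1)"
  if "i \<in> \<Delta>" for i
 proof -
  have "i = a \<or> i = b \<or> i = d" using that by (simp add: \<Delta>)
  moreover have "\<phi> * \<phi> = \<phi> + 1" by (rule \<phi>_square)
  ultimately show ?thesis using ne C by (auto simp: \<Delta> gram gram' C_def[symmetric] field_simps)
 qed
 show "(if l = a then dual_a else if l = b then dual_b else dual_d) \<bullet> j = 0 \<longleftrightarrow> j \<noteq> l"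
  if "l \<in> \<Delta>" "j \<in> \<Delta>" for l j
 proof -
  have D: "a \<bullet> dual_a = 2 * \<phi> - 3" "a \<bullet> dual_b = 0" "a \<bullet> dual_d = 0" "b \<bullet> dual_a = 0" "b \<bullet> dual_b = (2 - \<phi>) / 2"
   "b \<bullet> dual_d = 0" "d \<bullet> dual_a = 0" "d \<bullet> dual_b = 0" "d \<bullet> dual_d = 2 - \<phi>"
   using dual_inner[of 1 0 0] dual_inner[of 0 1 0] dual_inner[of 0 0 1] by (simp_all add: vec_simple)
  have "l = a \<or> l = b \<or> l = d" "j = a \<or> j = b \<or> j = d" using that by (simp_all add: \<Delta>)
  thus ?thesis using ne \<phi>_bounds by (elim disjE) (simp_all add: D[THEN inner_commute[THEN trans]])
 qed
qed (use \<Delta> unit in auto)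

text \<open>The five alternatives are the root directions of the dihedral group of order
  ten.\<close>

lemma roots_ab: "reflection (vec p q 0) \<in> refl_group {a, b}"
 if pq: "p = 0 \<or> q = 0 \<or> p = q \<or> p = \<phi> * q \<or> q = \<phi> * p" "(p, q) \<noteq> (0, 0)" for p q
proof -
 have A: "reflection a \<in> refl_group {a, b}" "reflection b \<in> refl_group {a, b}"
  by (simp_all add: reflection_in_refl_group)
 note R = reflection_conj_in_refl_group
 have ab: "reflection (vec 1 0 0) \<in> refl_group {a, b}" "reflection (vec 0 1 0) \<in> refl_group {a, b}"
  using A by (simp_all add: vec_simple)
 have 1: "reflection (vec \<phi> 1 0) \<in> refl_group {a, b}" using R[OF A(1) ab(2)] by (simp add: reflection_vec)
 have 2: "reflection (vec 1 \<phi> 0) \<in> refl_group {a, b}" using R[OF A(2) ab(1)] by (simp add: reflection_vec)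
 have "reflection (\<phi> *\<^sub>R vec 1 1 0) \<in> refl_group {a, b}"
  using R[OF A(1) 2] by (simp add: reflection_vec vec_arith \<phi>_square)
 hence 3: "reflection (vec 1 1 0) \<in> refl_group {a, b}" using \<phi>_bounds reflection_scaled[of \<phi> "vec 1 1 0"] by simp
 have S: "reflection (t *\<^sub>R x) \<in> refl_group {a, b}" if "t \<noteq> 0" "reflection x \<in> refl_group {a, b}" for t and x :: 'a
  using that by (simp add: reflection_scaled)
 from pq(1) consider "p = 0" "q \<noteq> 0" | "q = 0" "p \<noteq> 0" | "p = q" "p \<noteq> 0" | "p = \<phi> * q" "q \<noteq> 0" | "q = \<phi> * p" "p \<noteq> 0"
  using pq(2) by fastforce
 thus ?thesis
 proof cases
  case 1 thus ?thesis using S[OF 1(2) ab(2)] by (simp add: vec_arith)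
 next
  case 2 thus ?thesis using S[OF 2(2) ab(1)] by (simp add: vec_arith)
 next
  case 3 thus ?thesis using S[OF 3(2) \<open>reflection (vec 1 1 0) \<in> refl_group {a, b}\<close>] by (simp add: vec_arith)
 next
  case 4 thus ?thesis using S[OF 4(2) \<open>reflection (vec \<phi> 1 0) \<in> refl_group {a, b}\<close>] by (simp add: vec_arith mult.commute)
 next
  case 5 thus ?thesis using S[OF 5(2) \<open>reflection (vec 1 \<phi> 0) \<in> refl_group {a, b}\<close>] by (simp add: vec_arith mult.commute)
 qed
qed

lemma roots_bd: "reflection (vec 0 q r) \<in> refl_group {b, d}"
 if qr: "q = 0 \<or> r = 0 \<or> q = r" "(q, r) \<noteq> (0, 0)" for q r
proof -
 have A: "reflection b \<in> refl_group {b, d}" "reflection d \<in> refl_group {b, d}"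
  by (simp_all add: reflection_in_refl_group)
 have bd: "reflection (vec 0 1 0) \<in> refl_group {b, d}" "reflection (vec 0 0 1) \<in> refl_group {b, d}"
  using A by (simp_all add: vec_simple)
 have 1: "reflection (vec 0 1 1) \<in> refl_group {b, d}"
  using reflection_conj_in_refl_group[OF A(1) bd(2)] by (simp add: reflection_vec)
 have S: "reflection (t *\<^sub>R x) \<in> refl_group {b, d}" if "t \<noteq> 0" "reflection x \<in> refl_group {b, d}" for t and x :: 'a
  using that by (simp add: reflection_scaled)
 from qr consider "q = 0" "r \<noteq> 0" | "r = 0" "q \<noteq> 0" | "q = r" "q \<noteq> 0" by fastforce
 thus ?thesis
 proof cases
  case 1 thus ?thesis using S[OF 1(2) bd(2)] by (simp add: vec_arith)
 next
  case 2 thus ?thesis using S[OF 2(2) bd(1)] by (simp add: vec_arith)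
 next
  case 3 thus ?thesis using S[OF 3(2) \<open>reflection (vec 0 1 1) \<in> refl_group {b, d}\<close>] by (simp add: vec_arith)
 qed
qed

text \<open>The alternating words of length \<open>5\<close>, respectively \<open>3\<close>,
  starting with either generator are reflections in the same root. This braid relation gives the
  order of the product.\<close>

lemma dihedral_relations:
 "(reflection a \<circ> reflection b) ^^ 5 = id" "(reflection b \<circ> reflection d) ^^ 3 = id"
proof -
 have "reflection (reflection a (reflection b a)) = reflection (reflection b (reflection a b))"
  by (simp add: reflection_simple reflection_vec \<phi>_square)
 hence 1: "reflection a (reflection b (reflection a (reflection b (reflection a x)))) =
   reflection b (reflection a (reflection b (reflection a (reflection b x))))" for x
  unfolding reflection_conj_reflection by (simp add: fun_eq_iff)
 show "(reflection a \<circ> reflection b) ^^ 5 = id" by (simp add: fun_eq_iff numeral_eq_Suc 1)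
 have "reflection (reflection b d) = reflection (reflection d b)"
  by (simp add: reflection_simple)
 hence 2: "reflection b (reflection d (reflection b x)) = reflection d (reflection b (reflection d x))" for x
  unfolding reflection_conj_reflection by (simp add: fun_eq_iff)
 show "(reflection b \<circ> reflection d) ^^ 3 = id" by (simp add: fun_eq_iff numeral_eq_Suc 2)
qed

lemma pairs:
 assumes "J \<subseteq> \<Delta>" "card J = 2"
 shows "J = {a, b} \<or> J = {b, d} \<or> J = {a, d}"
proof -
 obtain x y where "J = {x, y}" "x \<noteq> y" using assms(2) by (auto simp: card_2_iff)
 thus ?thesis using assms(1) unfolding \<Delta> by auto
qed

lemma rank2_generated:
 assumes J: "J \<subseteq> \<Delta>" "card J = 2" and g: "g \<noteq> 0" "g' \<noteq> 0" "reflection g \<in> refl_group J" "reflection g' \<in> refl_group J"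
  "reflection g \<noteq> reflection g'"
 shows "refl_group {g, g'} = refl_group J"
 using pairs[OF J]
proof (elim disjE)
 assume "J = {a, b}"
 thus ?thesis using dihedral_generated[of 5 a b g g'] dihedral_relations(1) g by simp
next
 assume "J = {b, d}"
 thus ?thesis using dihedral_generated[of 3 b d g g'] dihedral_relations(2) g by simp
next
 assume J: "J = {a, d}"
 have nz: "a \<noteq> 0" "d \<noteq> 0" using unit by auto
 have "reflection g = reflection a \<or> reflection g = reflection d" "reflection g' = reflection a \<or> reflection g' = reflection d"
  using reflection_in_orthogonal_pair[OF gram(3) nz] g J by auto
 hence "reflection ` {g, g'} = reflection ` {a, d}" using g(5) by auto
 thus ?thesis unfolding refl_group_def J by simp
qed

end

text \<open>The vertex \<open>y0\<close> is \<open>\<tau>\<close> times the basis vector dual to \<open>d\<close>.\<close>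

locale type_H3_vectors = type_H3_roots +
 fixes \<tau> :: real and X :: "'a::euclidean_space set"
 assumes \<tau>: "0 < \<tau>" and X: "X = orbit_of (refl_group \<Delta>) (\<tau> *\<^sub>R vec (2 * \<phi> + 1) (2 * \<phi> + 2) (\<phi> + 2))"
begin

abbreviation "RW \<equiv> refl_group \<Delta>"

definition pt :: "real \<Rightarrow> real \<Rightarrow> real \<Rightarrow> 'a" where "pt p q r = \<tau> *\<^sub>R vec p q r"

abbreviation "y0 \<equiv> pt (2 * \<phi> + 1) (2 * \<phi> + 2) (\<phi> + 2)"
abbreviation "y1 \<equiv> pt (2 * \<phi> + 1) (2 * \<phi> + 2) \<phi>"
abbreviation "y2 \<equiv> pt (2 * \<phi> + 1) (2 * \<phi>) \<phi>"
abbreviation "y3 \<equiv> pt 1 (2 * \<phi>) \<phi>"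
abbreviation "y4 \<equiv> pt 1 0 \<phi>"
abbreviation "y5 \<equiv> pt (- 1) 0 \<phi>"

lemma pt_reflection: "reflection a (pt p q r) = pt (\<phi> * q - p) q r"
  "reflection b (pt p q r) = pt p (\<phi> * p + r - q) r" "reflection d (pt p q r) = pt p q (q - r)"
 by (simp_all add: pt_def reflection_scaleR reflection_vec)

lemma pt_arith: "pt p q r + pt p' q' r' = pt (p + p') (q + q') (r + r')"
  "pt p q r - pt p' q' r' = pt (p - p') (q - q') (r - r')" "- pt p q r = pt (- p) (- q) (- r)"
 by (simp_all add: pt_def vec_arith algebra_simps)

lemma pt_eq_iff: "pt p q r = pt p' q' r' \<longleftrightarrow> p = p' \<and> q = q' \<and> r = r'"
 using \<tau> by (simp add: pt_def vec_eq_iff)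

lemma pt_refl: "reflection (pt p q r) = reflection (vec p q r)"
 using \<tau> by (simp add: pt_def reflection_scaled)

lemma reflection_W: "reflection a \<in> RW" "reflection b \<in> RW" "reflection d \<in> RW"
 by (simp_all add: \<Delta> reflection_in_refl_group)

text \<open>\<open>y1\<close> to \<open>y5\<close> arise from \<open>y0\<close> by applying
  \<open>d\<close>, \<open>b\<close>, \<open>a\<close>, \<open>b\<close>, \<open>a\<close> in turn;
  \<open>d\<close> then leads from \<open>y5\<close> to \<open>- y4\<close> and so to the
  negatives.\<close>

definition Y :: "'a set" where "Y = {y0, y1, y2, y3, y4, y5, - y0, - y1, - y2, - y3, - y4, - y5}"

lemma reflection_table:
 "reflection a y0 = y0" "reflection a y1 = y1" "reflection a y2 = y3" "reflection a y3 = y2" "reflection a y4 = y5" "reflection a y5 = y4"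
 "reflection b y0 = y0" "reflection b y1 = y2" "reflection b y2 = y1" "reflection b y3 = y4" "reflection b y4 = y3" "reflection b y5 = y5"
 "reflection d y0 = y1" "reflection d y1 = y0" "reflection d y2 = y2" "reflection d y3 = y3" "reflection d y4 = - y5" "reflection d y5 = - y4"
 by (simp_all add: pt_reflection pt_arith pt_eq_iff algebra_simps \<phi>_square)

lemma Y_closed: "\<alpha> \<in> \<Delta> \<Longrightarrow> p \<in> Y \<Longrightarrow> reflection \<alpha> p \<in> Y"
 unfolding \<Delta> Y_def by (elim insertE emptyE) (simp_all only: reflection_table reflection_minus minus_minus insert_iff simp_thms)

lemma W_in_X: "w \<in> RW \<Longrightarrow> p \<in> X \<Longrightarrow> w p \<in> X"
proof -
 assume w: "w \<in> RW" and "p \<in> X"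
 then obtain g where "g \<in> RW" "p = g y0" by (auto simp: X orbit_of_def pt_def)
 hence "w p = (w \<circ> g) y0" "w \<circ> g \<in> RW" using refl_group_comp[OF w] by auto
 thus ?thesis unfolding X orbit_of_def pt_def by blast
qed

lemma y0_in_X: "y0 \<in> X"
 unfolding X orbit_of_def pt_def using id_in_refl_group[of \<Delta>] by (metis id_apply image_eqI)

lemma X_eq: "X = Y"
proof
 show "X \<subseteq> Y"
 proof
  fix p assume "p \<in> X"
  then obtain w where "w \<in> RW" and p: "p = w y0" by (auto simp: X orbit_of_def pt_def)
  then obtain bs where bs: "set bs \<subseteq> \<Delta>" "w = rword bs" by (auto elim: refl_groupE)
  have "y0 \<in> Y" by (simp add: Y_def)
  hence "rword bs y0 \<in> Y" using bs(1) by (induction bs) (auto intro: Y_closed)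
  thus "p \<in> Y" unfolding p bs(2) .
 qed
 have A: "reflection a p \<in> X" "reflection b p \<in> X" "reflection d p \<in> X" if "p \<in> X" for p
  using W_in_X reflection_W that by auto
 have 0: "y0 \<in> X" by (rule y0_in_X)
 have 1: "y1 \<in> X" using A(3)[OF 0] unfolding reflection_table .
 have 2: "y2 \<in> X" using A(2)[OF 1] unfolding reflection_table .
 have 3: "y3 \<in> X" using A(1)[OF 2] unfolding reflection_table .
 have 4: "y4 \<in> X" using A(2)[OF 3] unfolding reflection_table .
 have 5: "y5 \<in> X" using A(1)[OF 4] unfolding reflection_table .
 have 6: "- y4 \<in> X" using A(3)[OF 5] unfolding reflection_table .
 have 7: "- y5 \<in> X" using A(3)[OF 4] unfolding reflection_table .
 have 8: "- y3 \<in> X" using A(2)[OF 6] unfolding reflection_table reflection_minus .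
 have 9: "- y2 \<in> X" using A(1)[OF 8] unfolding reflection_table reflection_minus .
 have 10: "- y1 \<in> X" using A(2)[OF 9] unfolding reflection_table reflection_minus .
 have 11: "- y0 \<in> X" using A(3)[OF 10] unfolding reflection_table reflection_minus .
 show "Y \<subseteq> X" unfolding Y_def using 0 1 2 3 4 5 6 7 8 9 10 11 by simp
qed

lemma y_in_X: "y0 \<in> X" "y1 \<in> X" "y2 \<in> X" "y3 \<in> X" "y4 \<in> X" "y5 \<in> X"
 by (simp_all add: X_eq Y_def)

lemma X_minus: "p \<in> X \<Longrightarrow> - p \<in> X"
 unfolding X_eq Y_def by auto

lemma y0_inner: "y0 \<bullet> pt p q r = \<tau> * \<tau> * r"
 by (simp add: pt_def vec_inner field_simps \<phi>_square)

definition s :: real where "s = \<phi> * (\<tau> * \<tau>)"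

lemma s_pos: "0 < s"
 using \<tau> \<phi>_bounds by (simp add: s_def)

lemma sqrt_5_s: "sqrt 5 * s = \<tau> * \<tau> * (\<phi> + 2)"
 by (simp add: s_def sqrt_5_\<phi> algebra_simps \<phi>_square)

lemma X_transitive:
 assumes "p \<in> X"
 obtains w w' where "w \<in> RW" "w' \<in> RW" "w y0 = p" "\<And>x. w' (w x) = x" "\<And>x. w (w' x) = x"
proof -
 obtain w where w: "w \<in> RW" "p = w y0" using assms by (auto simp: X orbit_of_def pt_def)
 obtain w' where "w' \<in> RW" "\<And>x. w' (w x) = x" "\<And>x. w (w' x) = x" using refl_group_inverse[OF w(1)] by metis
 thus ?thesis using that w by blast
qed

lemma y0_others:
 assumes "p \<in> X" "p \<noteq> y0" "p \<noteq> - y0"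
 shows "p \<in> {y1, y2, y3, y4, y5, - y1, - y2, - y3, - y4, - y5}"
 using assms unfolding X_eq Y_def by blast

lemma X_self: "p \<in> X \<Longrightarrow> p \<bullet> p = sqrt 5 * s"
proof -
 assume "p \<in> X"
 then obtain w where "w \<in> RW" "w y0 = p" using X_transitive by metis
 thus ?thesis using refl_group_inner[of w \<Delta> y0 y0] y0_inner sqrt_5_s by auto
qed

lemma X_other:
 assumes "p \<in> X" "q \<in> X" "p \<noteq> q" "p \<noteq> - q"
 shows "p \<bullet> q = s \<or> p \<bullet> q = - s"
proof -
 obtain w w' where w: "w \<in> RW" "w' \<in> RW" "w y0 = p" "\<And>x. w' (w x) = x" "\<And>x. w (w' x) = x"
  using X_transitive[OF assms(1)] by metis
 have "w (- x) = - w x" for x using linear_neg[OF refl_group_linear[OF w(1)]] .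
 hence "w' q \<noteq> y0" "w' q \<noteq> - y0" using assms(3,4) w by (metis, metis minus_minus)
 hence "w' q \<in> {y1, y2, y3, y4, y5, - y1, - y2, - y3, - y4, - y5}"
  using W_in_X[OF w(2) assms(2)] by (intro y0_others)
 hence "y0 \<bullet> w' q = s \<or> y0 \<bullet> w' q = - s" by (elim insertE emptyE) (simp_all add: y0_inner s_def)
 moreover have "p \<bullet> q = y0 \<bullet> w' q" using refl_group_inner[OF w(1), of y0 "w' q"] w(3,5) by simp
 ultimately show ?thesis by simp
qed

lemma X_card: "card X = 12"
proof -
 have "distinct [y0, y1, y2, y3, y4, y5, - y0, - y1, - y2, - y3, - y4, - y5]"
  using \<phi>_bounds by (auto simp: pt_arith(3) pt_eq_iff)
 hence "card (set [y0, y1, y2, y3, y4, y5, - y0, - y1, - y2, - y3, - y4, - y5]) = 12"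
  by (subst distinct_card) simp_all
 thus ?thesis unfolding X_eq Y_def by simp
qed

lemma X_not_root: "p \<in> X \<Longrightarrow> reflection p \<notin> RW"
proof
 assume p: "p \<in> X" "reflection p \<in> RW"
 have "y1 \<noteq> y2" "y1 \<noteq> - y2" "p \<noteq> 0" using X_self[OF p(1)] s_pos \<phi>_bounds by (auto simp: pt_arith(3) pt_eq_iff)
 then obtain q where q: "q \<in> X" "p \<noteq> q" "p \<noteq> - q" using y_in_X(2,3) by (metis minus_minus)
 note pq = X_other[OF p(1) q]
 have e: "q \<bullet> reflection p q = 3 * s / sqrt 5"
  by (rule reflected_vertex_inner[OF X_self[OF p(1)] X_self[OF q(1)] pq s_pos])
 have rX: "reflection p q \<in> X" using W_in_X p(2) q(1) by blast
 have "q \<bullet> reflection p q \<in> {sqrt 5 * s, - (sqrt 5 * s), s, - s}"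
 proof (cases "q = reflection p q \<or> q = - reflection p q")
  case True
  thus ?thesis using X_self[OF rX] by (metis inner_minus_left insertI1 insertI2)
 next
  case False
  thus ?thesis using X_other[OF q(1) rX] by auto
 qed
 thus False unfolding e using not_vertex_inner[OF s_pos] by blast
qed

text \<open>The coordinates of \<open>y0\<close> to \<open>y5\<close>, one vertex from each
  antipodal pair.\<close>

definition C :: "(real \<times> real \<times> real) set" where
 "C = {(2 * \<phi> + 1, 2 * \<phi> + 2, \<phi> + 2), (2 * \<phi> + 1, 2 * \<phi> + 2, \<phi>), (2 * \<phi> + 1, 2 * \<phi>, \<phi>),
  (1, 2 * \<phi>, \<phi>), (1, 0, \<phi>), (- 1, 0, \<phi>)}"

lemma X_coords:
 assumes "p \<in> X"
 obtains u v t where "p = pt u v t" "(u, v, t) \<in> C \<or> (- u, - v, - t) \<in> C"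
proof -
 have "\<exists>u v t. (p = pt u v t \<or> p = pt (- u) (- v) (- t)) \<and> (u, v, t) \<in> C"
  using assms unfolding X_eq Y_def pt_arith(3) C_def by (elim insertE emptyE) blast+
 thus thesis using that by (metis minus_minus)
qed

lemma orth_span: "x \<in> span A \<Longrightarrow> (\<And>y. y \<in> A \<Longrightarrow> y \<bullet> u = 0) \<Longrightarrow> x \<bullet> u = 0"
 using orthogonal_to_span[of x A u] by (auto simp: orthogonal_def inner_commute)

lemma span_pairs:
 "vec p q r \<in> span {a, b} \<longleftrightarrow> r = 0" "vec p q r \<in> span {b, d} \<longleftrightarrow> p = 0" "vec p q r \<in> span {a, d} \<longleftrightarrow> q = 0"
proof -
 have S: "p *\<^sub>R x + q *\<^sub>R y \<in> span {x, y}" for p q and x y :: 'a by (intro span_add span_mul span_base) simp_all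
 have D: "a \<bullet> dual_b = 0" "a \<bullet> dual_d = 0" "b \<bullet> dual_a = 0" "b \<bullet> dual_d = 0" "d \<bullet> dual_a = 0" "d \<bullet> dual_b = 0"
  using dual_inner[of 1 0 0] dual_inner[of 0 1 0] dual_inner[of 0 0 1] by (simp_all add: vec_simple)
 show "vec p q r \<in> span {a, b} \<longleftrightarrow> r = 0"
 proof
  assume "vec p q r \<in> span {a, b}"
  hence "vec p q r \<bullet> dual_d = 0" by (rule orth_span) (use D in auto)
  thus "r = 0" using \<phi>_bounds by (simp add: dual_inner)
 qed (simp add: vec_def S)
 show "vec p q r \<in> span {b, d} \<longleftrightarrow> p = 0"
 proof
  assume "vec p q r \<in> span {b, d}"
  hence "vec p q r \<bullet> dual_a = 0" by (rule orth_span) (use D in auto)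
  thus "p = 0" using \<phi>_bounds by (simp add: dual_inner)
 qed (simp add: vec_def S)
 show "vec p q r \<in> span {a, d} \<longleftrightarrow> q = 0"
 proof
  assume "vec p q r \<in> span {a, d}"
  hence "vec p q r \<bullet> dual_b = 0" by (rule orth_span) (use D in auto)
  thus "q = 0" using \<phi>_bounds by (simp add: dual_inner)
 qed (simp add: vec_def S)
qed

lemma pt_span_pairs:
 "pt p q r \<in> span {a, b} \<longleftrightarrow> r = 0" "pt p q r \<in> span {b, d} \<longleftrightarrow> p = 0" "pt p q r \<in> span {a, d} \<longleftrightarrow> q = 0"
 unfolding pt_def vec_arith span_pairs using \<tau> by simp_all

text \<open>The third coordinate is the class modulo the span of \<open>a\<close> and
  \<open>b\<close>; the four classes are two single vertices and two pentagons.\<close>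

lemma level_ab:
 assumes "(u, v, t) \<in> C \<or> (- u, - v, - t) \<in> C"
 shows "t = \<phi> + 2 \<or> t = - (\<phi> + 2) \<or> t = \<phi> \<or> t = - \<phi>"
  "t = \<phi> + 2 \<Longrightarrow> u = 2 * \<phi> + 1 \<and> v = 2 * \<phi> + 2" "t = - (\<phi> + 2) \<Longrightarrow> u = - (2 * \<phi> + 1) \<and> v = - (2 * \<phi> + 2)"
  "t = \<phi> \<Longrightarrow> (u, v) \<in> {(2 * \<phi> + 1, 2 * \<phi> + 2), (2 * \<phi> + 1, 2 * \<phi>), (1, 2 * \<phi>), (1, 0), (- 1, 0)}"
  "t = - \<phi> \<Longrightarrow> (- u, - v) \<in> {(2 * \<phi> + 1, 2 * \<phi> + 2), (2 * \<phi> + 1, 2 * \<phi>), (1, 2 * \<phi>), (1, 0), (- 1, 0)}"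
 using assms \<phi>_bounds unfolding C_def by auto

lemma level_bd:
 assumes "(u, v, t) \<in> C \<or> (- u, - v, - t) \<in> C"
 shows "u = 2 * \<phi> + 1 \<or> u = - (2 * \<phi> + 1) \<or> u = 1 \<or> u = - 1"
  "u = 2 * \<phi> + 1 \<Longrightarrow> (v, t) \<in> {(2 * \<phi> + 2, \<phi> + 2), (2 * \<phi> + 2, \<phi>), (2 * \<phi>, \<phi>)}"
  "u = - (2 * \<phi> + 1) \<Longrightarrow> (v, t) \<in> {(- (2 * \<phi> + 2), - (\<phi> + 2)), (- (2 * \<phi> + 2), - \<phi>), (- (2 * \<phi>), - \<phi>)}"
  "u = 1 \<Longrightarrow> (v, t) \<in> {(2 * \<phi>, \<phi>), (0, \<phi>), (0, - \<phi>)}"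
  "u = - 1 \<Longrightarrow> (v, t) \<in> {(- (2 * \<phi>), - \<phi>), (0, \<phi>), (0, - \<phi>)}"
 using assms \<phi>_bounds unfolding C_def by auto

lemma level_ad:
 assumes "(u, v, t) \<in> C \<or> (- u, - v, - t) \<in> C"
 shows "v = 2 * \<phi> + 2 \<or> v = - (2 * \<phi> + 2) \<or> v = 2 * \<phi> \<or> v = - (2 * \<phi>) \<or> v = 0"
  "v = 2 * \<phi> + 2 \<Longrightarrow> u = 2 * \<phi> + 1" "v = - (2 * \<phi> + 2) \<Longrightarrow> u = - (2 * \<phi> + 1)"
  "v = 2 * \<phi> \<Longrightarrow> t = \<phi>" "v = - (2 * \<phi>) \<Longrightarrow> t = - \<phi>"
  "v = 0 \<Longrightarrow> (u = 1 \<or> u = - 1) \<and> (t = \<phi> \<or> t = - \<phi>)"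
 using assms \<phi>_bounds unfolding C_def by auto

lemma ab_directions:
 assumes "(u, v) \<in> {(2 * \<phi> + 1, 2 * \<phi> + 2), (2 * \<phi> + 1, 2 * \<phi>), (1, 2 * \<phi>), (1, 0), (- 1, 0)}"
  "(u', v') \<in> {(2 * \<phi> + 1, 2 * \<phi> + 2), (2 * \<phi> + 1, 2 * \<phi>), (1, 2 * \<phi>), (1, 0), (- 1, 0)}"
 shows "u - u' = 0 \<or> v - v' = 0 \<or> u - u' = v - v' \<or> u - u' = \<phi> * (v - v') \<or> v - v' = \<phi> * (u - u')"
 using assms by (elim insertE emptyE) (simp_all add: algebra_simps \<phi>_square)

lemma par_ab:
 assumes "p \<in> X" "q \<in> X" "p \<noteq> q" "p - q \<in> span {a, b}"
 shows "reflection (p - q) \<in> refl_group {a, b}"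
proof -
 obtain u v t where p: "p = pt u v t" "(u, v, t) \<in> C \<or> (- u, - v, - t) \<in> C" by (rule X_coords[OF assms(1)])
 obtain u' v' t' where q: "q = pt u' v' t'" "(u', v', t') \<in> C \<or> (- u', - v', - t') \<in> C" by (rule X_coords[OF assms(2)])
 have t: "t = t'" using assms(4) by (simp add: p(1) q(1) pt_arith pt_span_pairs)
 let ?L = "{(2 * \<phi> + 1, 2 * \<phi> + 2), (2 * \<phi> + 1, 2 * \<phi>), (1, 2 * \<phi>), (1, 0), (- 1, 0 :: real)}"
 note P = level_ab[OF p(2)] and Q = level_ab[OF q(2)[folded t]]
 from P(1) have "u = u' \<and> v = v' \<or> (u, v) \<in> ?L \<and> (u', v') \<in> ?L \<or> (- u, - v) \<in> ?L \<and> (- u', - v') \<in> ?L"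
 proof (elim disjE)
  assume "t = \<phi> + 2"
  thus ?thesis using P(2) Q(2) by simp
 next
  assume "t = - (\<phi> + 2)"
  thus ?thesis using P(3) Q(3) by simp
 next
  assume t: "t = \<phi>"
  show ?thesis by (rule disjI2, rule disjI1, rule conjI[OF P(4)[OF t] Q(4)[OF t]])
 next
  assume t: "t = - \<phi>"
  show ?thesis by (rule disjI2, rule disjI2, rule conjI[OF P(5)[OF t] Q(5)[OF t]])
 qed
 hence "u - u' = 0 \<or> v - v' = 0 \<or> u - u' = v - v' \<or> u - u' = \<phi> * (v - v') \<or> v - v' = \<phi> * (u - u')"
 proof (elim disjE conjE)
  assume "(- u, - v) \<in> ?L" "(- u', - v') \<in> ?L"
  from ab_directions[OF this] show ?thesis by (simp add: algebra_simps) argo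
 qed (use ab_directions in \<open>simp_all only: diff_self simp_thms\<close>)
 thus ?thesis using assms(3) t unfolding p(1) q(1) pt_arith pt_refl pt_eq_iff
  by (simp add: roots_ab)
qed

lemma par_bd:
 assumes "p \<in> X" "q \<in> X" "p \<noteq> q" "p - q \<in> span {b, d}"
 shows "reflection (p - q) \<in> refl_group {b, d}"
proof -
 obtain u v t where p: "p = pt u v t" "(u, v, t) \<in> C \<or> (- u, - v, - t) \<in> C" by (rule X_coords[OF assms(1)])
 obtain u' v' t' where q: "q = pt u' v' t'" "(u', v', t') \<in> C \<or> (- u', - v', - t') \<in> C" by (rule X_coords[OF assms(2)])
 have u: "u = u'" using assms(4) by (simp add: p(1) q(1) pt_arith pt_span_pairs)
 note P = level_bd[OF p(2)] and Q = level_bd[OF q(2)[folded u]]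
 from P(1) have "v - v' = 0 \<or> t - t' = 0 \<or> v - v' = t - t'"
 proof (elim disjE)
  assume "u = 2 * \<phi> + 1"
  from P(2)[OF this] Q(2)[OF this] show ?thesis by (elim insertE emptyE) simp_all
 next
  assume "u = - (2 * \<phi> + 1)"
  from P(3)[OF this] Q(3)[OF this] show ?thesis by (elim insertE emptyE) simp_all
 next
  assume "u = 1"
  from P(4)[OF this] Q(4)[OF this] show ?thesis by (elim insertE emptyE) simp_all
 next
  assume "u = - 1"
  from P(5)[OF this] Q(5)[OF this] show ?thesis by (elim insertE emptyE) simp_all
 qed
 thus ?thesis using assms(3) u unfolding p(1) q(1) pt_arith pt_refl pt_eq_iff
  by (simp add: roots_bd)
qed

lemma par_ad:
 assumes "p \<in> X" "q \<in> X" "p \<noteq> q" "p \<noteq> - q" "p - q \<in> span {a, d}"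
 shows "reflection (p - q) \<in> refl_group {a, d}"
proof -
 obtain u v t where p: "p = pt u v t" "(u, v, t) \<in> C \<or> (- u, - v, - t) \<in> C" by (rule X_coords[OF assms(1)])
 obtain u' v' t' where q: "q = pt u' v' t'" "(u', v', t') \<in> C \<or> (- u', - v', - t') \<in> C" by (rule X_coords[OF assms(2)])
 have v: "v = v'" using assms(5) by (simp add: p(1) q(1) pt_arith pt_span_pairs)
 have nm: "\<not> (u = - u' \<and> v = - v' \<and> t = - t')" using assms(4) by (simp add: p(1) q(1) pt_arith pt_eq_iff)
 note P = level_ad[OF p(2)] and Q = level_ad[OF q(2)[folded v]]
 from P(1) have ut: "u - u' = 0 \<or> t - t' = 0"
 proof (elim disjE)
  assume "v = 2 * \<phi> + 2"
  thus ?thesis using P(2) Q(2) by simp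
 next
  assume "v = - (2 * \<phi> + 2)"
  thus ?thesis using P(3) Q(3) by simp
 next
  assume "v = 2 * \<phi>"
  thus ?thesis using P(4) Q(4) by simp
 next
  assume "v = - (2 * \<phi>)"
  thus ?thesis using P(5) Q(5) by simp
 next
  assume "v = 0"
  thus ?thesis using P(6) Q(6) nm v by auto
 qed
 have pq: "p - q = \<tau> *\<^sub>R ((u - u') *\<^sub>R a + (t - t') *\<^sub>R d)" using v by (simp add: p(1) q(1) pt_arith) (simp add: pt_def vec_def)
 from ut show ?thesis
 proof
  assume "u - u' = 0"
  hence e: "p - q = (\<tau> * (t - t')) *\<^sub>R d" using pq by simp
  hence "\<tau> * (t - t') \<noteq> 0" using assms(3) by auto
  thus ?thesis unfolding e by (simp add: reflection_scaled reflection_in_refl_group)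
 next
  assume "t - t' = 0"
  hence e: "p - q = (\<tau> * (u - u')) *\<^sub>R a" using pq by simp
  hence "\<tau> * (u - u') \<noteq> 0" using assms(3) by auto
  thus ?thesis unfolding e by (simp add: reflection_scaled reflection_in_refl_group)
 qed
qed

text \<open>By transitivity one of the points is \<open>y0\<close>. The reflections in
  \<open>a\<close> and \<open>b\<close> fix \<open>y0\<close> and carry one of its roots to the
  next, so it suffices to start from \<open>y0 - y1\<close>, a multiple of \<open>d\<close>, and
  from \<open>y0 + y1\<close>.\<close>

lemma par_all:
 assumes pq: "p \<in> X" "q \<in> X" "p \<noteq> q" "p \<noteq> - q"
 shows "reflection (p - q) \<in> RW"
proof -
 obtain w w' where w: "w \<in> RW" "w' \<in> RW" "w y0 = p" "\<And>x. w' (w x) = x" "\<And>x. w (w' x) = x"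
  using X_transitive[OF pq(1)] by metis
 have lin: "linear w" using w(1) by (rule refl_group_linear)
 have "w' q \<noteq> y0" "w' q \<noteq> - y0" using pq(3,4) w linear_neg[OF lin] by (metis, metis minus_minus)
 hence q': "w' q \<in> {y1, y2, y3, y4, y5, - y1, - y2, - y3, - y4, - y5}"
  using W_in_X[OF w(2) pq(2)] by (intro y0_others)
 note R = reflection_conj_in_refl_group
 have step: "reflection (y0 - reflection x y) \<in> RW" if "reflection x \<in> RW" "reflection x y0 = y0" "reflection (y0 - y) \<in> RW" for x y
  using R[OF that(1,3)] that(2) by (simp add: reflection_diff)
 have "y0 - y1 = (2 * \<tau>) *\<^sub>R d" by (simp add: pt_arith) (simp add: pt_def vec_def)
 hence 1: "reflection (y0 - y1) \<in> RW" using \<tau> reflection_W(3) by (simp add: reflection_scaled)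
 have b: "reflection (vec 0 1 0) \<in> RW" using reflection_W(2) by (simp add: vec_simple)
 \<comment> \<open>This word carries \<open>b\<close> to the direction of
   \<open>y0 + y1\<close>.\<close>
 have "reflection (reflection b (reflection a (reflection b (reflection d (reflection b (reflection a (vec 0 1 0))))))) \<in> RW"
  by (rule R[OF reflection_W(2) R[OF reflection_W(1) R[OF reflection_W(2) R[OF reflection_W(3) R[OF reflection_W(2) R[OF reflection_W(1) b]]]]]])
 hence g: "reflection (vec (\<phi> + 1) (2 * \<phi>) \<phi>) \<in> RW"
  by (simp add: reflection_vec algebra_simps \<phi>_square)
 have "y0 - - y1 = (2 * \<tau> * \<phi>) *\<^sub>R vec (\<phi> + 1) (2 * \<phi>) \<phi>"
  by (simp add: pt_def vec_arith vec_eq_iff algebra_simps \<phi>_square)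
 hence m1: "reflection (y0 - - y1) \<in> RW" using \<tau> \<phi>_bounds g by (simp add: reflection_scaled)
 have 2: "reflection (y0 - y2) \<in> RW" using step[OF reflection_W(2) _ 1] unfolding reflection_table by simp
 have 3: "reflection (y0 - y3) \<in> RW" using step[OF reflection_W(1) _ 2] unfolding reflection_table by simp
 have 4: "reflection (y0 - y4) \<in> RW" using step[OF reflection_W(2) _ 3] unfolding reflection_table by simp
 have 5: "reflection (y0 - y5) \<in> RW" using step[OF reflection_W(1) _ 4] unfolding reflection_table by simp
 have m2: "reflection (y0 - - y2) \<in> RW" using step[OF reflection_W(2) _ m1] unfolding reflection_table reflection_minus by simp
 have m3: "reflection (y0 - - y3) \<in> RW" using step[OF reflection_W(1) _ m2] unfolding reflection_table reflection_minus by simp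
 have m4: "reflection (y0 - - y4) \<in> RW" using step[OF reflection_W(2) _ m3] unfolding reflection_table reflection_minus by simp
 have m5: "reflection (y0 - - y5) \<in> RW" using step[OF reflection_W(1) _ m4] unfolding reflection_table reflection_minus by simp
 have "reflection (y0 - w' q) \<in> RW"
  using q' 1 2 3 4 5 m1 m2 m3 m4 m5 by (elim insertE emptyE) (simp_all only:)
 hence "reflection (w (y0 - w' q)) \<in> RW" by (rule R[OF w(1)])
 thus ?thesis using w(3,5) by (simp add: linear_diff[OF lin])
qed

lemma orbit_H3:
 assumes "coxeter_bipartition \<Delta> \<Delta>\<^sub>p \<Delta>\<^sub>m" "positive_min_eigenvector \<Delta> k"
 shows "icosahedral_orbit \<Delta> \<Delta>\<^sub>p \<Delta>\<^sub>m k 10 X True s"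
proof -
 interpret cox_plane \<Delta> \<Delta>\<^sub>p \<Delta>\<^sub>m k 10 by (rule plane_H3[OF assms])
 have XV: "X \<subseteq> span \<Delta>" unfolding X_eq Y_def pt_def by (auto intro: vec_in_span span_mul span_neg)
 have dX: "\<alpha> \<in> span X" if "\<alpha> \<in> \<Delta>" for \<alpha>
 proof -
  have "y4 - y5 = (2 * \<tau>) *\<^sub>R a" "y1 - y2 = (2 * \<tau>) *\<^sub>R b" "y0 - y1 = (2 * \<tau>) *\<^sub>R d"
   by (simp_all add: pt_arith) (simp_all add: pt_def vec_def)
  moreover have "y4 - y5 \<in> span X" "y1 - y2 \<in> span X" "y0 - y1 \<in> span X"
   by (intro span_diff span_base y_in_X)+
  ultimately have "(2 * \<tau>) *\<^sub>R \<alpha> \<in> span X" using that unfolding \<Delta> by auto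
  hence "(1 / (2 * \<tau>)) *\<^sub>R ((2 * \<tau>) *\<^sub>R \<alpha>) \<in> span X" by (rule span_mul)
  thus ?thesis using \<tau> by simp
 qed
 have orb: "cox_orbit \<Delta> \<Delta>\<^sub>p \<Delta>\<^sub>m k 10 X True"
 proof
  show "X \<subseteq> span \<Delta>" by (rule XV)
  show "\<Delta> \<subseteq> span X" using dX by blast
  show "reflection \<alpha> p \<in> X" if "\<alpha> \<in> \<Delta>" "p \<in> X" for \<alpha> p
   using W_in_X[OF reflection_in_refl_group] that by blast
  show "p \<bullet> p = q \<bullet> q" if "p \<in> X" "q \<in> X" for p q using X_self that by simp
  show "card X = (if True then 10 + 2 else 10)" using X_card by simp
  show "- p \<in> X" if "p \<in> X" for p using X_minus that .
  show "reflection p \<notin> refl_group \<Delta>" if "p \<in> X" for p using X_not_root that .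
  show "reflection (p - q) \<in> refl_group J"
   if J: "J \<subseteq> \<Delta>" and pq: "p \<in> X" "q \<in> X" "rt True p q" "p - q \<in> span J" for J p q
  proof -
   have ne: "p \<noteq> q" "p \<noteq> - q" using pq(3) by (auto simp: rt_def)
   have finJ: "finite J" using J finite_simple by (rule finite_subset)
   have c3: "card \<Delta> = 3" using distinct_simple by (simp add: \<Delta>)
   have "card J \<le> 3" using card_mono[OF finite_simple J] c3 by simp
   then consider "card J = 0" | "card J = 1" | "card J = 2" | "card J = 3" by linarith
   thus ?thesis
   proof cases
    case 1
    thus ?thesis using pq(4) ne finJ by simp
   next
    case 2
    then obtain \<alpha> where \<alpha>: "J = {\<alpha>}" by (auto simp: card_1_singleton_iff)
    then obtain t where "p - q = t *\<^sub>R \<alpha>" using pq(4) by (auto simp: span_singleton)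
    moreover have "t \<noteq> 0" using ne calculation by auto
    ultimately show ?thesis using reflection_in_refl_group[of \<alpha> J] \<alpha> by (simp add: reflection_scaled)
   next
    case 3
    thus ?thesis using pairs[OF J] par_ab[OF pq(1,2) ne(1)] par_bd[OF pq(1,2) ne(1)] par_ad[OF pq(1,2) ne] pq(4) by auto
   next
    case 4
    hence "J = \<Delta>" using card_subset_eq[OF finite_simple J] c3 by simp
    thus ?thesis using par_all[OF pq(1,2) ne] by simp
   qed
  qed
  show "\<exists>r\<in>X. r \<in> span J \<and> r \<noteq> p \<and> r \<noteq> - p"
   if J: "J \<subseteq> \<Delta>" and p: "p \<in> X" "p \<in> span J" for J p
  proof -
   have p0: "p \<bullet> p \<noteq> 0" using X_self[OF p(1)] s_pos by simp
   \<comment> \<open>\<open>p\<close> is nonzero and lies in the span of \<open>J\<close>, so some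
     root of \<open>J\<close> is not orthogonal to it. The image of \<open>p\<close> under its
     reflection is the third point; it is not \<open>- p\<close>, since otherwise \<open>p\<close>
     would be a root.\<close>
   then obtain \<alpha> where \<alpha>: "\<alpha> \<in> J" "\<alpha> \<bullet> p \<noteq> 0" using orth_span[OF p(2), of p] by blast
   define r where "r = reflection \<alpha> p"
   have "reflection \<alpha> \<in> refl_group J" using \<alpha>(1) by (rule reflection_in_refl_group)
   hence "r \<in> span J" unfolding r_def using p(2) by (rule refl_group_in_span)
   moreover have aW: "reflection \<alpha> \<in> W" using \<alpha>(1) J by (auto intro: reflection_in_refl_group)
   hence "r \<in> X" unfolding r_def using p(1) by (rule W_in_X)
   moreover have rp: "r \<noteq> p" unfolding r_def using \<alpha>(2) by (simp add: reflection_fix_iff)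
   moreover have "r \<noteq> - p"
   proof
    assume "r = - p"
    hence "reflection \<alpha> = reflection (p - - p)" using rp unfolding r_def by (intro reflection_unique) auto
    also have "p - - p = 2 *\<^sub>R p" by (simp add: scaleR_2)
    finally have "reflection p \<in> W" using aW by (simp add: reflection_scaled)
    thus False using X_not_root[OF p(1)] by simp
   qed
   ultimately show ?thesis by blast
  qed
 qed
 have in01: "y0 \<bullet> y1 = s" "y0 \<bullet> y2 = s" unfolding y0_inner s_def by simp_all
 have in12: "y1 \<bullet> y2 = s"
  using reflection_inner[of d y0 y2] in01(2) unfolding reflection_table by simp
 \<comment> \<open>The fixed line passes through a vertex, the centre of a face or the midpoint of
   an edge, as the product of the two generators has order five, three or two.\<close>
 have ax: "\<exists>u. axis s X u \<and> (\<forall>x\<in>span \<Delta>. x \<in> span J \<longleftrightarrow> x \<bullet> u = 0)" if J: "J \<subseteq> \<Delta>" "card J = 2" for J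
  using pairs[OF J]
 proof (elim disjE)
  assume J: "J = {a, b}"
  have "x \<in> span J \<longleftrightarrow> x \<bullet> y0 = 0" if x: "x \<in> span \<Delta>" for x
  proof -
   obtain p q r where "x = vec p q r" using span_vec[OF x] by blast
   thus ?thesis using \<tau> unfolding J by (simp add: span_pairs pt_def vec_inner) (simp add: algebra_simps \<phi>_square)
  qed
  thus ?thesis using y_in_X(1) unfolding axis_def by blast
 next
  assume J: "J = {b, d}"
  have "x \<in> span J \<longleftrightarrow> x \<bullet> (y0 + y1 + y2) = 0" if x: "x \<in> span \<Delta>" for x
  proof -
   obtain p q r where "x = vec p q r" using span_vec[OF x] by blast
   moreover have "vec p q r \<bullet> (y0 + y1 + y2) = \<tau> * (\<phi> * p)"
    unfolding pt_arith by (simp add: pt_def vec_inner algebra_simps \<phi>_square)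
   ultimately show ?thesis using \<tau> \<phi>_bounds unfolding J by (simp add: span_pairs)
  qed
  thus ?thesis using y_in_X(1-3) in01 in12 unfolding axis_def by blast
 next
  assume J: "J = {a, d}"
  have "x \<in> span J \<longleftrightarrow> x \<bullet> (y0 + y1) = 0" if x: "x \<in> span \<Delta>" for x
  proof -
   obtain p q r where "x = vec p q r" using span_vec[OF x] by blast
   moreover have "vec p q r \<bullet> (y0 + y1) = \<tau> * q"
    unfolding pt_arith by (simp add: pt_def vec_inner algebra_simps \<phi>_square)
   ultimately show ?thesis using \<tau> unfolding J by (simp add: span_pairs)
  qed
  thus ?thesis using y_in_X(1-2) in01 unfolding axis_def by blast
 qed
 interpret cox_orbit \<Delta> \<Delta>\<^sub>p \<Delta>\<^sub>m k 10 X True by (rule orb)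
 show ?thesis
  by unfold_locales
   (use s_pos X_self X_other ax rank2_generated distinct_simple in \<open>auto simp: \<Delta>[THEN arg_cong[where f = card]]\<close>)
qed

end

section \<open>Identifying an arbitrary icosahedral orbit\<close>

lemma icosahedron_inner:
 assumes "regular_icosahedron_vertices X"
 obtains s where "0 < s" "finite X" "X \<noteq> {}" "\<And>p. p \<in> X \<Longrightarrow> p \<bullet> p = sqrt 5 * s" "\<And>p. p \<in> X \<Longrightarrow> \<exists>q\<in>X. p \<bullet> q = - s"
  "\<And>p q. p \<in> X \<Longrightarrow> q \<in> X \<Longrightarrow> p \<bullet> q \<in> {sqrt 5 * s, - (sqrt 5 * s), s, - s}"
proof -
 obtain r u v w where r: "r > 0" and uvw: "norm u = 1" "norm v = 1" "norm w = 1" "u \<bullet> v = 0" "v \<bullet> w = 0" "w \<bullet> u = 0"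
  and X: "X = {r *\<^sub>R (s *\<^sub>R x + (t * \<phi>) *\<^sub>R y) | s t x y.
     s \<in> {1, -1} \<and> t \<in> {1, -1} \<and> (x, y) \<in> {(u, v), (v, w), (w, u)}}"
  using assms unfolding regular_icosahedron_vertices_def \<phi>_def by blast
 have uu: "u \<bullet> u = 1" "v \<bullet> v = 1" "w \<bullet> w = 1" "v \<bullet> u = 0" "w \<bullet> v = 0" "u \<bullet> w = 0"
  using uvw by (simp_all add: dot_square_norm inner_commute)
 define s where "s = r * r * \<phi>"
 have s: "0 < s" "sqrt 5 * s = r * r * (\<phi> + 2)"
  using r \<phi>_bounds by (simp_all add: s_def sqrt_5_\<phi> algebra_simps \<phi>_square)
 have XI: "r *\<^sub>R (\<sigma> *\<^sub>R x + (t * \<phi>) *\<^sub>R y) \<in> X"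
  if "\<sigma> \<in> {1, -1}" "t \<in> {1, -1}" "(x, y) \<in> {(u, v), (v, w), (w, u)}" for \<sigma> t x y
  unfolding X using that by blast
 have XE: "\<exists>\<sigma> t x y. \<sigma> \<in> {1, -1} \<and> t \<in> {1, -1} \<and> (x, y) \<in> {(u, v), (v, w), (w, u)} \<and> p = r *\<^sub>R (\<sigma> *\<^sub>R x + (t * \<phi>) *\<^sub>R y)"
  if "p \<in> X" for p
  using that unfolding X by blast
 show thesis
 proof
  show "0 < s" by (rule s(1))
  have "X \<subseteq> (\<lambda>(s, t, x, y). r *\<^sub>R (s *\<^sub>R x + (t * \<phi>) *\<^sub>R y)) ` ({1, -1} \<times> {1, -1} \<times> {(u, v), (v, w), (w, u)})"
   unfolding X by (auto simp: image_iff)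
  thus "finite X" by (rule finite_subset) simp
  show "X \<noteq> {}" using XI[of 1 1 u v] by auto
  have inn: "(r *\<^sub>R (\<sigma> *\<^sub>R x + (t * \<phi>) *\<^sub>R y)) \<bullet> (r *\<^sub>R (\<sigma>' *\<^sub>R x' + (t' * \<phi>) *\<^sub>R y')) =
   r * r * (\<sigma> * \<sigma>' * (x \<bullet> x') + \<phi> * (\<sigma> * t' * (x \<bullet> y') + t * \<sigma>' * (y \<bullet> x')) + (\<phi> + 1) * (t * t' * (y \<bullet> y')))"
   for \<sigma> \<sigma>' t t' x x' y y'
   by (simp add: inner_add_left inner_add_right algebra_simps \<phi>_square)
  show "p \<bullet> p = sqrt 5 * s" if pX: "p \<in> X" for p
  proof -
   obtain \<sigma> t x y where p: "\<sigma> \<in> {1, -1}" "t \<in> {1, -1}" "(x, y) \<in> {(u, v), (v, w), (w, u)}"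
    "p = r *\<^sub>R (\<sigma> *\<^sub>R x + (t * \<phi>) *\<^sub>R y)" using XE[OF pX] by blast
   hence "\<sigma> * \<sigma> = 1" "t * t = 1" "x \<bullet> x = 1" "y \<bullet> y = 1" "x \<bullet> y = 0" "y \<bullet> x = 0" using uu uvw by auto
   thus ?thesis unfolding p(4) inn s(2) by (simp add: algebra_simps)
  qed
  show "\<exists>q\<in>X. p \<bullet> q = - s" if pX: "p \<in> X" for p
  proof -
   obtain \<sigma> t x y where p: "\<sigma> \<in> {1, -1}" "t \<in> {1, -1}" "(x, y) \<in> {(u, v), (v, w), (w, u)}"
    "p = r *\<^sub>R (\<sigma> *\<^sub>R x + (t * \<phi>) *\<^sub>R y)" using XE[OF pX] by blast
   hence "\<sigma> * \<sigma> = 1" "t * t = 1" "x \<bullet> x = 1" "y \<bullet> y = 1" "x \<bullet> y = 0" "y \<bullet> x = 0" using uu uvw by auto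
   hence "p \<bullet> (r *\<^sub>R (\<sigma> *\<^sub>R x + ((- t) * \<phi>) *\<^sub>R y)) = - s"
    unfolding p(4) inn by (simp add: s_def algebra_simps)
   moreover have "r *\<^sub>R (\<sigma> *\<^sub>R x + ((- t) * \<phi>) *\<^sub>R y) \<in> X" using p by (intro XI) auto
   ultimately show ?thesis by blast
  qed
  show "p \<bullet> q \<in> {sqrt 5 * s, - (sqrt 5 * s), s, - s}" if pq: "p \<in> X" "q \<in> X" for p q
  proof -
   obtain \<sigma> t x y where p: "\<sigma> \<in> {1, -1}" "t \<in> {1, -1}" "(x, y) \<in> {(u, v), (v, w), (w, u)}"
    "p = r *\<^sub>R (\<sigma> *\<^sub>R x + (t * \<phi>) *\<^sub>R y)" using XE[OF pq(1)] by blast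
   obtain \<sigma>' t' x' y' where q: "\<sigma>' \<in> {1, -1}" "t' \<in> {1, -1}" "(x', y') \<in> {(u, v), (v, w), (w, u)}"
    "q = r *\<^sub>R (\<sigma>' *\<^sub>R x' + (t' * \<phi>) *\<^sub>R y')" using XE[OF pq(2)] by blast
   have st: "\<sigma> * \<sigma>' = 1 \<or> \<sigma> * \<sigma>' = - 1" "t * t' = 1 \<or> t * t' = - 1" "\<sigma> * t' = 1 \<or> \<sigma> * t' = - 1" "t * \<sigma>' = 1 \<or> t * \<sigma>' = - 1"
    using p q by auto
   have "x \<bullet> x' = 1 \<and> x \<bullet> y' = 0 \<and> y \<bullet> x' = 0 \<and> y \<bullet> y' = 1 \<or> x \<bullet> x' = 0 \<and> x \<bullet> y' = 1 \<and> y \<bullet> x' = 0 \<and> y \<bullet> y' = 0 \<or>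
    x \<bullet> x' = 0 \<and> x \<bullet> y' = 0 \<and> y \<bullet> x' = 1 \<and> y \<bullet> y' = 0"
    using p(3) q(3) uu uvw by (elim insertE emptyE) simp_all
   then consider "x \<bullet> x' = 1" "x \<bullet> y' = 0" "y \<bullet> x' = 0" "y \<bullet> y' = 1" | "x \<bullet> x' = 0" "x \<bullet> y' = 1" "y \<bullet> x' = 0" "y \<bullet> y' = 0"
    | "x \<bullet> x' = 0" "x \<bullet> y' = 0" "y \<bullet> x' = 1" "y \<bullet> y' = 0" by blast
   thus ?thesis
   proof cases
    case 1
    define A B where "A = \<sigma> * \<sigma>'" and "B = t * t'"
    have "p \<bullet> q = r * r * (A + (\<phi> + 1) * B)" unfolding p(4) q(4) inn A_def B_def using 1 by simp
    moreover have "A = 1 \<or> A = - 1" "B = 1 \<or> B = - 1" using st(1,2) by (simp_all add: A_def B_def)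
    ultimately show ?thesis unfolding s(2) by (elim disjE) (simp_all add: s_def algebra_simps)
   next
    case 2
    define A where "A = \<sigma> * t'"
    have "p \<bullet> q = r * r * (\<phi> * A)" unfolding p(4) q(4) inn A_def using 2 by simp
    moreover have "A = 1 \<or> A = - 1" using st(3) by (simp add: A_def)
    ultimately show ?thesis by (elim disjE) (simp_all add: s_def algebra_simps)
   next
    case 3
    define A where "A = t * \<sigma>'"
    have "p \<bullet> q = r * r * (\<phi> * A)" unfolding p(4) q(4) inn A_def using 3 by simp
    moreover have "A = 1 \<or> A = - 1" using st(4) by (simp add: A_def)
    ultimately show ?thesis by (elim disjE) (simp_all add: s_def algebra_simps)
   qed
  qed
 qed
qed

text \<open>The orbit has a point in the closed fundamental chamber. The possible inner products of
  vertices restrict its products with unit roots to a few values, and a root with large coefficients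
  then forces it onto the ray of the basis vector dual to \<open>d\<close>.\<close>

lemma (in type_H3_roots) icosahedron_dominant:
 assumes x: "x \<in> span \<Delta>" "X = orbit_of (refl_group \<Delta>) x" and ico: "regular_icosahedron_vertices X"
 obtains \<tau> where "type_H3_vectors a b d \<Delta> \<tau> X"
proof -
 let ?W = "refl_group \<Delta>"
 obtain s where s: "0 < s" "finite X" "X \<noteq> {}" "\<And>p. p \<in> X \<Longrightarrow> p \<bullet> p = sqrt 5 * s" "\<And>p. p \<in> X \<Longrightarrow> \<exists>q\<in>X. p \<bullet> q = - s"
  "\<And>p q. p \<in> X \<Longrightarrow> q \<in> X \<Longrightarrow> p \<bullet> q \<in> {sqrt 5 * s, - (sqrt 5 * s), s, - s}"
  using icosahedron_inner[OF ico] by metis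
 have WX: "w p \<in> X" if w: "w \<in> ?W" and "p \<in> X" for w p
 proof -
  obtain g where "g \<in> ?W" "p = g x" using \<open>p \<in> X\<close> by (auto simp: x(2) orbit_of_def)
  hence "w p = (w \<circ> g) x" "w \<circ> g \<in> ?W" using refl_group_comp[OF w] by auto
  thus ?thesis unfolding x(2) orbit_of_def by blast
 qed
 have XV: "p \<in> span \<Delta>" if "p \<in> X" for p using that x refl_group_in_span by (auto simp: orbit_of_def)
 have nr: "reflection p \<notin> ?W" if p: "p \<in> X" for p
 proof
  assume rp: "reflection p \<in> ?W"
  obtain q where q: "q \<in> X" "p \<bullet> q = - s" using s(5)[OF p] by blast
  hence e: "q \<bullet> reflection p q = 3 * s / sqrt 5"
   using s(1) s(4)[OF p] s(4)[OF q(1)] by (intro reflected_vertex_inner) auto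
  show False using s(6)[OF q(1) WX[OF rp q(1)]] not_vertex_inner[OF s(1)] unfolding e by blast
 qed
 \<comment> \<open>If a reflection in a unit root \<open>y\<close> moves \<open>p\<close> to a
   vertex at inner product \<open>s\<close> or \<open>- s\<close> from it, the squared product of
   \<open>p\<close> and \<open>y\<close> is \<open>(\<phi> - 1) * s\<close> or
   \<open>\<phi> * s\<close>. These are the squares of \<open>\<tau>\<close> and
   \<open>\<phi> * \<tau>\<close>.\<close>
 define \<tau> where "\<tau> = sqrt ((\<phi> - 1) * s)"
 have t0: "0 < \<tau>" using s(1) \<phi>_bounds by (simp add: \<tau>_def)
 have tt: "\<tau> * \<tau> = (\<phi> - 1) * s" using s(1) \<phi>_bounds by (simp add: \<tau>_def)
 have ptt: "(\<phi> * \<tau>) * (\<phi> * \<tau>) = \<phi> * s"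
 proof -
  have "(\<phi> * \<tau>) * (\<phi> * \<tau>) = \<phi> * \<phi> * (\<tau> * \<tau>)" by (simp only: mult_ac)
  thus ?thesis unfolding tt by (simp add: algebra_simps \<phi>_square)
 qed
 have root: "p \<bullet> y \<in> {0, \<tau>, - \<tau>, \<phi> * \<tau>, - (\<phi> * \<tau>)}" if y: "reflection y \<in> ?W" "y \<bullet> y = 1" and p: "p \<in> X" for y p
 proof -
  have rX: "reflection y p \<in> X" using WX y(1) p by blast
  have e: "p \<bullet> reflection y p = sqrt 5 * s - 2 * ((p \<bullet> y) * (p \<bullet> y))"
   using y(2) by (simp add: reflection_def inner_diff_right s(4)[OF p] inner_commute[of y p])
  have "p \<bullet> reflection y p \<noteq> - (sqrt 5 * s)"
  proof
   assume m: "p \<bullet> reflection y p = - (sqrt 5 * s)"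
   have "(p + reflection y p) \<bullet> (p + reflection y p) = 0"
    using m s(4)[OF p] s(4)[OF rX] by (simp add: inner_add_left inner_add_right inner_commute[of "reflection y p" p])
   hence "p + reflection y p = 0" by simp
   hence r: "reflection y p = - p" by (simp add: eq_neg_iff_add_eq_0 add.commute)
   have p0: "p \<noteq> 0" using s(1) s(4)[OF p] by auto
   hence "reflection y = reflection (p - - p)" using r neg_eq_self[of p] by (intro reflection_unique) auto
   also have "p - - p = 2 *\<^sub>R p" by (simp add: scaleR_2)
   finally show False using nr[OF p] y(1) by (simp add: reflection_scaled)
  qed
  hence "p \<bullet> reflection y p = sqrt 5 * s \<or> p \<bullet> reflection y p = s \<or> p \<bullet> reflection y p = - s"
   using s(6)[OF p rX] by blast
  hence "(p \<bullet> y) * (p \<bullet> y) = 0 \<or> (p \<bullet> y) * (p \<bullet> y) = \<tau> * \<tau> \<or> (p \<bullet> y) * (p \<bullet> y) = (\<phi> * \<tau>) * (\<phi> * \<tau>)"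
   unfolding e tt ptt sqrt_5_\<phi> by (auto simp: algebra_simps)
  thus ?thesis unfolding square_eq_iff by auto
 qed
 \<comment> \<open>\<open>\<Omega>\<close> is positive on the simple roots, so a point of the orbit
   maximising it is dominant: a simple reflection with negative product would raise the
   value.\<close>
 define \<Omega> where "\<Omega> = dual_a + dual_b + dual_d"
 obtain x0 where x0: "x0 \<in> X" "\<And>p. p \<in> X \<Longrightarrow> p \<bullet> \<Omega> \<le> x0 \<bullet> \<Omega>"
 proof -
  have "Max ((\<lambda>p. p \<bullet> \<Omega>) ` X) \<in> (\<lambda>p. p \<bullet> \<Omega>) ` X" using s(2,3) by (intro Max_in) auto
  then obtain x0 where "x0 \<in> X" "x0 \<bullet> \<Omega> = Max ((\<lambda>p. p \<bullet> \<Omega>) ` X)" by auto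
  thus ?thesis using that[of x0] s(2) by simp
 qed
 have dom: "0 \<le> x0 \<bullet> \<alpha>" if \<alpha>: "\<alpha> \<in> \<Delta>" for \<alpha>
 proof -
  have pos: "0 < \<alpha> \<bullet> \<Omega>"
  proof -
   have "a \<bullet> \<Omega> = 2 * \<phi> - 3" "b \<bullet> \<Omega> = (2 - \<phi>) / 2" "d \<bullet> \<Omega> = 2 - \<phi>"
    using dual_inner[of 1 0 0] dual_inner[of 0 1 0] dual_inner[of 0 0 1]
    by (simp_all add: vec_simple \<Omega>_def inner_add_right)
   thus ?thesis using \<alpha> \<phi>_bounds unfolding \<Delta> by auto
  qed
  have "reflection \<alpha> x0 \<bullet> \<Omega> \<le> x0 \<bullet> \<Omega>" using x0 WX[OF reflection_in_refl_group[OF \<alpha>]] by blast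
  moreover have "norm \<alpha> = 1" using \<alpha> unit unfolding \<Delta> by auto
  hence "reflection \<alpha> x0 \<bullet> \<Omega> = x0 \<bullet> \<Omega> - 2 * (x0 \<bullet> \<alpha>) * (\<alpha> \<bullet> \<Omega>)"
   by (simp add: unit_reflection inner_diff_left inner_commute[of \<alpha> x0])
  ultimately have "0 \<le> (x0 \<bullet> \<alpha>) * (\<alpha> \<bullet> \<Omega>)" by (simp add: mult.commute)
  thus ?thesis using pos by (simp add: zero_le_mult_iff)
 qed
 have W: "reflection a \<in> ?W" "reflection b \<in> ?W" "reflection d \<in> ?W" by (simp_all add: \<Delta> reflection_in_refl_group)
 \<comment> \<open>A root whose coefficients at \<open>a\<close> and \<open>b\<close> exceed
   \<open>\<phi>\<close>. Nonzero products of \<open>x0\<close> with simple roots are at least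
   \<open>\<tau>\<close>, while the product with \<open>\<gamma>\<close> is at most
   \<open>\<phi> * \<tau>\<close>; so \<open>x0\<close> is orthogonal to \<open>a\<close> and
   \<open>b\<close>.\<close>
 define \<gamma> where "\<gamma> = vec (\<phi> + 1) (\<phi> + 1) \<phi>"
 have g: "reflection a (reflection b (reflection d (reflection b (reflection a b)))) = \<gamma>"
  by (simp add: \<gamma>_def reflection_simple reflection_vec algebra_simps \<phi>_square)
 note R = reflection_conj_in_refl_group
 have gW: "reflection \<gamma> \<in> ?W"
  unfolding g[symmetric] by (rule R[OF W(1) R[OF W(2) R[OF W(3) R[OF W(2) R[OF W(1,2)]]]]])
 have gg: "\<gamma> \<bullet> \<gamma> = 1" unfolding g[symmetric] reflection_inner by (rule gram')
 have gx: "x0 \<bullet> \<gamma> = (\<phi> + 1) * (x0 \<bullet> a) + (\<phi> + 1) * (x0 \<bullet> b) + \<phi> * (x0 \<bullet> d)"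
  by (simp add: \<gamma>_def vec_def inner_add_right)
 have le: "x0 \<bullet> \<gamma> \<le> \<phi> * \<tau>"
 proof -
  have "\<tau> \<le> \<phi> * \<tau>" "0 \<le> \<phi> * \<tau>" using t0 \<phi>_bounds by simp_all
  thus ?thesis using root[OF gW gg x0(1)] t0 by (elim insertE emptyE) linarith+
 qed
 have vals: "x0 \<bullet> \<alpha> = 0 \<or> \<tau> \<le> x0 \<bullet> \<alpha>" "x0 \<bullet> \<alpha> \<le> \<tau> \<Longrightarrow> x0 \<bullet> \<alpha> = 0 \<or> x0 \<bullet> \<alpha> = \<tau>" if \<alpha>: "\<alpha> \<in> \<Delta>" for \<alpha>
 proof -
  have "norm \<alpha> = 1" using \<alpha> unit unfolding \<Delta> by auto
  hence "\<alpha> \<bullet> \<alpha> = 1" by (simp add: dot_square_norm)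
  note r = root[OF reflection_in_refl_group[OF \<alpha>] this x0(1)]
  have lt: "\<tau> < \<phi> * \<tau>" using t0 \<phi>_bounds by simp
  show "x0 \<bullet> \<alpha> = 0 \<or> \<tau> \<le> x0 \<bullet> \<alpha>"
   using r dom[OF \<alpha>] t0 lt by (elim insertE emptyE) (rule disjI1, assumption | rule disjI2, linarith)+
  assume "x0 \<bullet> \<alpha> \<le> \<tau>"
  thus "x0 \<bullet> \<alpha> = 0 \<or> x0 \<bullet> \<alpha> = \<tau>"
   using dom[OF \<alpha>] t0 lt r[unfolded insert_iff empty_iff simp_thms] by argo
 qed
 have D: "a \<in> \<Delta>" "b \<in> \<Delta>" "d \<in> \<Delta>" by (auto simp: \<Delta>)
 have big: "\<phi> * \<tau> < (\<phi> + 1) * \<tau>" using t0 by (simp add: algebra_simps)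
 have nn: "0 \<le> (\<phi> + 1) * (x0 \<bullet> a)" "0 \<le> (\<phi> + 1) * (x0 \<bullet> b)" "0 \<le> \<phi> * (x0 \<bullet> d)" using dom D \<phi>_bounds by auto
 have xa: "x0 \<bullet> a = 0"
 proof (rule ccontr)
  assume "x0 \<bullet> a \<noteq> 0"
  hence "(\<phi> + 1) * \<tau> \<le> (\<phi> + 1) * (x0 \<bullet> a)" using vals(1)[OF D(1)] \<phi>_bounds by simp
  thus False using le big nn unfolding gx by linarith
 qed
 have xb: "x0 \<bullet> b = 0"
 proof (rule ccontr)
  assume "x0 \<bullet> b \<noteq> 0"
  hence "(\<phi> + 1) * \<tau> \<le> (\<phi> + 1) * (x0 \<bullet> b)" using vals(1)[OF D(2)] \<phi>_bounds by simp
  thus False using le big nn unfolding gx by linarith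
 qed
 have "x0 \<bullet> d \<le> \<tau>" using le \<phi>_bounds unfolding gx xa xb by simp
 hence xd: "x0 \<bullet> d = 0 \<or> x0 \<bullet> d = \<tau>" by (rule vals(2)[OF D(3)])
 have zero: "u = 0" if u: "u \<in> span \<Delta>" "u \<bullet> a = 0" "u \<bullet> b = 0" "u \<bullet> d = 0" for u
 proof -
  have "orthogonal u u" by (rule orthogonal_to_span[OF u(1)]) (use u in \<open>auto simp: \<Delta> orthogonal_def\<close>)
  thus ?thesis by (simp add: orthogonal_def)
 qed
 have "x0 \<noteq> 0" using s(1) s(4)[OF x0(1)] by auto
 hence xd: "x0 \<bullet> d = \<tau>" using xd zero[OF XV[OF x0(1)] xa xb] by blast
 define y where "y = \<tau> *\<^sub>R vec (2 * \<phi> + 1) (2 * \<phi> + 2) (\<phi> + 2)"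
 have "y \<bullet> a = 0" "y \<bullet> b = 0" "y \<bullet> d = \<tau>"
  using vec_inner[of "2 * \<phi> + 1" "2 * \<phi> + 2" "\<phi> + 2" 1 0 0] vec_inner[of "2 * \<phi> + 1" "2 * \<phi> + 2" "\<phi> + 2" 0 1 0]
   vec_inner[of "2 * \<phi> + 1" "2 * \<phi> + 2" "\<phi> + 2" 0 0 1]
  by (simp_all add: y_def vec_simple field_simps \<phi>_square)
 moreover have "x0 - y \<in> span \<Delta>"
  unfolding y_def by (rule span_diff[OF XV[OF x0(1)] span_mul[OF vec_in_span]])
 ultimately have "x0 - y = 0" using xa xb xd by (intro zero) (auto simp: inner_diff_left)
 hence x0y: "x0 = y" by simp
 have "X = orbit_of ?W y"
 proof
  obtain g where gx: "g \<in> ?W" "x0 = g x" using x0(1) by (auto simp: x(2) orbit_of_def)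
  obtain g' where g': "g' \<in> ?W" "\<And>x. g' (g x) = x" using refl_group_inverse[OF gx(1)] by metis
  show "orbit_of ?W y \<subseteq> X" using WX x0(1) x0y by (auto simp: orbit_of_def)
  show "X \<subseteq> orbit_of ?W y"
  proof
   fix p assume "p \<in> X"
   then obtain f where f: "f \<in> ?W" "p = f x" by (auto simp: x(2) orbit_of_def)
   hence "p = (f \<circ> g') y" "f \<circ> g' \<in> ?W" using gx g' x0y refl_group_comp[OF f(1) g'(1)] by auto
   thus "p \<in> orbit_of ?W y" unfolding orbit_of_def by blast
  qed
 qed
 hence "type_H3_vectors a b d \<Delta> \<tau> X" using t0 by unfold_locales (simp_all add: y_def)
 thus thesis by (rule that)
qed

theorem mainTheorem2:
  fixes \<Delta> \<Delta>\<^sub>p \<Delta>\<^sub>m X :: "'a::euclidean_space set"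
  and k :: "'a \<Rightarrow> real"
  and W' :: "('a \<Rightarrow> 'a) set"
 assumes "(\<exists>n\<ge>2. type_A n \<Delta> X) \<or> (\<exists>n\<ge>2. type_B n \<Delta> X) \<or> (\<exists>n\<ge>4. type_D n \<Delta> X) \<or>
     (\<exists>m\<ge>3. type_I2 m \<Delta> X) \<or> type_H3 \<Delta> X"
  and "coxeter_bipartition \<Delta> \<Delta>\<^sub>p \<Delta>\<^sub>m"
  and "positive_min_eigenvector \<Delta> k"
  and "parabolic \<Delta> W'"
 shows "noncrossing_parabolic \<Delta> (bipartite_coxeter_element \<Delta>\<^sub>p \<Delta>\<^sub>m) W' \<longleftrightarrow>
  (\<forall>B\<in>blocks W' X. \<forall>B'\<in>blocks W' X. B \<noteq> B' \<longrightarrow>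
   noncrossing_blocks (coxeter_plane k \<Delta>\<^sub>p \<Delta>\<^sub>m) B B')"
 using assms(1)
proof (elim disjE exE conjE)
 fix n assume "2 \<le> n" "type_A n \<Delta> X"
 then obtain e where e: "orthonormal_family (n + 1) e" "\<Delta> = {sgn (e i - e (i + 1)) | i. i \<in> {1..n}}"
  "X = {orth_proj (span \<Delta>) (e i) | i. i \<in> {1..n + 1}}" unfolding type_A_def by blast
 hence "type_A_vectors n e \<Delta> X" using \<open>2 \<le> n\<close> by unfold_locales
 then interpret orthogonal_orbit \<Delta> \<Delta>\<^sub>p \<Delta>\<^sub>m k "n + 1" X False by (rule type_A_vectors.orbit_A[OF _ assms(2,3)])
 show ?thesis by (rule noncrossing_iff_noncrossing_blocks[OF assms(4)])
next
 fix n assume "2 \<le> n" "type_B n \<Delta> X"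
 then obtain e where e: "orthonormal_family n e" "\<Delta> = {sgn (e i - e (i + 1)) | i. i \<in> {1..n - 1}} \<union> {e n}"
  "X = {e i | i. i \<in> {1..n}} \<union> {- e i | i. i \<in> {1..n}}" unfolding type_B_def by blast
 hence "type_B_vectors n e X \<Delta>" using \<open>2 \<le> n\<close> by unfold_locales
 then interpret orthogonal_orbit \<Delta> \<Delta>\<^sub>p \<Delta>\<^sub>m k "2 * n" X False by (rule type_B_vectors.orbit_B[OF _ assms(2,3)])
 show ?thesis by (rule noncrossing_iff_noncrossing_blocks[OF assms(4)])
next
 fix n assume "4 \<le> n" "type_D n \<Delta> X"
 then obtain e where e: "orthonormal_family n e"
  "\<Delta> = {sgn (e i - e (i + 1)) | i. i \<in> {1..n - 1}} \<union> {sgn (e (n - 1) + e n)}"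
  "X = {e i | i. i \<in> {1..n}} \<union> {- e i | i. i \<in> {1..n}}" unfolding type_D_def by blast
 have "2 \<le> n" using \<open>4 \<le> n\<close> by simp
 hence "type_D_vectors n e X \<Delta>" using e \<open>4 \<le> n\<close> by unfold_locales
 then interpret orthogonal_orbit \<Delta> \<Delta>\<^sub>p \<Delta>\<^sub>m k "2 * n - 2" X True by (rule type_D_vectors.orbit_D[OF _ assms(2,3)])
 show ?thesis by (rule noncrossing_iff_noncrossing_blocks[OF assms(4)])
next
 fix m :: nat assume m: "3 \<le> m" "type_I2 m \<Delta> X"
 then obtain a b x where "norm a = 1" "norm b = 1" "a \<bullet> b = - cos (pi / real m)" "\<Delta> = {a, b}"
  and x: "x \<in> span \<Delta>" "X = orbit_of (refl_group \<Delta>) x" unfolding type_I2_def by blast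
 hence "type_I2_roots m a b \<Delta>" using m(1) by unfold_locales
 thus ?thesis by (rule type_I2_roots.noncrossing_iff_I2[OF _ assms(2,3) x assms(4)])
next
 assume "type_H3 \<Delta> X"
 then obtain a b d x where ab: "norm a = 1" "norm b = 1" "norm d = 1" "a \<bullet> b = - cos (pi / 5)" "b \<bullet> d = - cos (pi / 3)"
   "a \<bullet> d = 0" "\<Delta> = {a, b, d}"
  and x: "x \<in> span \<Delta>" "X = orbit_of (refl_group \<Delta>) x" "regular_icosahedron_vertices X" unfolding type_H3_def by blast
 interpret type_H3_roots a b d \<Delta>
  by unfold_locales (use ab in \<open>simp_all add: cos_pi_5 cos_60 \<phi>_def\<close>)
 obtain \<tau> where "type_H3_vectors a b d \<Delta> \<tau> X" by (rule icosahedron_dominant[OF x])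
 then interpret H: type_H3_vectors a b d \<Delta> \<tau> X .
 interpret icosahedral_orbit \<Delta> \<Delta>\<^sub>p \<Delta>\<^sub>m k 10 X True H.s by (rule H.orbit_H3[OF assms(2,3)])
 show ?thesis by (rule noncrossing_iff_icosahedral[OF assms(4)])
qed

end
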